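(* The semigroup of contractions $(e^{t\mathcal{A}})_{t\ge0}$ is strongly stable on $\mathcal{H}$, in the sense that $$\lim_{t\to+\infty}\|e^{t\mathcal{A}}\Phi_0\|_{\mathcal{H}}=0\qquad\text{for all }\Phi_0\in\mathcal{H}.$$
   Context: Constants: $0<L_0<L$; $\rho_0,\rho_1,\rho_2,\alpha_1,\alpha_2,\beta_1,\beta_2,\kappa>0$; $\gamma\in\mathbb{R}\setminus\{0\}$. All functions are complex valued. Spaces: $\mathbb{V}_1=\{(u,y)\in H^1(0,L_0)\times H^1(L_0,L): u(0)=0,\ y(L)=0,\ u(L_0)=y(L_0)\}$; $\mathbb{W}_1=\{(u,y)\in (H^2(0,L_0)\times H^2(L_0,L))\cap\mathbb{V}_1: u_x(0)=y_x(L)=0,\ u_x(L_0)=y_x(L_0)\}$; $\mathbb{V}_2=\mathbb{V}_1\times L^2(0,L_0)$; $\mathbb{W}_2=\mathbb{W}_1\times H^1_0(0,L_0)$; $\mathbb{L}_2=L^2(0,L_0)\times L^2(L_0,L)\times L^2(0,L_0)$. With $\mathbb{L}_2$ identified with its dual, $\mathbb{W}_2\subset\mathbb{V}_2\subset\mathbb{L}_2\subset\mathbb{V}_2'\subset\mathbb{W}_2'$ (duals consist of bounded antilinear functionals; an element of $\mathbb{W}_2'$ belongs to $\mathbb{V}_2'$ if it extends to a bounded antilinear functional on $\mathbb{V}_2$). Forms: for $(u,y),(\hat u,\hat y)\in\mathbb{W}_1$, $a((u,y),(\hat u,\hat y))=\beta_1\int_0^{L_0}u_{xx}\overline{\hat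 u_{xx}}\,dx+\beta_2\int_{L_0}^L y_{xx}\overline{\hat y_{xx}}\,dx$; for $(u,y,\theta),(\hat u,\hat y,\hat\theta)\in\mathbb{W}_2$, $b((u,y,\theta),(\hat u,\hat y,\hat\theta))=\gamma\int_0^{L_0}(u_x\overline{\hat\theta_x}-\theta_x\overline{\hat u_x})\,dx+\kappa\int_0^{L_0}\theta_x\overline{\hat\theta_x}\,dx$; for $(u,y,\theta),(\hat u,\hat y,\hat\theta)\in\mathbb{V}_2$, $c((u,y,\theta),(\hat u,\hat y,\hat\theta))=\int_0^{L_0}(\rho_1u\overline{\hat u}+\alpha_1u_x\overline{\hat u_x})\,dx+\int_{L_0}^L(\rho_2y\overline{\hat y}+\alpha_2y_x\overline{\hat y_x})\,dx+\rho_0\int_0^{L_0}\theta\overline{\hat\theta}\,dx$. The forms $a$ and $c$ are used as the inner products of $\mathbb{W}_1$ and $\mathbb{V}_2$. Operators: $C:\mathbb{V}_2\to\mathbb{V}_2'$ is the isomorphism $\langle CU,\hat U\rangle=c(U,\hat U)$; $B:\mathbb{W}_2\to\mathbb{W}_2'$ is given by $\langle BU,\hat U\rangle=b(U,\hat U)$; $A_1:\mathbb{W}_1\to\mathbb{W}_2'$ is given by $\langle A_1Z,(\hat u,\hat y,\hat\theta)\rangle=a(Z,(\hat u,\hat y))$. Energy space $\mathcal{H}=\mathbb{W}_1\times\mathbb{V}_2$ with inner product $\langle(\Phi_1,\Phi_2),(\hat\Phi_1,\hat\Phi_2)\rangle_{\mathcal{H}}=a(\Phi_1,\hat\Phi_1)+c(\Phi_2,\hat\Phi_2)$.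 Write $\Phi_1=(u,y)$, $\Phi_2=(v,z,\theta)$. Operator: $D(\mathcal{A})=\{(\Phi_1,\Phi_2)\in\mathbb{W}_1\times\mathbb{W}_2: B\Phi_2+A_1\Phi_1\in\mathbb{V}_2'\}$, $\mathcal{A}(\Phi_1,\Phi_2)=\big((v,z),-C^{-1}(B\Phi_2+A_1\Phi_1)\big)$. $(e^{t\mathcal{A}})_{t\ge0}$ denotes the $C_0$-semigroup of contractions on $\mathcal{H}$ generated by $\mathcal{A}$. *)

theory Defs
  imports "HOL-Analysis.Analysis"
begin

subsection \<open>Complex vector spaces\<close>

class complex_vector = ab_group_add +
  fixes scaleC :: "complex \<Rightarrow> 'a \<Rightarrow> 'a" (infixr "*\<^sub>C" 75)
  assumes scaleC_add_right: "c *\<^sub>C (x + y) = c *\<^sub>C x + c *\<^sub>C y"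
    and scaleC_add_left: "(c + d) *\<^sub>C x = c *\<^sub>C x + d *\<^sub>C x"
    and scaleC_scaleC: "c *\<^sub>C d *\<^sub>C x = (c * d) *\<^sub>C x"
    and scaleC_one: "1 *\<^sub>C x = x"

instantiation prod :: (complex_vector, complex_vector) complex_vector
begin

definition scaleC_prod_def: "c *\<^sub>C x = (c *\<^sub>C fst x, c *\<^sub>C snd x)"

instance
  by standard
    (simp_all add: scaleC_prod_def scaleC_add_right scaleC_add_left scaleC_scaleC scaleC_one
      prod_eq_iff)

end

definition complex_linear_on ::
  "'a::complex_vector set \<Rightarrow> ('a \<Rightarrow> 'b::complex_vector) \<Rightarrow> bool" where
  "complex_linear_on S f \<longleftrightarrow>
     (\<forall>x\<in>S. \<forall>y\<in>S. f (x + y) = f x + f y) \<and> (\<forall>c. \<forall>x\<in>S. f (c *\<^sub>C x) = c *\<^sub>C f x)"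

definition antilinear_on :: "'a::complex_vector set \<Rightarrow> ('a \<Rightarrow> complex) \<Rightarrow> bool" where
  "antilinear_on S F \<longleftrightarrow>
     (\<forall>x\<in>S. \<forall>y\<in>S. F (x + y) = F x + F y) \<and> (\<forall>c. \<forall>x\<in>S. F (c *\<^sub>C x) = cnj c * F x)"

text \<open>Functionals on a subspace \<open>S\<close> are made extensional, so that they are equal as soon as they
  agree on \<open>S\<close>.\<close>

definition antidual :: "'a::complex_vector set \<Rightarrow> ('a \<Rightarrow> real) \<Rightarrow> ('a \<Rightarrow> complex) set" where
  "antidual S nrm =
     {F \<in> extensional S. antilinear_on S F \<and> (\<exists>M. \<forall>x\<in>S. cmod (F x) \<le> M * nrm x)}"

subsection \<open>Contraction semigroups on a normed space with carrier \<open>S\<close> and norm \<open>nrm\<close>\<close>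

definition C0_contraction_semigroup ::
  "'a::complex_vector set \<Rightarrow> ('a \<Rightarrow> real) \<Rightarrow> (real \<Rightarrow> 'a \<Rightarrow> 'a) \<Rightarrow> bool" where
  "C0_contraction_semigroup S nrm T \<longleftrightarrow>
     (\<forall>t\<ge>0. T t ` S \<subseteq> S \<and> complex_linear_on S (T t) \<and> (\<forall>x\<in>S. nrm (T t x) \<le> nrm x)) \<and>
     (\<forall>x\<in>S. T 0 x = x) \<and>
     (\<forall>s\<ge>0. \<forall>t\<ge>0. \<forall>x\<in>S. T (s + t) x = T s (T t x)) \<and>
     (\<forall>x\<in>S. ((\<lambda>t. nrm (T t x - x)) \<longlongrightarrow> 0) (at_right 0))"

definition infinitesimal_generator_graph ::
  "'a::complex_vector set \<Rightarrow> ('a \<Rightarrow> real) \<Rightarrow> (real \<Rightarrow> 'a \<Rightarrow> 'a) \<Rightarrow> ('a \<times> 'a) set" where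
  "infinitesimal_generator_graph S nrm T =
     {(x, y). x \<in> S \<and> y \<in> S \<and>
        ((\<lambda>h. nrm (complex_of_real (1 / h) *\<^sub>C (T h x - x) - y)) \<longlongrightarrow> 0) (at_right 0)}"

text \<open>The generator agrees with \<open>A\<close> as an unbounded operator: same domain \<open>D\<close>, same values.\<close>

definition semigroup_generated_by ::
  "'a::complex_vector set \<Rightarrow> ('a \<Rightarrow> real) \<Rightarrow> (real \<Rightarrow> 'a \<Rightarrow> 'a) \<Rightarrow> 'a set \<Rightarrow> ('a \<Rightarrow> 'a) \<Rightarrow> bool" where
  "semigroup_generated_by S nrm T D A \<longleftrightarrow>
     infinitesimal_generator_graph S nrm T = {(x, A x) | x. x \<in> D}"

subsection \<open>Complex square-integrable functions modulo equality almost everywhere\<close>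

definition square_integrable :: "(real \<Rightarrow> complex) \<Rightarrow> bool" where
  "square_integrable f \<longleftrightarrow>
     f \<in> borel_measurable lborel \<and> integrable lborel (\<lambda>x. (cmod (f x))\<^sup>2)"

definition L2_rel :: "(real \<Rightarrow> complex) \<Rightarrow> (real \<Rightarrow> complex) \<Rightarrow> bool" where
  "L2_rel f g \<longleftrightarrow> square_integrable f \<and> square_integrable g \<and> (AE x in lborel. f x = g x)"

lemma square_integrable_zero: "square_integrable (\<lambda>_. 0)"
  by (simp add: square_integrable_def)

lemma square_integrable_add:
  assumes "square_integrable f" "square_integrable g"
  shows "square_integrable (\<lambda>x. f x + g x)"
proof -
  have [measurable]: "f \<in> borel_measurable lborel" "g \<in> borel_measurable lborel"
    using assms by (auto simp: square_integrable_def)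
  have int: "integrable lborel (\<lambda>x. 2 * (cmod (f x))\<^sup>2 + 2 * (cmod (g x))\<^sup>2)"
    using assms by (auto simp: square_integrable_def)
  have bound: "(cmod (f x + g x))\<^sup>2 \<le> 2 * (cmod (f x))\<^sup>2 + 2 * (cmod (g x))\<^sup>2" for x
  proof -
    have "(cmod (f x + g x))\<^sup>2 \<le> (cmod (f x) + cmod (g x))\<^sup>2"
      by (intro power_mono norm_triangle_ineq) auto
    also have "\<dots> \<le> 2 * (cmod (f x))\<^sup>2 + 2 * (cmod (g x))\<^sup>2"
      using zero_le_power2[of "cmod (f x) - cmod (g x)"]
      by (simp add: power2_eq_square algebra_simps)
    finally show ?thesis .
  qed
  have "integrable lborel (\<lambda>x. (cmod (f x + g x))\<^sup>2)"
    by (rule Bochner_Integration.integrable_bound[OF int]) (use bound in simp_all)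
  then show ?thesis
    by (simp add: square_integrable_def)
qed

lemma square_integrable_scale:
  "square_integrable f \<Longrightarrow> square_integrable (\<lambda>x. c * f x)"
  by (auto simp: square_integrable_def norm_mult power_mult_distrib)

lemma square_integrable_uminus:
  "square_integrable f \<Longrightarrow> square_integrable (\<lambda>x. - f x)"
  by (auto simp: square_integrable_def)

lemma square_integrable_diff:
  "square_integrable f \<Longrightarrow> square_integrable g \<Longrightarrow> square_integrable (\<lambda>x. f x - g x)"
  using square_integrable_add[of f "\<lambda>x. - g x"] square_integrable_uminus[of g] by simp

text \<open>The measure is \<open>lborel\<close>; since every Lebesgue measurable function agrees almost everywhere with
  a Borel one, this is the usual space \<open>L\<^sup>2(\<real>)\<close>.\<close>

quotient_type L2 = "real \<Rightarrow> complex" / partial: L2_rel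
proof (rule part_equivpI)
  show "\<exists>f. L2_rel f f"
    by (rule exI[of _ "\<lambda>_. 0"]) (simp add: L2_rel_def square_integrable_zero)
  show "symp L2_rel"
    by (rule sympI) (simp add: L2_rel_def eq_commute)
  show "transp L2_rel"
  proof (rule transpI)
    fix f g h assume "L2_rel f g" "L2_rel g h"
    moreover from this have "AE x in lborel. f x = g x" "AE x in lborel. g x = h x"
      by (simp_all add: L2_rel_def)
    then have "AE x in lborel. f x = h x"
      by eventually_elim simp
    ultimately show "L2_rel f h"
      by (simp add: L2_rel_def)
  qed
qed

lemma L2_rel_AE: "L2_rel f g \<Longrightarrow> AE x in lborel. f x = g x"
  by (simp add: L2_rel_def)

lemma L2_rel_add:
  assumes "L2_rel f f'" "L2_rel g g'"
  shows "L2_rel (\<lambda>x. f x + g x) (\<lambda>x. f' x + g' x)"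
proof -
  have "AE x in lborel. f x + g x = f' x + g' x"
    using L2_rel_AE[OF assms(1)] L2_rel_AE[OF assms(2)] by eventually_elim simp
  with assms show ?thesis
    by (simp add: L2_rel_def square_integrable_add)
qed

lemma L2_rel_diff:
  assumes "L2_rel f f'" "L2_rel g g'"
  shows "L2_rel (\<lambda>x. f x - g x) (\<lambda>x. f' x - g' x)"
proof -
  have "AE x in lborel. f x - g x = f' x - g' x"
    using L2_rel_AE[OF assms(1)] L2_rel_AE[OF assms(2)] by eventually_elim simp
  with assms show ?thesis
    by (simp add: L2_rel_def square_integrable_diff)
qed

lemma L2_rel_uminus:
  assumes "L2_rel f f'"
  shows "L2_rel (\<lambda>x. - f x) (\<lambda>x. - f' x)"
proof -
  have "AE x in lborel. - f x = - f' x"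
    using L2_rel_AE[OF assms] by eventually_elim simp
  with assms show ?thesis
    by (simp add: L2_rel_def square_integrable_uminus)
qed

lemma L2_rel_scale:
  assumes "L2_rel f f'"
  shows "L2_rel (\<lambda>x. c * f x) (\<lambda>x. c * f' x)"
proof -
  have "AE x in lborel. c * f x = c * f' x"
    using L2_rel_AE[OF assms] by eventually_elim simp
  with assms show ?thesis
    by (simp add: L2_rel_def square_integrable_scale)
qed

instantiation L2 :: complex_vector
begin

lift_definition zero_L2 :: L2 is "\<lambda>_. 0"
  by (simp add: L2_rel_def square_integrable_zero)

lift_definition plus_L2 :: "L2 \<Rightarrow> L2 \<Rightarrow> L2" is "\<lambda>f g x. f x + g x"
  by (rule L2_rel_add)

lift_definition minus_L2 :: "L2 \<Rightarrow> L2 \<Rightarrow> L2" is "\<lambda>f g x. f x - g x"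
  by (rule L2_rel_diff)

lift_definition uminus_L2 :: "L2 \<Rightarrow> L2" is "\<lambda>f x. - f x"
  by (rule L2_rel_uminus)

lift_definition scaleC_L2 :: "complex \<Rightarrow> L2 \<Rightarrow> L2" is "\<lambda>c f x. c * f x"
  by (rule L2_rel_scale)

instance
proof
  fix x y z :: L2 and c d :: complex
  show "x + y + z = x + (y + z)"
    by transfer (simp add: L2_rel_def add.assoc square_integrable_add)
  show "x + y = y + x"
    by transfer (simp add: L2_rel_def add.commute square_integrable_add)
  show "0 + x = x"
    by transfer (simp add: L2_rel_def)
  show "- x + x = 0"
    by transfer (simp add: L2_rel_def square_integrable_zero)
  show "x - y = x + - y"
    by transfer (simp add: L2_rel_def square_integrable_diff)
  show "c *\<^sub>C (x + y) = c *\<^sub>C x + c *\<^sub>C y"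
    by transfer
      (simp add: L2_rel_def distrib_left square_integrable_add square_integrable_scale)
  show "(c + d) *\<^sub>C x = c *\<^sub>C x + d *\<^sub>C x"
    by transfer
      (simp add: L2_rel_def distrib_right square_integrable_add square_integrable_scale)
  show "c *\<^sub>C d *\<^sub>C x = (c * d) *\<^sub>C x"
    by transfer (simp add: L2_rel_def mult.assoc square_integrable_scale)
  show "1 *\<^sub>C x = x"
    by transfer (simp add: L2_rel_def)
qed

end

text \<open>\<open>L\<^sup>2(a,b)\<close> is the space of those classes that vanish almost everywhere outside \<open>(a,b)\<close>, that
  is, its elements are extended by zero.\<close>

lift_definition vanishes_outside :: "real \<Rightarrow> real \<Rightarrow> L2 \<Rightarrow> bool" is
  "\<lambda>a b f. AE x in lborel. x \<notin> {a<..<b} \<longrightarrow> f x = 0"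
proof -
  fix a b and f f' :: "real \<Rightarrow> complex"
  assume "L2_rel f f'"
  then show "(AE x in lborel. x \<notin> {a<..<b} \<longrightarrow> f x = 0) \<longleftrightarrow>
      (AE x in lborel. x \<notin> {a<..<b} \<longrightarrow> f' x = 0)"
    by (intro eventually_cong[OF L2_rel_AE]) (assumption, metis)
qed

definition L2_on :: "real \<Rightarrow> real \<Rightarrow> L2 set" where
  "L2_on a b = {f. vanishes_outside a b f}"

lift_definition L2_inner :: "real \<Rightarrow> real \<Rightarrow> L2 \<Rightarrow> L2 \<Rightarrow> complex" is
  "\<lambda>a b f g. LINT x:{a<..<b}|lborel. f x * cnj (g x)"
proof -
  fix a b and f f' g g' :: "real \<Rightarrow> complex"
  assume rel: "L2_rel f f'" "L2_rel g g'"
  then have [measurable]: "f \<in> borel_measurable lborel" "f' \<in> borel_measurable lborel"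
      "g \<in> borel_measurable lborel" "g' \<in> borel_measurable lborel"
    by (simp_all add: L2_rel_def square_integrable_def)
  have [measurable]: "cnj \<in> borel_measurable borel"
    by (intro borel_measurable_continuous_onI continuous_intros)
  have "AE x in lborel. indicator {a<..<b} x *\<^sub>R (f x * cnj (g x)) =
      indicator {a<..<b} x *\<^sub>R (f' x * cnj (g' x))"
    using L2_rel_AE[OF rel(1)] L2_rel_AE[OF rel(2)] by eventually_elim simp
  then show "(LINT x:{a<..<b}|lborel. f x * cnj (g x)) =
      (LINT x:{a<..<b}|lborel. f' x * cnj (g' x))"
    unfolding set_lebesgue_integral_def
    by (intro integral_cong_AE) measurable
qed

subsection \<open>Sobolev spaces on a bounded interval\<close>

definition smooth :: "(real \<Rightarrow> complex) \<Rightarrow> bool" where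
  "smooth \<phi> \<longleftrightarrow>
     (\<exists>D. D 0 = \<phi> \<and> (\<forall>(n::nat) x. (D n has_vector_derivative D (Suc n) x) (at x)))"

definition test_function :: "real \<Rightarrow> real \<Rightarrow> (real \<Rightarrow> complex) \<Rightarrow> bool" where
  "test_function a b \<phi> \<longleftrightarrow>
     smooth \<phi> \<and> (\<exists>K. compact K \<and> K \<subseteq> {a<..<b} \<and> (\<forall>x. x \<notin> K \<longrightarrow> \<phi> x = 0))"

lemma test_function_measurable:
  assumes "test_function a b \<phi>"
  shows "\<phi> \<in> borel_measurable borel" "(\<lambda>x. vector_derivative \<phi> (at x)) \<in> borel_measurable borel"
proof -
  obtain D where D: "D 0 = \<phi>" "\<And>(n::nat) x. (D n has_vector_derivative D (Suc n) x) (at x)"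
    using assms by (auto simp: test_function_def smooth_def)
  have cont: "continuous_on UNIV (D n)" for n
    by (meson D(2) continuous_at_imp_continuous_on has_vector_derivative_continuous)
  have "(\<lambda>x. vector_derivative \<phi> (at x)) = D 1"
    using D(2)[of 0] D(1) by (auto simp: fun_eq_iff intro!: vector_derivative_at)
  then show "\<phi> \<in> borel_measurable borel"
    "(\<lambda>x. vector_derivative \<phi> (at x)) \<in> borel_measurable borel"
    using cont[of 0] cont[of 1] D(1) by (auto intro: borel_measurable_continuous_onI)
qed

lemma integral_cong_L2_rel:
  assumes "L2_rel f g" and [measurable]: "h \<in> borel_measurable borel"
  shows "(LINT x:{a<..<b}|lborel. f x * h x) = (LINT x:{a<..<b}|lborel. g x * h x)"
proof -
  have [measurable]: "f \<in> borel_measurable lborel" "g \<in> borel_measurable lborel"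
    using assms(1) by (simp_all add: L2_rel_def square_integrable_def)
  have "AE x in lborel. indicator {a<..<b} x *\<^sub>R (f x * h x) =
      indicator {a<..<b} x *\<^sub>R (g x * h x)"
    using L2_rel_AE[OF assms(1)] by eventually_elim simp
  then show ?thesis
    unfolding set_lebesgue_integral_def
    by (intro integral_cong_AE) measurable
qed

lift_definition has_weak_derivative :: "real \<Rightarrow> real \<Rightarrow> L2 \<Rightarrow> L2 \<Rightarrow> bool" is
  "\<lambda>a b f g. \<forall>\<phi>. test_function a b \<phi> \<longrightarrow>
     (LINT x:{a<..<b}|lborel. f x * vector_derivative \<phi> (at x)) =
     - (LINT x:{a<..<b}|lborel. g x * \<phi> x)"
  by (intro all_cong1 imp_cong refl arg_cong2[where f = "(=)"] arg_cong[where f = uminus]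
        integral_cong_L2_rel)
     (auto intro: test_function_measurable)

definition weak_derivative :: "real \<Rightarrow> real \<Rightarrow> L2 \<Rightarrow> L2" where
  "weak_derivative a b f = (THE g. g \<in> L2_on a b \<and> has_weak_derivative a b f g)"

definition H1 :: "real \<Rightarrow> real \<Rightarrow> L2 set" where
  "H1 a b = {f \<in> L2_on a b. \<exists>g \<in> L2_on a b. has_weak_derivative a b f g}"

definition H2 :: "real \<Rightarrow> real \<Rightarrow> L2 set" where
  "H2 a b = {f \<in> H1 a b. weak_derivative a b f \<in> H1 a b}"

definition H1_norm :: "real \<Rightarrow> real \<Rightarrow> L2 \<Rightarrow> real" where
  "H1_norm a b f = sqrt (Re (L2_inner a b f f
     + L2_inner a b (weak_derivative a b f) (weak_derivative a b f)))"

definition H10 :: "real \<Rightarrow> real \<Rightarrow> L2 set" where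
  "H10 a b = {f \<in> H1 a b. \<forall>e>0. \<exists>\<phi>. test_function a b \<phi> \<and> H1_norm a b (f - abs_L2 \<phi>) < e}"

lift_definition continuous_representative :: "real \<Rightarrow> real \<Rightarrow> L2 \<Rightarrow> (real \<Rightarrow> complex) \<Rightarrow> bool" is
  "\<lambda>a b f g. continuous_on {a..b} g \<and> (AE x in lborel. x \<in> {a<..<b} \<longrightarrow> f x = g x)"
proof -
  fix a b and f f' :: "real \<Rightarrow> complex"
  assume "L2_rel f f'"
  then have "(AE x in lborel. x \<in> {a<..<b} \<longrightarrow> f x = g x) \<longleftrightarrow>
      (AE x in lborel. x \<in> {a<..<b} \<longrightarrow> f' x = g x)" for g
    by (intro eventually_cong[OF L2_rel_AE]) (assumption, metis)
  then show "(\<lambda>g. continuous_on {a..b} g \<and> (AE x in lborel. x \<in> {a<..<b} \<longrightarrow> f x = g x)) =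
      (\<lambda>g. continuous_on {a..b} g \<and> (AE x in lborel. x \<in> {a<..<b} \<longrightarrow> f' x = g x))"
    by simp
qed

text \<open>Pointwise values, end points included, refer to the continuous representative on \<open>[a,b]\<close>,
  which every element of \<open>H\<^sup>1(a,b)\<close> has.\<close>

definition value_at :: "real \<Rightarrow> real \<Rightarrow> L2 \<Rightarrow> real \<Rightarrow> complex" where
  "value_at a b f x = (THE c. \<exists>g. continuous_representative a b f g \<and> g x = c)"

subsection \<open>The coupled system\<close>

record params =
  L\<^sub>0 :: real
  L :: real
  \<rho>\<^sub>0 :: real
  \<rho>\<^sub>1 :: real
  \<rho>\<^sub>2 :: real
  \<alpha>\<^sub>1 :: real
  \<alpha>\<^sub>2 :: real
  \<beta>\<^sub>1 :: real
  \<beta>\<^sub>2 :: real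
  \<gamma> :: real
  \<kappa> :: real

abbreviation d\<^sub>1 :: "params \<Rightarrow> L2 \<Rightarrow> L2" where
  "d\<^sub>1 p \<equiv> weak_derivative 0 (L\<^sub>0 p)"

abbreviation d\<^sub>2 :: "params \<Rightarrow> L2 \<Rightarrow> L2" where
  "d\<^sub>2 p \<equiv> weak_derivative (L\<^sub>0 p) (L p)"

abbreviation ip\<^sub>1 :: "params \<Rightarrow> L2 \<Rightarrow> L2 \<Rightarrow> complex" where
  "ip\<^sub>1 p \<equiv> L2_inner 0 (L\<^sub>0 p)"

abbreviation ip\<^sub>2 :: "params \<Rightarrow> L2 \<Rightarrow> L2 \<Rightarrow> complex" where
  "ip\<^sub>2 p \<equiv> L2_inner (L\<^sub>0 p) (L p)"

abbreviation val\<^sub>1 :: "params \<Rightarrow> L2 \<Rightarrow> real \<Rightarrow> complex" where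
  "val\<^sub>1 p \<equiv> value_at 0 (L\<^sub>0 p)"

abbreviation val\<^sub>2 :: "params \<Rightarrow> L2 \<Rightarrow> real \<Rightarrow> complex" where
  "val\<^sub>2 p \<equiv> value_at (L\<^sub>0 p) (L p)"

definition V\<^sub>1 :: "params \<Rightarrow> (L2 \<times> L2) set" where
  "V\<^sub>1 p = {(u, y). u \<in> H1 0 (L\<^sub>0 p) \<and> y \<in> H1 (L\<^sub>0 p) (L p) \<and>
     val\<^sub>1 p u 0 = 0 \<and> val\<^sub>2 p y (L p) = 0 \<and> val\<^sub>1 p u (L\<^sub>0 p) = val\<^sub>2 p y (L\<^sub>0 p)}"

definition W\<^sub>1 :: "params \<Rightarrow> (L2 \<times> L2) set" where
  "W\<^sub>1 p = {(u, y). u \<in> H2 0 (L\<^sub>0 p) \<and> y \<in> H2 (L\<^sub>0 p) (L p) \<and> (u, y) \<in> V\<^sub>1 p \<and>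
     val\<^sub>1 p (d\<^sub>1 p u) 0 = 0 \<and> val\<^sub>2 p (d\<^sub>2 p y) (L p) = 0 \<and>
     val\<^sub>1 p (d\<^sub>1 p u) (L\<^sub>0 p) = val\<^sub>2 p (d\<^sub>2 p y) (L\<^sub>0 p)}"

definition V\<^sub>2 :: "params \<Rightarrow> (L2 \<times> L2 \<times> L2) set" where
  "V\<^sub>2 p = {(u, y, \<theta>). (u, y) \<in> V\<^sub>1 p \<and> \<theta> \<in> L2_on 0 (L\<^sub>0 p)}"

definition W\<^sub>2 :: "params \<Rightarrow> (L2 \<times> L2 \<times> L2) set" where
  "W\<^sub>2 p = {(u, y, \<theta>). (u, y) \<in> W\<^sub>1 p \<and> \<theta> \<in> H10 0 (L\<^sub>0 p)}"

fun form_a :: "params \<Rightarrow> L2 \<times> L2 \<Rightarrow> L2 \<times> L2 \<Rightarrow> complex" where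
  "form_a p (u, y) (u', y') =
     \<beta>\<^sub>1 p * ip\<^sub>1 p (d\<^sub>1 p (d\<^sub>1 p u)) (d\<^sub>1 p (d\<^sub>1 p u'))
     + \<beta>\<^sub>2 p * ip\<^sub>2 p (d\<^sub>2 p (d\<^sub>2 p y)) (d\<^sub>2 p (d\<^sub>2 p y'))"

fun form_b :: "params \<Rightarrow> L2 \<times> L2 \<times> L2 \<Rightarrow> L2 \<times> L2 \<times> L2 \<Rightarrow> complex" where
  "form_b p (u, y, \<theta>) (u', y', \<theta>') =
     \<gamma> p * (ip\<^sub>1 p (d\<^sub>1 p u) (d\<^sub>1 p \<theta>') - ip\<^sub>1 p (d\<^sub>1 p \<theta>) (d\<^sub>1 p u'))
     + \<kappa> p * ip\<^sub>1 p (d\<^sub>1 p \<theta>) (d\<^sub>1 p \<theta>')"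

fun form_c :: "params \<Rightarrow> L2 \<times> L2 \<times> L2 \<Rightarrow> L2 \<times> L2 \<times> L2 \<Rightarrow> complex" where
  "form_c p (u, y, \<theta>) (u', y', \<theta>') =
     \<rho>\<^sub>1 p * ip\<^sub>1 p u u' + \<alpha>\<^sub>1 p * ip\<^sub>1 p (d\<^sub>1 p u) (d\<^sub>1 p u')
     + \<rho>\<^sub>2 p * ip\<^sub>2 p y y' + \<alpha>\<^sub>2 p * ip\<^sub>2 p (d\<^sub>2 p y) (d\<^sub>2 p y')
     + \<rho>\<^sub>0 p * ip\<^sub>1 p \<theta> \<theta>'"

definition V\<^sub>2_dual :: "params \<Rightarrow> (L2 \<times> L2 \<times> L2 \<Rightarrow> complex) set" where
  "V\<^sub>2_dual p = antidual (V\<^sub>2 p) (\<lambda>U. sqrt (Re (form_c p U U)))"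

text \<open>The inclusion of the antidual of \<open>V\<^sub>2\<close> in that of \<open>W\<^sub>2\<close>; it is injective since \<open>W\<^sub>2\<close> is dense
  in \<open>V\<^sub>2\<close>.\<close>

definition dual_inclusion ::
  "params \<Rightarrow> (L2 \<times> L2 \<times> L2 \<Rightarrow> complex) \<Rightarrow> (L2 \<times> L2 \<times> L2 \<Rightarrow> complex)" where
  "dual_inclusion p F = restrict F (W\<^sub>2 p)"

definition op_C :: "params \<Rightarrow> L2 \<times> L2 \<times> L2 \<Rightarrow> (L2 \<times> L2 \<times> L2 \<Rightarrow> complex)" where
  "op_C p U = (\<lambda>U' \<in> V\<^sub>2 p. form_c p U U')"

definition op_B :: "params \<Rightarrow> L2 \<times> L2 \<times> L2 \<Rightarrow> (L2 \<times> L2 \<times> L2 \<Rightarrow> complex)" where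
  "op_B p U = (\<lambda>U' \<in> W\<^sub>2 p. form_b p U U')"

definition op_A\<^sub>1 :: "params \<Rightarrow> L2 \<times> L2 \<Rightarrow> (L2 \<times> L2 \<times> L2 \<Rightarrow> complex)" where
  "op_A\<^sub>1 p Z = (\<lambda>(u', y', \<theta>') \<in> W\<^sub>2 p. form_a p Z (u', y'))"

type_synonym state = "(L2 \<times> L2) \<times> (L2 \<times> L2 \<times> L2)"

definition energy_space :: "params \<Rightarrow> state set" where
  "energy_space p = W\<^sub>1 p \<times> V\<^sub>2 p"

definition energy_inner :: "params \<Rightarrow> state \<Rightarrow> state \<Rightarrow> complex" where
  "energy_inner p \<Phi> \<Psi> = form_a p (fst \<Phi>) (fst \<Psi>) + form_c p (snd \<Phi>) (snd \<Psi>)"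

definition energy_norm :: "params \<Rightarrow> state \<Rightarrow> real" where
  "energy_norm p \<Phi> = sqrt (Re (energy_inner p \<Phi> \<Phi>))"

definition BA\<^sub>1 :: "params \<Rightarrow> state \<Rightarrow> (L2 \<times> L2 \<times> L2 \<Rightarrow> complex)" where
  "BA\<^sub>1 p \<Phi> = (\<lambda>U' \<in> W\<^sub>2 p. op_B p (snd \<Phi>) U' + op_A\<^sub>1 p (fst \<Phi>) U')"

definition dom_A :: "params \<Rightarrow> state set" where
  "dom_A p = {\<Phi> \<in> W\<^sub>1 p \<times> W\<^sub>2 p. BA\<^sub>1 p \<Phi> \<in> dual_inclusion p ` V\<^sub>2_dual p}"

fun op_A :: "params \<Rightarrow> state \<Rightarrow> state" where
  "op_A p (\<Phi>\<^sub>1, (v, z, \<theta>)) =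
     ((v, z), - inv_into (V\<^sub>2 p) (op_C p)
        (inv_into (V\<^sub>2_dual p) (dual_inclusion p) (BA\<^sub>1 p (\<Phi>\<^sub>1, (v, z, \<theta>)))))"

end

theory Submission
  imports Defs
begin

text \<open>The proof avoids both compactness and spectral theory. By density of \<open>D(\<A>\<^sup>6)\<close> and contractivity it
  suffices to treat orbits starting in \<open>D(\<A>\<^sup>6)\<close>, for which several time derivatives remain bounded in the
  energy norm. The energy of each derivative decreases at the rate \<open>2 \<kappa> \<parallel>\<theta>\<^sub>x\<parallel>\<^sup>2\<close>, whose derivative is bounded, so
  \<open>\<theta>\<^sub>x\<close> tends to \<open>0\<close>. The heat equation then forces \<open>u\<^sub>t\<close>, hence also its traces at \<open>L\<^sub>0\<close>, to tend to \<open>0\<close>.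
  On the undamped interval the multiplier \<open>(x - L) y\<^sub>t\<^sub>x - y\<^sub>t\<close> yields a bounded functional whose time derivative
  is at most a null function minus half of the energy of the differentiated orbit; therefore that energy tends to
  \<open>0\<close>. Testing the equation with the displacement itself transfers the decay to the orbit.\<close>


subsection \<open>The Hilbert space of square-integrable classes\<close>

text \<open>Dissipation acts only through the temperature gradient on the first interval, and the
  heat equation sees the displacement only through its velocity. Smallness is therefore available
  for time derivatives of order at least one, so the undifferentiated orbit cannot be treated
  directly. The exponent six comes from counting losses: the multiplier estimate at order 1 needs
  \<open>U 3\<close> small, the heat equation for \<open>U 3\<close> needs
  \<open>\<Theta> 3\<close>, and the decay of its gradient differentiates the energy of
  \<open>X 3\<close> twice, so \<open>X 5\<close> must be bounded; writing \<open>X 5\<close> in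
  terms of displacements takes one more power of the generator. Two features of the setting shape
  the preparation. The energy is not the product norm of the type of states, so states are mapped
  isometrically by \<open>emb\<close> onto a closed subspace of seven copies of \<open>L2\<close>,
  where semigroup theory is done. The domain of the generator is described only through functionals,
  so its elements come with two derivatives in space; the Rellich identity for y_xx needs a third
  one, which is recovered from the weak equation.\<close>

lemma cnj_measurable [measurable]: "cnj \<in> borel_measurable borel"
  by (intro borel_measurable_continuous_onI continuous_intros)

lemma square_integrable_measurable: "square_integrable f \<Longrightarrow> f \<in> borel_measurable borel"
  by (simp add: square_integrable_def)

lemma square_integrable_mult_cnj:
  assumes "square_integrable f" "square_integrable g"
  shows "integrable lborel (\<lambda>x. f x * cnj (g x))"
proof -
  have [measurable]: "f \<in> borel_measurable borel" "g \<in> borel_measurable borel"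
    using assms by (auto dest: square_integrable_measurable)
  have int: "integrable lborel (\<lambda>x. (cmod (f x))\<^sup>2 + (cmod (g x))\<^sup>2)"
    using assms by (auto simp: square_integrable_def)
  have bound: "cmod (f x * cnj (g x)) \<le> (cmod (f x))\<^sup>2 + (cmod (g x))\<^sup>2" for x
  proof -
    have "0 \<le> (cmod (f x) - cmod (g x))\<^sup>2" "0 \<le> cmod (f x) * cmod (g x)" by auto
    then show ?thesis
      unfolding norm_mult complex_mod_cnj power2_diff by linarith
  qed
  show ?thesis
    by (rule Bochner_Integration.integrable_bound[OF int]) (use bound in auto)
qed

text \<open>Integrating over the whole line removes the interval from the notation: classes in
  \<open>L2_on a b\<close> vanish outside, so \<open>L2_inner_eq_cip\<close> identifies this with
  \<open>L2_inner a b\<close> once one argument is supported there.\<close>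

lift_definition cip :: "L2 \<Rightarrow> L2 \<Rightarrow> complex" is "\<lambda>f g. LINT x|lborel. f x * cnj (g x)"
proof -
  fix f f' g g' :: "real \<Rightarrow> complex"
  assume rel: "L2_rel f f'" "L2_rel g g'"
  then have [measurable]: "f \<in> borel_measurable borel" "f' \<in> borel_measurable borel"
      "g \<in> borel_measurable borel" "g' \<in> borel_measurable borel"
    by (simp_all add: L2_rel_def square_integrable_def)
  have "AE x in lborel. f x * cnj (g x) = f' x * cnj (g' x)"
    using L2_rel_AE[OF rel(1)] L2_rel_AE[OF rel(2)] by eventually_elim simp
  then show "(LINT x|lborel. f x * cnj (g x)) = (LINT x|lborel. f' x * cnj (g' x))"
    by (intro integral_cong_AE) measurable
qed

lemma cip_add_left: "cip (f + g) h = cip f h + cip g h"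
  by transfer
    (simp add: L2_rel_def distrib_right square_integrable_mult_cnj)

lemma cip_cnj: "cip g f = cnj (cip f g)"
proof transfer
  fix f g :: "real \<Rightarrow> complex"
  have "(LINT x|lborel. g x * cnj (f x)) = (LINT x|lborel. cnj (f x * cnj (g x)))"
    by (simp add: mult.commute)
  also have "\<dots> = cnj (LINT x|lborel. f x * cnj (g x))"
    by (rule Bochner_Integration.integral_cnj)
  finally show "(LINT x|lborel. g x * cnj (f x)) = cnj (LINT x|lborel. f x * cnj (g x))" .
qed

lemma cip_add_right: "cip h (f + g) = cip h f + cip h g"
  using arg_cong[OF cip_add_left[of f g h], of cnj] by (simp add: cip_cnj[symmetric])

lemma cip_scaleC_left: "cip (c *\<^sub>C f) h = c * cip f h"
  by transfer (simp add: mult.assoc)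

lemma cip_scaleC_right: "cip h (c *\<^sub>C f) = cnj c * cip h f"
  using arg_cong[OF cip_scaleC_left[of c f h], of cnj] by (simp add: cip_cnj[symmetric])

lemma scaleC_minus1: "(-1) *\<^sub>C f = - f" for f :: "'a::complex_vector"
proof -
  have "0 *\<^sub>C f = 0"
    using scaleC_add_left[of 0 0 f] by simp
  moreover have "(1 + -1) *\<^sub>C f = f + (-1) *\<^sub>C f"
    by (simp only: scaleC_add_left scaleC_one)
  ultimately show ?thesis
    by (simp add: eq_neg_iff_add_eq_0 add.commute)
qed

lemma scaleC_zero_left [simp]: "0 *\<^sub>C f = (0::'a::complex_vector)"
  using scaleC_add_left[of 0 0 f] by simp

lemma scaleC_zero_right [simp]: "c *\<^sub>C (0::'a::complex_vector) = 0"
  using scaleC_add_right[of c 0 0] by simp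

lemma scaleC_diff_right: "c *\<^sub>C (x - y) = c *\<^sub>C x - c *\<^sub>C (y::'a::complex_vector)"
  using scaleC_add_right[of c "x - y" y] by (simp add: eq_diff_eq)

lemma cip_self: "Im (cip f f) = 0" "Re (cip f f) \<ge> 0"
proof -
  have "cip f f = of_real (Re (cip f f)) \<and> Re (cip f f) \<ge> 0"
  proof transfer
    fix f :: "real \<Rightarrow> complex"
    have *: "(\<lambda>x. f x * cnj (f x)) = (\<lambda>x. of_real ((cmod (f x))\<^sup>2))"
      by (rule ext) (rule complex_norm_square[symmetric])
    show "(LINT x|lborel. f x * cnj (f x)) = complex_of_real (Re (LINT x|lborel. f x * cnj (f x))) \<and>
       0 \<le> Re (LINT x|lborel. f x * cnj (f x))"
      unfolding * integral_complex_of_real by simp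
  qed
  then show "Im (cip f f) = 0" "Re (cip f f) \<ge> 0"
    by (auto simp: complex_eq_iff)
qed

lemma cip_self_eq_0: "Re (cip f f) = 0 \<longleftrightarrow> f = 0"
proof transfer
  fix f :: "real \<Rightarrow> complex"
  assume "L2_rel f f"
  then have [measurable]: "f \<in> borel_measurable lborel" and sq: "square_integrable f"
    and i: "integrable lborel (\<lambda>x. (cmod (f x))\<^sup>2)"
    by (auto simp: L2_rel_def square_integrable_def)
  have *: "(\<lambda>x. f x * cnj (f x)) = (\<lambda>x. of_real ((cmod (f x))\<^sup>2))"
    by (rule ext) (rule complex_norm_square[symmetric])
  have "Re (LINT x|lborel. f x * cnj (f x)) = 0 \<longleftrightarrow> (AE x in lborel. (cmod (f x))\<^sup>2 = 0)"
    unfolding * integral_complex_of_real Re_complex_of_real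
    using i by (intro integral_nonneg_eq_0_iff_AE) auto
  also have "\<dots> \<longleftrightarrow> L2_rel f (\<lambda>_. 0)"
    using sq by (simp add: L2_rel_def square_integrable_zero)
  finally show "Re (LINT x|lborel. f x * cnj (f x)) = 0 \<longleftrightarrow> L2_rel f (\<lambda>_. 0)" .
qed

text \<open>The real part of \<open>cip\<close> gives norms, limits, time derivatives and integrals
  of functions with values in \<open>L2\<close>; the complex structure stays available through
  \<open>cip\<close> and \<open>scaleC\<close>.\<close>

instantiation L2 :: real_inner
begin

definition scaleR_L2 :: "real \<Rightarrow> L2 \<Rightarrow> L2" where
  "scaleR_L2 r f = complex_of_real r *\<^sub>C f"

definition inner_L2 :: "L2 \<Rightarrow> L2 \<Rightarrow> real" where
  "inner_L2 f g = Re (cip f g)"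

definition norm_L2 :: "L2 \<Rightarrow> real" where
  "norm_L2 f = sqrt (inner f f)"

definition dist_L2 :: "L2 \<Rightarrow> L2 \<Rightarrow> real" where
  "dist_L2 f g = norm (f - g)"

definition sgn_L2 :: "L2 \<Rightarrow> L2" where
  "sgn_L2 f = complex_of_real (inverse (norm f)) *\<^sub>C f"

definition uniformity_L2 :: "(L2 \<times> L2) filter" where
  "uniformity_L2 = (INF e\<in>{0<..}. principal {(x, y). dist x y < e})"

definition open_L2 :: "L2 set \<Rightarrow> bool" where
  "open_L2 U \<longleftrightarrow> (\<forall>x\<in>U. eventually (\<lambda>(x', y). x' = x \<longrightarrow> y \<in> U) uniformity)"

instance
proof
  fix x y z :: L2 and r s :: real
  show "r *\<^sub>R (x + y) = r *\<^sub>R x + r *\<^sub>R y"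
    by (simp add: scaleR_L2_def scaleC_add_right)
  show "(r + s) *\<^sub>R x = r *\<^sub>R x + s *\<^sub>R x"
    by (simp add: scaleR_L2_def scaleC_add_left)
  show "r *\<^sub>R s *\<^sub>R x = (r * s) *\<^sub>R x"
    by (simp add: scaleR_L2_def scaleC_scaleC)
  show "1 *\<^sub>R x = x"
    by (simp add: scaleR_L2_def scaleC_one)
  show "inner x y = inner y x"
    unfolding inner_L2_def by (simp add: cip_cnj[of x y])
  show "inner (x + y) z = inner x z + inner y z"
    by (simp add: inner_L2_def cip_add_left)
  show "inner (r *\<^sub>R x) y = r * inner x y"
    by (simp add: inner_L2_def scaleR_L2_def cip_scaleC_left)
  show "0 \<le> inner x x" "inner x x = 0 \<longleftrightarrow> x = 0"
    by (simp_all add: inner_L2_def cip_self cip_self_eq_0)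
qed (simp_all add: dist_L2_def sgn_L2_def scaleR_L2_def uniformity_L2_def open_L2_def norm_L2_def)

end

lemma norm_L2_sq: "(norm f)\<^sup>2 = Re (cip f f)" for f :: L2
  by (simp add: norm_L2_def inner_L2_def cip_self)

lemma cip_self_norm: "cip f f = of_real ((norm f)\<^sup>2)" for f :: L2
  by (simp add: norm_L2_sq complex_eq_iff cip_self)

lemma norm_scaleC_L2: "norm (c *\<^sub>C f) = cmod c * norm f" for f :: L2
proof -
  have "(norm (c *\<^sub>C f))\<^sup>2 = Re (c * cnj c * cip f f)"
    by (simp add: norm_L2_sq cip_scaleC_left cip_scaleC_right mult.assoc[symmetric])
  also have "\<dots> = (cmod c * norm f)\<^sup>2"
    by (simp only: cip_self_norm power_mult_distrib flip: complex_norm_square of_real_mult) simp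
  finally show ?thesis
    by (simp add: power2_eq_iff_nonneg)
qed

text \<open>Rotating \<open>f\<close> by the phase of \<open>cip f g\<close> makes the pairing real
  and nonnegative, and the real Cauchy-Schwarz inequality applies.\<close>

lemma cip_cauchy_schwarz: "cmod (cip f g) \<le> norm f * norm g"
proof (cases "cip f g = 0")
  case False
  define c where "c = cip f g / cmod (cip f g)"
  have c: "cmod c = 1" using False by (simp add: c_def norm_divide)
  have "cnj c * cip f g = of_real (cmod (cip f g))"
    using False complex_norm_square[of "cip f g"]
    by (simp add: c_def field_simps power2_eq_square)
  then have "cip (cnj c *\<^sub>C f) g = of_real (cmod (cip f g))"
    by (simp add: cip_scaleC_left)
  then have "cmod (cip f g) = inner (cnj c *\<^sub>C f) g"
    by (simp add: inner_L2_def)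
  also have "\<dots> \<le> norm (cnj c *\<^sub>C f) * norm g" by (rule norm_cauchy_schwarz)
  finally show ?thesis by (simp add: norm_scaleC_L2 c)
qed simp

text \<open>Conjugate linearity in the second argument is still real linearity, so limits,
  continuity and the product rule for \<open>cip\<close> come from the general theory.\<close>

lemma bounded_bilinear_cip: "bounded_bilinear cip"
proof
  fix a a' b b' :: L2 and r :: real
  show "cip (a + a') b = cip a b + cip a' b" by (rule cip_add_left)
  show "cip a (b + b') = cip a b + cip a b'" by (rule cip_add_right)
  show "cip (r *\<^sub>R a) b = r *\<^sub>R cip a b"
    unfolding scaleR_L2_def cip_scaleC_left scaleR_conv_of_real ..
  show "cip a (r *\<^sub>R b) = r *\<^sub>R cip a b"
    unfolding scaleR_L2_def cip_scaleC_right scaleR_conv_of_real by simp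
  show "\<exists>K. \<forall>a b. cmod (cip a b) \<le> norm a * norm b * K"
    by (rule exI[of _ 1]) (simp add: cip_cauchy_schwarz)
qed

interpretation cip: bounded_bilinear cip by (rule bounded_bilinear_cip)

lemma bounded_linear_scaleC_left: "bounded_linear (\<lambda>c. c *\<^sub>C (f::L2))"
proof
  fix c d and r :: real
  show "(c + d) *\<^sub>C f = c *\<^sub>C f + d *\<^sub>C f" by (rule scaleC_add_left)
  show "(r *\<^sub>R c) *\<^sub>C f = r *\<^sub>R c *\<^sub>C f"
    by (simp add: scaleR_L2_def scaleC_scaleC scaleR_conv_of_real)
  show "\<exists>K. \<forall>c. norm (c *\<^sub>C f) \<le> norm c * K"
    by (rule exI[of _ "norm f"]) (simp add: norm_scaleC_L2)
qed

lemma abs_L2_cases: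
  obtains f where "square_integrable f" "x = abs_L2 f"
  using that by (induction x rule: L2.abs_induct) (auto simp: L2_rel_def)

lemma cip_abs_L2:
  "square_integrable f \<Longrightarrow> square_integrable g \<Longrightarrow>
   cip (abs_L2 f) (abs_L2 g) = (LINT x|lborel. f x * cnj (g x))"
  by (simp add: cip.abs_eq L2_rel_def)

lemma norm_abs_L2:
  assumes "square_integrable f"
  shows "(norm (abs_L2 f))\<^sup>2 = (LINT x|lborel. (cmod (f x))\<^sup>2)"
proof -
  have *: "(\<lambda>x. f x * cnj (f x)) = (\<lambda>x. of_real ((cmod (f x))\<^sup>2))"
    by (rule ext) (rule complex_norm_square[symmetric])
  show ?thesis
    using assms unfolding norm_L2_sq by (simp only: cip_abs_L2 * integral_complex_of_real) simp
qed

lemma abs_L2_eq_iff: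
  "square_integrable f \<Longrightarrow> square_integrable g \<Longrightarrow>
   abs_L2 f = abs_L2 g \<longleftrightarrow> (AE x in lborel. f x = g x)"
  using Quotient3_rel[OF Quotient3_L2, of f g] by (auto simp: L2_rel_def)

lemma abs_L2_diff:
  "square_integrable f \<Longrightarrow> square_integrable g \<Longrightarrow> abs_L2 f - abs_L2 g = abs_L2 (\<lambda>x. f x - g x)"
  by (simp add: minus_L2.abs_eq L2_rel_def)

lemma abs_L2_add:
  "square_integrable f \<Longrightarrow> square_integrable g \<Longrightarrow> abs_L2 f + abs_L2 g = abs_L2 (\<lambda>x. f x + g x)"
  by (simp add: plus_L2.abs_eq L2_rel_def)

lemma abs_L2_scaleC:
  "square_integrable f \<Longrightarrow> c *\<^sub>C abs_L2 f = abs_L2 (\<lambda>x. c * f x)"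
  by (simp add: scaleC_L2.abs_eq L2_rel_def)

lemma norm_abs_L2_cmod:
  assumes "square_integrable f"
  shows "square_integrable (\<lambda>x. complex_of_real (cmod (f x)))"
    "norm (abs_L2 (\<lambda>x. complex_of_real (cmod (f x)))) = norm (abs_L2 f)"
proof -
  show sq: "square_integrable (\<lambda>x. complex_of_real (cmod (f x)))"
    using assms by (auto simp: square_integrable_def)
  have "(norm (abs_L2 (\<lambda>x. complex_of_real (cmod (f x)))))\<^sup>2 = (norm (abs_L2 f))\<^sup>2"
    by (simp add: norm_abs_L2 assms sq)
  then show "norm (abs_L2 (\<lambda>x. complex_of_real (cmod (f x)))) = norm (abs_L2 f)"
    by (simp add: power2_eq_iff_nonneg)
qed

section \<open>Completeness by the Riesz-Fischer argument\<close>

lemma nn_integral_norm_abs_L2: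
  assumes "square_integrable f"
  shows "(\<integral>\<^sup>+x. ennreal ((cmod (f x))\<^sup>2) \<partial>lborel) = ennreal ((norm (abs_L2 f))\<^sup>2)"
  using assms by (subst nn_integral_eq_integral) (auto simp: square_integrable_def norm_abs_L2[OF assms])

lemma square_integrable_sum:
  "finite I \<Longrightarrow> (\<And>i. i \<in> I \<Longrightarrow> square_integrable (g i)) \<Longrightarrow> square_integrable (\<lambda>x. \<Sum>i\<in>I. g i x)"
  by (induction I rule: finite_induct) (auto intro: square_integrable_add square_integrable_zero)

lemma abs_L2_sum:
  "finite I \<Longrightarrow> (\<And>i. i \<in> I \<Longrightarrow> square_integrable (g i)) \<Longrightarrow>
    (\<Sum>i\<in>I. abs_L2 (g i)) = abs_L2 (\<lambda>x. \<Sum>i\<in>I. g i x)"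
proof (induction I rule: finite_induct)
  case empty
  show ?case by (simp add: zero_L2_def)
next
  case (insert i I)
  then show ?case by (simp add: abs_L2_add square_integrable_sum)
qed

text \<open>The norms of the increments sum to at most 2, and so do the norms of the partial sums of
  their moduli. Monotone convergence makes the full sum finite almost everywhere, and the sequence
  itself is recovered by telescoping.\<close>

lemma L2_fast_Cauchy_AE_convergent:
  assumes f: "\<And>n. square_integrable (f n)"
    and fast: "\<And>n. norm (abs_L2 (f (Suc n)) - abs_L2 (f n)) \<le> (1/2) ^ n"
  shows "AE x in lborel. convergent (\<lambda>n. f n x)"
proof -
  define d where "d n x = complex_of_real (cmod (f (Suc n) x - f n x))" for n x
  have sqd: "square_integrable (d n)" for n
    unfolding d_def by (intro norm_abs_L2_cmod(1) square_integrable_diff f)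
  have nd: "norm (abs_L2 (d n)) \<le> (1/2) ^ n" for n
    unfolding d_def using fast[of n]
    by (simp add: norm_abs_L2_cmod(2) square_integrable_diff f abs_L2_diff)
  define G where "G N x = (\<Sum>n<N. d n x)" for N x
  have sqG: "square_integrable (G N)" for N
    unfolding G_def by (intro square_integrable_sum sqd) auto
  have [measurable]: "G N \<in> borel_measurable borel" for N
    using sqG by (rule square_integrable_measurable)
  have Greal: "cmod (G N x) = (\<Sum>n<N. cmod (f (Suc n) x - f n x))" for N x
    unfolding G_def d_def of_real_sum[symmetric] norm_of_real by (simp add: sum_nonneg)
  have nG: "norm (abs_L2 (G N)) \<le> 2" for N
  proof -
    have "norm (abs_L2 (G N)) \<le> (\<Sum>n<N. norm (abs_L2 (d n)))"
      unfolding G_def using sqd by (subst abs_L2_sum[symmetric]) (auto intro: norm_sum)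
    also have "\<dots> \<le> (\<Sum>n<N. (1/2) ^ n)"
      by (intro sum_mono nd)
    also have "\<dots> \<le> (\<Sum>n. (1/2::real) ^ n)"
      by (intro sum_le_suminf) (auto intro: summable_geometric)
    also have "\<dots> = 2" by (subst suminf_geometric) auto
    finally show ?thesis .
  qed
  have inc: "incseq (\<lambda>N x. ennreal ((cmod (G N x))\<^sup>2))"
    unfolding Greal by (intro incseq_SucI le_funI ennreal_leI power_mono) (auto intro: sum_nonneg)
  have "(\<integral>\<^sup>+x. (SUP N. ennreal ((cmod (G N x))\<^sup>2)) \<partial>lborel) =
      (SUP N. \<integral>\<^sup>+x. ennreal ((cmod (G N x))\<^sup>2) \<partial>lborel)"
    by (intro nn_integral_monotone_convergence_SUP inc) auto
  also have "\<dots> \<le> ennreal 4"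
  proof (rule SUP_least)
    fix N
    have "(norm (abs_L2 (G N)))\<^sup>2 \<le> 2\<^sup>2"
      by (intro power_mono nG) auto
    then show "(\<integral>\<^sup>+x. ennreal ((cmod (G N x))\<^sup>2) \<partial>lborel) \<le> ennreal 4"
      unfolding nn_integral_norm_abs_L2[OF sqG] by (intro ennreal_leI) simp
  qed
  finally have "(\<integral>\<^sup>+x. (SUP N. ennreal ((cmod (G N x))\<^sup>2)) \<partial>lborel) \<noteq> \<infinity>"
    by (auto simp: top_unique)
  then have "AE x in lborel. (SUP N. ennreal ((cmod (G N x))\<^sup>2)) \<noteq> \<infinity>"
    by (intro nn_integral_PInf_AE) auto
  then show ?thesis
  proof eventually_elim
    fix x
    assume fin: "(SUP N. ennreal ((cmod (G N x))\<^sup>2)) \<noteq> \<infinity>"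
    then obtain B where B: "B \<ge> 0" "(SUP N. ennreal ((cmod (G N x))\<^sup>2)) = ennreal B"
      by (cases "SUP N. ennreal ((cmod (G N x))\<^sup>2)") auto
    have "(cmod (G N x))\<^sup>2 \<le> B" for N
    proof -
      have "ennreal ((cmod (G N x))\<^sup>2) \<le> ennreal B"
        unfolding B(2)[symmetric] by (rule SUP_upper) simp
      then show ?thesis using B(1) by (simp add: ennreal_le_iff)
    qed
    then have "cmod (G N x) \<le> sqrt B" for N
      by (simp add: real_le_rsqrt)
    then have "summable (\<lambda>n. cmod (f (Suc n) x - f n x))"
      unfolding Greal
      by (intro summableI_nonneg_bounded[where x = "sqrt B"]) auto
    then have "summable (\<lambda>n. f (Suc n) x - f n x)"
      by (rule summable_norm_cancel)
    then have "convergent (\<lambda>n. \<Sum>i<n. (f (Suc i) x - f i x))"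
      by (simp add: summable_iff_convergent)
    then have "convergent (\<lambda>n. f n x - f 0 x)"
      by (simp add: sum_lessThan_telescope[of "\<lambda>n. f n x"])
    then show "convergent (\<lambda>n. f n x)"
      using convergent_add[OF _ convergent_const, of "\<lambda>n. f n x - f 0 x" "f 0 x"] by simp
  qed
qed

text \<open>The limit is built pointwise almost everywhere; Fatou's lemma turns the Cauchy bound on
  \<open>X n - X m\<close> into a bound on the distance of \<open>X m\<close> from the pointwise
  limit.\<close>

lemma L2_fast_Cauchy_convergent:
  fixes X :: "nat \<Rightarrow> L2"
  assumes C: "Cauchy X" and fast: "\<And>n. norm (X (Suc n) - X n) \<le> (1/2) ^ n"
  shows "convergent X"
proof -
  have "\<forall>n. \<exists>f. square_integrable f \<and> X n = abs_L2 f"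
    by (metis abs_L2_cases)
  then obtain f where f: "\<And>n. square_integrable (f n)" and Xf: "\<And>n. X n = abs_L2 (f n)"
    by metis
  have [measurable]: "f n \<in> borel_measurable borel" for n
    using f by (rule square_integrable_measurable)
  have conv: "AE x in lborel. convergent (\<lambda>n. f n x)"
    using fast by (intro L2_fast_Cauchy_AE_convergent f) (simp add: Xf)
  \<comment> \<open>\<open>lim\<close> is unspecified where the sequence diverges; this happens only
    on a null set, and measurability of \<open>lim\<close> holds regardless.\<close>
  define F where "F x = lim (\<lambda>n. f n x)" for x
  have [measurable]: "F \<in> borel_measurable borel"
    unfolding F_def by (rule borel_measurable_lim_metric) simp
  have fatou: "(\<integral>\<^sup>+x. ennreal ((cmod (F x - f m x))\<^sup>2) \<partial>lborel) \<le> ennreal (e\<^sup>2)"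
    if e: "e > 0" and M: "\<And>n. n \<ge> M \<Longrightarrow> norm (X n - X m) \<le> e" for e m M
  proof -
    have "(\<integral>\<^sup>+x. ennreal ((cmod (F x - f m x))\<^sup>2) \<partial>lborel) =
        (\<integral>\<^sup>+x. liminf (\<lambda>n. ennreal ((cmod (f n x - f m x))\<^sup>2)) \<partial>lborel)"
    proof (rule nn_integral_cong_AE)
      show "AE x in lborel. ennreal ((cmod (F x - f m x))\<^sup>2) =
          liminf (\<lambda>n. ennreal ((cmod (f n x - f m x))\<^sup>2))"
        using conv
      proof eventually_elim
        fix x assume "convergent (\<lambda>n. f n x)"
        then have "(\<lambda>n. f n x) \<longlonglongrightarrow> F x"
          by (simp add: convergent_LIMSEQ_iff F_def)
        then have "(\<lambda>n. ennreal ((cmod (f n x - f m x))\<^sup>2)) \<longlonglongrightarrow> ennreal ((cmod (F x - f m x))\<^sup>2)"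
          by (intro tendsto_intros) auto
        then show "ennreal ((cmod (F x - f m x))\<^sup>2) =
            liminf (\<lambda>n. ennreal ((cmod (f n x - f m x))\<^sup>2))"
          by (metis lim_imp_Liminf sequentially_bot)
      qed
    qed
    also have "\<dots> \<le> liminf (\<lambda>n. \<integral>\<^sup>+x. ennreal ((cmod (f n x - f m x))\<^sup>2) \<partial>lborel)"
      by (rule nn_integral_liminf) measurable
    also have "\<dots> = liminf (\<lambda>n. ennreal ((norm (X n - X m))\<^sup>2))"
      by (simp add: nn_integral_norm_abs_L2 square_integrable_diff f Xf abs_L2_diff)
    also have "\<dots> \<le> ennreal (e\<^sup>2)"
    proof (rule Liminf_le)
      show "\<forall>\<^sub>F n in sequentially. ennreal ((norm (X n - X m))\<^sup>2) \<le> ennreal (e\<^sup>2)"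
        using eventually_ge_at_top[of M]
        by eventually_elim (auto intro!: ennreal_leI power_mono M)
    qed simp
    finally show ?thesis .
  qed
  have sq: "square_integrable (\<lambda>x. F x - f m x) \<and> norm (abs_L2 (\<lambda>x. F x - f m x)) \<le> e"
    if e: "e > 0" and M: "\<And>n. n \<ge> M \<Longrightarrow> norm (X n - X m) \<le> e" for e m M
  proof -
    have *: "(\<integral>\<^sup>+x. ennreal ((cmod (F x - f m x))\<^sup>2) \<partial>lborel) \<le> ennreal (e\<^sup>2)"
      using fatou[of e M m] e M by blast
    have "(\<integral>\<^sup>+x. ennreal ((cmod (F x - f m x))\<^sup>2) \<partial>lborel) < top"
      using * by (rule le_less_trans) (rule ennreal_less_top)
    then have si: "square_integrable (\<lambda>x. F x - f m x)"
      unfolding square_integrable_def by (auto intro!: integrableI_bounded)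
    have "ennreal ((norm (abs_L2 (\<lambda>x. F x - f m x)))\<^sup>2) \<le> ennreal (e\<^sup>2)"
      using * nn_integral_norm_abs_L2[OF si] by simp
    then have "(norm (abs_L2 (\<lambda>x. F x - f m x)))\<^sup>2 \<le> e\<^sup>2"
      by (simp add: ennreal_le_iff)
    then show ?thesis
      using si e by (simp add: abs_le_square_iff[symmetric])
  qed
  have Cm: "\<exists>M. \<forall>m\<ge>M. \<forall>n\<ge>M. norm (X n - X m) \<le> e" if "e > 0" for e
    using CauchyD[OF C that] by (metis less_imp_le)
  obtain M1 where "\<forall>m\<ge>M1. \<forall>n\<ge>M1. norm (X n - X m) \<le> 1"
    using Cm[of 1] by auto
  then have "square_integrable (\<lambda>x. F x - f M1 x)"
    using sq[of 1 M1 M1] by auto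
  from square_integrable_add[OF this f[of M1]] have sqF: "square_integrable F"
    by simp
  have "X \<longlonglongrightarrow> abs_L2 F"
  proof (rule LIMSEQ_I)
    fix r :: real assume r: "0 < r"
    obtain M where M: "\<forall>m\<ge>M. \<forall>n\<ge>M. norm (X n - X m) \<le> r/2"
      using Cm[of "r/2"] r by auto
    have "norm (X m - abs_L2 F) < r" if "m \<ge> M" for m
    proof -
      have "norm (abs_L2 (\<lambda>x. F x - f m x)) \<le> r/2"
        using sq[of "r/2" M m] M that r by auto
      then have "norm (abs_L2 F - X m) \<le> r/2"
        by (simp add: Xf abs_L2_diff sqF f)
      then show ?thesis using r by (simp add: norm_minus_commute)
    qed
    then show "\<exists>no. \<forall>n\<ge>no. norm (X n - abs_L2 F) < r" by blast
  qed
  then show ?thesis by (rule convergentI)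
qed

instance L2 :: banach
proof
  fix X :: "nat \<Rightarrow> L2"
  assume C: "Cauchy X"
  have "\<forall>k::nat. \<exists>N. \<forall>m\<ge>N. \<forall>n\<ge>N. norm (X m - X n) < (1/2) ^ k"
    by (intro allI CauchyD[OF C]) simp
  then obtain N where N: "\<And>k m n. m \<ge> N k \<Longrightarrow> n \<ge> N k \<Longrightarrow> norm (X m - X n) < (1/2) ^ k"
    by metis
  \<comment> \<open>The maximum makes \<open>r\<close> strictly increasing while keeping
    \<open>r n \<ge> N n\<close>, so consecutive terms of the subsequence differ by at most the n-th
    power of 1/2.\<close>
  define r where "r = rec_nat (N 0) (\<lambda>n k. max (N (Suc n)) (Suc k))"
  have r_Suc: "r (Suc n) = max (N (Suc n)) (Suc (r n))" for n
    by (simp add: r_def)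
  have r_N: "r n \<ge> N n" for n
    by (cases n) (auto simp: r_def)
  have r: "strict_mono r"
    by (rule strict_monoI_Suc) (simp add: r_Suc)
  have "norm ((X \<circ> r) (Suc n) - (X \<circ> r) n) \<le> (1/2) ^ n" for n
  proof -
    have "r (Suc n) \<ge> r n" by (simp add: r_Suc)
    then have "r (Suc n) \<ge> N n" using r_N[of n] by simp
    then show ?thesis using N[of n "r (Suc n)" "r n"] r_N[of n] by simp
  qed
  moreover have "Cauchy (X \<circ> r)"
    using C r by (rule Cauchy_subseq_Cauchy)
  ultimately have "convergent (X \<circ> r)"
    by (intro L2_fast_Cauchy_convergent)
  then obtain l where l: "(X \<circ> r) \<longlonglongrightarrow> l"
    by (auto simp: convergent_def)
  have "X \<longlonglongrightarrow> l"
  proof (rule LIMSEQ_I)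
    fix e :: real assume e: "0 < e"
    obtain M where M: "\<And>m n. m \<ge> M \<Longrightarrow> n \<ge> M \<Longrightarrow> norm (X m - X n) < e/2"
      using CauchyD[OF C, of "e/2"] e by auto
    obtain K where K: "\<And>n. n \<ge> K \<Longrightarrow> norm ((X \<circ> r) n - l) < e/2"
      using LIMSEQ_D[OF l, of "e/2"] e by auto
    have "norm (X n - l) < e" if "n \<ge> M" for n
    proof -
      have "r (max K M) \<ge> M"
        using seq_suble[OF r, of "max K M"] by simp
      then have "norm (X n - X (r (max K M))) < e/2" "norm (X (r (max K M)) - l) < e/2"
        using M[OF that] K[of "max K M"] by auto
      then show ?thesis
        using norm_triangle_lt[of "X n - X (r (max K M))" "X (r (max K M)) - l" e] by simp
    qed
    then show "\<exists>no. \<forall>n\<ge>no. norm (X n - l) < e" by blast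
  qed
  then show "convergent X" by (rule convergentI)
qed

subsection \<open>Smooth test functions\<close>

text \<open>Coinduction: if every member of a class has a derivative in the class, then choosing one
  derivative for each member and iterating the choice produces the full sequence of derivatives
  demanded by \<open>smooth\<close>.\<close>

lemma smooth_coinduct:
  assumes "P f"
    and step: "\<And>f. P f \<Longrightarrow> \<exists>g. P g \<and> (\<forall>x. (f has_vector_derivative g x) (at x))"
  shows "smooth f"
proof -
  obtain d where d: "\<And>f. P f \<Longrightarrow> P (d f) \<and> (\<forall>x. (f has_vector_derivative d f x) (at x))"
    using step by metis
  define D where "D n = (d ^^ n) f" for n
  have "P (D n)" for n
    by (induction n) (use assms(1) d in \<open>auto simp: D_def\<close>)
  then have "\<forall>n x. (D n has_vector_derivative D (Suc n) x) (at x)"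
    using d by (simp add: D_def)
  then show ?thesis
    unfolding smooth_def by (intro exI[of _ D]) (simp add: D_def)
qed

lemma smooth_derivative:
  assumes "smooth f"
  obtains g where "smooth g" "\<And>x. (f has_vector_derivative g x) (at x)"
proof -
  obtain D where D: "D 0 = f" "\<And>(n::nat) x. (D n has_vector_derivative D (Suc n) x) (at x)"
    using assms by (auto simp: smooth_def)
  have "smooth (D (Suc 0))"
    unfolding smooth_def by (rule exI[of _ "\<lambda>n. D (Suc n)"]) (use D in auto)
  with that[of "D (Suc 0)"] D(2)[of 0] D(1) show thesis by auto
qed

lemma smooth_add:
  assumes "smooth f" "smooth g"
  shows "smooth (\<lambda>x. f x + g x)"
proof (rule smooth_coinduct[where P = "\<lambda>h. \<exists>f g. smooth f \<and> smooth g \<and> h = (\<lambda>x. f x + g x)"])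
  fix h assume "\<exists>f g. smooth f \<and> smooth g \<and> h = (\<lambda>x. f x + g x)"
  then obtain f g where h: "smooth f" "smooth g" "h = (\<lambda>x. f x + g x)" by blast
  obtain f' where f': "smooth f'" "\<And>x. (f has_vector_derivative f' x) (at x)"
    using smooth_derivative[OF h(1)] by blast
  obtain g' where g': "smooth g'" "\<And>x. (g has_vector_derivative g' x) (at x)"
    using smooth_derivative[OF h(2)] by blast
  show "\<exists>k. (\<exists>f g. smooth f \<and> smooth g \<and> k = (\<lambda>x. f x + g x)) \<and>
      (\<forall>x. (h has_vector_derivative k x) (at x))"
    using f' g' by (intro exI[of _ "\<lambda>x. f' x + g' x"]) (auto simp: h(3) intro: has_vector_derivative_add)
qed (use assms in blast)

text \<open>The derivative of a product is a sum of two products, so the class handed to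
  \<open>smooth_coinduct\<close> must be closed under sums.\<close>

inductive sum_of_smooth_products :: "(real \<Rightarrow> complex) \<Rightarrow> bool" where
  prod: "smooth f \<Longrightarrow> smooth g \<Longrightarrow> sum_of_smooth_products (\<lambda>x. f x * g x)"
| sum: "sum_of_smooth_products f \<Longrightarrow> sum_of_smooth_products g \<Longrightarrow>
    sum_of_smooth_products (\<lambda>x. f x + g x)"

lemma smooth_mult:
  assumes "smooth f" "smooth g"
  shows "smooth (\<lambda>x. f x * g x)"
proof (rule smooth_coinduct[where P = sum_of_smooth_products])
  fix h assume "sum_of_smooth_products h"
  then show "\<exists>k. sum_of_smooth_products k \<and> (\<forall>x. (h has_vector_derivative k x) (at x))"
  proof induction
    case (prod f g)
    obtain f' where f': "smooth f'" "\<And>x. (f has_vector_derivative f' x) (at x)"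
      using smooth_derivative[OF prod(1)] by blast
    obtain g' where g': "smooth g'" "\<And>x. (g has_vector_derivative g' x) (at x)"
      using smooth_derivative[OF prod(2)] by blast
    show ?case
      by (intro exI[of _ "\<lambda>x. f x * g' x + f' x * g x"] conjI allI has_vector_derivative_mult f' g'
          sum_of_smooth_products.intros prod)
  next
    case (sum f g)
    then obtain f' g' where *: "sum_of_smooth_products f'" "sum_of_smooth_products g'"
        "\<And>x. (f has_vector_derivative f' x) (at x)" "\<And>x. (g has_vector_derivative g' x) (at x)"
      by metis
    show ?case
      by (intro exI[of _ "\<lambda>x. f' x + g' x"] conjI allI has_vector_derivative_add *
          sum_of_smooth_products.intros)
  qed
qed (intro sum_of_smooth_products.intros assms)

lemma smooth_const: "smooth (\<lambda>x. c)"
  by (rule smooth_coinduct[where P = "\<lambda>h. \<exists>c. h = (\<lambda>x. c)"]) (auto intro!: exI[of _ "\<lambda>x. 0"])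

text \<open>Each differentiation brings out a factor \<open>r\<close>, which the scalar
  \<open>c\<close> in the invariant absorbs.\<close>

lemma smooth_affine:
  assumes "smooth f"
  shows "smooth (\<lambda>x. f (r * x + s))"
proof (rule smooth_coinduct[where P = "\<lambda>h. \<exists>f c. smooth f \<and> h = (\<lambda>x. c * f (r * x + s))"])
  fix h assume "\<exists>f c. smooth f \<and> h = (\<lambda>x. c * f (r * x + s))"
  then obtain f c where h: "smooth f" "h = (\<lambda>x. c * f (r * x + s))" by blast
  obtain f' where f': "smooth f'" "\<And>x. (f has_vector_derivative f' x) (at x)"
    using smooth_derivative[OF h(1)] by blast
  have "(h has_vector_derivative c * of_real r * f' (r * x + s)) (at x)" for x
  proof -
    have "((\<lambda>x. r * x + s) has_vector_derivative r) (at x)"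
      by (auto intro!: derivative_eq_intros)
    from vector_diff_chain_at[OF this f'(2)]
    have "((\<lambda>x. f (r * x + s)) has_vector_derivative r *\<^sub>R f' (r * x + s)) (at x)"
      by (simp add: o_def)
    from has_vector_derivative_mult_right[OF this, of c] show ?thesis
      by (simp add: h(2) scaleR_conv_of_real mult.assoc)
  qed
  then show "\<exists>k. (\<exists>f c. smooth f \<and> k = (\<lambda>x. c * f (r * x + s))) \<and>
      (\<forall>x. (h has_vector_derivative k x) (at x))"
    using f'(1) by (intro exI[of _ "\<lambda>x. c * of_real r * f' (r * x + s)"]) blast
qed (intro exI[of _ f] exI[of _ 1], use assms in simp)

section \<open>Smooth cutoff functions\<close>

lemma poly_times_exp_tendsto_0: "((\<lambda>y::real. poly p y * exp (- y)) \<longlongrightarrow> 0) at_top"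
proof -
  have "((\<lambda>y::real. \<Sum>i\<le>degree p. coeff p i * (y ^ i / exp y)) \<longlongrightarrow> (\<Sum>i\<le>degree p. coeff p i * 0)) at_top"
    by (intro tendsto_intros tendsto_power_div_exp_0)
  then show ?thesis
    by (simp add: poly_altdef exp_minus divide_inverse sum_distrib_right mult.assoc)
qed

lemma smooth_exp_inverse: "smooth (\<lambda>x. of_real (if x > 0 then exp (- (1 / x)) else 0))"
proof -
  \<comment> \<open>This family is closed under differentiation: with y = 1/x, differentiating p(y)
    exp(-y) replaces p by y^2 (p - p'), which is the polynomial in \<open>der\<close>. The case p =
    1 is the function wanted.\<close>
  define e where "e p x = (if x > 0 then poly p (1 / x) * exp (- (1 / x)) else 0)" for p and x :: real
  have der: "(e p has_real_derivative e ([:0, 0, 1:] * (p - pderiv p)) x) (at x)" for p x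
  proof -
    consider "x > 0" | "x < 0" | "x = 0" by linarith
    then show ?thesis
    proof cases
      case 1
      have "((\<lambda>x. poly p (1 / x) * exp (- (1 / x))) has_real_derivative
          (poly p (1 / x) - poly (pderiv p) (1 / x)) * (1 / x * (1 / x)) * exp (- (1 / x))) (at x)"
      proof -
        have i: "((\<lambda>x. 1 / x) has_real_derivative - (1 / x * (1 / x))) (at x)"
          using 1 by (auto intro!: derivative_eq_intros)
        show ?thesis
          by (rule DERIV_cong[OF DERIV_mult[OF DERIV_chain2[OF poly_DERIV i]
                DERIV_chain2[OF DERIV_exp DERIV_minus[OF i]]]]) (simp add: algebra_simps)
      qed
      then have "(e p has_real_derivative
          (poly p (1 / x) - poly (pderiv p) (1 / x)) * (1 / x * (1 / x)) * exp (- (1 / x))) (at x)"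
        by (rule has_field_derivative_transform_within_open[where S = "{0<..}"])
          (use 1 in \<open>auto simp: e_def\<close>)
      then show ?thesis using 1 by (simp add: e_def mult.commute mult.left_commute)
    next
      case 2
      have "(e p has_real_derivative 0) (at x)"
        by (rule has_field_derivative_transform_within_open[where S = "{..<0}", OF DERIV_const[of 0]])
          (use 2 in \<open>auto simp: e_def\<close>)
      then show ?thesis using 2 by (simp add: e_def)
    next
      case 3
      have "((\<lambda>h. (e p (0 + h) - e p 0) / h) \<longlongrightarrow> 0) (at 0)"
      proof (rule filterlim_split_at)
        show "((\<lambda>h. (e p (0 + h) - e p 0) / h) \<longlongrightarrow> 0) (at_left 0)"
          by (rule tendsto_eventually) (auto simp: e_def eventually_at_filter)
        \<comment> \<open>At the origin the right difference quotient is y p(y) exp(-y) with y = 1/h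
          tending to infinity.\<close>
        have "((\<lambda>h. poly ([:0,1:] * p) (inverse h) * exp (- inverse h)) \<longlongrightarrow> 0) (at_right 0)"
          by (rule filterlim_compose[OF poly_times_exp_tendsto_0 filterlim_inverse_at_top_right])
        then show "((\<lambda>h. (e p (0 + h) - e p 0) / h) \<longlongrightarrow> 0) (at_right 0)"
        proof (rule Lim_transform_eventually)
          show "\<forall>\<^sub>F h in at_right 0. poly ([:0,1:] * p) (inverse h) * exp (- inverse h) = (e p (0 + h) - e p 0) / h"
            using eventually_at_right_less[of "0::real"]
            by eventually_elim (simp add: e_def divide_inverse)
        qed
      qed
      then show ?thesis using 3 by (simp add: DERIV_def e_def)
    qed
  qed
  have "smooth (\<lambda>x. of_real (e 1 x))"
  proof (rule smooth_coinduct[where P = "\<lambda>h. \<exists>p. h = (\<lambda>x. of_real (e p x))"])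
    fix h assume "\<exists>p. h = (\<lambda>x. complex_of_real (e p x))"
    then obtain p where h: "h = (\<lambda>x. of_real (e p x))" by blast
    show "\<exists>k. (\<exists>p. k = (\<lambda>x. complex_of_real (e p x))) \<and> (\<forall>x. (h has_vector_derivative k x) (at x))"
      unfolding h
    proof (intro exI[of _ "\<lambda>x. of_real (e ([:0, 0, 1:] * (p - pderiv p)) x)"] conjI allI)
      show "\<exists>q. (\<lambda>x. complex_of_real (e ([:0, 0, 1:] * (p - pderiv p)) x)) = (\<lambda>x. of_real (e q x))"
        by blast
    qed (intro has_vector_derivative_of_real der)
  qed blast
  then show ?thesis by (simp add: e_def[abs_def] if_distrib cong: if_cong)
qed

text \<open>Two copies of exp(-1/x), one facing each end of the interval, stretched by n + 1. Both
  exponents tend to 0 as n grows, so the functions approximate the indicator of the open interval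
  while being supported in its closure.\<close>

definition plateau :: "nat \<Rightarrow> real \<Rightarrow> real \<Rightarrow> real \<Rightarrow> real" where
  "plateau n s t x = (if s < x \<and> x < t then exp (- (1 / (real (Suc n) * (x - s)))) * exp (- (1 / (real (Suc n) * (t - x)))) else 0)"

lemma smooth_plateau: "smooth (\<lambda>x. of_real (plateau n s t x))"
proof -
  let ?e = "\<lambda>x. complex_of_real (if x > 0 then exp (- (1 / x)) else 0)"
  have "smooth (\<lambda>x. ?e (real (Suc n) * x + (- (real (Suc n) * s))) * ?e (- real (Suc n) * x + real (Suc n) * t))"
    by (intro smooth_mult smooth_affine[OF smooth_exp_inverse])
  also have "(\<lambda>x. ?e (real (Suc n) * x + (- (real (Suc n) * s))) * ?e (- real (Suc n) * x + real (Suc n) * t)) =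
     (\<lambda>x. of_real (plateau n s t x))"
  proof
    fix x
    have *: "real (Suc n) * x + (- (real (Suc n) * s)) = real (Suc n) * (x - s)"
      "- real (Suc n) * x + real (Suc n) * t = real (Suc n) * (t - x)"
      by (simp_all add: algebra_simps)
    show "?e (real (Suc n) * x + (- (real (Suc n) * s))) * ?e (- real (Suc n) * x + real (Suc n) * t) =
       of_real (plateau n s t x)"
      unfolding * plateau_def by (auto simp: zero_less_mult_iff simp del: of_nat_Suc)
  qed
  finally show ?thesis .
qed

lemma plateau_bounds: "0 \<le> plateau n s t x" "plateau n s t x \<le> indicator {s<..<t} x"
  unfolding plateau_def by (auto simp: indicator_def simp del: of_nat_Suc intro!: mult_le_one)

lemma plateau_tendsto: "(\<lambda>n. plateau n s t x) \<longlonglongrightarrow> indicator {s<..<t} x"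
proof (cases "s < x \<and> x < t")
  case True
  have *: "(\<lambda>n. - (1 / (real (Suc n) * c))) \<longlonglongrightarrow> 0" for c
  proof -
    have "(\<lambda>n. - (inverse (real (Suc n)) * (1 / c))) \<longlonglongrightarrow> - (0 * (1 / c))"
      by (intro tendsto_intros LIMSEQ_inverse_real_of_nat)
    then show ?thesis by (simp add: divide_inverse del: of_nat_Suc)
  qed
  have "(\<lambda>n. exp (- (1 / (real (Suc n) * (x - s)))) * exp (- (1 / (real (Suc n) * (t - x))))) \<longlonglongrightarrow> exp 0 * exp 0"
    by (intro tendsto_intros *)
  then show ?thesis using True by (simp add: plateau_def indicator_def del: of_nat_Suc)
next
  case False
  then have "(\<lambda>n. plateau n s t x) = (\<lambda>n. 0)" "indicator {s<..<t} x = (0::real)"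
    by (auto simp: plateau_def)
  then show ?thesis by simp
qed

lemma test_functionI:
  assumes "smooth \<phi>" "a < k" "l < b" "\<And>x. x < k \<or> l < x \<Longrightarrow> \<phi> x = 0"
  shows "test_function a b \<phi>"
  unfolding test_function_def using assms
  by (intro conjI exI[of _ "{k..l}"]) (auto simp: subset_iff)

lemma test_functionE:
  assumes "test_function a b \<phi>" "a < b"
  obtains k l where "a < k" "k < l" "l < b" "smooth \<phi>" "\<And>x. x \<le> k \<or> l \<le> x \<Longrightarrow> \<phi> x = 0"
proof -
  obtain K where K: "compact K" "K \<subseteq> {a<..<b}" "\<forall>x. x \<notin> K \<longrightarrow> \<phi> x = 0" and s: "smooth \<phi>"
    using assms(1) by (auto simp: test_function_def)
  \<comment> \<open>The midpoint keeps the compact set nonempty, so that its minimum and maximum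
    exist even if \<open>K\<close> is empty.\<close>
  define K' where "K' = insert ((a + b) / 2) K"
  have K': "compact K'" "K' \<noteq> {}" "K' \<subseteq> {a<..<b}"
    using K assms(2) by (auto simp: K'_def)
  obtain k where k: "k \<in> K'" "\<forall>x\<in>K'. k \<le> x" using compact_attains_inf[OF K'(1,2)] by blast
  obtain l where l: "l \<in> K'" "\<forall>x\<in>K'. x \<le> l" using compact_attains_sup[OF K'(1,2)] by blast
  have kl: "a < k" "k \<le> l" "l < b" using k l K' by auto
  show thesis
  \<comment> \<open>\<phi> may be nonzero at the extreme points of \<open>K'\<close>. Moving halfway
    towards the ends of the interval leaves a closed half-line on each side where \<phi> vanishes
    and makes the two bounds distinct.\<close>
  proof (rule that[of "(a + k) / 2" "(l + b) / 2"])
    fix x assume "x \<le> (a + k) / 2 \<or> (l + b) / 2 \<le> x"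
    then have "x < k \<or> x > l" using kl by auto
    then have "x \<notin> K'" using k(2) l(2) by (meson not_less)
    then show "\<phi> x = 0" using K(3) by (auto simp: K'_def)
  qed (use kl s in auto)
qed

lemma test_function_plateau:
  assumes "a < s" "t < b"
  shows "test_function a b (\<lambda>x. of_real (plateau n s t x))"
  using assms by (intro test_functionI[OF smooth_plateau]) (auto simp: plateau_def)

lemma test_function_combination:
  assumes "test_function a b \<phi>" "test_function a b \<psi>" "a < b"
  shows "test_function a b (\<lambda>x. c * \<phi> x + d * \<psi> x)"
proof -
  obtain k l where 1: "a < k" "k < l" "l < b" "smooth \<phi>" "\<And>x. x \<le> k \<or> l \<le> x \<Longrightarrow> \<phi> x = 0"
    using test_functionE[OF assms(1,3)] by blast
  obtain k' l' where 2: "a < k'" "k' < l'" "l' < b" "smooth \<psi>" "\<And>x. x \<le> k' \<or> l' \<le> x \<Longrightarrow> \<psi> x = 0"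
    using test_functionE[OF assms(2,3)] by blast
  show ?thesis
  proof (rule test_functionI[where k = "min k k'" and l = "max l l'"])
    show "smooth (\<lambda>x. c * \<phi> x + d * \<psi> x)"
      by (intro smooth_add smooth_mult smooth_const 1 2)
  qed (use 1 2 in auto)
qed

lemma test_function_derivative:
  assumes "test_function a b \<phi>" "a < b"
  obtains \<phi>' where "test_function a b \<phi>'" "\<And>x. (\<phi> has_vector_derivative \<phi>' x) (at x)"
    "(\<lambda>x. vector_derivative \<phi> (at x)) = \<phi>'"
proof -
  obtain k l where 1: "a < k" "k < l" "l < b" "smooth \<phi>" "\<And>x. x \<le> k \<or> l \<le> x \<Longrightarrow> \<phi> x = 0"
    using test_functionE[OF assms] by blast
  obtain g where g: "smooth g" "\<And>x. (\<phi> has_vector_derivative g x) (at x)"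
    using smooth_derivative[OF 1(4)] by blast
  have "g x = 0" if "x < k \<or> l < x" for x
  proof -
    have "(\<phi> has_vector_derivative 0) (at x)"
      by (rule has_vector_derivative_transform_within_open[where S = "{..<k} \<union> {l<..}" and f = "\<lambda>x. 0"])
        (use that 1(5) in auto)
    from vector_derivative_at[OF this] vector_derivative_at[OF g(2)[of x]] show ?thesis by simp
  qed
  then have "test_function a b g"
    by (intro test_functionI[OF g(1) 1(1) 1(3)]) auto
  moreover have "(\<lambda>x. vector_derivative \<phi> (at x)) = g"
    using g(2) by (auto intro!: ext vector_derivative_at)
  ultimately show thesis using that[of g] g by auto
qed

lemma test_function_continuous:
  assumes "test_function a b \<phi>"
  shows "continuous_on S \<phi>"
proof -
  obtain g where g: "\<And>x. (\<phi> has_vector_derivative g x) (at x)"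
    using smooth_derivative assms unfolding test_function_def by metis
  then have "continuous_on UNIV \<phi>"
    by (meson continuous_at_imp_continuous_on has_vector_derivative_continuous)
  then show ?thesis by (rule continuous_on_subset) simp
qed

lemma test_function_square_integrable:
  assumes "test_function a b \<phi>" "a < b"
  shows "square_integrable \<phi>"
proof -
  obtain k l where 1: "a < k" "k < l" "l < b" "smooth \<phi>" "\<And>x. x \<le> k \<or> l \<le> x \<Longrightarrow> \<phi> x = 0"
    using test_functionE[OF assms] by blast
  have "integrable lborel (\<lambda>x. indicator {a..b} x *\<^sub>R (cmod (\<phi> x))\<^sup>2)"
    by (intro borel_integrable_compact continuous_intros test_function_continuous[OF assms(1)]) simp
  also have "(\<lambda>x. indicator {a..b} x *\<^sub>R (cmod (\<phi> x))\<^sup>2) = (\<lambda>x. (cmod (\<phi> x))\<^sup>2)"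
  proof
    fix x
    show "indicator {a..b} x *\<^sub>R (cmod (\<phi> x))\<^sup>2 = (cmod (\<phi> x))\<^sup>2"
      using 1(5)[of x] 1(1-3) by (cases "x \<in> {a..b}") auto
  qed
  finally show ?thesis
    using test_function_measurable(1)[OF assms(1)] by (simp add: square_integrable_def)
qed

subsection \<open>Weak derivatives on an interval\<close>

lemma rep_L2: "square_integrable (rep_L2 f)" "abs_L2 (rep_L2 f) = f"
  using Quotient3_rel_rep[OF Quotient3_L2, of f f] Quotient3_abs_rep[OF Quotient3_L2, of f]
  by (auto simp: L2_rel_def)

lemma rep_L2_measurable [measurable]: "rep_L2 f \<in> borel_measurable borel"
  using rep_L2(1) by (rule square_integrable_measurable)

lemma cip_rep: "cip f g = (LINT x|lborel. rep_L2 f x * cnj (rep_L2 g x))"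
  using cip_abs_L2[OF rep_L2(1) rep_L2(1), of f g] by (simp add: rep_L2(2))

lemma rep_abs_L2_AE: "square_integrable f \<Longrightarrow> AE x in lborel. rep_L2 (abs_L2 f) x = f x"
  using abs_L2_eq_iff[OF rep_L2(1), of f "abs_L2 f"] by (simp add: rep_L2(2))

lemma L2_on_rep: "f \<in> L2_on a b \<longleftrightarrow> (AE x in lborel. x \<notin> {a<..<b} \<longrightarrow> rep_L2 f x = 0)"
  using vanishes_outside.abs_eq[of "rep_L2 f" a b] rep_L2[of f]
  by (simp add: L2_on_def L2_rel_def)

lemma L2_on_abs:
  "square_integrable f \<Longrightarrow> abs_L2 f \<in> L2_on a b \<longleftrightarrow> (AE x in lborel. x \<notin> {a<..<b} \<longrightarrow> f x = 0)"
  using vanishes_outside.abs_eq[of f a b] by (simp add: L2_on_def L2_rel_def)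

lemma L2_on_add: "f \<in> L2_on a b \<Longrightarrow> g \<in> L2_on a b \<Longrightarrow> f + g \<in> L2_on a b"
proof -
  assume f: "f \<in> L2_on a b" and g: "g \<in> L2_on a b"
  obtain u v where u: "square_integrable u" "f = abs_L2 u" and v: "square_integrable v" "g = abs_L2 v"
    by (metis abs_L2_cases)
  have "AE x in lborel. x \<notin> {a<..<b} \<longrightarrow> u x + v x = 0"
    using f g unfolding u(2) v(2) L2_on_abs[OF u(1)] L2_on_abs[OF v(1)]
    by eventually_elim auto
  then show ?thesis
    by (simp add: u v abs_L2_add L2_on_abs square_integrable_add)
qed

lemma L2_on_scaleC:
  assumes f: "f \<in> L2_on a b"
  shows "c *\<^sub>C f \<in> L2_on a b"
proof -
  obtain u where u: "square_integrable u" "f = abs_L2 u"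
    by (metis abs_L2_cases)
  have "AE x in lborel. x \<notin> {a<..<b} \<longrightarrow> c * u x = 0"
    using f unfolding u(2) L2_on_abs[OF u(1)] by eventually_elim auto
  then show ?thesis
    by (simp add: u abs_L2_scaleC L2_on_abs square_integrable_scale)
qed

lemma L2_on_zero: "0 \<in> L2_on a b"
  using L2_on_abs[OF square_integrable_zero, of a b] by (simp add: zero_L2_def)

lemma L2_on_diff: "f \<in> L2_on a b \<Longrightarrow> g \<in> L2_on a b \<Longrightarrow> f - g \<in> L2_on a b"
  using L2_on_add[of f a b "(-1) *\<^sub>C g"] L2_on_scaleC[of g a b "-1"] by (simp add: scaleC_minus1)

lemma square_integrable_cmult_indicator:
  assumes "square_integrable f" "A \<in> sets borel"
  shows "square_integrable (\<lambda>x. indicator A x * f x)"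
proof -
  have [measurable]: "f \<in> borel_measurable borel" "A \<in> sets borel"
    using assms by (auto dest: square_integrable_measurable)
  have "integrable lborel (\<lambda>x. indicator A x *\<^sub>R (cmod (f x))\<^sup>2)"
    using assms by (intro integrable_mult_indicator) (auto simp: square_integrable_def)
  also have "(\<lambda>x. indicator A x *\<^sub>R (cmod (f x))\<^sup>2) = (\<lambda>x. (cmod (indicator A x * f x))\<^sup>2)"
    by (auto simp: indicator_def)
  finally show ?thesis by (simp add: square_integrable_def)
qed

lemma L2_inner_eq_cip:
  assumes "f \<in> L2_on a b \<or> g \<in> L2_on a b"
  shows "L2_inner a b f g = cip f g"
proof -
  have "L2_inner a b f g = (LINT x:{a<..<b}|lborel. rep_L2 f x * cnj (rep_L2 g x))"
    using L2_inner.abs_eq[of "rep_L2 f" "rep_L2 g" a b] by (simp add: rep_L2 L2_rel_def)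
  also have "\<dots> = cip f g"
    unfolding cip_rep set_lebesgue_integral_def
  proof (rule integral_cong_AE)
    have "AE x in lborel. x \<notin> {a<..<b} \<longrightarrow> rep_L2 f x * cnj (rep_L2 g x) = 0"
      using assms unfolding L2_on_rep
    proof
      assume "AE x in lborel. x \<notin> {a<..<b} \<longrightarrow> rep_L2 f x = 0"
      then show ?thesis by eventually_elim auto
    next
      assume "AE x in lborel. x \<notin> {a<..<b} \<longrightarrow> rep_L2 g x = 0"
      then show ?thesis by eventually_elim auto
    qed
    then show "AE x in lborel. indicator {a<..<b} x *\<^sub>R (rep_L2 f x * cnj (rep_L2 g x)) =
        rep_L2 f x * cnj (rep_L2 g x)"
      by eventually_elim (auto simp: indicator_def)
  qed measurable
  finally show ?thesis .
qed

text \<open>These indicator classes have three uses: pairing with \<open>box_fun s t\<close>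
  integrates over (s,t), \<open>box_fun a b\<close> is the constant function 1 on the interval, and
  \<open>box_fun a x\<close> is the kernel of the primitive. For t \<le> s the class is 0.\<close>

definition box_fun :: "real \<Rightarrow> real \<Rightarrow> L2" where
  "box_fun s t = abs_L2 (indicator {s<..<t})"

lemma square_integrable_box: "square_integrable (indicator {s<..<t})"
proof -
  have "integrable lborel (indicat_real {s<..<t})"
    by (cases "s \<le> t") (auto intro!: integrable_real_indicator)
  moreover have "(\<lambda>x. (cmod (indicator {s<..<t} x))\<^sup>2) = indicat_real {s<..<t}"
    by (auto simp: indicator_def)
  ultimately show ?thesis by (simp add: square_integrable_def)
qed

lemma cip_box: "cip f (box_fun s t) = (LINT x:{s<..<t}|lborel. rep_L2 f x)"
proof -
  have "cip f (box_fun s t) = (LINT x|lborel. rep_L2 f x * cnj (indicator {s<..<t} x))"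
    unfolding box_fun_def using cip_abs_L2[OF rep_L2(1)[of f] square_integrable_box[of s t]]
    by (simp add: rep_L2(2))
  also have "\<dots> = (LINT x:{s<..<t}|lborel. rep_L2 f x)"
    unfolding set_lebesgue_integral_def
    by (intro Bochner_Integration.integral_cong) (auto simp: indicator_def)
  finally show ?thesis .
qed

lemma set_integrable_rep_L2: "set_integrable lborel {s<..<t} (rep_L2 f)"
proof -
  have "integrable lborel (\<lambda>x. rep_L2 f x * cnj (indicator {s<..<t} x))"
    by (rule square_integrable_mult_cnj[OF rep_L2(1) square_integrable_box])
  also have "(\<lambda>x. rep_L2 f x * cnj (indicator {s<..<t} x)) = (\<lambda>x. indicator {s<..<t} x *\<^sub>R rep_L2 f x)"
    by (auto simp: indicator_def)
  finally show ?thesis by (simp add: set_integrable_def)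
qed

lemma box_fun_L2_on: "a \<le> s \<Longrightarrow> t \<le> b \<Longrightarrow> box_fun s t \<in> L2_on a b"
  unfolding box_fun_def L2_on_abs[OF square_integrable_box] by (auto simp: indicator_def)

lemma box_fun_empty: "t \<le> s \<Longrightarrow> box_fun s t = 0"
  unfolding box_fun_def zero_L2_def
  by (subst abs_L2_eq_iff[OF square_integrable_box square_integrable_zero]) auto

lemma norm_box_fun: "s \<le> t \<Longrightarrow> norm (box_fun s t) = sqrt (t - s)"
proof -
  assume st: "s \<le> t"
  have "(norm (box_fun s t))\<^sup>2 = (LINT x|lborel. indicat_real {s<..<t} x)"
    unfolding box_fun_def norm_abs_L2[OF square_integrable_box]
    by (intro Bochner_Integration.integral_cong) (auto simp: indicator_def)
  also have "\<dots> = t - s" using st by simp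
  finally show ?thesis by (metis norm_ge_zero real_sqrt_unique)
qed

lemma box_fun_split: "s \<le> m \<Longrightarrow> m \<le> t \<Longrightarrow> box_fun s t = box_fun s m + box_fun m t"
  unfolding box_fun_def abs_L2_add[OF square_integrable_box square_integrable_box]
proof (subst abs_L2_eq_iff)
  assume st: "s \<le> m" "m \<le> t"
  show "square_integrable (\<lambda>x. indicator {s<..<m} x + indicator {m<..<t} x)"
    by (intro square_integrable_add square_integrable_box)
  have "AE x in lborel. x \<noteq> m" by (rule AE_lborel_singleton)
  then show "AE x in lborel. indicator {s<..<t} x = (indicator {s<..<m} x + indicator {m<..<t} x :: complex)"
    by eventually_elim (use st in \<open>auto simp: indicator_def\<close>)
qed (rule square_integrable_box)

lemma cip_box_box:
  assumes "a \<le> s" "s \<le> t" "t \<le> b"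
  shows "cip (box_fun a b) (box_fun s t) = of_real (t - s)"
proof -
  have "cip (box_fun a b) (box_fun s t) = (LINT x|lborel. complex_of_real (indicat_real {s<..<t} x))"
    unfolding box_fun_def cip_abs_L2[OF square_integrable_box square_integrable_box]
    using assms by (intro Bochner_Integration.integral_cong) (auto simp: indicator_def)
  also have "\<dots> = of_real (t - s)"
    using assms by (simp only: integral_complex_of_real) simp
  finally show ?thesis .
qed

text \<open>This Hoelder bound of exponent 1/2 is the source of continuity for primitives and of the
  trace estimates in \<open>H1\<close>.\<close>

lemma norm_box_fun_diff: "norm (box_fun a x - box_fun a y) \<le> sqrt \<bar>x - y\<bar>"
proof -
  have *: "norm (box_fun a x - box_fun a y) \<le> sqrt (y - x)" if "x \<le> y" for x y
  proof -
    consider "y \<le> a" | "x \<le> a" "a \<le> y" | "a \<le> x" by linarith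
    then show ?thesis
    proof cases
      case 1 then show ?thesis using that by (simp add: box_fun_empty)
    next
      case 2 then show ?thesis using that by (simp add: box_fun_empty norm_box_fun)
    next
      case 3
      then have "box_fun a x - box_fun a y = - box_fun x y"
        using box_fun_split[of a x y] that by simp
      then show ?thesis using that by (simp add: norm_box_fun)
    qed
  qed
  show ?thesis
    using *[of x y] *[of y x] by (cases "x \<le> y") (auto simp: norm_minus_commute)
qed

lemma continuous_cip_box: "continuous_on S (\<lambda>x. cip f (box_fun a x))"
proof -
  have "continuous_on S (\<lambda>x. box_fun a x)"
    unfolding continuous_on_def
  proof
    fix x assume "x \<in> S"
    have "((\<lambda>y. sqrt \<bar>y - x\<bar>) \<longlongrightarrow> sqrt \<bar>x - x\<bar>) (at x within S)"
      by (intro tendsto_intros)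
    then have "((\<lambda>y. sqrt \<bar>y - x\<bar>) \<longlongrightarrow> 0) (at x within S)" by simp
    then have "((\<lambda>y. norm (box_fun a y - box_fun a x)) \<longlongrightarrow> 0) (at x within S)"
      by (rule Lim_null_comparison[rotated]) (auto intro!: always_eventually norm_box_fun_diff)
    then show "((\<lambda>y. box_fun a y) \<longlongrightarrow> box_fun a x) (at x within S)"
      by (rule LIM_zero_cancel[OF tendsto_norm_zero_cancel])
  qed
  then show ?thesis by (rule cip.continuous_on[OF continuous_on_const])
qed

text \<open>Vanishing integrals over compactly contained intervals extend to all intervals (a,d) by
  continuity, and then to all Borel sets, because the half-lines generate them and are closed under
  intersection. A function all of whose integrals vanish is zero almost everywhere.\<close>

lemma L2_on_eq_0I:
  assumes f: "f \<in> L2_on a b" and ab: "a < b"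
    and zero: "\<And>s t. a < s \<Longrightarrow> s < t \<Longrightarrow> t < b \<Longrightarrow> cip f (box_fun s t) = 0"
  shows "f = 0"
proof -
  have z: "cip f (box_fun a d) = 0" if d: "a < d" "d \<le> b" for d
  proof -
    \<comment> \<open>Cutting off two end pieces of length e costs at most two terms of size
      \<open>norm f * sqrt e\<close>.\<close>
    have bound: "cmod (cip f (box_fun a d)) \<le> 2 * norm f * sqrt e" if e: "0 < e" "e < (d - a) / 2" for e
    proof -
      have "box_fun a d = box_fun a (a + e) + (box_fun (a + e) (d - e) + box_fun (d - e) d)"
        using e by (simp add: box_fun_split[of a "a+e" d] box_fun_split[of "a+e" "d-e" d])
      then have "cip f (box_fun a d) = cip f (box_fun a (a + e)) + cip f (box_fun (d - e) d)"
        using zero[of "a + e" "d - e"] e d by (simp add: cip_add_right)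
      also have "cmod \<dots> \<le> norm f * norm (box_fun a (a + e)) + norm f * norm (box_fun (d - e) d)"
        by (rule norm_triangle_le[OF add_mono[OF cip_cauchy_schwarz cip_cauchy_schwarz]])
      finally show ?thesis using e by (simp add: norm_box_fun mult.commute)
    qed
    have "((\<lambda>e. 2 * norm f * sqrt e) \<longlongrightarrow> 2 * norm f * sqrt 0) (at_right 0)"
      by (intro tendsto_intros)
    moreover have "\<forall>\<^sub>F e in at_right 0. cmod (cip f (box_fun a d)) \<le> 2 * norm f * sqrt e"
      by (rule eventually_at_rightI[of 0 "(d - a) / 2"]) (use d bound in auto)
    ultimately have "cmod (cip f (box_fun a d)) \<le> 2 * norm f * sqrt 0"
      by (intro tendsto_le[OF _ _ tendsto_const]) auto
    then show ?thesis by simp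
  qed
  define h where "h x = indicator {a<..<b} x *\<^sub>R rep_L2 f x" for x
  have hint: "integrable lborel h"
    using set_integrable_rep_L2[of a b f] by (simp add: set_integrable_def h_def[abs_def])
  have si: "set_integrable lborel A h" if "A \<in> sets borel" for A
    unfolding set_integrable_def using that hint by (intro integrable_mult_indicator) auto
  have P: "(LINT x:A|lborel. h x) = 0" if "A \<in> sigma_sets UNIV (range (\<lambda>c::real. {..c}))" for A
  proof (rule sigma_sets_induct_disjoint[OF _ _ that])
    show "Int_stable (range (\<lambda>c::real. {..c}))"
      by (auto simp: Int_stable_def)
    show "range (\<lambda>c::real. {..c}) \<subseteq> Pow UNIV"
      by simp
  next
    fix A assume "A \<in> range (\<lambda>c::real. {..c})"
    then obtain c where A: "A = {..c}" by blast
    have "(LINT x:A|lborel. h x) = (LINT x:{a<..<min b c}|lborel. rep_L2 f x)"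
      unfolding set_lebesgue_integral_def
    proof (rule integral_cong_AE)
      have "AE x in lborel. x \<noteq> c" by (rule AE_lborel_singleton)
      then show "AE x in lborel. indicator A x *\<^sub>R h x = indicator {a<..<min b c} x *\<^sub>R rep_L2 f x"
        by eventually_elim (auto simp: A h_def indicator_def)
    qed (auto simp: A h_def[abs_def])
    also have "\<dots> = 0"
      unfolding cip_box[symmetric] using z[of "min b c"] ab
      by (cases "c \<le> a") (auto simp: box_fun_empty cip.zero_right)
    finally show "(LINT x:A|lborel. h x) = 0" .
  next
    show "(LINT x:{}|lborel. h x) = 0" by (simp add: set_lebesgue_integral_def)
  next
    fix A assume A: "A \<in> sigma_sets UNIV (range (\<lambda>c::real. {..c}))" and "(LINT x:A|lborel. h x) = 0"
    have [measurable]: "A \<in> sets borel"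
      using A by (simp add: borel_eq_atMost)
    have "(LINT x:UNIV|lborel. h x) = (LINT x:A|lborel. h x) + (LINT x:UNIV - A|lborel. h x)"
      using set_integral_Un[of A "UNIV - A" lborel h] by (simp add: si)
    moreover have "(LINT x:UNIV|lborel. h x) = 0"
      using z[of b] ab by (simp add: set_lebesgue_integral_def h_def cip_box)
    ultimately show "(LINT x:UNIV - A|lborel. h x) = 0"
      using \<open>(LINT x:A|lborel. h x) = 0\<close> by simp
  next
    fix A :: "nat \<Rightarrow> real set"
    assume d: "disjoint_family A" and A: "range A \<subseteq> sigma_sets UNIV (range (\<lambda>c::real. {..c}))"
      and IH: "\<And>i. (LINT x:A i|lborel. h x) = 0"
    have "\<And>i. A i \<in> sets borel"
      using A by (auto simp: borel_eq_atMost)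
    then have "(LINT x:(\<Union>i. A i)|lborel. h x) = (\<Sum>i. (LINT x:A i|lborel. h x))"
      using d by (intro lebesgue_integral_countable_add si) (auto simp: disjoint_family_on_def)
    then show "(LINT x:(\<Union>i. A i)|lborel. h x) = 0"
      using IH by simp
  qed
  \<comment> \<open>Uniqueness of densities: \<open>h\<close> and 0 have the same integral over
    every Borel set.\<close>
  have "AE x in lborel. h x = 0"
    by (rule sigma_finite_measure.density_unique_banach[OF lborel.sigma_finite_measure_axioms hint, of "\<lambda>x. 0"])
      (auto simp: borel_eq_atMost P set_lebesgue_integral_def[of _ _ "\<lambda>x. 0"])
  moreover have "AE x in lborel. x \<notin> {a<..<b} \<longrightarrow> rep_L2 f x = 0"
    using f by (simp add: L2_on_rep)
  ultimately have "AE x in lborel. rep_L2 f x = 0"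
    by eventually_elim (auto simp: h_def indicator_def split: if_splits)
  then have "abs_L2 (rep_L2 f) = abs_L2 (\<lambda>x. 0)"
    by (subst abs_L2_eq_iff) (auto simp: rep_L2 square_integrable_zero)
  then show ?thesis by (simp add: rep_L2 zero_L2_def)
qed

text \<open>Integration by parts without derivatives: the product of the two integrals is a double
  integral over the plane, and the diagonal, a null set, splits it into the two triangles whose
  iterated integrals stand on the left.\<close>

lemma triangle_Fubini:
  fixes F G :: "real \<Rightarrow> complex"
  assumes [simp]: "integrable lborel F" "integrable lborel G"
  shows "(LINT x|lborel. F x * (LINT s|lborel. (if s < x then G s else 0))) +
      (LINT x|lborel. (LINT s|lborel. (if s < x then F s else 0)) * G x) =
      integral\<^sup>L lborel F * integral\<^sup>L lborel G"
proof -
  have [measurable]: "F \<in> borel_measurable borel" "G \<in> borel_measurable borel"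
    using borel_measurable_integrable[OF assms(1)] borel_measurable_integrable[OF assms(2)] by simp_all
  have cut: "integrable lborel (\<lambda>s. if s < x then H s else 0)" "integrable lborel (\<lambda>s. if x < s then H s else 0)"
    if H: "integrable lborel H" for x and H :: "real \<Rightarrow> complex"
  proof -
    have [measurable]: "H \<in> borel_measurable borel"
      using borel_measurable_integrable[OF H] by simp
    show "integrable lborel (\<lambda>s. if s < x then H s else 0)" "integrable lborel (\<lambda>s. if x < s then H s else 0)"
      by (rule Bochner_Integration.integrable_bound[OF H]; simp)+
  qed
  \<comment> \<open>\<open>K\<close> is the integrand on one of the triangles; exchanging the order
    of integration turns primitives of \<open>G\<close> into integrals of \<open>F\<close> over the
    complementary half-lines.\<close>
  define K where "K x s = (if s < x then F x * G s else 0)" for x s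
  have K[measurable]: "case_prod K \<in> borel_measurable (lborel \<Otimes>\<^sub>M lborel)"
    unfolding K_def by measurable
  have intK: "integrable (lborel \<Otimes>\<^sub>M lborel) (case_prod K)"
  proof (rule lborel_pair.Fubini_integrable[OF K])
    have i: "integrable lborel (\<lambda>x. cmod (F x) * (LINT s|lborel. cmod (G s)))"
      by simp
    have b: "norm (LINT y|lborel. cmod (case_prod K (x, y))) \<le> norm (cmod (F x) * (LINT s|lborel. cmod (G s)))" for x
    proof -
      have "(LINT y|lborel. cmod (K x y)) \<le> (LINT y|lborel. cmod (F x) * cmod (G y))"
        by (rule integral_mono_AE')
          (auto simp: K_def norm_mult intro!: always_eventually)
      moreover have "0 \<le> (LINT y|lborel. cmod (K x y))" by simp
      ultimately show ?thesis by simp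
    qed
    show "integrable lborel (\<lambda>x. LINT y|lborel. cmod (case_prod K (x, y)))"
      by (rule Bochner_Integration.integrable_bound[OF i _ AE_I2[OF b]]) measurable
    show "AE x in lborel. integrable lborel (\<lambda>y. case_prod K (x, y))"
    proof (rule AE_I2)
      fix x
      have "(\<lambda>y. case_prod K (x, y)) = (\<lambda>y. F x * (if y < x then G y else 0))"
        by (auto simp: K_def)
      then show "integrable lborel (\<lambda>y. case_prod K (x, y))"
        by (simp add: cut)
    qed
  qed
  have "(LINT x|lborel. F x * (LINT s|lborel. (if s < x then G s else 0))) = (LINT x|lborel. LINT s|lborel. K x s)"
  proof (rule Bochner_Integration.integral_cong)
    fix x
    have "K x = (\<lambda>s. F x * (if s < x then G s else 0))" by (auto simp: K_def)
    then show "F x * (LINT s|lborel. (if s < x then G s else 0)) = (LINT s|lborel. K x s)" by simp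
  qed simp
  also have "\<dots> = (LINT x|lborel. LINT s|lborel. K s x)"
    by (rule lborel_pair.Fubini_integral[OF intK, symmetric])
  also have "\<dots> = (LINT x|lborel. (LINT s|lborel. (if x < s then F s else 0)) * G x)"
  proof (rule Bochner_Integration.integral_cong)
    fix x
    have "(\<lambda>s. K s x) = (\<lambda>s. (if x < s then F s else 0) * G x)" by (auto simp: K_def)
    then show "(LINT s|lborel. K s x) = (LINT s|lborel. (if x < s then F s else 0)) * G x" by simp
  qed simp
  finally have 1: "(LINT x|lborel. F x * (LINT s|lborel. (if s < x then G s else 0))) =
      (LINT x|lborel. (LINT s|lborel. (if x < s then F s else 0)) * G x)" .
  have bd: "cmod (LINT s|lborel. (if s < x then F s else 0)) \<le> (LINT s|lborel. cmod (F s))"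
    "cmod (LINT s|lborel. (if x < s then F s else 0)) \<le> (LINT s|lborel. cmod (F s))" for x
    by (rule order_trans[OF integral_norm_bound], rule integral_mono_AE', auto intro!: always_eventually)+
  have int: "integrable lborel (\<lambda>x. (LINT s|lborel. (if x < s then F s else 0)) * G x)"
    "integrable lborel (\<lambda>x. (LINT s|lborel. (if s < x then F s else 0)) * G x)"
  proof -
    have i: "integrable lborel (\<lambda>x. complex_of_real (LINT s|lborel. cmod (F s)) * G x)" by simp
    show "integrable lborel (\<lambda>x. (LINT s|lborel. (if x < s then F s else 0)) * G x)"
      by (rule Bochner_Integration.integrable_bound[OF i])
        (auto intro!: always_eventually mult_right_mono bd simp: norm_mult)
    show "integrable lborel (\<lambda>x. (LINT s|lborel. (if s < x then F s else 0)) * G x)"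
      by (rule Bochner_Integration.integrable_bound[OF i])
        (auto intro!: always_eventually mult_right_mono bd simp: norm_mult)
  qed
  have sum: "(LINT s|lborel. (if x < s then F s else 0)) + (LINT s|lborel. (if s < x then F s else 0)) =
      integral\<^sup>L lborel F" for x
  proof -
    have "(LINT s|lborel. (if x < s then F s else 0)) + (LINT s|lborel. (if s < x then F s else 0)) =
      (LINT s|lborel. (if x < s then F s else 0) + (if s < x then F s else 0))"
      by (simp add: cut)
    also have "\<dots> = integral\<^sup>L lborel F"
    proof (rule integral_cong_AE)
      have "AE s in lborel. s \<noteq> x" by (rule AE_lborel_singleton)
      then show "AE s in lborel. (if x < s then F s else 0) + (if s < x then F s else 0) = F s"
        by eventually_elim auto
    qed auto
    finally show ?thesis .
  qed
  have "(LINT x|lborel. (LINT s|lborel. (if x < s then F s else 0)) * G x) +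
      (LINT x|lborel. (LINT s|lborel. (if s < x then F s else 0)) * G x) =
      (LINT x|lborel. ((LINT s|lborel. (if x < s then F s else 0)) + (LINT s|lborel. (if s < x then F s else 0))) * G x)"
    unfolding distrib_right by (rule Bochner_Integration.integral_add[symmetric]) (fact int)+
  also have "\<dots> = integral\<^sup>L lborel F * integral\<^sup>L lborel G"
    unfolding sum by simp
  finally show ?thesis unfolding 1 .
qed

section \<open>Continuous representatives and primitives\<close>

definition cfun :: "real \<Rightarrow> real \<Rightarrow> (real \<Rightarrow> complex) \<Rightarrow> L2" where
  "cfun a b h = abs_L2 (\<lambda>x. indicator {a<..<b} x * h x)"

lemma square_integrable_cfun:
  assumes "continuous_on {a..b} h"
  shows "square_integrable (\<lambda>x. indicator {a<..<b} x * h x)"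
proof -
  have "(\<lambda>x. indicator {a..b} x *\<^sub>R h x) \<in> borel_measurable borel"
    using assms by (intro borel_measurable_continuous_on_indicator) auto
  moreover have "(\<lambda>x. indicator {a..b} x *\<^sub>R h x) = (\<lambda>x. indicator {a..b} x * h x)"
    by (auto simp: indicator_def)
  ultimately have "(\<lambda>x. indicator {a..b} x * h x) \<in> borel_measurable borel" by simp
  moreover have "integrable lborel (\<lambda>x. indicator {a..b} x *\<^sub>R (cmod (h x))\<^sup>2)"
    by (intro borel_integrable_compact continuous_intros assms) simp
  moreover have "(\<lambda>x. indicator {a..b} x *\<^sub>R (cmod (h x))\<^sup>2) = (\<lambda>x. (cmod (indicator {a..b} x * h x))\<^sup>2)"
    by (auto simp: indicator_def)
  ultimately have "square_integrable (\<lambda>x. indicator {a..b} x * h x)"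
    by (simp add: square_integrable_def)
  then have "square_integrable (\<lambda>x. indicator {a<..<b} x * (indicator {a..b} x * h x))"
    by (rule square_integrable_cmult_indicator) simp
  also have "(\<lambda>x. indicator {a<..<b} x * (indicator {a..b} x * h x)) = (\<lambda>x. indicator {a<..<b} x * h x)"
    by (auto simp: indicator_def)
  finally show ?thesis .
qed

lemma cfun_L2_on: "continuous_on {a..b} h \<Longrightarrow> cfun a b h \<in> L2_on a b"
  unfolding cfun_def by (simp add: L2_on_abs square_integrable_cfun)

lemma cfun_cong: "(\<And>x. a < x \<Longrightarrow> x < b \<Longrightarrow> h x = h' x) \<Longrightarrow> cfun a b h = cfun a b h'"
  unfolding cfun_def by (intro arg_cong[where f = abs_L2]) (auto simp: indicator_def)

lemma cfun_add:
  "continuous_on {a..b} g \<Longrightarrow> continuous_on {a..b} h \<Longrightarrow> cfun a b (\<lambda>x. g x + h x) = cfun a b g + cfun a b h"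
  unfolding cfun_def by (simp add: abs_L2_add square_integrable_cfun distrib_left)

lemma cfun_scaleC:
  "continuous_on {a..b} h \<Longrightarrow> cfun a b (\<lambda>x. c * h x) = c *\<^sub>C cfun a b h"
  unfolding cfun_def by (simp add: abs_L2_scaleC square_integrable_cfun mult.left_commute)

lemma cfun_const: "cfun a b (\<lambda>x. c) = c *\<^sub>C box_fun a b"
  unfolding cfun_def box_fun_def by (simp add: abs_L2_scaleC square_integrable_box mult.commute)

lemma continuous_representative_iff:
  assumes "f \<in> L2_on a b"
  shows "continuous_representative a b f h \<longleftrightarrow> continuous_on {a..b} h \<and> f = cfun a b h"
proof -
  have "continuous_representative a b f h \<longleftrightarrow>
      continuous_on {a..b} h \<and> (AE x in lborel. x \<in> {a<..<b} \<longrightarrow> rep_L2 f x = h x)"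
    using continuous_representative.abs_eq[of "rep_L2 f"]
    by (simp add: rep_L2 L2_rel_def fun_eq_iff)
  also have "\<dots> \<longleftrightarrow> continuous_on {a..b} h \<and> f = cfun a b h"
  proof (intro conj_cong refl)
    assume c: "continuous_on {a..b} h"
    have "f = cfun a b h \<longleftrightarrow> (AE x in lborel. rep_L2 f x = indicator {a<..<b} x * h x)"
      using abs_L2_eq_iff[OF rep_L2(1) square_integrable_cfun[OF c], of f]
      by (simp add: rep_L2 cfun_def)
    also have "\<dots> \<longleftrightarrow> (AE x in lborel. x \<in> {a<..<b} \<longrightarrow> rep_L2 f x = h x)"
      using assms unfolding L2_on_rep
      by (intro iffI; elim eventually_rev_mp; intro always_eventually; auto simp: indicator_def)
    finally show "(AE x in lborel. x \<in> {a<..<b} \<longrightarrow> rep_L2 f x = h x) \<longleftrightarrow> f = cfun a b h" by simp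
  qed
  finally show ?thesis .
qed

text \<open>The open set where two continuous functions differ has positive measure unless it is
  empty; the end points follow by density. This makes the definite description in
  \<open>value_at\<close> well defined.\<close>

lemma cfun_inject:
  assumes c: "continuous_on {a..b} g" "continuous_on {a..b} h" and ab: "a < b"
    and eq: "cfun a b g = cfun a b h" and x: "x \<in> {a..b}"
  shows "g x = h x"
proof -
  have ae: "AE x in lborel. indicator {a<..<b} x * g x = indicator {a<..<b} x * h x"
    using eq unfolding cfun_def abs_L2_eq_iff[OF square_integrable_cfun[OF c(1)] square_integrable_cfun[OF c(2)]] .
  have inner: "g y - h y = 0" if y: "y \<in> {a<..<b}" for y
  proof (rule ccontr)
    assume ne: "g y - h y \<noteq> 0"
    have "continuous_on {a<..<b} (\<lambda>x. g x - h x)"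
      by (intro continuous_intros continuous_on_subset[OF c(1)] continuous_on_subset[OF c(2)]) auto
    then have "open ({a<..<b} \<inter> (\<lambda>x. g x - h x) -` (- {0}))"
      by (intro continuous_open_preimage) auto
    then obtain e where e: "e > 0" "ball y e \<subseteq> {a<..<b} \<inter> (\<lambda>x. g x - h x) -` (- {0})"
      using y ne unfolding open_contains_ball by blast
    have "AE x in lborel. x \<notin> {y - e<..<y + e}"
      using ae
    proof eventually_elim
      fix x assume *: "indicator {a<..<b} x * g x = indicator {a<..<b} x * h x"
      show "x \<notin> {y - e<..<y + e}"
      proof
        assume "x \<in> {y - e<..<y + e}"
        then have "x \<in> ball y e" by (auto simp: dist_real_def)
        with e(2) have "x \<in> {a<..<b}" "g x - h x \<noteq> 0" by auto
        with * show False by simp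
      qed
    qed
    then have "emeasure lborel {x\<in>space lborel. \<not> x \<notin> {y - e<..<y + e}} = 0"
      by (intro emeasure_eq_0_AE) auto
    also have "{x\<in>space lborel. \<not> x \<notin> {y - e<..<y + e}} = {y - e<..<y + e}" by auto
    finally show False using e(1) by simp
  qed
  have "continuous_on (closure {a<..<b}) (\<lambda>x. g x - h x)"
    using ab by (intro continuous_intros; simp add: c)
  from continuous_constant_on_closure[OF this inner, of x] show ?thesis
    using x ab by simp
qed

lemma value_at_cfun:
  assumes "continuous_on {a..b} h" "a < b" "x \<in> {a..b}"
  shows "value_at a b (cfun a b h) x = h x"
  unfolding value_at_def
proof (rule the_equality)
  show "\<exists>g. continuous_representative a b (cfun a b h) g \<and> g x = h x"
    using assms by (intro exI[of _ h]) (simp add: continuous_representative_iff cfun_L2_on)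
  fix c assume "\<exists>g. continuous_representative a b (cfun a b h) g \<and> g x = c"
  then obtain g where "continuous_on {a..b} g" "cfun a b h = cfun a b g" "g x = c"
    using assms by (auto simp: continuous_representative_iff cfun_L2_on)
  then show "c = h x"
    using cfun_inject[OF _ assms(1) assms(2), of g x] assms(3) by simp
qed

text \<open>The Volterra primitive vanishing at \<open>a\<close>. Writing the integral over (a,x) as
  a pairing with an indicator lets it inherit linearity, continuity and norm bounds from
  \<open>cip\<close>.\<close>

definition prim :: "real \<Rightarrow> real \<Rightarrow> L2 \<Rightarrow> L2" where
  "prim a b g = cfun a b (\<lambda>x. cip g (box_fun a x))"

lemma prim_L2_on: "prim a b g \<in> L2_on a b"
  unfolding prim_def by (intro cfun_L2_on continuous_cip_box)

lemma prim_add: "prim a b (f + g) = prim a b f + prim a b g"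
  unfolding prim_def cip_add_left by (intro cfun_add continuous_cip_box)

lemma prim_scaleC: "prim a b (c *\<^sub>C f) = c *\<^sub>C prim a b f"
  unfolding prim_def cip_scaleC_left by (intro cfun_scaleC continuous_cip_box)

lemma cip_cfun_right:
  assumes "continuous_on {a..b} h"
  shows "cip f (cfun a b h) = (LINT x|lborel. (indicator {a<..<b} x *\<^sub>R rep_L2 f x) * cnj (h x))"
proof -
  have "cip f (cfun a b h) = (LINT x|lborel. rep_L2 f x * cnj (indicator {a<..<b} x * h x))"
    using cip_abs_L2[OF rep_L2(1) square_integrable_cfun[OF assms], of f] by (simp add: cfun_def rep_L2)
  also have "\<dots> = (LINT x|lborel. (indicator {a<..<b} x *\<^sub>R rep_L2 f x) * cnj (h x))"
    by (intro Bochner_Integration.integral_cong) (auto simp: indicator_def)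
  finally show ?thesis .
qed

text \<open>\<open>triangle_Fubini\<close> for the truncated representatives. In operator terms: up
  to a term of rank one, the adjoint of the Volterra operator is its negative.\<close>

lemma cip_prim_parts:
  "cip f (prim a b g) + cip (prim a b f) g = cip f (box_fun a b) * cnj (cip g (box_fun a b))"
proof -
  define F where "F x = indicator {a<..<b} x *\<^sub>R rep_L2 f x" for x
  define G where "G x = cnj (indicator {a<..<b} x *\<^sub>R rep_L2 g x)" for x
  have iF: "integrable lborel F" and iG: "integrable lborel G"
    unfolding F_def[abs_def] G_def[abs_def]
    by (intro complex_integrable_cnj[THEN iffD2] set_integrable_rep_L2[unfolded set_integrable_def])+
  have cf: "cip f (box_fun a x) = (LINT s|lborel. (if s < x then F s else 0))"
    and cg: "cnj (cip g (box_fun a x)) = (LINT s|lborel. (if s < x then G s else 0))" if "x \<in> {a<..<b}" for x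
  proof -
    show "cip f (box_fun a x) = (LINT s|lborel. (if s < x then F s else 0))"
      unfolding cip_box set_lebesgue_integral_def
      using that by (intro Bochner_Integration.integral_cong) (auto simp: F_def indicator_def)
    show "cnj (cip g (box_fun a x)) = (LINT s|lborel. (if s < x then G s else 0))"
      unfolding cip_box set_lebesgue_integral_def Bochner_Integration.integral_cnj[symmetric]
      using that by (intro Bochner_Integration.integral_cong) (auto simp: G_def indicator_def)
  qed
  have "cip f (prim a b g) = (LINT x|lborel. F x * (LINT s|lborel. (if s < x then G s else 0)))"
    unfolding prim_def cip_cfun_right[OF continuous_cip_box]
    by (intro Bochner_Integration.integral_cong) (auto simp: F_def indicator_def cg)
  moreover have "cip (prim a b f) g = (LINT x|lborel. (LINT s|lborel. (if s < x then F s else 0)) * G x)"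
  proof -
    have "cip (prim a b f) g = cnj (cip g (prim a b f))" by (rule cip_cnj)
    also have "\<dots> = (LINT x|lborel. G x * cip f (box_fun a x))"
      unfolding prim_def cip_cfun_right[OF continuous_cip_box] Bochner_Integration.integral_cnj[symmetric]
      by (simp add: G_def)
    also have "\<dots> = (LINT x|lborel. (LINT s|lborel. (if s < x then F s else 0)) * G x)"
      by (intro Bochner_Integration.integral_cong) (auto simp: G_def indicator_def cf)
    finally show ?thesis .
  qed
  moreover have "cip f (box_fun a b) = integral\<^sup>L lborel F" "cnj (cip g (box_fun a b)) = integral\<^sup>L lborel G"
    unfolding cip_box set_lebesgue_integral_def F_def[abs_def] G_def[abs_def]
      Bochner_Integration.integral_cnj by (rule refl)+
  ultimately show ?thesis
    using triangle_Fubini[OF iF iG] by simp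
qed

section \<open>Weak derivatives and the lemma of du Bois-Reymond\<close>

lemma smooth_cnj:
  assumes "smooth f"
  shows "smooth (\<lambda>x. cnj (f x))"
proof (rule smooth_coinduct[where P = "\<lambda>h. \<exists>g. smooth g \<and> h = (\<lambda>x. cnj (g x))"])
  fix h assume "\<exists>g. smooth g \<and> h = (\<lambda>x. cnj (g x))"
  then obtain g where g: "smooth g" "h = (\<lambda>x. cnj (g x))" by blast
  obtain g' where g': "smooth g'" "\<And>x. (g has_vector_derivative g' x) (at x)"
    using smooth_derivative[OF g(1)] by blast
  show "\<exists>k. (\<exists>g. smooth g \<and> k = (\<lambda>x. cnj (g x))) \<and> (\<forall>x. (h has_vector_derivative k x) (at x))"
    using g' by (intro exI[of _ "\<lambda>x. cnj (g' x)"]) (auto simp: g(2) intro!: has_vector_derivative_cnj)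
qed (use assms in blast)

lemma test_function_cnj: "test_function a b \<phi> \<Longrightarrow> test_function a b (\<lambda>x. cnj (\<phi> x))"
  unfolding test_function_def by (auto intro: smooth_cnj)

lemma test_function_outside: "test_function a b \<phi> \<Longrightarrow> x \<notin> {a<..<b} \<Longrightarrow> \<phi> x = 0"
  unfolding test_function_def by blast

lemma cip_test_function:
  assumes "test_function a b \<phi>" "a < b"
  shows "cip f (abs_L2 \<phi>) = (LINT x:{a<..<b}|lborel. rep_L2 f x * cnj (\<phi> x))"
proof -
  have "cip f (abs_L2 \<phi>) = (LINT x|lborel. rep_L2 f x * cnj (\<phi> x))"
    using cip_abs_L2[OF rep_L2(1) test_function_square_integrable[OF assms], of f] by (simp add: rep_L2)
  also have "\<dots> = (LINT x:{a<..<b}|lborel. rep_L2 f x * cnj (\<phi> x))"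
    unfolding set_lebesgue_integral_def
  proof (rule Bochner_Integration.integral_cong)
    fix x
    show "rep_L2 f x * cnj (\<phi> x) = indicator {a<..<b} x *\<^sub>R (rep_L2 f x * cnj (\<phi> x))"
      using test_function_outside[OF assms(1), of x] by (cases "x \<in> {a<..<b}") auto
  qed simp
  finally show ?thesis .
qed

text \<open>Test functions are closed under conjugation, so the bilinear pairing in the definition
  can be exchanged for the sesquilinear \<open>cip\<close>; naming the derivative of the test
  function also avoids \<open>vector_derivative\<close>.\<close>

lemma has_weak_derivative_iff:
  assumes ab: "a < b"
  shows "has_weak_derivative a b f g \<longleftrightarrow>
    (\<forall>\<phi> \<phi>'. test_function a b \<phi> \<longrightarrow> test_function a b \<phi>' \<longrightarrow> (\<forall>x. (\<phi> has_vector_derivative \<phi>' x) (at x)) \<longrightarrow>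
      cip f (abs_L2 \<phi>') = - cip g (abs_L2 \<phi>))"
proof -
  have "has_weak_derivative a b f g \<longleftrightarrow> (\<forall>\<phi>. test_function a b \<phi> \<longrightarrow>
     (LINT x:{a<..<b}|lborel. rep_L2 f x * vector_derivative \<phi> (at x)) =
     - (LINT x:{a<..<b}|lborel. rep_L2 g x * \<phi> x))"
    using has_weak_derivative.abs_eq[of "rep_L2 f" "rep_L2 g"] by (simp add: rep_L2 L2_rel_def)
  also have "\<dots> \<longleftrightarrow> (\<forall>\<phi> \<phi>'. test_function a b \<phi> \<longrightarrow> test_function a b \<phi>' \<longrightarrow> (\<forall>x. (\<phi> has_vector_derivative \<phi>' x) (at x)) \<longrightarrow>
      cip f (abs_L2 \<phi>') = - cip g (abs_L2 \<phi>))" (is "?L = ?R")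
  proof
    assume L: ?L
    show ?R
    proof (intro allI impI)
      fix \<phi> \<phi>'
      assume t: "test_function a b \<phi>" "test_function a b \<phi>'" and d: "\<forall>x. (\<phi> has_vector_derivative \<phi>' x) (at x)"
      have "vector_derivative (\<lambda>x. cnj (\<phi> x)) (at x) = cnj (\<phi>' x)" for x
        using d by (intro vector_derivative_at has_vector_derivative_cnj) auto
      then show "cip f (abs_L2 \<phi>') = - cip g (abs_L2 \<phi>)"
        using L[rule_format, OF test_function_cnj[OF t(1)]]
        by (simp add: cip_test_function[OF t(1) ab] cip_test_function[OF t(2) ab])
    qed
  next
    assume R: ?R
    show ?L
    proof (intro allI impI)
      fix \<phi> assume t: "test_function a b \<phi>"
      obtain \<phi>' where t': "test_function a b \<phi>'" "\<And>x. (\<phi> has_vector_derivative \<phi>' x) (at x)"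
        "(\<lambda>x. vector_derivative \<phi> (at x)) = \<phi>'"
        using test_function_derivative[OF t ab] by blast
      have "\<forall>x. ((\<lambda>x. cnj (\<phi> x)) has_vector_derivative cnj (\<phi>' x)) (at x)"
        using t'(2) by (auto intro: has_vector_derivative_cnj)
      from R[rule_format, OF test_function_cnj[OF t] test_function_cnj[OF t'(1)] this[rule_format]]
      show "(LINT x:{a<..<b}|lborel. rep_L2 f x * vector_derivative \<phi> (at x)) =
          - (LINT x:{a<..<b}|lborel. rep_L2 g x * \<phi> x)"
        using fun_cong[OF t'(3)]
        by (simp add: cip_test_function[OF test_function_cnj[OF t] ab] cip_test_function[OF test_function_cnj[OF t'(1)] ab])
    qed
  qed
  finally show ?thesis .
qed

lemma cip_abs_box:
  assumes "square_integrable f"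
  shows "cip (abs_L2 f) (box_fun s t) = (LINT x:{s..t}|lborel. f x)"
proof -
  have [measurable]: "f \<in> borel_measurable borel"
    using assms by (rule square_integrable_measurable)
  have "cip (abs_L2 f) (box_fun s t) = (LINT x|lborel. f x * cnj (indicator {s<..<t} x))"
    unfolding box_fun_def using cip_abs_L2[OF assms square_integrable_box[of s t]] .
  also have "\<dots> = (LINT x:{s..t}|lborel. f x)"
    unfolding set_lebesgue_integral_def
  proof (rule integral_cong_AE)
    show "AE x in lborel. f x * cnj (indicator {s<..<t} x) = indicator {s..t} x *\<^sub>R f x"
      using AE_lborel_singleton[of s] AE_lborel_singleton[of t]
      by eventually_elim (auto simp: indicator_def)
  qed measurable
  finally show ?thesis .
qed

lemma test_function_prim:
  assumes t: "test_function a b \<phi>" "test_function a b \<phi>'" and d: "\<And>x. (\<phi> has_vector_derivative \<phi>' x) (at x)"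
    and ab: "a < b"
  shows "prim a b (abs_L2 \<phi>') = abs_L2 \<phi>" "cip (abs_L2 \<phi>') (box_fun a b) = 0"
proof -
  have *: "cip (abs_L2 \<phi>') (box_fun a x) = \<phi> x" if "a \<le> x" for x
  proof -
    have "cip (abs_L2 \<phi>') (box_fun a x) = (LINT s:{a..x}|lborel. \<phi>' s)"
      by (rule cip_abs_box[OF test_function_square_integrable[OF t(2) ab]])
    also have "\<dots> = \<phi> x - \<phi> a"
      unfolding set_lebesgue_integral_def using that
      by (rule integral_FTC_atLeastAtMost)
        (auto intro: has_vector_derivative_at_within[OF d] test_function_continuous[OF t(2)])
    finally show ?thesis using test_function_outside[OF t(1), of a] by simp
  qed
  have "prim a b (abs_L2 \<phi>') = cfun a b \<phi>"
    unfolding prim_def by (intro cfun_cong *) auto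
  also have "(\<lambda>x. indicator {a<..<b} x * \<phi> x) = \<phi>"
    using test_function_outside[OF t(1)] by (auto simp: indicator_def fun_eq_iff)
  then have "cfun a b \<phi> = abs_L2 \<phi>" by (simp add: cfun_def)
  finally show "prim a b (abs_L2 \<phi>') = abs_L2 \<phi>" .
  show "cip (abs_L2 \<phi>') (box_fun a b) = 0"
    using *[of b] test_function_outside[OF t(1), of b] ab by simp
qed

text \<open>The derivative of a test function has mean zero, which kills both the constant and the
  boundary product in \<open>cip_prim_parts\<close>.\<close>

lemma has_weak_derivative_prim:
  assumes ab: "a < b"
  shows "has_weak_derivative a b (C *\<^sub>C box_fun a b + prim a b g) g"
  unfolding has_weak_derivative_iff[OF ab]
proof (intro allI impI)
  fix \<phi> \<phi>' assume t: "test_function a b \<phi>" "test_function a b \<phi>'" "\<forall>x. (\<phi> has_vector_derivative \<phi>' x) (at x)"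
  note p = test_function_prim[OF t(1,2) t(3)[rule_format] ab]
  have "cip (box_fun a b) (abs_L2 \<phi>') = 0"
    using p(2) cip_cnj[of "box_fun a b" "abs_L2 \<phi>'"] by simp
  then show "cip (C *\<^sub>C box_fun a b + prim a b g) (abs_L2 \<phi>') = - cip g (abs_L2 \<phi>)"
    using cip_prim_parts[of g a b "abs_L2 \<phi>'"] p
    by (simp add: cip_add_left cip_scaleC_left add_eq_0_iff2)
qed

text \<open>Dominated convergence, with the indicator itself as majorant of the squared
  error.\<close>

lemma plateau_L2_tendsto: "(\<lambda>n. abs_L2 (\<lambda>x. of_real (plateau n s t x))) \<longlonglongrightarrow> box_fun s t"
proof -
  let ?p = "\<lambda>n x. complex_of_real (plateau n s t x)"
  have p: "square_integrable (?p n)" for n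
    by (rule test_function_square_integrable[OF test_function_plateau[of "min s t - 1" _ _ "max s t + 1"]]) auto
  have [measurable]: "plateau n s t \<in> borel_measurable borel" for n
    unfolding plateau_def by measurable
  have n: "(norm (abs_L2 (?p n) - box_fun s t))\<^sup>2 = (LINT x|lborel. (plateau n s t x - indicator {s<..<t} x)\<^sup>2)" for n
  proof -
    have "(norm (abs_L2 (?p n) - box_fun s t))\<^sup>2 = (LINT x|lborel. (cmod (?p n x - indicator {s<..<t} x))\<^sup>2)"
      unfolding box_fun_def abs_L2_diff[OF p square_integrable_box]
      by (rule norm_abs_L2[OF square_integrable_diff[OF p square_integrable_box]])
    also have "\<dots> = (LINT x|lborel. (plateau n s t x - indicator {s<..<t} x)\<^sup>2)"
    proof (rule Bochner_Integration.integral_cong)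
      fix x
      have "?p n x - indicator {s<..<t} x = of_real (plateau n s t x - indicator {s<..<t} x)"
        by (simp add: indicator_def)
      then show "(cmod (?p n x - indicator {s<..<t} x))\<^sup>2 = (plateau n s t x - indicator {s<..<t} x)\<^sup>2"
        by (simp only: norm_of_real power2_abs)
    qed simp
    finally show ?thesis .
  qed
  have "(\<lambda>n. LINT x|lborel. (plateau n s t x - indicator {s<..<t} x)\<^sup>2) \<longlonglongrightarrow> integral\<^sup>L lborel (\<lambda>x::real. 0::real)"
  proof (rule Bochner_Integration.integral_dominated_convergence[where w = "indicat_real {s<..<t}"
        and s = "\<lambda>n x. (plateau n s t x - indicator {s<..<t} x)\<^sup>2"])
    show "integrable lborel (indicat_real {s<..<t})"
      by (cases "s \<le> t") (auto intro!: integrable_real_indicator)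
    show "AE x in lborel. (\<lambda>n. (plateau n s t x - indicator {s<..<t} x)\<^sup>2) \<longlonglongrightarrow> 0"
    proof (rule AE_I2)
      fix x
      have "(\<lambda>n. (plateau n s t x - indicator {s<..<t} x)\<^sup>2) \<longlonglongrightarrow> (indicator {s<..<t} x - indicator {s<..<t} x)\<^sup>2"
        by (intro tendsto_intros plateau_tendsto)
      then show "(\<lambda>n. (plateau n s t x - indicator {s<..<t} x)\<^sup>2) \<longlonglongrightarrow> 0" by simp
    qed
    show "AE x in lborel. norm ((plateau n s t x - indicator {s<..<t} x)\<^sup>2) \<le> indicat_real {s<..<t} x" for n
    proof (rule AE_I2)
      fix x
      show "norm ((plateau n s t x - indicator {s<..<t} x)\<^sup>2) \<le> indicat_real {s<..<t} x"
      proof (cases "x \<in> {s<..<t}")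
        case True
        then have "\<bar>plateau n s t x - 1\<bar> \<le> 1"
          using plateau_bounds[of n s t x] by simp
        then have "(plateau n s t x - 1)\<^sup>2 \<le> 1" by (simp add: abs_square_le_1)
        then show ?thesis using True by simp
      next
        case False
        then show ?thesis using plateau_bounds[of n s t x] by simp
      qed
    qed
  qed auto
  then have "(\<lambda>n. (norm (abs_L2 (?p n) - box_fun s t))\<^sup>2) \<longlonglongrightarrow> 0"
    unfolding n by simp
  from tendsto_real_sqrt[OF this] have "(\<lambda>n. norm (abs_L2 (?p n) - box_fun s t)) \<longlonglongrightarrow> 0"
    by simp
  then show ?thesis
    by (rule LIM_zero_cancel[OF tendsto_norm_zero_cancel])
qed

lemma cip_plateau_tendsto:
  "(\<lambda>n. cip f (abs_L2 (\<lambda>x. of_real (plateau n s t x)))) \<longlonglongrightarrow> cip f (box_fun s t)"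
  by (intro cip.tendsto tendsto_const plateau_L2_tendsto)

lemma has_weak_derivative_unique_zero:
  assumes ab: "a < b" and g: "g \<in> L2_on a b" and d: "has_weak_derivative a b 0 g"
  shows "g = 0"
proof (rule L2_on_eq_0I[OF g ab])
  fix s t assume st: "a < s" "s < t" "t < b"
  have "cip g (abs_L2 (\<lambda>x. of_real (plateau n s t x))) = 0" for n
  proof -
    have tp: "test_function a b (\<lambda>x. of_real (plateau n s t x))"
      using st by (intro test_function_plateau)
    obtain \<phi>' where "test_function a b \<phi>'" "\<And>x. ((\<lambda>x. complex_of_real (plateau n s t x)) has_vector_derivative \<phi>' x) (at x)"
      using test_function_derivative[OF tp ab] by blast
    then show ?thesis
      using d tp unfolding has_weak_derivative_iff[OF ab] by (simp add: cip.zero_left)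
  qed
  then show "cip g (box_fun s t) = 0"
    using cip_plateau_tendsto[of g s t] by (simp add: LIMSEQ_const_iff)
qed

text \<open>Test functions of mean zero are derivatives of test functions, so \<open>r\<close>
  annihilates them. Balancing the masses of two plateaus and letting them tend to indicators shows
  that \<open>r\<close> has the same average over every subinterval.\<close>

lemma du_Bois_Reymond:
  assumes ab: "a < b" and r: "r \<in> L2_on a b" and d: "has_weak_derivative a b r 0"
  obtains C where "r = C *\<^sub>C box_fun a b"
proof -
  have z: "cip r (abs_L2 \<psi>) = 0" if t: "test_function a b \<psi>" and i: "cip (abs_L2 \<psi>) (box_fun a b) = 0" for \<psi>
  proof -
    obtain k l where kl: "a < k" "k < l" "l < b" "smooth \<psi>" "\<And>x. x \<le> k \<or> l \<le> x \<Longrightarrow> \<psi> x = 0"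
      using test_functionE[OF t ab] by blast
    \<comment> \<open>The candidate primitive of \<psi>: mean zero makes it vanish to the right of
      the support of \<psi>, so that it has compact support again.\<close>
    define \<phi> where "\<phi> x = (if x < b then integral {a..x} \<psi> else 0)" for x
    have cont: "continuous_on S \<psi>" for S by (rule test_function_continuous[OF t])
    have i0: "integral {a..x} \<psi> = 0" if "x \<le> k" for x
      using that kl(5) by (intro integral_eq_0_iff[THEN iffD2] | intro integral_unique has_integral_is_0) auto
    have ileb: "(LINT s:{a..x}|lborel. \<psi> s) = integral {a..x} \<psi>" for x
      by (rule set_borel_integral_eq_integral(2)) (intro borel_integrable_atLeastAtMost' cont)
    have ib: "integral {a..b} \<psi> = 0"
      using i cip_abs_box[OF test_function_square_integrable[OF t ab], of a b] ileb[of b] by simp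
    have il: "integral {a..x} \<psi> = 0" if "l \<le> x" "x \<le> b" for x
    proof -
      have "integral {a..x} \<psi> + integral {x..b} \<psi> = integral {a..b} \<psi>"
        using that kl by (intro Henstock_Kurzweil_Integration.integral_combine integrable_continuous_real cont) auto
      moreover have "integral {x..b} \<psi> = 0"
        using that kl(5) by (intro integral_unique has_integral_is_0) auto
      ultimately show ?thesis using ib by simp
    qed
    have der: "(\<phi> has_vector_derivative \<psi> x) (at x)" for x
    proof -
      consider "x < k" | "l < x" | "k \<le> x" "x \<le> l" by linarith
      then show ?thesis
      proof cases
        case 1
        have "(\<phi> has_vector_derivative 0) (at x)"
          by (rule has_vector_derivative_transform_within_open[where S = "{..<k}" and f = "\<lambda>x. 0"])
            (use 1 i0 in \<open>auto simp: \<phi>_def\<close>)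
        then show ?thesis using 1 kl(5)[of x] by simp
      next
        case 2
        have "(\<phi> has_vector_derivative 0) (at x)"
          by (rule has_vector_derivative_transform_within_open[where S = "{l<..}" and f = "\<lambda>x. 0"])
            (use 2 il in \<open>auto simp: \<phi>_def\<close>)
        then show ?thesis using 2 kl(5)[of x] by simp
      next
        case 3
        have "((\<lambda>u. integral {a..u} \<psi>) has_vector_derivative \<psi> x) (at x within {a..b})"
          using 3 kl by (intro integral_has_vector_derivative cont) auto
        then have "((\<lambda>u. integral {a..u} \<psi>) has_vector_derivative \<psi> x) (at x within {a<..<b})"
          by (rule has_vector_derivative_within_subset) auto
        then have "((\<lambda>u. integral {a..u} \<psi>) has_vector_derivative \<psi> x) (at x)"
          using 3 kl by (subst (asm) at_within_open) auto
        then show ?thesis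
          by (rule has_vector_derivative_transform_within_open[where S = "{a<..<b}"])
            (use 3 kl in \<open>auto simp: \<phi>_def\<close>)
      qed
    qed
    have "smooth \<phi>"
      using kl(4) der unfolding smooth_def
    proof (elim exE conjE)
      fix D :: "nat \<Rightarrow> real \<Rightarrow> complex"
      assume D: "D 0 = \<psi>" "\<forall>n x. (D n has_vector_derivative D (Suc n) x) (at x)"
      show "\<exists>D. D 0 = \<phi> \<and> (\<forall>n x. (D n has_vector_derivative D (Suc n) x) (at x))"
        using D der by (intro exI[of _ "case_nat \<phi> D"]) (auto split: nat.split)
    qed
    then have "test_function a b \<phi>"
      by (rule test_functionI[OF _ kl(1) kl(3)]) (auto simp: \<phi>_def i0 il)
    then show ?thesis
      using d t der unfolding has_weak_derivative_iff[OF ab] by (simp add: cip.zero_left)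
  qed
  let ?p = "\<lambda>n s t. abs_L2 (\<lambda>x. complex_of_real (plateau n s t x))"
  \<comment> \<open>The middle third serves as a fixed reference interval; the average of
    \<open>r\<close> over it will be the constant.\<close>
  define s' where "s' = (2 * a + b) / 3"
  define t' where "t' = (a + 2 * b) / 3"
  have st': "a < s'" "s' < t'" "t' < b" using ab by (auto simp: s'_def t'_def)
  have lim: "of_real (t' - s') * cip r (box_fun s t) = of_real (t - s) * cip r (box_fun s' t')"
    if st: "a < s" "s < t" "t < b" for s t
  proof -
    have e: "cnj (cip (?p n s' t') (box_fun a b)) * cip r (?p n s t) =
       cnj (cip (?p n s t) (box_fun a b)) * cip r (?p n s' t')" for n
    proof -
      \<comment> \<open>Weighting each plateau with the mass of the other one gives a combination of
        mean zero.\<close>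
      let ?A = "cip (?p n s' t') (box_fun a b)" and ?B = "cip (?p n s t) (box_fun a b)"
      have t1: "test_function a b (\<lambda>x. of_real (plateau n s t x))"
        and t2: "test_function a b (\<lambda>x. of_real (plateau n s' t' x))"
        using st st' by (auto intro: test_function_plateau)
      note sq1 = test_function_square_integrable[OF t1 ab] and sq2 = test_function_square_integrable[OF t2 ab]
      have eq: "abs_L2 (\<lambda>x. ?A * of_real (plateau n s t x) + (- ?B) * of_real (plateau n s' t' x)) =
          ?A *\<^sub>C ?p n s t + (- ?B) *\<^sub>C ?p n s' t'"
        by (simp only: abs_L2_scaleC[OF sq1] abs_L2_scaleC[OF sq2]
            abs_L2_add[OF square_integrable_scale[OF sq1] square_integrable_scale[OF sq2]])
      have "cip r (abs_L2 (\<lambda>x. ?A * of_real (plateau n s t x) + (- ?B) * of_real (plateau n s' t' x))) = 0"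
        by (intro z test_function_combination[OF t1 t2 ab])
          (simp only: eq, simp add: cip_add_left cip_scaleC_left)
      then show ?thesis
        unfolding eq by (simp add: cip_add_right cip_scaleC_right)
    qed
    have "(\<lambda>n. cnj (cip (?p n s' t') (box_fun a b)) * cip r (?p n s t)) \<longlonglongrightarrow>
        cnj (cip (box_fun s' t') (box_fun a b)) * cip r (box_fun s t)"
      by (intro tendsto_intros cip.tendsto plateau_L2_tendsto)
    moreover have "(\<lambda>n. cnj (cip (?p n s' t') (box_fun a b)) * cip r (?p n s t)) \<longlonglongrightarrow>
        cnj (cip (box_fun s t) (box_fun a b)) * cip r (box_fun s' t')"
      unfolding e by (intro tendsto_intros cip.tendsto plateau_L2_tendsto)
    ultimately have "cnj (cip (box_fun s' t') (box_fun a b)) * cip r (box_fun s t) =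
        cnj (cip (box_fun s t) (box_fun a b)) * cip r (box_fun s' t')"
      by (rule LIMSEQ_unique)
    then show ?thesis
      using st st' by (simp add: cip_cnj[symmetric] cip_box_box)
  qed
  define C where "C = cip r (box_fun s' t') / of_real (t' - s')"
  have "r - C *\<^sub>C box_fun a b = 0"
  proof (rule L2_on_eq_0I[OF _ ab])
    show "r - C *\<^sub>C box_fun a b \<in> L2_on a b"
      by (intro L2_on_diff L2_on_scaleC r box_fun_L2_on) auto
    fix s t assume st: "a < s" "s < t" "t < b"
    have "cip r (box_fun s t) = C * of_real (t - s)"
      using lim[OF st] st'(2) by (simp add: C_def field_simps)
    then show "cip (r - C *\<^sub>C box_fun a b) (box_fun s t) = 0"
      using st by (simp add: cip.diff_left cip_scaleC_left cip_box_box)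
  qed
  then have "r = C *\<^sub>C box_fun a b" by simp
  then show thesis by (rule that)
qed

lemma norm_cfun_le:
  assumes h: "continuous_on {a..b} h" and M: "\<And>x. a < x \<Longrightarrow> x < b \<Longrightarrow> cmod (h x) \<le> M" and ab: "a \<le> b" "0 \<le> M"
  shows "norm (cfun a b h) \<le> M * sqrt (b - a)"
proof -
  have "(norm (cfun a b h))\<^sup>2 = (LINT x|lborel. (cmod (indicator {a<..<b} x * h x))\<^sup>2)"
    unfolding cfun_def by (rule norm_abs_L2[OF square_integrable_cfun[OF h]])
  also have "\<dots> \<le> (LINT x|lborel. M\<^sup>2 * indicat_real {a<..<b} x)"
  proof (rule integral_mono_AE')
    show "integrable lborel (\<lambda>x. M\<^sup>2 * indicat_real {a<..<b} x)"
      using ab by (auto intro!: integrable_real_indicator)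
    show "AE x in lborel. (cmod (indicator {a<..<b} x * h x))\<^sup>2 \<le> M\<^sup>2 * indicat_real {a<..<b} x"
      by (rule AE_I2) (auto simp: indicator_def intro!: power_mono M)
  qed auto
  also have "\<dots> = (M * sqrt (b - a))\<^sup>2"
    using ab by (simp add: power_mult_distrib)
  finally show ?thesis
    by (rule power2_le_imp_le) (use ab in auto)
qed

lemma norm_prim_le:
  assumes "a \<le> b"
  shows "norm (prim a b g) \<le> (b - a) * norm g"
proof -
  have "norm (prim a b g) \<le> (norm g * sqrt (b - a)) * sqrt (b - a)"
    unfolding prim_def
  proof (rule norm_cfun_le)
    fix x assume x: "a < x" "x < b"
    have "cmod (cip g (box_fun a x)) \<le> norm g * norm (box_fun a x)" by (rule cip_cauchy_schwarz)
    also have "\<dots> \<le> norm g * sqrt (b - a)"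
      using x by (intro mult_left_mono) (auto simp: norm_box_fun)
    finally show "cmod (cip g (box_fun a x)) \<le> norm g * sqrt (b - a)" .
  qed (use assms in \<open>auto intro: continuous_cip_box\<close>)
  then show ?thesis using assms by (simp add: mult.commute mult.left_commute)
qed

lemma bounded_linear_prim:
  assumes "a \<le> b"
  shows "bounded_linear (prim a b)"
proof
  show "\<exists>K. \<forall>x. norm (prim a b x) \<le> norm x * K"
    using norm_prim_le[OF assms] by (intro exI[of _ "b - a"]) (simp add: mult.commute)
qed (simp_all add: prim_add prim_scaleC scaleR_L2_def)

text \<open>Subtracting the primitive of the weak derivative leaves a class with weak derivative 0,
  hence a constant. The calculus in \<open>H1\<close> below rests on this representation.\<close>

lemma has_weak_derivative_imp_prim:
  assumes ab: "a < b" and f: "f \<in> L2_on a b" and d: "has_weak_derivative a b f g"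
  obtains C where "f = C *\<^sub>C box_fun a b + prim a b g"
proof -
  have "has_weak_derivative a b (f - prim a b g) 0"
    using d has_weak_derivative_prim[OF ab, of 0 g] unfolding has_weak_derivative_iff[OF ab]
    by (simp add: cip.diff_left cip.zero_left)
  moreover have "f - prim a b g \<in> L2_on a b"
    by (intro L2_on_diff f prim_L2_on)
  ultimately obtain C where "f - prim a b g = C *\<^sub>C box_fun a b"
    using du_Bois_Reymond[OF ab] by blast
  then show thesis by (intro that[of C]) (simp add: diff_eq_eq)
qed

lemma weak_derivative_eqI:
  assumes ab: "a < b" and g: "g \<in> L2_on a b" and d: "has_weak_derivative a b f g"
  shows "weak_derivative a b f = g"
  unfolding weak_derivative_def
proof (rule the_equality)
  fix g' assume g': "g' \<in> L2_on a b \<and> has_weak_derivative a b f g'"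
  then have "has_weak_derivative a b 0 (g' - g)"
    using d unfolding has_weak_derivative_iff[OF ab] by (simp add: cip.diff_left cip.zero_left)
  then have "g' - g = 0"
    using g g' by (intro has_weak_derivative_unique_zero[OF ab]) (auto intro: L2_on_diff)
  then show "g' = g" by simp
qed (use g d in simp)

lemma const_plus_prim_eq_cfun:
  "C *\<^sub>C box_fun a b + prim a b g = cfun a b (\<lambda>x. C + cip g (box_fun a x))"
  unfolding prim_def cfun_const[symmetric]
  by (rule cfun_add[symmetric]) (intro continuous_intros continuous_cip_box)+

lemma const_plus_prim:
  assumes ab: "a < b" and g: "g \<in> L2_on a b"
  shows "C *\<^sub>C box_fun a b + prim a b g \<in> H1 a b"
    "weak_derivative a b (C *\<^sub>C box_fun a b + prim a b g) = g"
    "x \<in> {a..b} \<Longrightarrow> value_at a b (C *\<^sub>C box_fun a b + prim a b g) x = C + cip g (box_fun a x)"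
proof -
  have d: "has_weak_derivative a b (C *\<^sub>C box_fun a b + prim a b g) g"
    by (rule has_weak_derivative_prim[OF ab])
  then show "C *\<^sub>C box_fun a b + prim a b g \<in> H1 a b"
    unfolding H1_def using g by (auto intro!: L2_on_add L2_on_scaleC prim_L2_on box_fun_L2_on)
  show "weak_derivative a b (C *\<^sub>C box_fun a b + prim a b g) = g"
    using weak_derivative_eqI[OF ab g d] .
  show "value_at a b (C *\<^sub>C box_fun a b + prim a b g) x = C + cip g (box_fun a x)" if "x \<in> {a..b}"
    unfolding const_plus_prim_eq_cfun
    by (rule value_at_cfun[OF _ ab that]) (intro continuous_intros continuous_cip_box)
qed

section \<open>The space \<open>H1\<close>: representation, traces, closedness\<close>

lemma H1_L2_on: "f \<in> H1 a b \<Longrightarrow> f \<in> L2_on a b"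
  by (simp add: H1_def)

lemma H1_E:
  assumes ab: "a < b" and f: "f \<in> H1 a b"
  obtains C g where "g \<in> L2_on a b" "f = C *\<^sub>C box_fun a b + prim a b g"
  using assms has_weak_derivative_imp_prim[OF ab] unfolding H1_def by blast

lemma H1_repr:
  assumes ab: "a < b" and f: "f \<in> H1 a b"
  shows "weak_derivative a b f \<in> L2_on a b"
    "f = value_at a b f a *\<^sub>C box_fun a b + prim a b (weak_derivative a b f)"
    "x \<in> {a..b} \<Longrightarrow> value_at a b f x = value_at a b f a + cip (weak_derivative a b f) (box_fun a x)"
    "f = cfun a b (value_at a b f)" "continuous_on {a..b} (value_at a b f)"
proof -
  obtain C g where g: "g \<in> L2_on a b" "f = C *\<^sub>C box_fun a b + prim a b g"
    using H1_E[OF ab f] .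
  note p = const_plus_prim[OF ab g(1), where C = C, folded g(2)]
  have v: "value_at a b f a = C"
    using p(3)[of a] ab by (simp add: box_fun_empty cip.zero_right)
  show "weak_derivative a b f \<in> L2_on a b" using p(2) g(1) by simp
  show "f = value_at a b f a *\<^sub>C box_fun a b + prim a b (weak_derivative a b f)"
    unfolding p(2) v by (rule g(2))
  show e: "value_at a b f x = value_at a b f a + cip (weak_derivative a b f) (box_fun a x)" if "x \<in> {a..b}" for x
    unfolding p(2) v by (rule p(3)[OF that])
  have "f = cfun a b (\<lambda>x. C + cip g (box_fun a x))"
    using g(2) const_plus_prim_eq_cfun by simp
  also have "\<dots> = cfun a b (value_at a b f)"
    using p(3) by (intro cfun_cong) auto
  finally show "f = cfun a b (value_at a b f)" .
  show "continuous_on {a..b} (value_at a b f)"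
    by (subst continuous_on_cong[OF refl p(3)]) (auto intro!: continuous_intros continuous_cip_box)
qed

lemma H1_add:
  assumes ab: "a < b" and f: "f \<in> H1 a b" and g: "g \<in> H1 a b"
  shows "f + g \<in> H1 a b" "weak_derivative a b (f + g) = weak_derivative a b f + weak_derivative a b g"
    "x \<in> {a..b} \<Longrightarrow> value_at a b (f + g) x = value_at a b f x + value_at a b g x"
proof -
  have eq: "f + g = (value_at a b f a + value_at a b g a) *\<^sub>C box_fun a b
      + prim a b (weak_derivative a b f + weak_derivative a b g)"
    unfolding scaleC_add_left prim_add
    by (subst H1_repr(2)[OF ab f], subst H1_repr(2)[OF ab g]) simp
  have "weak_derivative a b f + weak_derivative a b g \<in> L2_on a b"
    by (intro L2_on_add H1_repr(1)[OF ab] f g)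
  note p = const_plus_prim[OF ab this, where C = "value_at a b f a + value_at a b g a", folded eq]
  show "f + g \<in> H1 a b" "weak_derivative a b (f + g) = weak_derivative a b f + weak_derivative a b g"
    using p by auto
  show "value_at a b (f + g) x = value_at a b f x + value_at a b g x" if "x \<in> {a..b}"
    using p(3)[OF that] H1_repr(3)[OF ab f that] H1_repr(3)[OF ab g that] by (simp add: cip_add_left)
qed

lemma H1_scaleC:
  assumes ab: "a < b" and f: "f \<in> H1 a b"
  shows "c *\<^sub>C f \<in> H1 a b" "weak_derivative a b (c *\<^sub>C f) = c *\<^sub>C weak_derivative a b f"
    "x \<in> {a..b} \<Longrightarrow> value_at a b (c *\<^sub>C f) x = c * value_at a b f x"
proof -
  have eq: "c *\<^sub>C f = (c * value_at a b f a) *\<^sub>C box_fun a b + prim a b (c *\<^sub>C weak_derivative a b f)"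
    unfolding prim_scaleC scaleC_scaleC[symmetric] scaleC_add_right[symmetric]
    using H1_repr(2)[OF ab f] by simp
  have "c *\<^sub>C weak_derivative a b f \<in> L2_on a b"
    by (intro L2_on_scaleC H1_repr(1)[OF ab] f)
  note p = const_plus_prim[OF ab this, where C = "c * value_at a b f a", folded eq]
  show "c *\<^sub>C f \<in> H1 a b" "weak_derivative a b (c *\<^sub>C f) = c *\<^sub>C weak_derivative a b f"
    using p by auto
  show "value_at a b (c *\<^sub>C f) x = c * value_at a b f x" if "x \<in> {a..b}"
    using p(3)[OF that] H1_repr(3)[OF ab f that] by (simp add: cip_scaleC_left algebra_simps)
qed

lemma H1_zero:
  assumes "a < b"
  shows "0 \<in> H1 a b" "weak_derivative a b 0 = 0" "x \<in> {a..b} \<Longrightarrow> value_at a b 0 x = 0"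
proof -
  have "0 = 0 *\<^sub>C box_fun a b + prim a b 0"
    by (simp add: bounded_linear.linear[OF bounded_linear_prim] assms less_imp_le linear_0)
  from const_plus_prim[OF assms L2_on_zero, where C = 0, folded this]
  show "0 \<in> H1 a b" "weak_derivative a b 0 = 0" "x \<in> {a..b} \<Longrightarrow> value_at a b 0 x = 0"
    by (auto simp: cip.zero_left)
qed

lemma H1_diff:
  assumes ab: "a < b" and f: "f \<in> H1 a b" and g: "g \<in> H1 a b"
  shows "f - g \<in> H1 a b" "weak_derivative a b (f - g) = weak_derivative a b f - weak_derivative a b g"
    "x \<in> {a..b} \<Longrightarrow> value_at a b (f - g) x = value_at a b f x - value_at a b g x"
  using H1_add[OF ab f H1_scaleC(1)[OF ab g, of "-1"]] H1_scaleC[OF ab g, where c = "-1"]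
  by (simp_all add: scaleC_minus1)

text \<open>Inserting constant plus primitive for both functions reduces the claim to
  \<open>cip_prim_parts\<close>; the cross terms assemble into the product of the values at
  \<open>b\<close>.\<close>

lemma H1_parts:
  assumes ab: "a < b" and f: "f \<in> H1 a b" and g: "g \<in> H1 a b"
  shows "cip (weak_derivative a b f) g + cip f (weak_derivative a b g) =
    value_at a b f b * cnj (value_at a b g b) - value_at a b f a * cnj (value_at a b g a)"
proof -
  let ?f' = "weak_derivative a b f" and ?g' = "weak_derivative a b g"
  let ?C = "value_at a b f a" and ?D = "value_at a b g a"
  let ?P = "cip ?f' (box_fun a b)" and ?Q = "cip ?g' (box_fun a b)"
  have 1: "cip ?f' g = cnj ?D * ?P + cip ?f' (prim a b ?g')"
    by (subst H1_repr(2)[OF ab g]) (simp add: cip_add_right cip_scaleC_right)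
  have 2: "cip f ?g' = ?C * cnj ?Q + (?P * cnj ?Q - cip ?f' (prim a b ?g'))"
    using cip_prim_parts[of ?f' a b ?g']
    by (subst H1_repr(2)[OF ab f]) (simp add: cip_add_left cip_scaleC_left cip_cnj[of "box_fun a b"] eq_diff_eq add.commute)
  have 3: "value_at a b f b = ?C + ?P" "value_at a b g b = ?D + ?Q"
    using H1_repr(3)[OF ab f, of b] H1_repr(3)[OF ab g, of b] ab by auto
  have "(d * P + X) + (C * q + (P * q - X)) = (C + P) * (d + q) - C * d" for d P X C q :: complex
    by (simp add: algebra_simps)
  then show ?thesis
    unfolding 1 2 3 complex_cnj_add .
qed

lemma value_at_diff_le:
  assumes ab: "a < b" and f: "f \<in> H1 a b" and "x \<in> {a..b}" "y \<in> {a..b}"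
  shows "cmod (value_at a b f x - value_at a b f y) \<le> norm (weak_derivative a b f) * sqrt \<bar>x - y\<bar>"
proof -
  have "value_at a b f x - value_at a b f y = cip (weak_derivative a b f) (box_fun a x - box_fun a y)"
    using H1_repr(3)[OF ab f, of x] H1_repr(3)[OF ab f, of y] assms(3,4) by (simp add: cip.diff_right)
  also have "cmod \<dots> \<le> norm (weak_derivative a b f) * norm (box_fun a x - box_fun a y)"
    by (rule cip_cauchy_schwarz)
  also have "\<dots> \<le> norm (weak_derivative a b f) * sqrt \<bar>x - y\<bar>"
    by (intro mult_left_mono norm_box_fun_diff norm_ge_zero)
  finally show ?thesis .
qed

lemma value_at_le:
  assumes ab: "a < b" and f: "f \<in> H1 a b" and "x \<in> {a..b}" "y \<in> {a..b}"
  shows "cmod (value_at a b f x) \<le> cmod (value_at a b f y) + sqrt (b - a) * norm (weak_derivative a b f)"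
proof -
  have "cmod (value_at a b f x) \<le> cmod (value_at a b f y) + cmod (value_at a b f x - value_at a b f y)"
    using norm_triangle_ineq[of "value_at a b f y" "value_at a b f x - value_at a b f y"] by simp
  also have "cmod (value_at a b f x - value_at a b f y) \<le> norm (weak_derivative a b f) * sqrt \<bar>x - y\<bar>"
    by (rule value_at_diff_le[OF assms])
  also have "\<dots> \<le> norm (weak_derivative a b f) * sqrt (b - a)"
    using assms by (intro mult_left_mono) auto
  finally show ?thesis by (simp add: mult.commute)
qed

lemma H1_norm_le:
  assumes ab: "a < b" and f: "f \<in> H1 a b" and y: "y \<in> {a..b}"
  shows "norm f \<le> sqrt (b - a) * cmod (value_at a b f y) + (b - a) * norm (weak_derivative a b f)"
proof -
  have "norm (cfun a b (value_at a b f)) \<le> (cmod (value_at a b f y) + sqrt (b - a) * norm (weak_derivative a b f)) * sqrt (b - a)"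
    using ab by (intro norm_cfun_le H1_repr(5)[OF ab f] value_at_le[OF ab f _ y]) auto
  also have "\<dots> = sqrt (b - a) * cmod (value_at a b f y) + (sqrt (b - a) * sqrt (b - a)) * norm (weak_derivative a b f)"
    by (simp only: algebra_simps)
  finally show ?thesis
    using ab H1_repr(4)[OF ab f, symmetric] by simp
qed

text \<open>The constant part of \<open>f\<close>, namely \<open>f\<close> minus the primitive of
  its derivative, has norm |f(a)| times the root of the length. This bounds the value at
  \<open>a\<close>, and \<open>value_at_le\<close> carries the bound to \<open>x\<close>.\<close>

lemma trace_le:
  assumes ab: "a < b" and f: "f \<in> H1 a b" and x: "x \<in> {a..b}"
  shows "cmod (value_at a b f x) \<le> norm f / sqrt (b - a) + 2 * sqrt (b - a) * norm (weak_derivative a b f)"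
proof -
  have "value_at a b f a *\<^sub>C box_fun a b = f - prim a b (weak_derivative a b f)"
    using H1_repr(2)[OF ab f] by (simp add: eq_diff_eq)
  then have "cmod (value_at a b f a) * sqrt (b - a) = norm (f - prim a b (weak_derivative a b f))"
    using ab norm_scaleC_L2[of "value_at a b f a" "box_fun a b"] by (simp add: norm_box_fun)
  also have "\<dots> \<le> norm f + (b - a) * norm (weak_derivative a b f)"
    using ab norm_prim_le[of a b "weak_derivative a b f"] by (intro norm_triangle_le_diff) auto
  finally have "cmod (value_at a b f a) \<le> (norm f + (b - a) * norm (weak_derivative a b f)) / sqrt (b - a)"
    using ab by (simp add: pos_le_divide_eq)
  also have "\<dots> = norm f / sqrt (b - a) + sqrt (b - a) * norm (weak_derivative a b f)"
    using ab real_div_sqrt[of "b - a"] by (simp add: add_divide_distrib flip: times_divide_eq_left)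
  finally show ?thesis
    using value_at_le[OF ab f x, of a] ab by simp
qed

text \<open>\<open>L2_on a b\<close> is the set of fixed points of this bounded projection, hence
  closed.\<close>

definition cut :: "real \<Rightarrow> real \<Rightarrow> L2 \<Rightarrow> L2" where
  "cut a b f = abs_L2 (\<lambda>x. indicator {a<..<b} x * rep_L2 f x)"

lemma cut_eq_iff: "cut a b f = f \<longleftrightarrow> f \<in> L2_on a b"
proof -
  have "cut a b f = f \<longleftrightarrow> (AE x in lborel. indicator {a<..<b} x * rep_L2 f x = rep_L2 f x)"
    using abs_L2_eq_iff[OF square_integrable_cmult_indicator[OF rep_L2(1)[of f]] rep_L2(1)[of f], of "{a<..<b}"]
    by (simp add: cut_def rep_L2)
  also have "\<dots> \<longleftrightarrow> f \<in> L2_on a b"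
    unfolding L2_on_rep by (intro eventually_cong always_eventually allI refl | auto simp: indicator_def)+
  finally show ?thesis .
qed

lemma cut_abs_L2: "square_integrable u \<Longrightarrow> cut a b (abs_L2 u) = abs_L2 (\<lambda>x. indicator {a<..<b} x * u x)"
proof -
  assume u: "square_integrable u"
  have "AE x in lborel. indicator {a<..<b} x * rep_L2 (abs_L2 u) x = indicator {a<..<b} x * u x"
    using rep_abs_L2_AE[OF u] by eventually_elim simp
  then show ?thesis
    unfolding cut_def using u
    by (subst abs_L2_eq_iff) (auto intro!: square_integrable_cmult_indicator rep_L2(1))
qed

lemma bounded_linear_cut: "bounded_linear (cut a b)"
proof
  fix f g :: L2 and r :: real
  obtain u v where u: "square_integrable u" "f = abs_L2 u" and v: "square_integrable v" "g = abs_L2 v"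
    by (metis abs_L2_cases)
  note i = square_integrable_cmult_indicator[of _ "{a<..<b}"]
  show "cut a b (f + g) = cut a b f + cut a b g"
    by (simp add: u v abs_L2_add cut_abs_L2 square_integrable_add i distrib_left)
  show "cut a b (r *\<^sub>R f) = r *\<^sub>R cut a b f"
    by (simp add: u scaleR_L2_def abs_L2_scaleC cut_abs_L2 square_integrable_scale i mult.left_commute)
next
  show "\<exists>K. \<forall>x. norm (cut a b x) \<le> norm x * K"
  proof (intro exI[of _ 1] allI)
    fix f :: L2
    obtain u where u: "square_integrable u" "f = abs_L2 u" by (metis abs_L2_cases)
    have iu: "square_integrable (\<lambda>x. indicator {a<..<b} x * u x)"
      by (rule square_integrable_cmult_indicator[OF u(1)]) simp
    have "(norm (cut a b f))\<^sup>2 \<le> (norm f)\<^sup>2"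
      unfolding u(2) cut_abs_L2[OF u(1)] norm_abs_L2[OF iu] norm_abs_L2[OF u(1)]
      using u(1) iu by (intro integral_mono) (auto simp: square_integrable_def indicator_def)
    then show "norm (cut a b f) \<le> norm f * 1"
      by (simp add: abs_le_square_iff[symmetric])
  qed
qed

lemma L2_on_closed:
  assumes "\<And>n::nat. f n \<in> L2_on a b" "f \<longlonglongrightarrow> g"
  shows "g \<in> L2_on a b"
proof -
  have "(\<lambda>n. cut a b (f n)) \<longlonglongrightarrow> cut a b g"
    by (rule bounded_linear.tendsto[OF bounded_linear_cut assms(2)])
  then have "f \<longlonglongrightarrow> cut a b g"
    using assms(1) by (simp add: cut_eq_iff[THEN iffD2])
  then have "cut a b g = g"
    using assms(2) by (rule LIMSEQ_unique)
  then show ?thesis by (simp add: cut_eq_iff)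
qed

text \<open>The constant parts of the \<open>f n\<close> converge because their coefficients are
  read off by pairing with \<open>box_fun a b\<close>; so the representation passes to the limit,
  and with it every point value.\<close>

lemma H1_closed:
  assumes ab: "a < b" and f: "\<And>n::nat. f n \<in> H1 a b" and lim: "f \<longlonglongrightarrow> g"
    and lim': "(\<lambda>n. weak_derivative a b (f n)) \<longlonglongrightarrow> g'"
  shows "g \<in> H1 a b" "weak_derivative a b g = g'"
    "x \<in> {a..b} \<Longrightarrow> (\<lambda>n. value_at a b (f n) x) \<longlonglongrightarrow> value_at a b g x"
proof -
  have g': "g' \<in> L2_on a b"
    by (rule L2_on_closed[OF H1_repr(1)[OF ab f] lim'])
  have r: "f n - prim a b (weak_derivative a b (f n)) = value_at a b (f n) a *\<^sub>C box_fun a b" for n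
    using H1_repr(2)[OF ab f[of n]] by (simp add: diff_eq_eq)
  have l: "(\<lambda>n. f n - prim a b (weak_derivative a b (f n))) \<longlonglongrightarrow> g - prim a b g'"
    using ab by (intro tendsto_diff lim bounded_linear.tendsto[OF bounded_linear_prim lim']) simp
  have "(\<lambda>n. cip (f n - prim a b (weak_derivative a b (f n))) (box_fun a b) / of_real (b - a)) \<longlonglongrightarrow>
      cip (g - prim a b g') (box_fun a b) / of_real (b - a)"
    using ab by (intro tendsto_intros cip.tendsto l) auto
  moreover have "cip (f n - prim a b (weak_derivative a b (f n))) (box_fun a b) / of_real (b - a) = value_at a b (f n) a" for n
    unfolding r using ab by (simp add: cip_scaleC_left cip_box_box)
  ultimately have c: "(\<lambda>n. value_at a b (f n) a) \<longlonglongrightarrow> cip (g - prim a b g') (box_fun a b) / of_real (b - a)"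
    (is "_ \<longlonglongrightarrow> ?C") by simp
  have "(\<lambda>n. value_at a b (f n) a *\<^sub>C box_fun a b) \<longlonglongrightarrow> ?C *\<^sub>C box_fun a b"
    by (rule bounded_linear.tendsto[OF bounded_linear_scaleC_left c])
  then have "g - prim a b g' = ?C *\<^sub>C box_fun a b"
    using l unfolding r by (metis LIMSEQ_unique)
  then have g: "g = ?C *\<^sub>C box_fun a b + prim a b g'"
    by (simp add: diff_eq_eq)
  note p = const_plus_prim[OF ab g', where C = ?C, folded g]
  show "g \<in> H1 a b" "weak_derivative a b g = g'" by (fact p)+
  show "(\<lambda>n. value_at a b (f n) x) \<longlonglongrightarrow> value_at a b g x" if x: "x \<in> {a..b}"
  proof -
    have "(\<lambda>n. value_at a b (f n) a + cip (weak_derivative a b (f n)) (box_fun a x)) \<longlonglongrightarrow> ?C + cip g' (box_fun a x)"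
      by (intro tendsto_intros c cip.tendsto lim')
    then show ?thesis
      using H1_repr(3)[OF ab f x] p(3)[OF x] by simp
  qed
qed

lemma cfun_C1:
  assumes ab: "a < b" and d: "\<And>x. (h has_vector_derivative h' x) (at x)" and c: "continuous_on {a..b} h'"
  shows "cfun a b h \<in> H1 a b" "weak_derivative a b (cfun a b h) = cfun a b h'"
    "x \<in> {a..b} \<Longrightarrow> value_at a b (cfun a b h) x = h x"
proof -
  have *: "cip (cfun a b h') (box_fun a x) = h x - h a" if x: "a \<le> x" "x \<le> b" for x
  proof -
    have "cip (cfun a b h') (box_fun a x) = (LINT s:{a..x}|lborel. indicator {a<..<b} s * h' s)"
      unfolding cfun_def by (rule cip_abs_box[OF square_integrable_cfun[OF c]])
    also have "\<dots> = (LINT s|lborel. indicator {a..x} s *\<^sub>R h' s)"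
      unfolding set_lebesgue_integral_def
    proof (rule integral_cong_AE)
      show "(\<lambda>s. indicat_real {a..x} s *\<^sub>R (indicator {a<..<b} s * h' s)) \<in> borel_measurable lborel"
        using square_integrable_measurable[OF square_integrable_cfun[OF c]] by simp
      show "(\<lambda>s. indicat_real {a..x} s *\<^sub>R h' s) \<in> borel_measurable lborel"
        using borel_measurable_continuous_on_indicator[of "{a..x}" h'] continuous_on_subset[OF c] x by auto
      show "AE s in lborel. indicat_real {a..x} s *\<^sub>R (indicator {a<..<b} s * h' s) = indicat_real {a..x} s *\<^sub>R h' s"
        using AE_lborel_singleton[of a] AE_lborel_singleton[of b]
        by eventually_elim (use x in \<open>auto simp: indicator_def\<close>)
    qed
    also have "\<dots> = h x - h a"
      using x by (intro integral_FTC_atLeastAtMost) (auto intro: has_vector_derivative_at_within[OF d] continuous_on_subset[OF c])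
    finally show ?thesis .
  qed
  have eq: "cfun a b h = h a *\<^sub>C box_fun a b + prim a b (cfun a b h')"
    unfolding const_plus_prim_eq_cfun by (intro cfun_cong) (simp add: *)
  note p = const_plus_prim[OF ab cfun_L2_on[OF c], where C = "h a", folded eq]
  show "cfun a b h \<in> H1 a b" "weak_derivative a b (cfun a b h) = cfun a b h'" by (fact p)+
  show "value_at a b (cfun a b h) x = h x" if "x \<in> {a..b}"
    using p(3)[OF that] * that by simp
qed

subsection \<open>Multiplication by an affine function\<close>

text \<open>Multiplication by x - c, cut off to the interval so that it is a bounded operator. It
  supplies the weight in every Rellich identity below.\<close>

definition mulx :: "real \<Rightarrow> real \<Rightarrow> real \<Rightarrow> L2 \<Rightarrow> L2" where
  "mulx a b c f = abs_L2 (\<lambda>x. indicator {a<..<b} x * (of_real (x - c) * rep_L2 f x))"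

lemma mulx_bound:
  "cmod (indicator {a<..<b} x * (of_real (x - c) * z)) \<le> (\<bar>a\<bar> + \<bar>b\<bar> + \<bar>c\<bar>) * cmod z"
proof (cases "x \<in> {a<..<b}")
  case True
  then have "\<bar>x - c\<bar> \<le> \<bar>a\<bar> + \<bar>b\<bar> + \<bar>c\<bar>" by auto
  then have "\<bar>x - c\<bar> * cmod z \<le> (\<bar>a\<bar> + \<bar>b\<bar> + \<bar>c\<bar>) * cmod z"
    by (intro mult_right_mono) auto
  moreover have "cmod (of_real (x - c) * z) = \<bar>x - c\<bar> * cmod z"
    by (simp only: norm_mult norm_of_real)
  ultimately show ?thesis using True by simp
qed simp

lemma square_integrable_mulx:
  assumes "square_integrable u"
  shows "square_integrable (\<lambda>x. indicator {a<..<b} x * (of_real (x - c) * u x))"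
proof -
  have [measurable]: "u \<in> borel_measurable borel"
    using assms by (rule square_integrable_measurable)
  have i: "integrable lborel (\<lambda>x. (\<bar>a\<bar> + \<bar>b\<bar> + \<bar>c\<bar>)\<^sup>2 * (cmod (u x))\<^sup>2)"
    using assms by (simp add: square_integrable_def)
  have "integrable lborel (\<lambda>x. (cmod (indicator {a<..<b} x * (of_real (x - c) * u x)))\<^sup>2)"
  proof (rule Bochner_Integration.integrable_bound[OF i])
    show "AE x in lborel. norm ((cmod (indicator {a<..<b} x * (of_real (x - c) * u x)))\<^sup>2)
        \<le> norm ((\<bar>a\<bar> + \<bar>b\<bar> + \<bar>c\<bar>)\<^sup>2 * (cmod (u x))\<^sup>2)"
    proof (rule AE_I2)
      fix x
      have "(cmod (indicator {a<..<b} x * (of_real (x - c) * u x)))\<^sup>2 \<le> ((\<bar>a\<bar> + \<bar>b\<bar> + \<bar>c\<bar>) * cmod (u x))\<^sup>2"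
        by (rule power_mono[OF mulx_bound]) simp
      then show "norm ((cmod (indicator {a<..<b} x * (of_real (x - c) * u x)))\<^sup>2)
        \<le> norm ((\<bar>a\<bar> + \<bar>b\<bar> + \<bar>c\<bar>)\<^sup>2 * (cmod (u x))\<^sup>2)"
        by (simp only: real_norm_def abs_of_nonneg zero_le_power2 power_mult_distrib mult_nonneg_nonneg)
    qed
  qed measurable
  then show ?thesis by (simp add: square_integrable_def)
qed

lemma mulx_abs_L2:
  assumes "square_integrable u"
  shows "mulx a b c (abs_L2 u) = abs_L2 (\<lambda>x. indicator {a<..<b} x * (of_real (x - c) * u x))"
proof -
  have "AE x in lborel. indicator {a<..<b} x * (of_real (x - c) * rep_L2 (abs_L2 u) x)
      = indicator {a<..<b} x * (of_real (x - c) * u x)"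
    using rep_abs_L2_AE[OF assms] by eventually_elim simp
  then show ?thesis
    unfolding mulx_def abs_L2_eq_iff[OF square_integrable_mulx[OF rep_L2(1)] square_integrable_mulx[OF assms]] .
qed

lemma mulx_L2_on: "mulx a b c f \<in> L2_on a b"
  unfolding mulx_def L2_on_abs[OF square_integrable_mulx[OF rep_L2(1)]] by (rule AE_I2) auto

lemma mulx_scaleC: "mulx a b c (k *\<^sub>C f) = k *\<^sub>C mulx a b c f"
proof -
  obtain u where u: "square_integrable u" "f = abs_L2 u" by (metis abs_L2_cases)
  show ?thesis
    unfolding u(2) abs_L2_scaleC[OF u(1)] mulx_abs_L2[OF u(1)] mulx_abs_L2[OF square_integrable_scale[OF u(1)]]
      abs_L2_scaleC[OF square_integrable_mulx[OF u(1)]]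
    by (intro arg_cong[where f = abs_L2] ext) (simp only: mult.left_commute)
qed

lemma norm_mulx_le: "norm (mulx a b c f) \<le> (\<bar>a\<bar> + \<bar>b\<bar> + \<bar>c\<bar>) * norm f"
proof -
  let ?K = "\<bar>a\<bar> + \<bar>b\<bar> + \<bar>c\<bar>"
  obtain u where u: "square_integrable u" "f = abs_L2 u" by (metis abs_L2_cases)
  note i = square_integrable_mulx[OF u(1), of a b c]
  have "(norm (mulx a b c f))\<^sup>2 = (LINT x|lborel. (cmod (indicator {a<..<b} x * (of_real (x - c) * u x)))\<^sup>2)"
    unfolding u(2) mulx_abs_L2[OF u(1)] norm_abs_L2[OF i] ..
  also have "\<dots> \<le> (LINT x|lborel. ?K\<^sup>2 * (cmod (u x))\<^sup>2)"
  proof (rule integral_mono)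
    show "integrable lborel (\<lambda>x. (cmod (indicator {a<..<b} x * (of_real (x - c) * u x)))\<^sup>2)"
      "integrable lborel (\<lambda>x. ?K\<^sup>2 * (cmod (u x))\<^sup>2)"
      using i u(1) by (auto simp: square_integrable_def)
    fix x
    have "(cmod (indicator {a<..<b} x * (of_real (x - c) * u x)))\<^sup>2 \<le> (?K * cmod (u x))\<^sup>2"
      by (rule power_mono[OF mulx_bound]) simp
    then show "(cmod (indicator {a<..<b} x * (of_real (x - c) * u x)))\<^sup>2 \<le> ?K\<^sup>2 * (cmod (u x))\<^sup>2"
      by (simp only: power_mult_distrib)
  qed
  also have "\<dots> = (?K * norm f)\<^sup>2"
    unfolding u(2) power_mult_distrib norm_abs_L2[OF u(1)] by simp
  finally show ?thesis by (rule power2_le_imp_le) simp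
qed

lemma bounded_linear_mulx: "bounded_linear (mulx a b c)"
proof
  fix f g :: L2 and r :: real
  obtain u v where u: "square_integrable u" "f = abs_L2 u" and v: "square_integrable v" "g = abs_L2 v"
    by (metis abs_L2_cases)
  show "mulx a b c (f + g) = mulx a b c f + mulx a b c g"
    by (simp add: u v abs_L2_add mulx_abs_L2 square_integrable_add square_integrable_mulx distrib_left
        del: of_real_diff)
  show "mulx a b c (r *\<^sub>R f) = r *\<^sub>R mulx a b c f"
    by (simp add: scaleR_L2_def mulx_scaleC)
next
  show "\<exists>K. \<forall>x. norm (mulx a b c x) \<le> norm x * K"
    using norm_mulx_le[of a b c] by (intro exI[of _ "\<bar>a\<bar> + \<bar>b\<bar> + \<bar>c\<bar>"]) (simp add: mult.commute)
qed

lemma cip_mulx: "cip (mulx a b c f) g = cip f (mulx a b c g)"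
proof -
  obtain u v where u: "square_integrable u" "f = abs_L2 u" and v: "square_integrable v" "g = abs_L2 v"
    by (metis abs_L2_cases)
  show ?thesis
    unfolding u(2) v(2) mulx_abs_L2[OF u(1)] mulx_abs_L2[OF v(1)]
      cip_abs_L2[OF square_integrable_mulx[OF u(1)] v(1)] cip_abs_L2[OF u(1) square_integrable_mulx[OF v(1)]]
    by (intro Bochner_Integration.integral_cong) (auto simp: indicator_def)
qed

lemma mulx_cfun:
  assumes "continuous_on {a..b} h"
  shows "mulx a b c (cfun a b h) = cfun a b (\<lambda>x. of_real (x - c) * h x)"
  unfolding cfun_def mulx_abs_L2[OF square_integrable_cfun[OF assms]]
  by (intro arg_cong[where f = abs_L2]) (auto simp: indicator_def)

lemma smooth_linear: "smooth (\<lambda>x. of_real (x - c))"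
proof (rule smooth_coinduct[where P = "\<lambda>h. \<exists>\<alpha> \<beta>. h = (\<lambda>x. complex_of_real (\<alpha> * x + \<beta>))"])
  show "\<exists>\<alpha> \<beta>. (\<lambda>x. complex_of_real (x - c)) = (\<lambda>x. complex_of_real (\<alpha> * x + \<beta>))"
    by (intro exI[of _ 1] exI[of _ "-c"]) simp
  fix h assume "\<exists>\<alpha> \<beta>. h = (\<lambda>x. complex_of_real (\<alpha> * x + \<beta>))"
  then obtain \<alpha> \<beta> where h: "h = (\<lambda>x. complex_of_real (\<alpha> * x + \<beta>))" by blast
  have "((\<lambda>x. \<alpha> * x + \<beta>) has_field_derivative \<alpha>) (at x)" for x
    by (auto intro!: derivative_eq_intros)
  then have "(h has_vector_derivative of_real \<alpha>) (at x)" for x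
    unfolding h by (rule has_vector_derivative_of_real)
  then show "\<exists>k. (\<exists>\<alpha> \<beta>. k = (\<lambda>x. complex_of_real (\<alpha> * x + \<beta>))) \<and> (\<forall>x. (h has_vector_derivative k x) (at x))"
  proof (intro exI[of _ "\<lambda>x. of_real \<alpha>"] conjI)
    show "\<exists>\<alpha>' \<beta>. (\<lambda>x. complex_of_real \<alpha>) = (\<lambda>x. complex_of_real (\<alpha>' * x + \<beta>))"
      by (rule exI[of _ 0], rule exI[of _ \<alpha>]) simp
  qed blast
qed

text \<open>The weight is moved to the other side: if \<phi> is a test function, so is (x - c)
  \<phi>, and the derivative of the weight contributes the extra term \<open>f\<close>.\<close>

lemma H1_mulx:
  assumes ab: "a < b" and f: "f \<in> H1 a b"
  shows "mulx a b c f \<in> H1 a b" "weak_derivative a b (mulx a b c f) = f + mulx a b c (weak_derivative a b f)"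
    "x \<in> {a..b} \<Longrightarrow> value_at a b (mulx a b c f) x = of_real (x - c) * value_at a b f x"
proof -
  let ?f' = "weak_derivative a b f"
  have g: "f + mulx a b c ?f' \<in> L2_on a b"
    by (intro L2_on_add H1_L2_on[OF f] mulx_L2_on)
  have df: "has_weak_derivative a b f ?f'"
    by (subst H1_repr(2)[OF ab f]) (rule has_weak_derivative_prim[OF ab])
  have d: "has_weak_derivative a b (mulx a b c f) (f + mulx a b c ?f')"
    unfolding has_weak_derivative_iff[OF ab]
  proof (intro allI impI)
    fix \<phi> \<phi>'
    assume t: "test_function a b \<phi>" "test_function a b \<phi>'" and dd: "\<forall>x. (\<phi> has_vector_derivative \<phi>' x) (at x)"
    have tm: "test_function a b (\<lambda>x. of_real (x - c) * \<psi> x)" if "test_function a b \<psi>" for \<psi>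
      using that smooth_mult[OF smooth_linear[of c], of \<psi>] unfolding test_function_def by auto
    have mul: "mulx a b c (abs_L2 \<psi>) = abs_L2 (\<lambda>x. of_real (x - c) * \<psi> x)" if "test_function a b \<psi>" for \<psi>
      unfolding mulx_abs_L2[OF test_function_square_integrable[OF that ab]]
      using test_function_outside[OF that]
      by (intro arg_cong[where f = abs_L2]) (auto simp: indicator_def fun_eq_iff)
    have t': "test_function a b (\<lambda>x. of_real (x - c) * \<phi>' x + \<phi> x)"
      using test_function_combination[OF tm[OF t(2)] t(1) ab, of 1 1] by simp
    have "((\<lambda>x. of_real (x - c) * \<phi> x) has_vector_derivative of_real (x - c) * \<phi>' x + \<phi> x) (at x)" for x
    proof -
      have "((\<lambda>x. x - c) has_field_derivative 1) (at x)" by (auto intro!: derivative_eq_intros)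
      from has_vector_derivative_mult[OF has_vector_derivative_of_real[OF this] dd[rule_format, of x]]
      show ?thesis by simp
    qed
    then have "cip f (abs_L2 (\<lambda>x. of_real (x - c) * \<phi>' x + \<phi> x)) = - cip ?f' (abs_L2 (\<lambda>x. of_real (x - c) * \<phi> x))"
      using df tm[OF t(1)] t' unfolding has_weak_derivative_iff[OF ab] by blast
    moreover have "abs_L2 (\<lambda>x. of_real (x - c) * \<phi>' x + \<phi> x) = mulx a b c (abs_L2 \<phi>') + abs_L2 \<phi>"
      unfolding mul[OF t(2)]
      by (rule abs_L2_add[symmetric]; intro test_function_square_integrable[OF _ ab] tm t)
    ultimately show "cip (mulx a b c f) (abs_L2 \<phi>') = - cip (f + mulx a b c ?f') (abs_L2 \<phi>)"
      unfolding mul[OF t(1), symmetric] by (simp add: cip_mulx cip_add_left cip_add_right algebra_simps eq_neg_iff_add_eq_0)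
  qed
  show "weak_derivative a b (mulx a b c f) = f + mulx a b c ?f'"
    by (rule weak_derivative_eqI[OF ab g d])
  show "mulx a b c f \<in> H1 a b"
    unfolding H1_def using g d mulx_L2_on by blast
  show "value_at a b (mulx a b c f) x = of_real (x - c) * value_at a b f x" if "x \<in> {a..b}"
  proof -
    have "mulx a b c f = cfun a b (\<lambda>x. of_real (x - c) * value_at a b f x)"
      by (subst H1_repr(4)[OF ab f]) (rule mulx_cfun[OF H1_repr(5)[OF ab f]])
    then show ?thesis
      using value_at_cfun[OF _ ab that, of "\<lambda>x. of_real (x - c) * value_at a b f x"]
      by (simp add: continuous_intros H1_repr(5)[OF ab f])
  qed
qed

text \<open>Twice the real part of f' times the conjugate of f is the derivative of |f|^2,
  integrated here against the weight x - c. Placing \<open>c\<close> at an end point removes the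
  boundary term there; every application below does so.\<close>

lemma rellich_identity:
  assumes ab: "a < b" and f: "f \<in> H1 a b"
  shows "2 * Re (cip f (mulx a b c (weak_derivative a b f))) =
    (b - c) * (cmod (value_at a b f b))\<^sup>2 - (a - c) * (cmod (value_at a b f a))\<^sup>2 - (norm f)\<^sup>2"
proof -
  let ?f' = "weak_derivative a b f"
  have "cip ?f' (mulx a b c f) + cip f (f + mulx a b c ?f') =
      value_at a b f b * cnj (of_real (b - c) * value_at a b f b) - value_at a b f a * cnj (of_real (a - c) * value_at a b f a)"
    using H1_parts[OF ab f H1_mulx(1)[OF ab f, of c]] H1_mulx(2)[OF ab f, of c] ab
      H1_mulx(3)[OF ab f, of b c] H1_mulx(3)[OF ab f, of a c] by simp
  also have "\<dots> = of_real ((b - c) * (cmod (value_at a b f b))\<^sup>2 - (a - c) * (cmod (value_at a b f a))\<^sup>2)"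
  proof -
    have *: "z * cnj (of_real r * z) = of_real (r * (cmod z)\<^sup>2)" for z r
      by (simp only: complex_cnj_mult complex_cnj_complex_of_real of_real_mult complex_norm_square mult.left_commute)
    show ?thesis unfolding * by (rule of_real_diff[symmetric])
  qed
  finally have "Re (cip ?f' (mulx a b c f) + cip f (f + mulx a b c ?f')) =
      (b - c) * (cmod (value_at a b f b))\<^sup>2 - (a - c) * (cmod (value_at a b f a))\<^sup>2"
    by (simp only: Re_complex_of_real)
  moreover have "Re (cip ?f' (mulx a b c f)) = Re (cip f (mulx a b c ?f'))"
    using cip_cnj[of "mulx a b c ?f'" f] by (simp add: cip_mulx)
  ultimately show ?thesis
    by (simp add: cip_add_right norm_L2_sq)
qed

section \<open>Boundary values of \<open>H10\<close>\<close>

lemma H1_test_function: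
  assumes ab: "a < b" and t: "test_function a b \<phi>"
  shows "abs_L2 \<phi> \<in> H1 a b" "value_at a b (abs_L2 \<phi>) a = 0" "value_at a b (abs_L2 \<phi>) b = 0"
    "abs_L2 \<phi> \<in> H10 a b"
proof -
  obtain \<phi>' where t': "test_function a b \<phi>'" "\<And>x. (\<phi> has_vector_derivative \<phi>' x) (at x)"
    using test_function_derivative[OF t ab] by blast
  have eq: "abs_L2 \<phi> = 0 *\<^sub>C box_fun a b + prim a b (abs_L2 \<phi>')"
    using test_function_prim[OF t t' ab] by simp
  have l2: "abs_L2 \<phi>' \<in> L2_on a b"
    unfolding L2_on_abs[OF test_function_square_integrable[OF t'(1) ab]]
    using test_function_outside[OF t'(1)] by auto
  note p = const_plus_prim[OF ab l2, where C = 0, folded eq]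
  show h: "abs_L2 \<phi> \<in> H1 a b" by (fact p)
  show "value_at a b (abs_L2 \<phi>) a = 0" "value_at a b (abs_L2 \<phi>) b = 0"
    using p(3)[of a] p(3)[of b] ab test_function_prim(2)[OF t t' ab] by (auto simp: box_fun_empty cip.zero_right)
  have "H1_norm a b (abs_L2 \<phi> - abs_L2 \<phi>) = 0"
    using H1_zero(2)[OF ab] by (simp add: H1_norm_def L2_inner_eq_cip L2_on_zero cip.zero_left)
  then show "abs_L2 \<phi> \<in> H10 a b"
    unfolding H10_def using h t by (auto intro!: exI[of _ \<phi>])
qed

lemma H10_zero: "a < b \<Longrightarrow> 0 \<in> H10 a b"
proof -
  assume ab: "a < b"
  have "test_function a b (\<lambda>_. 0)"
    unfolding test_function_def using smooth_const by auto
  from H1_test_function(4)[OF ab this] show ?thesis by (simp add: zero_L2_def)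
qed

lemma H1_norm_eq:
  assumes ab: "a < b" and f: "f \<in> H1 a b"
  shows "H1_norm a b f = sqrt ((norm f)\<^sup>2 + (norm (weak_derivative a b f))\<^sup>2)"
  using H1_repr(1)[OF ab f] H1_L2_on[OF f] by (simp add: H1_norm_def L2_inner_eq_cip norm_L2_sq)

text \<open>Test functions vanish at both ends, and \<open>trace_le\<close> makes point values
  continuous for \<open>H1_norm\<close>.\<close>

lemma H10_value:
  assumes ab: "a < b" and f: "f \<in> H10 a b"
  shows "value_at a b f a = 0" "value_at a b f b = 0"
proof -
  have f1: "f \<in> H1 a b" using f by (simp add: H10_def)
  have bound: "cmod (value_at a b f x) \<le> (1 / sqrt (b - a) + 2 * sqrt (b - a)) * e"
    if e: "e > 0" and x: "x = a \<or> x = b" for e x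
  proof -
    obtain \<phi> where \<phi>: "test_function a b \<phi>" "H1_norm a b (f - abs_L2 \<phi>) < e"
      using f e unfolding H10_def by blast
    let ?g = "f - abs_L2 \<phi>"
    note t = H1_test_function[OF ab \<phi>(1)]
    note g = H1_diff[OF ab f1 t(1)]
    have "norm ?g \<le> H1_norm a b ?g" "norm (weak_derivative a b ?g) \<le> H1_norm a b ?g"
      unfolding H1_norm_eq[OF ab g(1)] by (auto intro!: real_le_rsqrt)
    then have n: "norm ?g \<le> e" "norm (weak_derivative a b ?g) \<le> e" using \<phi>(2) by auto
    have "cmod (value_at a b f x) = cmod (value_at a b ?g x)"
      using g(3)[of x] t x ab by auto
    also have "\<dots> \<le> norm ?g / sqrt (b - a) + 2 * sqrt (b - a) * norm (weak_derivative a b ?g)"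
      using x ab by (intro trace_le[OF ab g(1)]) auto
    also have "\<dots> \<le> e / sqrt (b - a) + 2 * sqrt (b - a) * e"
      using n ab by (intro add_mono divide_right_mono mult_left_mono) auto
    finally show ?thesis by (simp add: algebra_simps)
  qed
  have z: "cmod (value_at a b f x) \<le> 0" if x: "x = a \<or> x = b" for x
  proof (rule field_le_epsilon)
    fix e :: real assume e: "0 < e"
    define K where "K = 1 / sqrt (b - a) + 2 * sqrt (b - a)"
    have K: "K > 0" unfolding K_def using ab by (intro add_pos_pos) auto
    have "cmod (value_at a b f x) \<le> K * (e / K)"
      unfolding K_def by (rule bound) (use e K x in \<open>auto simp: K_def\<close>)
    also have "K * (e / K) = e" using K by simp
    finally show "cmod (value_at a b f x) \<le> 0 + e" by simp
  qed
  show "value_at a b f a = 0" "value_at a b f b = 0" using z by auto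
qed

section \<open>Riesz representation and projections in a closed subspace\<close>

lemma riesz_closed_subspace:
  fixes X :: "'a::{real_inner, banach} set" and f :: "'a \<Rightarrow> real"
  assumes X: "subspace X" "closed X"
    and add: "\<And>x y. x \<in> X \<Longrightarrow> y \<in> X \<Longrightarrow> f (x + y) = f x + f y"
    and scale: "\<And>r x. x \<in> X \<Longrightarrow> f (r *\<^sub>R x) = r * f x"
    and bd: "\<And>x. x \<in> X \<Longrightarrow> \<bar>f x\<bar> \<le> M * norm x"
  obtains z where "z \<in> X" "\<And>x. x \<in> X \<Longrightarrow> f x = inner z x"
proof -
  \<comment> \<open>The representing vector is found as the minimiser of this quadratic functional;
    completing the square bounds it below by \<open>- M\<^sup>2\<close>.\<close>
  define J where "J x = (norm x)\<^sup>2 - 2 * f x" for x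
  have lower: "- M\<^sup>2 \<le> J x" if "x \<in> X" for x
  proof -
    have "0 \<le> (norm x - M)\<^sup>2" by simp
    then show ?thesis using bd[OF that] unfolding J_def power2_diff by (simp add: mult.commute)
  qed
  define I where "I = Inf (J ` X)"
  have bdd: "bdd_below (J ` X)" using lower by (auto intro!: bdd_belowI2)
  have ne: "X \<noteq> {}" using X(1) subspace_0 by blast
  have I: "I \<le> J x" if "x \<in> X" for x
    unfolding I_def using bdd that by (intro cInf_lower) auto
  define r where "r n = 1 / real (Suc n)" for n
  have "\<exists>x\<in>X. J x < I + r n" for n
  proof -
    have "Inf (J ` X) < I + r n" by (simp add: I_def r_def)
    then show ?thesis using ne bdd by (subst (asm) cInf_less_iff) auto
  qed
  then obtain x where x: "\<And>n. x n \<in> X" "\<And>n. J (x n) < I + r n" by metis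
  \<comment> \<open>At the midpoint \<open>J\<close> is at least the infimum, so the parallelogram
    identity forces a minimising sequence to be Cauchy.\<close>
  have par: "(norm (x m - x n))\<^sup>2 \<le> 2 * r m + 2 * r n" for m n
  proof -
    let ?m = "(1/2) *\<^sub>R (x m + x n)"
    have mX: "?m \<in> X" by (intro subspace_scale subspace_add X x)
    have "f ?m = (f (x m) + f (x n)) / 2"
      using scale[of "x m + x n" "1/2"] add[of "x m" "x n"] x by (simp add: subspace_add[OF X(1)])
    moreover have "(norm ?m)\<^sup>2 = (norm (x m + x n))\<^sup>2 / 4"
      by (simp add: power_mult_distrib power2_eq_square)
    moreover have "(norm (x m + x n))\<^sup>2 + (norm (x m - x n))\<^sup>2 = 2 * (norm (x m))\<^sup>2 + 2 * (norm (x n))\<^sup>2"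
      by (simp add: power2_norm_eq_inner inner_add_left inner_add_right inner_diff_left inner_diff_right)
    ultimately have "(norm (x m - x n))\<^sup>2 = 2 * J (x m) + 2 * J (x n) - 4 * J ?m"
      unfolding J_def by simp
    also have "\<dots> \<le> 2 * (I + r m) + 2 * (I + r n) - 4 * I"
    proof -
      have "2 * p + 2 * q - 4 * j \<le> 2 * (I + u) + 2 * (I + w) - 4 * I"
        if "I \<le> j" "p < I + u" "q < I + w" for j p q u w
        using that by argo
      then show ?thesis using I[OF mX] x(2) by blast
    qed
    finally show ?thesis by (simp add: algebra_simps)
  qed
  have "Cauchy x"
  proof (rule CauchyI)
    fix e :: real assume e: "0 < e"
    obtain N where N: "4 / e\<^sup>2 < real N" using reals_Archimedean2 by blast
    have "norm (x m - x n) < e" if "m \<ge> N" "n \<ge> N" for m n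
    proof -
      have "real N > 0" using N e by (smt (verit) divide_pos_pos zero_less_power)
      have "r m < 1 / real N" "r n < 1 / real N"
        unfolding r_def using that \<open>real N > 0\<close> by (auto intro!: divide_strict_left_mono)
      moreover have "4 * (1 / real N) < e\<^sup>2"
        using N \<open>real N > 0\<close> e by (simp add: field_simps)
      ultimately have "(norm (x m - x n))\<^sup>2 < e\<^sup>2"
        using par[of m n] by linarith
      then show ?thesis using e by (simp add: power_less_imp_less_base)
    qed
    then show "\<exists>M. \<forall>m\<ge>M. \<forall>n\<ge>M. norm (x m - x n) < e" by blast
  qed
  then obtain z where z: "x \<longlonglongrightarrow> z"
    using Cauchy_convergent convergent_def by blast
  have zX: "z \<in> X" using closed_sequentially[OF X(2)] x(1) z by blast
  have "(\<lambda>n. f (x n)) \<longlonglongrightarrow> f z"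
  proof (rule LIM_zero_cancel[OF Lim_null_comparison[where g = "\<lambda>n. M * norm (x n - z)"]])
    have "f (x n) - f z = f (x n - z)" for n
      using add[of "x n - z" z] x(1) zX by (simp add: subspace_diff[OF X(1)])
    then show "\<forall>\<^sub>F n in sequentially. norm (f (x n) - f z) \<le> M * norm (x n - z)"
      using bd x(1) zX by (auto intro!: always_eventually simp: subspace_diff[OF X(1)])
    have "(\<lambda>n. M * norm (x n - z)) \<longlonglongrightarrow> M * norm (z - z)"
      by (intro tendsto_intros z)
    then show "(\<lambda>n. M * norm (x n - z)) \<longlonglongrightarrow> 0" by simp
  qed
  then have "(\<lambda>n. J (x n)) \<longlonglongrightarrow> J z"
    unfolding J_def by (intro tendsto_intros z)
  moreover have "(\<lambda>n. I + r n) \<longlonglongrightarrow> I + 0"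
    unfolding r_def by (intro tendsto_intros LIMSEQ_Suc[OF lim_1_over_n])
  ultimately have JI: "J z \<le> I"
    using x(2) by (intro LIMSEQ_le[of "\<lambda>n. J (x n)" _ "\<lambda>n. I + r n"]) (auto intro: less_imp_le)
  have "f w = inner z w" if w: "w \<in> X" for w
  proof (rule ccontr)
    assume ne: "f w \<noteq> inner z w"
    define d where "d = inner z w - f w"
    have d: "d \<noteq> 0" using ne by (simp add: d_def)
    have q: "0 \<le> t\<^sup>2 * (norm w)\<^sup>2 + 2 * t * d" for t
    proof -
      have "J z \<le> J (z + t *\<^sub>R w)"
        using JI I[of "z + t *\<^sub>R w"] zX w by (simp add: subspace_add[OF X(1)] subspace_scale[OF X(1)])
      also have "\<dots> = J z + t\<^sup>2 * (norm w)\<^sup>2 + 2 * t * d"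
      proof -
        have "(norm (z + t *\<^sub>R w))\<^sup>2 = (norm z)\<^sup>2 + 2 * t * inner z w + t\<^sup>2 * (norm w)\<^sup>2"
          unfolding power2_norm_eq_inner
          by (simp add: inner_add_left inner_add_right inner_commute[of w z] power2_eq_square distrib_left)
        then show ?thesis
          unfolding J_def d_def
          using add[OF zX, of "t *\<^sub>R w"] scale[OF w, of t] w
          by (simp add: subspace_scale[OF X(1)] algebra_simps)
      qed
      finally show ?thesis by simp
    qed
    \<comment> \<open>The added 1 keeps the denominator positive when w = 0; the parameter t = -d/N
      then makes the quadratic polynomial in \<open>q\<close> negative.\<close>
    define N where "N = (norm w)\<^sup>2 + 1"
    have N: "N > 0" by (simp add: N_def add_nonneg_pos)
    have "(- d / N)\<^sup>2 * (norm w)\<^sup>2 + 2 * (- d / N) * d \<le> (- d / N)\<^sup>2 * N + 2 * (- d / N) * d"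
      by (intro add_right_mono mult_left_mono) (auto simp: N_def)
    also have "\<dots> = - (d\<^sup>2 / N)" using N by (simp add: field_simps power2_eq_square)
    also have "\<dots> < 0" using N d by simp
    finally show False using q[of "- d / N"] by linarith
  qed
  then show thesis using zX by (intro that[of z])
qed

text \<open>An operator that is linear and bounded only on the subspace becomes so on the whole
  space after composition with \<open>P\<close>; it can then be taken under an integral.\<close>

lemma orthogonal_projection_exists:
  fixes X :: "'a::{real_inner, banach} set"
  assumes X: "subspace X" "closed X"
  obtains P where "bounded_linear P" "\<And>v. P v \<in> X" "\<And>x. x \<in> X \<Longrightarrow> P x = x"
proof -
  have "\<exists>z\<in>X. \<forall>x\<in>X. inner v x = inner z x" for v
    by (rule riesz_closed_subspace[OF X, of "\<lambda>x. inner v x" "norm v"])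
      (auto simp: inner_add_right Cauchy_Schwarz_ineq2)
  then obtain P where P: "\<And>v. P v \<in> X" "\<And>v x. x \<in> X \<Longrightarrow> inner v x = inner (P v) x" by metis
  have unique: "P v = z" if "z \<in> X" "\<And>x. x \<in> X \<Longrightarrow> inner v x = inner z x" for v z
  proof -
    have "inner (P v - z) (P v - z) = 0"
      using P(2)[of "P v - z" v] that(2)[of "P v - z"] subspace_diff[OF X(1) P(1) that(1), of v]
      by (simp add: inner_diff_left)
    then show ?thesis by simp
  qed
  have "bounded_linear P"
  proof
    fix u v and r :: real
    show "P (u + v) = P u + P v"
    proof (rule unique)
      show "inner (u + v) x = inner (P u + P v) x" if "x \<in> X" for x
        using P(2)[OF that, of u] P(2)[OF that, of v] by (simp only: inner_add_left)
    qed (intro subspace_add[OF X(1)] P)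
    show "P (r *\<^sub>R u) = r *\<^sub>R P u"
    proof (rule unique)
      show "inner (r *\<^sub>R u) x = inner (r *\<^sub>R P u) x" if "x \<in> X" for x
        using P(2)[OF that, of u] by (simp only: inner_scaleR_left)
    qed (intro subspace_scale[OF X(1)] P)
  next
    show "\<exists>K. \<forall>v. norm (P v) \<le> norm v * K"
    proof (intro exI[of _ 1] allI)
      fix v
      have "(norm (P v))\<^sup>2 = inner v (P v)"
        using P(2)[OF P(1), of v v] by (simp add: power2_norm_eq_inner)
      also have "\<dots> \<le> norm v * norm (P v)" by (rule norm_cauchy_schwarz)
      finally show "norm (P v) \<le> norm v * 1"
        by (cases "P v = 0") (auto simp: power2_eq_square)
    qed
  qed
  moreover have "P x = x" if "x \<in> X" for x using that by (intro unique) auto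
  ultimately show thesis using P(1) that by blast
qed

subsection \<open>Contraction semigroups on a closed subspace\<close>

text \<open>The semigroup acts on a closed subspace of a Hilbert space because the image of the
  energy space under \<open>emb\<close> is such a subspace and not a type of its own. Values of
  \<open>S t\<close> outside \<open>X\<close> are unconstrained.\<close>

locale contraction_semigroup =
  fixes X :: "'a::{real_inner, banach} set" and S :: "real \<Rightarrow> 'a \<Rightarrow> 'a"
  assumes X: "subspace X" "closed X"
    and maps: "0 \<le> t \<Longrightarrow> x \<in> X \<Longrightarrow> S t x \<in> X"
    and S_add: "0 \<le> t \<Longrightarrow> x \<in> X \<Longrightarrow> y \<in> X \<Longrightarrow> S t (x + y) = S t x + S t y"
    and S_scaleR: "0 \<le> t \<Longrightarrow> x \<in> X \<Longrightarrow> S t (r *\<^sub>R x) = r *\<^sub>R S t x"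
    and contraction: "0 \<le> t \<Longrightarrow> x \<in> X \<Longrightarrow> norm (S t x) \<le> norm x"
    and S_0: "x \<in> X \<Longrightarrow> S 0 x = x"
    and S_plus: "0 \<le> s \<Longrightarrow> 0 \<le> t \<Longrightarrow> x \<in> X \<Longrightarrow> S (s + t) x = S s (S t x)"
    and strongly_continuous: "x \<in> X \<Longrightarrow> ((\<lambda>t. S t x) \<longlongrightarrow> x) (at_right 0)"
begin

lemma X_diff: "x \<in> X \<Longrightarrow> y \<in> X \<Longrightarrow> x - y \<in> X"
  by (rule subspace_diff[OF X(1)])

lemma X_scaleR: "x \<in> X \<Longrightarrow> r *\<^sub>R x \<in> X"
  by (rule subspace_scale[OF X(1)])

lemma S_diff: "0 \<le> t \<Longrightarrow> x \<in> X \<Longrightarrow> y \<in> X \<Longrightarrow> S t (x - y) = S t x - S t y"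
  using S_add[of t x "-1 *\<^sub>R y"] S_scaleR[of t y "-1"] X_scaleR[of y "-1"] by simp

lemma near_0:
  assumes x: "x \<in> X" and e: "e > 0"
  obtains d where "d > 0" "\<And>h. 0 \<le> h \<Longrightarrow> h < d \<Longrightarrow> norm (S h x - x) < e"
proof -
  obtain d where d: "d > 0" "\<forall>h>0. h < d \<longrightarrow> dist (S h x) x < e"
    using tendstoD[OF strongly_continuous[OF x] e] unfolding eventually_at_right_field by auto
  show thesis
  proof (rule that[OF d(1)])
    fix h :: real assume "0 \<le> h" "h < d"
    then show "norm (S h x - x) < e"
      using d(2) e x S_0 by (cases "h = 0") (auto simp: dist_norm)
  qed
qed

lemma S_diff_time:
  assumes "x \<in> X" "0 \<le> s" "s \<le> t"
  shows "norm (S t x - S s x) \<le> norm (S (t - s) x - x)"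
proof -
  have "S t x - S s x = S s (S (t - s) x - x)"
    using assms S_plus[of s "t - s" x] by (simp add: S_diff maps)
  then show ?thesis
    using assms by (simp add: contraction X_diff maps)
qed

lemma continuous_orbit:
  assumes x: "x \<in> X"
  shows "continuous_on {0..} (\<lambda>t. S t x)"
  unfolding continuous_on_iff
proof (intro ballI allI impI)
  fix t e :: real assume t: "t \<in> {0..}" and e: "0 < e"
  obtain d where d: "d > 0" "\<And>h. 0 \<le> h \<Longrightarrow> h < d \<Longrightarrow> norm (S h x - x) < e"
    using near_0[OF x e] by blast
  have "dist (S s x) (S t x) < e" if "s \<in> {0..}" "dist s t < d" for s
  proof (cases "s \<le> t")
    case True
    then have "norm (S t x - S s x) < e"
      using S_diff_time[OF x, of s t] d(2)[of "t - s"] that t by (auto simp: dist_real_def)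
    then show ?thesis by (simp add: dist_norm norm_minus_commute)
  next
    case False
    then have "norm (S s x - S t x) < e"
      using S_diff_time[OF x, of t s] d(2)[of "s - t"] that t by (auto simp: dist_real_def)
    then show ?thesis by (simp add: dist_norm)
  qed
  then show "\<exists>d>0. \<forall>s\<in>{0..}. dist s t < d \<longrightarrow> dist (S s x) (S t x) < e"
    using d(1) by blast
qed

definition gen :: "('a \<times> 'a) set" where
  "gen = {(x, y). x \<in> X \<and> y \<in> X \<and> ((\<lambda>h. (1 / h) *\<^sub>R (S h x - x)) \<longlongrightarrow> y) (at_right 0)}"

lemma gen_near_0:
  assumes g: "(x, y) \<in> gen" and e: "e > 0"
  obtains d where "d > 0" "\<And>h. 0 < h \<Longrightarrow> h < d \<Longrightarrow> norm (S h x - x - h *\<^sub>R y) \<le> e * h"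
proof -
  obtain d where d: "d > 0" "\<forall>h>0. h < d \<longrightarrow> dist ((1 / h) *\<^sub>R (S h x - x)) y < e"
  proof -
    have "((\<lambda>h. (1 / h) *\<^sub>R (S h x - x)) \<longlongrightarrow> y) (at_right 0)"
      using g by (simp add: gen_def)
    from tendstoD[OF this e] that show ?thesis
      unfolding eventually_at_right_field by auto
  qed
  have "norm (S h x - x - h *\<^sub>R y) \<le> e * h" if h: "0 < h" "h < d" for h
  proof -
    have "S h x - x - h *\<^sub>R y = h *\<^sub>R ((1 / h) *\<^sub>R (S h x - x) - y)"
      using h by (simp add: scaleR_diff_right)
    then have "norm (S h x - x - h *\<^sub>R y) = h * norm ((1 / h) *\<^sub>R (S h x - x) - y)"
      using h by (simp only: norm_scaleR abs_of_pos)
    also have "\<dots> \<le> h * e"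
      using d(2) h by (intro mult_left_mono) (auto simp: dist_norm less_imp_le)
    finally show ?thesis by (simp add: mult.commute)
  qed
  then show thesis using d(1) that by blast
qed

lemma gen_S:
  assumes g: "(x, y) \<in> gen" and t: "0 \<le> t"
  shows "(S t x, S t y) \<in> gen"
proof -
  have x: "x \<in> X" and y: "y \<in> X" and lim: "((\<lambda>h. (1 / h) *\<^sub>R (S h x - x)) \<longlongrightarrow> y) (at_right 0)"
    using g by (auto simp: gen_def)
  have "((\<lambda>h. (1 / h) *\<^sub>R (S h (S t x) - S t x)) \<longlongrightarrow> S t y) (at_right 0)"
  proof (rule LIM_zero_cancel[OF Lim_null_comparison])
    show "\<forall>\<^sub>F h in at_right 0. norm ((1 / h) *\<^sub>R (S h (S t x) - S t x) - S t y) \<le> norm ((1 / h) *\<^sub>R (S h x - x) - y)"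
      using eventually_at_right_less[of "0::real"]
    proof eventually_elim
      fix h :: real assume h: "0 < h"
      have "(1 / h) *\<^sub>R (S h (S t x) - S t x) - S t y = S t ((1 / h) *\<^sub>R (S h x - x) - y)"
        using h t x y S_plus[of h t x] S_plus[of t h x]
        by (simp add: S_diff S_scaleR X_diff X_scaleR maps add.commute)
      then show "norm ((1 / h) *\<^sub>R (S h (S t x) - S t x) - S t y) \<le> norm ((1 / h) *\<^sub>R (S h x - x) - y)"
        using h t x y by (simp add: contraction X_diff X_scaleR maps)
    qed
    show "((\<lambda>h. norm ((1 / h) *\<^sub>R (S h x - x) - y)) \<longlongrightarrow> 0) (at_right 0)"
      by (rule tendsto_norm_zero[OF LIM_zero[OF lim]])
  qed
  then show ?thesis using maps[OF t] x y by (simp add: gen_def)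
qed

text \<open>For later times the increment is \<open>S t\<close> applied to an increment at 0. For
  earlier times \<open>S s\<close> is pulled out instead, and contractivity keeps both errors
  small.\<close>

lemma has_vector_derivative_orbit:
  assumes g: "(x, y) \<in> gen" and t: "0 < t"
  shows "((\<lambda>t. S t x) has_vector_derivative S t y) (at t)"
  unfolding has_vector_derivative_def has_derivative_at_alt
proof (intro conjI allI impI)
  show "bounded_linear (\<lambda>h. h *\<^sub>R S t y)" by (rule bounded_linear_scaleR_left)
  fix e :: real assume e: "0 < e"
  have x: "x \<in> X" and y: "y \<in> X" using g by (auto simp: gen_def)
  obtain d1 where d1: "d1 > 0" "\<And>h. 0 < h \<Longrightarrow> h < d1 \<Longrightarrow> norm (S h x - x - h *\<^sub>R y) \<le> (e/2) * h"
    using gen_near_0[OF g, of "e/2"] e by auto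
  obtain d2 where d2: "d2 > 0" "\<And>h. 0 \<le> h \<Longrightarrow> h < d2 \<Longrightarrow> norm (S h y - y) < e / 2"
    using near_0[OF y, of "e/2"] e by auto
  have main: "norm (S s x - S t x - (s - t) *\<^sub>R S t y) \<le> e * norm (s - t)"
    if s: "norm (s - t) < min t (min d1 d2)" for s
  proof -
    consider "s = t" | "s > t" | "s < t" by linarith
    then show ?thesis
    proof cases
      case 1 then show ?thesis by simp
    next
      case 2
      define h where "h = s - t"
      have h: "h > 0" "h < d1" "s = t + h" using 2 s by (auto simp: h_def)
      have "S s x - S t x - (s - t) *\<^sub>R S t y = S t (S h x - x - h *\<^sub>R y)"
        using h t x y S_plus[of t h x] by (simp add: S_diff S_scaleR X_diff X_scaleR maps)
      then have "norm (S s x - S t x - (s - t) *\<^sub>R S t y) \<le> norm (S h x - x - h *\<^sub>R y)"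
        using h t x y by (simp only:) (intro contraction; simp add: X_diff X_scaleR maps)
      also have "\<dots> \<le> (e/2) * h" using d1(2) h by blast
      also have "\<dots> \<le> e * norm (s - t)" using h e by simp
      finally show ?thesis .
    next
      case 3
      \<comment> \<open>From the left the reference derivative is \<open>S h y\<close> rather than
        \<open>y\<close>; strong continuity at \<open>y\<close> bounds the discrepancy and uses the
        second half of \<open>e\<close>.\<close>
      define h where "h = t - s"
      have h: "h > 0" "h < d1" "h < d2" "h < t" "s = t - h" "0 < s" using 3 s by (auto simp: h_def)
      have St: "S t w = S s (S h w)" if "w \<in> X" for w
        using S_plus[of s h w] that h by simp
      have "S s (S h x - x - h *\<^sub>R y) = S s (S h x) - S s x - h *\<^sub>R S s y"
        using h x y by (simp add: S_diff S_scaleR X_diff X_scaleR maps)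
      moreover have "S s (S h y - y) = S s (S h y) - S s y"
        using h x y by (simp add: S_diff X_diff X_scaleR maps)
      moreover have "s - t = - h" using h by simp
      ultimately have "S s x - S t x - (s - t) *\<^sub>R S t y = h *\<^sub>R S s (S h y - y) - S s (S h x - x - h *\<^sub>R y)"
        by (simp add: St[OF x] St[OF y] scaleR_diff_right)
      also have "norm \<dots> \<le> h * norm (S h y - y) + norm (S h x - x - h *\<^sub>R y)"
      proof (rule order_trans[OF norm_triangle_ineq4 add_mono])
        show "norm (h *\<^sub>R S s (S h y - y)) \<le> h * norm (S h y - y)"
          using h y by (simp add: contraction X_diff maps)
        show "norm (S s (S h x - x - h *\<^sub>R y)) \<le> norm (S h x - x - h *\<^sub>R y)"
          using h x y by (intro contraction) (auto intro!: X_diff X_scaleR maps)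
      qed
      also have "\<dots> \<le> h * (e/2) + (e/2) * h"
        using d1(2)[of h] d2(2)[of h] h by (intro add_mono mult_left_mono) auto
      also have "\<dots> = e * norm (s - t)" using h by simp
      finally show ?thesis .
    qed
  qed
  show "\<exists>d>0. \<forall>s. norm (s - t) < d \<longrightarrow> norm (S s x - S t x - (s - t) *\<^sub>R S t y) \<le> e * norm (s - t)"
    using main t d1(1) d2(1) by (intro exI[of _ "min t (min d1 d2)"]) auto
qed

section \<open>Averaged orbits and density of the domains of powers\<close>

definition average :: "real \<Rightarrow> 'a \<Rightarrow> 'a" where
  "average h x = (1 / h) *\<^sub>R integral {0..h} (\<lambda>t. S t x)"

lemma integrable_orbit: "x \<in> X \<Longrightarrow> 0 \<le> s \<Longrightarrow> (\<lambda>t. S t x) integrable_on {s..t}"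
  by (intro integrable_continuous_real continuous_on_subset[OF continuous_orbit]) auto

text \<open>The projection fixes the orbit and commutes with the integral, so it fixes the
  integral.\<close>

lemma integral_orbit_in_X:
  assumes x: "x \<in> X"
  shows "integral {0..h} (\<lambda>t. S t x) \<in> X"
proof -
  obtain P where P: "bounded_linear P" "\<And>v. P v \<in> X" "\<And>x. x \<in> X \<Longrightarrow> P x = x"
    using orthogonal_projection_exists[OF X] by blast
  have "P (integral {0..h} (\<lambda>t. S t x)) = integral {0..h} (P \<circ> (\<lambda>t. S t x))"
    by (rule integral_linear[OF integrable_orbit[OF x] P(1), symmetric]) simp
  also have "\<dots> = integral {0..h} (\<lambda>t. S t x)"
    using P(3) maps x by (intro integral_cong) auto
  finally show ?thesis using P(2) by metis
qed

lemma average_in_X: "x \<in> X \<Longrightarrow> average h x \<in> X"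
  unfolding average_def by (intro X_scaleR integral_orbit_in_X)

text \<open>\<open>S s\<close> is linear only on \<open>X\<close>; composed with the projection it
  becomes a bounded operator that can be taken under the integral.\<close>

lemma S_integral_orbit:
  assumes x: "x \<in> X" and s: "0 \<le> s" and h: "0 \<le> h"
  shows "S s (integral {0..h} (\<lambda>t. S t x)) = integral {s..s + h} (\<lambda>t. S t x)"
proof -
  obtain P where P: "bounded_linear P" "\<And>v. P v \<in> X" "\<And>x. x \<in> X \<Longrightarrow> P x = x"
    using orthogonal_projection_exists[OF X] by blast
  have bl: "bounded_linear (\<lambda>v. S s (P v))"
  proof
    fix u v and r :: real
    show "S s (P (u + v)) = S s (P u) + S s (P v)"
      by (simp add: linear_add[OF bounded_linear.linear[OF P(1)]] S_add s P(2))
    show "S s (P (r *\<^sub>R u)) = r *\<^sub>R S s (P u)"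
      by (simp add: linear_scale[OF bounded_linear.linear[OF P(1)]] S_scaleR s P(2))
    obtain K where K: "\<And>x. norm (P x) \<le> norm x * K"
      using bounded_linear.bounded[OF P(1)] by blast
    show "\<exists>K. \<forall>x. norm (S s (P x)) \<le> norm x * K"
      using order_trans[OF contraction[OF s P(2)] K] by blast
  qed
  have "S s (integral {0..h} (\<lambda>t. S t x)) = S s (P (integral {0..h} (\<lambda>t. S t x)))"
    using P(3) integral_orbit_in_X[OF x] by simp
  also have "\<dots> = integral {0..h} ((\<lambda>v. S s (P v)) \<circ> (\<lambda>t. S t x))"
    by (rule integral_linear[OF integrable_orbit[OF x] bl, symmetric]) simp
  also have "\<dots> = integral {0..h} (\<lambda>t. S (t + s) x)"
  proof (rule integral_cong)
    fix t assume t: "t \<in> {0..h}"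
    then show "((\<lambda>v. S s (P v)) \<circ> (\<lambda>t. S t x)) t = S (t + s) x"
      using P(3) maps x s S_plus[of s t x] by (simp add: add.commute)
  qed
  also have "\<dots> = integral {s..s + h} (\<lambda>t. S t x)"
    using integral_shift_real_ivl[where a = s and b = "s + h" and c = s and f = "\<lambda>t. S t x"] by simp
  finally show ?thesis .
qed

lemma integral_orbit_tendsto:
  assumes x: "x \<in> X" and a: "0 \<le> a"
  shows "((\<lambda>h. (1 / h) *\<^sub>R integral {a..a + h} (\<lambda>t. S t x)) \<longlongrightarrow> S a x) (at_right 0)"
proof (rule tendstoI)
  fix e :: real assume e: "0 < e"
  obtain d where d: "d > 0" "\<And>h. 0 \<le> h \<Longrightarrow> h < d \<Longrightarrow> norm (S h x - x) < e / 2"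
    using near_0[OF x, of "e/2"] e by auto
  have "dist ((1 / h) *\<^sub>R integral {a..a + h} (\<lambda>t. S t x)) (S a x) < e" if h: "0 < h" "h < d" for h
  proof -
    have "integral {a..a + h} (\<lambda>t. S t x - S a x) = integral {a..a + h} (\<lambda>t. S t x) - h *\<^sub>R S a x"
      using h by (subst Henstock_Kurzweil_Integration.integral_diff) (auto intro!: integrable_orbit x a)
    moreover have "norm (integral {a..a + h} (\<lambda>t. S t x - S a x)) \<le> e / 2 * (a + h - a)"
    proof (rule integral_bound)
      show "continuous_on {a..a + h} (\<lambda>t. S t x - S a x)"
        using a by (intro continuous_intros continuous_on_subset[OF continuous_orbit[OF x]]) auto
      fix t assume t: "t \<in> {a..a + h}"
      then show "norm (S t x - S a x) \<le> e / 2"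
        using S_diff_time[OF x a, of t] d(2)[of "t - a"] h by auto
    qed (use h in simp)
    ultimately have *: "norm (integral {a..a + h} (\<lambda>t. S t x) - h *\<^sub>R S a x) \<le> e / 2 * h" by simp
    have "(1 / h) *\<^sub>R integral {a..a + h} (\<lambda>t. S t x) - S a x =
        (1 / h) *\<^sub>R (integral {a..a + h} (\<lambda>t. S t x) - h *\<^sub>R S a x)"
      using h by (simp add: scaleR_diff_right)
    then have "norm ((1 / h) *\<^sub>R integral {a..a + h} (\<lambda>t. S t x) - S a x) =
        (1 / h) * norm (integral {a..a + h} (\<lambda>t. S t x) - h *\<^sub>R S a x)"
      using h by (simp only: norm_scaleR) simp
    also have "\<dots> \<le> (1 / h) * (e / 2 * h)"
      using * h by (intro mult_left_mono) auto
    also have "\<dots> < e" using h e by simp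
    finally show ?thesis by (simp add: dist_norm)
  qed
  then show "\<forall>\<^sub>F h in at_right 0. dist ((1 / h) *\<^sub>R integral {a..a + h} (\<lambda>t. S t x)) (S a x) < e"
    using d(1) unfolding eventually_at_right_field by (auto intro!: exI[of _ d])
qed

lemma average_tendsto: "x \<in> X \<Longrightarrow> ((\<lambda>h. average h x) \<longlongrightarrow> x) (at_right 0)"
  using integral_orbit_tendsto[of x 0] by (simp add: average_def S_0)

text \<open>Shifting the window [0,h] by k changes the integral only at its two ends; divided by k,
  these pieces tend to \<open>S h x\<close> and \<open>x\<close>. Averaging therefore always lands
  in the domain of the generator.\<close>

lemma average_gen:
  assumes x: "x \<in> X" and h: "0 < h"
  shows "(average h x, (1 / h) *\<^sub>R (S h x - x)) \<in> gen"
proof -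
  let ?I = "\<lambda>a b. integral {a..b} (\<lambda>t. S t x)"
  have "((\<lambda>k. (1 / h) *\<^sub>R ((1 / k) *\<^sub>R ?I h (h + k) - (1 / k) *\<^sub>R ?I 0 (0 + k))) \<longlongrightarrow> (1 / h) *\<^sub>R (S h x - S 0 x)) (at_right 0)"
    using h by (intro tendsto_intros integral_orbit_tendsto[OF x]) auto
  then have "((\<lambda>k. (1 / k) *\<^sub>R (S k (average h x) - average h x)) \<longlongrightarrow> (1 / h) *\<^sub>R (S h x - S 0 x)) (at_right 0)"
  proof (rule Lim_transform_eventually)
    show "\<forall>\<^sub>F k in at_right 0. (1 / h) *\<^sub>R ((1 / k) *\<^sub>R ?I h (h + k) - (1 / k) *\<^sub>R ?I 0 (0 + k)) =
        (1 / k) *\<^sub>R (S k (average h x) - average h x)"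
      using eventually_at_right_less[of "0::real"]
    proof eventually_elim
      fix k :: real assume k: "0 < k"
      have "S k (average h x) = (1 / h) *\<^sub>R ?I k (k + h)"
        unfolding average_def using k h x by (simp add: S_scaleR integral_orbit_in_X S_integral_orbit)
      moreover have "?I 0 k + ?I k (k + h) = ?I 0 (k + h)" "?I 0 h + ?I h (h + k) = ?I 0 (h + k)"
        using k h x by (intro Henstock_Kurzweil_Integration.integral_combine integrable_orbit; simp)+
      then have "?I k (k + h) - ?I 0 h = ?I h (h + k) - ?I 0 k"
        by (simp add: algebra_simps)
      ultimately show "(1 / h) *\<^sub>R ((1 / k) *\<^sub>R ?I h (h + k) - (1 / k) *\<^sub>R ?I 0 (0 + k)) =
          (1 / k) *\<^sub>R (S k (average h x) - average h x)"
        unfolding average_def by (simp add: scaleR_diff_right[symmetric] mult.commute)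
    qed
  qed
  then show ?thesis
    using x h by (simp add: gen_def average_in_X S_0 X_scaleR X_diff maps)
qed

text \<open>By the fundamental theorem of calculus the average of the derivative is the increment of
  the orbit divided by h, which \<open>average_gen\<close> recognises as the generator applied to
  the average.\<close>

lemma average_gen_gen:
  assumes g: "(x, y) \<in> gen" and h: "0 < h"
  shows "(average h x, average h y) \<in> gen"
proof -
  have x: "x \<in> X" and y: "y \<in> X" using g by (auto simp: gen_def)
  have "((\<lambda>t. S t y) has_integral (S h x - S 0 x)) {0..h}"
  proof (rule fundamental_theorem_of_calculus_interior)
    show "continuous_on {0..h} (\<lambda>t. S t x)"
      by (rule continuous_on_subset[OF continuous_orbit[OF x]]) auto
  qed (use h in \<open>auto intro: has_vector_derivative_orbit[OF g]\<close>)
  then have "average h y = (1 / h) *\<^sub>R (S h x - x)"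
    unfolding average_def using x by (simp add: integral_unique S_0)
  then show ?thesis using average_gen[OF x h] by simp
qed

text \<open>\<open>gen_dom k\<close> is the domain of the k-th power of the generator.\<close>

fun gen_dom :: "nat \<Rightarrow> 'a set" where
  "gen_dom 0 = X"
| "gen_dom (Suc k) = {x. \<exists>y \<in> gen_dom k. (x, y) \<in> gen}"

lemma average_gen_dom: "x \<in> gen_dom k \<Longrightarrow> 0 < h \<Longrightarrow> average h x \<in> gen_dom (Suc k)"
proof (induction k arbitrary: x)
  case 0
  then show ?case using average_gen[of x h] by (auto simp: X_scaleR X_diff maps)
next
  case (Suc k)
  then obtain y where y: "y \<in> gen_dom k" "(x, y) \<in> gen" by auto
  have "average h y \<in> gen_dom (Suc k)" by (rule Suc.IH[OF y(1) Suc.prems(2)])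
  moreover have "(average h x, average h y) \<in> gen" by (rule average_gen_gen[OF y(2) Suc.prems(2)])
  ultimately show ?case by (subst gen_dom.simps) blast
qed

lemma gen_dom_subset: "gen_dom k \<subseteq> X"
  by (cases k) (auto simp: gen_def)

text \<open>Averages gain one power of the generator and converge to the point averaged, so an
  approximation in \<open>gen_dom k\<close> within half the error can be improved to one in
  \<open>gen_dom (Suc k)\<close>.\<close>

lemma gen_dom_dense:
  assumes "x \<in> X" "e > 0"
  obtains y where "y \<in> gen_dom k" "norm (x - y) < e"
  using assms
proof (induction k arbitrary: x e thesis)
  case 0
  then show ?case by (intro 0(1)[of x]) auto
next
  case (Suc k)
  obtain y where y: "y \<in> gen_dom k" "norm (x - y) < e / 2"
    using Suc.IH[of x "e/2"] Suc.prems by auto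
  have yX: "y \<in> X" using y gen_dom_subset by blast
  obtain d where d: "d > 0" "\<forall>h>0. h < d \<longrightarrow> dist (average h y) y < e / 2"
    using tendstoD[OF average_tendsto[OF yX], of "e/2"] Suc.prems
    unfolding eventually_at_right_field by auto
  have "dist (average (d/2) y) y < e / 2" using d by auto
  then have "norm (x - average (d/2) y) < e"
    using y(2) norm_triangle_lt[of "x - y" "y - average (d/2) y" e]
    by (simp add: dist_norm norm_minus_commute)
  then show ?case
    using Suc.prems(1) average_gen_dom[OF y(1), of "d/2"] d(1) by simp
qed

text \<open>\<open>w j\<close> stands for the j-th power of the generator applied to
  \<open>x\<close>; the orbits of the \<open>w j\<close> will be the successive time derivatives of
  the orbit of \<open>x\<close>.\<close>

lemma gen_dom_chain:
  assumes "x \<in> gen_dom k"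
  obtains w where "w 0 = x" "\<And>j. j < k \<Longrightarrow> (w j, w (Suc j)) \<in> gen" "\<And>j. j \<le> k \<Longrightarrow> w j \<in> X"
  using assms
proof (induction k arbitrary: x thesis)
  case 0
  then show ?case by (intro 0(1)[of "\<lambda>_. x"]) auto
next
  case (Suc k)
  then obtain y where y: "y \<in> gen_dom k" "(x, y) \<in> gen" by auto
  obtain w where w: "w 0 = y" "\<And>j. j < k \<Longrightarrow> (w j, w (Suc j)) \<in> gen" "\<And>j. j \<le> k \<Longrightarrow> w j \<in> X"
    using Suc.IH[OF _ y(1)] by blast
  show ?case
  proof (rule Suc.prems(1)[of "case_nat x w"])
    show "(case_nat x w j, case_nat x w (Suc j)) \<in> gen" if "j < Suc k" for j
      using that w y by (cases j) auto
    show "case_nat x w j \<in> X" if "j \<le> Suc k" for j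
      using that w y by (cases j) (auto simp: gen_def)
  qed simp
qed

end

subsection \<open>The energy space\<close>

text \<open>While \<open>prim a b g\<close> is the primitive vanishing at \<open>a\<close>, the following one vanishes at \<open>b\<close>.\<close>

definition bprim :: "real \<Rightarrow> real \<Rightarrow> L2 \<Rightarrow> L2" where
  "bprim a b g = (- cip g (box_fun a b)) *\<^sub>C box_fun a b + prim a b g"

lemma bounded_linear_bprim:
  assumes "a \<le> b"
  shows "bounded_linear (bprim a b)"
  unfolding bprim_def[abs_def]
  by (intro bounded_linear_add bounded_linear_prim[OF assms] bounded_linear_minus
      bounded_linear_compose[OF bounded_linear_scaleC_left] cip.bounded_linear_left)

lemma H1_eq_prim:
  assumes "a < b" "f \<in> H1 a b" "value_at a b f a = 0"
  shows "f = prim a b (weak_derivative a b f)"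
  using H1_repr(2)[OF assms(1,2)] assms(3) by simp

lemma H1_eq_bprim:
  assumes "a < b" "f \<in> H1 a b" "value_at a b f b = 0"
  shows "f = bprim a b (weak_derivative a b f)"
proof -
  have "value_at a b f a = - cip (weak_derivative a b f) (box_fun a b)"
    using H1_repr(3)[OF assms(1,2), of b] assms by (simp add: eq_neg_iff_add_eq_0)
  then show ?thesis
    using H1_repr(2)[OF assms(1,2)] by (simp add: bprim_def)
qed

locale plate =
  fixes p :: params
  assumes ab1: "0 < L\<^sub>0 p" and ab2: "L\<^sub>0 p < L p"
    and \<rho>_pos: "\<rho>\<^sub>0 p > 0" "\<rho>\<^sub>1 p > 0" "\<rho>\<^sub>2 p > 0"
    and \<alpha>_pos: "\<alpha>\<^sub>1 p > 0" "\<alpha>\<^sub>2 p > 0"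
    and \<beta>_pos: "\<beta>\<^sub>1 p > 0" "\<beta>\<^sub>2 p > 0"
    and \<kappa>_pos: "\<kappa> p > 0" and \<gamma>_ne: "\<gamma> p \<noteq> 0"
begin

lemma V1_D:
  assumes "(u, y) \<in> V\<^sub>1 p"
  shows "u \<in> H1 0 (L\<^sub>0 p)" "y \<in> H1 (L\<^sub>0 p) (L p)" "val\<^sub>1 p u 0 = 0" "val\<^sub>2 p y (L p) = 0"
    "val\<^sub>1 p u (L\<^sub>0 p) = val\<^sub>2 p y (L\<^sub>0 p)"
  using assms by (auto simp: V\<^sub>1_def)

lemma W1_D:
  assumes "(u, y) \<in> W\<^sub>1 p"
  shows "(u, y) \<in> V\<^sub>1 p" "d\<^sub>1 p u \<in> H1 0 (L\<^sub>0 p)" "d\<^sub>2 p y \<in> H1 (L\<^sub>0 p) (L p)"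
    "val\<^sub>1 p (d\<^sub>1 p u) 0 = 0" "val\<^sub>2 p (d\<^sub>2 p y) (L p) = 0"
    "val\<^sub>1 p (d\<^sub>1 p u) (L\<^sub>0 p) = val\<^sub>2 p (d\<^sub>2 p y) (L\<^sub>0 p)"
  using assms by (auto simp: W\<^sub>1_def H2_def)

lemma W1_I:
  assumes "(u, y) \<in> V\<^sub>1 p" "d\<^sub>1 p u \<in> H1 0 (L\<^sub>0 p)" "d\<^sub>2 p y \<in> H1 (L\<^sub>0 p) (L p)"
    "val\<^sub>1 p (d\<^sub>1 p u) 0 = 0" "val\<^sub>2 p (d\<^sub>2 p y) (L p) = 0"
    "val\<^sub>1 p (d\<^sub>1 p u) (L\<^sub>0 p) = val\<^sub>2 p (d\<^sub>2 p y) (L\<^sub>0 p)"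
  shows "(u, y) \<in> W\<^sub>1 p"
  using assms by (auto simp: W\<^sub>1_def H2_def V\<^sub>1_def)

lemma V1_add: "(u, y) \<in> V\<^sub>1 p \<Longrightarrow> (u', y') \<in> V\<^sub>1 p \<Longrightarrow> (u + u', y + y') \<in> V\<^sub>1 p"
  using ab1 ab2 by (auto simp: V\<^sub>1_def H1_add)

lemma V1_scaleC: "(u, y) \<in> V\<^sub>1 p \<Longrightarrow> (c *\<^sub>C u, c *\<^sub>C y) \<in> V\<^sub>1 p"
  using ab1 ab2 by (auto simp: V\<^sub>1_def H1_scaleC)

lemma W1_add:
  assumes 1: "(u, y) \<in> W\<^sub>1 p" and 2: "(u', y') \<in> W\<^sub>1 p"
  shows "(u + u', y + y') \<in> W\<^sub>1 p"
    "d\<^sub>1 p (d\<^sub>1 p (u + u')) = d\<^sub>1 p (d\<^sub>1 p u) + d\<^sub>1 p (d\<^sub>1 p u')"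
    "d\<^sub>2 p (d\<^sub>2 p (y + y')) = d\<^sub>2 p (d\<^sub>2 p y) + d\<^sub>2 p (d\<^sub>2 p y')"
proof -
  note d1 = V1_D[OF W1_D(1)[OF 1]] W1_D[OF 1] and d2 = V1_D[OF W1_D(1)[OF 2]] W1_D[OF 2]
  have e: "d\<^sub>1 p (u + u') = d\<^sub>1 p u + d\<^sub>1 p u'" "d\<^sub>2 p (y + y') = d\<^sub>2 p y + d\<^sub>2 p y'"
    using ab1 ab2 d1 d2 by (auto simp: H1_add)
  show "(u + u', y + y') \<in> W\<^sub>1 p"
    by (rule W1_I) (use ab1 ab2 d1 d2 in \<open>auto simp: e H1_add V1_add\<close>)
  show "d\<^sub>1 p (d\<^sub>1 p (u + u')) = d\<^sub>1 p (d\<^sub>1 p u) + d\<^sub>1 p (d\<^sub>1 p u')"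
    "d\<^sub>2 p (d\<^sub>2 p (y + y')) = d\<^sub>2 p (d\<^sub>2 p y) + d\<^sub>2 p (d\<^sub>2 p y')"
    unfolding e using ab1 ab2 d1 d2 by (auto simp: H1_add)
qed

lemma W1_scaleC:
  assumes 1: "(u, y) \<in> W\<^sub>1 p"
  shows "(c *\<^sub>C u, c *\<^sub>C y) \<in> W\<^sub>1 p"
    "d\<^sub>1 p (d\<^sub>1 p (c *\<^sub>C u)) = c *\<^sub>C d\<^sub>1 p (d\<^sub>1 p u)"
    "d\<^sub>2 p (d\<^sub>2 p (c *\<^sub>C y)) = c *\<^sub>C d\<^sub>2 p (d\<^sub>2 p y)"
proof -
  note d1 = V1_D[OF W1_D(1)[OF 1]] W1_D[OF 1]
  have e: "d\<^sub>1 p (c *\<^sub>C u) = c *\<^sub>C d\<^sub>1 p u" "d\<^sub>2 p (c *\<^sub>C y) = c *\<^sub>C d\<^sub>2 p y"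
    using ab1 ab2 d1 by (auto simp: H1_scaleC)
  show "(c *\<^sub>C u, c *\<^sub>C y) \<in> W\<^sub>1 p"
    by (rule W1_I) (use ab1 ab2 d1 in \<open>auto simp: e H1_scaleC V1_scaleC\<close>)
  show "d\<^sub>1 p (d\<^sub>1 p (c *\<^sub>C u)) = c *\<^sub>C d\<^sub>1 p (d\<^sub>1 p u)"
    "d\<^sub>2 p (d\<^sub>2 p (c *\<^sub>C y)) = c *\<^sub>C d\<^sub>2 p (d\<^sub>2 p y)"
    unfolding e using ab1 ab2 d1 by (auto simp: H1_scaleC)
qed

lemma W1_zero: "(0, 0) \<in> W\<^sub>1 p"
  using ab1 ab2 by (intro W1_I) (auto simp: V\<^sub>1_def H1_zero)

section \<open>The energy space as a closed subspace of seven copies of \<open>L2\<close>\<close>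

lemma energy_space_D:
  assumes "((u, y), (v, z, \<theta>)) \<in> energy_space p"
  shows "(u, y) \<in> W\<^sub>1 p" "(v, z) \<in> V\<^sub>1 p" "\<theta> \<in> L2_on 0 (L\<^sub>0 p)"
  using assms by (auto simp: energy_space_def V\<^sub>2_def)

lemma energy_space_I:
  "(u, y) \<in> W\<^sub>1 p \<Longrightarrow> (v, z) \<in> V\<^sub>1 p \<Longrightarrow> \<theta> \<in> L2_on 0 (L\<^sub>0 p) \<Longrightarrow> ((u, y), (v, z, \<theta>)) \<in> energy_space p"
  by (auto simp: energy_space_def V\<^sub>2_def)

text \<open>Square roots of the coefficients turn the weighted energy into the plain norm of the
  product. The displacements and their first derivatives are left out: the boundary conditions
  determine them from the second derivatives.\<close>

fun emb :: "state \<Rightarrow> L2 \<times> L2 \<times> L2 \<times> L2 \<times> L2 \<times> L2 \<times> L2" where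
  "emb ((u, y), (v, z, \<theta>)) =
    (sqrt (\<beta>\<^sub>1 p) *\<^sub>R d\<^sub>1 p (d\<^sub>1 p u), sqrt (\<beta>\<^sub>2 p) *\<^sub>R d\<^sub>2 p (d\<^sub>2 p y),
     sqrt (\<rho>\<^sub>1 p) *\<^sub>R v, sqrt (\<alpha>\<^sub>1 p) *\<^sub>R d\<^sub>1 p v, sqrt (\<rho>\<^sub>2 p) *\<^sub>R z, sqrt (\<alpha>\<^sub>2 p) *\<^sub>R d\<^sub>2 p z,
     sqrt (\<rho>\<^sub>0 p) *\<^sub>R \<theta>)"

lemma state_cases:
  obtains u y v z \<theta> where "(\<Phi>::state) = ((u, y), (v, z, \<theta>))"
  by (cases \<Phi>) auto

lemma d_L2_on:
  "u \<in> H1 0 (L\<^sub>0 p) \<Longrightarrow> d\<^sub>1 p u \<in> L2_on 0 (L\<^sub>0 p)" "y \<in> H1 (L\<^sub>0 p) (L p) \<Longrightarrow> d\<^sub>2 p y \<in> L2_on (L\<^sub>0 p) (L p)"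
  using H1_repr(1)[OF ab1] H1_repr(1)[OF ab2] by auto

lemma form_a_cip:
  assumes "(u, y) \<in> W\<^sub>1 p"
  shows "form_a p (u, y) (u', y') = \<beta>\<^sub>1 p * cip (d\<^sub>1 p (d\<^sub>1 p u)) (d\<^sub>1 p (d\<^sub>1 p u')) + \<beta>\<^sub>2 p * cip (d\<^sub>2 p (d\<^sub>2 p y)) (d\<^sub>2 p (d\<^sub>2 p y'))"
  using W1_D[OF assms] by (simp add: L2_inner_eq_cip d_L2_on)

lemma form_c_cip:
  assumes "(u, y) \<in> V\<^sub>1 p" "\<theta> \<in> L2_on 0 (L\<^sub>0 p)"
  shows "form_c p (u, y, \<theta>) (u', y', \<theta>') =
     \<rho>\<^sub>1 p * cip u u' + \<alpha>\<^sub>1 p * cip (d\<^sub>1 p u) (d\<^sub>1 p u')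
     + \<rho>\<^sub>2 p * cip y y' + \<alpha>\<^sub>2 p * cip (d\<^sub>2 p y) (d\<^sub>2 p y') + \<rho>\<^sub>0 p * cip \<theta> \<theta>'"
  using V1_D[OF assms(1)] assms(2) by (simp add: L2_inner_eq_cip d_L2_on H1_L2_on)

lemma form_b_cip:
  assumes "(u, y) \<in> V\<^sub>1 p" "\<theta> \<in> H1 0 (L\<^sub>0 p)"
  shows "form_b p (u, y, \<theta>) (u', y', \<theta>') =
     \<gamma> p * (cip (d\<^sub>1 p u) (d\<^sub>1 p \<theta>') - cip (d\<^sub>1 p \<theta>) (d\<^sub>1 p u')) + \<kappa> p * cip (d\<^sub>1 p \<theta>) (d\<^sub>1 p \<theta>')"
  using V1_D[OF assms(1)] assms(2) by (simp add: L2_inner_eq_cip d_L2_on)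

lemma inner_emb:
  assumes "\<Phi> \<in> energy_space p"
  shows "inner (emb \<Phi>) (emb \<Psi>) = Re (energy_inner p \<Phi> \<Psi>)"
proof -
  obtain u y v z \<theta> where \<Phi>: "\<Phi> = ((u, y), (v, z, \<theta>))" by (rule state_cases)
  obtain u' y' v' z' \<theta>' where \<Psi>: "\<Psi> = ((u', y'), (v', z', \<theta>'))" by (rule state_cases)
  note d = energy_space_D[OF assms[unfolded \<Phi>]]
  have s: "sqrt c * (sqrt c * r) = c * r" if "c > 0" for c r :: real
    using that by (simp flip: mult.assoc)
  show ?thesis
    unfolding \<Phi> \<Psi> energy_inner_def fst_conv snd_conv form_a_cip[OF d(1)] form_c_cip[OF d(2,3)]
    using \<rho>_pos \<alpha>_pos \<beta>_pos by (simp add: s) (simp add: inner_L2_def)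
qed

lemma energy_norm_emb: "\<Phi> \<in> energy_space p \<Longrightarrow> energy_norm p \<Phi> = norm (emb \<Phi>)"
  by (simp add: energy_norm_def norm_eq_sqrt_inner inner_emb)

lemma emb_add:
  assumes "\<Phi> \<in> energy_space p" "\<Psi> \<in> energy_space p"
  shows "\<Phi> + \<Psi> \<in> energy_space p" "emb (\<Phi> + \<Psi>) = emb \<Phi> + emb \<Psi>"
proof -
  obtain u y v z \<theta> where \<Phi>: "\<Phi> = ((u, y), (v, z, \<theta>))" by (rule state_cases)
  obtain u' y' v' z' \<theta>' where \<Psi>: "\<Psi> = ((u', y'), (v', z', \<theta>'))" by (rule state_cases)
  note d = energy_space_D[OF assms(1)[unfolded \<Phi>]] and d' = energy_space_D[OF assms(2)[unfolded \<Psi>]]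
  note v = V1_D[OF d(2)] V1_D[OF d'(2)]
  show "\<Phi> + \<Psi> \<in> energy_space p"
    using d d' unfolding \<Phi> \<Psi> by (auto intro!: energy_space_I W1_add V1_add L2_on_add)
  show "emb (\<Phi> + \<Psi>) = emb \<Phi> + emb \<Psi>"
    unfolding \<Phi> \<Psi> using ab1 ab2 v by (simp add: W1_add[OF d(1) d'(1)] H1_add scaleR_add_right)
qed

lemma energy_space_scaleC:
  assumes "\<Phi> \<in> energy_space p"
  shows "c *\<^sub>C \<Phi> \<in> energy_space p"
proof -
  obtain u y v z \<theta> where \<Phi>: "\<Phi> = ((u, y), (v, z, \<theta>))" by (rule state_cases)
  note d = energy_space_D[OF assms(1)[unfolded \<Phi>]]
  show ?thesis
    using d unfolding \<Phi> by (auto simp: scaleC_prod_def intro!: energy_space_I W1_scaleC V1_scaleC L2_on_scaleC)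
qed

lemma emb_scaleR:
  assumes "\<Phi> \<in> energy_space p"
  shows "emb (complex_of_real r *\<^sub>C \<Phi>) = r *\<^sub>R emb \<Phi>"
proof -
  obtain u y v z \<theta> where \<Phi>: "\<Phi> = ((u, y), (v, z, \<theta>))" by (rule state_cases)
  note d = energy_space_D[OF assms(1)[unfolded \<Phi>]]
  note v = V1_D[OF d(2)]
  show ?thesis
    unfolding \<Phi> using ab1 ab2 v
    by (simp add: scaleC_prod_def W1_scaleC[OF d(1)] H1_scaleC)
      (simp add: scaleR_L2_def scaleC_scaleC mult.commute)
qed

lemma emb_diff:
  assumes "\<Phi> \<in> energy_space p" "\<Psi> \<in> energy_space p"
  shows "\<Phi> - \<Psi> \<in> energy_space p" "emb (\<Phi> - \<Psi>) = emb \<Phi> - emb \<Psi>"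
proof -
  have *: "\<Phi> - \<Psi> = \<Phi> + (-1) *\<^sub>C \<Psi>" by (simp add: scaleC_minus1)
  show "\<Phi> - \<Psi> \<in> energy_space p" "emb (\<Phi> - \<Psi>) = emb \<Phi> - emb \<Psi>"
    unfolding * using emb_add[OF assms(1) energy_space_scaleC[OF assms(2), of "-1"]] emb_scaleR[OF assms(2), of "-1"]
    by simp_all
qed

text \<open>Each function is integrated from its clamped end: from 0 on the first interval, and from
  \<open>L p\<close> on the second, where \<open>bprim\<close> takes the place of
  \<open>prim\<close>.\<close>

lemma W1_prim:
  assumes "(u, y) \<in> W\<^sub>1 p"
  shows "d\<^sub>1 p u = prim 0 (L\<^sub>0 p) (d\<^sub>1 p (d\<^sub>1 p u))" "d\<^sub>2 p y = bprim (L\<^sub>0 p) (L p) (d\<^sub>2 p (d\<^sub>2 p y))"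
  using W1_D[OF assms] H1_eq_prim[OF ab1] H1_eq_bprim[OF ab2] by blast+

lemma V1_prim:
  assumes "(u, y) \<in> V\<^sub>1 p"
  shows "u = prim 0 (L\<^sub>0 p) (d\<^sub>1 p u)" "y = bprim (L\<^sub>0 p) (L p) (d\<^sub>2 p y)"
  using V1_D[OF assms] H1_eq_prim[OF ab1] H1_eq_bprim[OF ab2] by blast+

lemma emb_eq_0:
  assumes "\<Phi> \<in> energy_space p" "emb \<Phi> = 0"
  shows "\<Phi> = 0"
proof -
  obtain u y v z \<theta> where \<Phi>: "\<Phi> = ((u, y), (v, z, \<theta>))" by (rule state_cases)
  note d = energy_space_D[OF assms(1)[unfolded \<Phi>]]
  have z: "prim 0 (L\<^sub>0 p) 0 = 0" "bprim (L\<^sub>0 p) (L p) 0 = 0"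
    using ab1 ab2 linear_0[OF bounded_linear.linear[OF bounded_linear_prim]]
      linear_0[OF bounded_linear.linear[OF bounded_linear_bprim]] by auto
  have e: "d\<^sub>1 p (d\<^sub>1 p u) = 0" "d\<^sub>2 p (d\<^sub>2 p y) = 0" "v = 0" "z = 0" "\<theta> = 0"
    using assms(2) \<rho>_pos \<beta>_pos unfolding \<Phi> by (auto simp: zero_prod_def)
  then have "d\<^sub>1 p u = 0" "d\<^sub>2 p y = 0" using W1_prim[OF d(1)] z by auto
  then have "u = 0" "y = 0" using V1_prim[OF W1_D(1)[OF d(1)]] z by auto
  then show ?thesis using e by (simp add: \<Phi> zero_prod_def)
qed

lemma inj_emb: "inj_on emb (energy_space p)"
proof (rule inj_onI)
  fix \<Phi> \<Psi> assume *: "\<Phi> \<in> energy_space p" "\<Psi> \<in> energy_space p" "emb \<Phi> = emb \<Psi>"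
  then have "\<Phi> - \<Psi> = 0" by (intro emb_eq_0) (auto simp: emb_diff)
  then show "\<Phi> = \<Psi>" by simp
qed

lemma zero_energy_space: "0 \<in> energy_space p"
  unfolding zero_prod_def using W1_zero W1_D(1)[OF W1_zero] L2_on_zero by (intro energy_space_I) auto

lemma subspace_emb: "subspace (emb ` energy_space p)"
proof (rule subspaceI)
  have "emb (complex_of_real 0 *\<^sub>C 0) = 0"
    unfolding emb_scaleR[OF zero_energy_space, of 0] by simp
  then show "0 \<in> emb ` energy_space p"
    using imageI[OF zero_energy_space, of emb] by simp
next
  fix x y assume "x \<in> emb ` energy_space p" "y \<in> emb ` energy_space p"
  then obtain \<Phi> \<Psi> where "\<Phi> \<in> energy_space p" "x = emb \<Phi>" "\<Psi> \<in> energy_space p" "y = emb \<Psi>" by blast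
  then show "x + y \<in> emb ` energy_space p"
    using imageI[OF emb_add(1)[of \<Phi> \<Psi>], of emb] by (simp add: emb_add(2))
next
  fix c x assume "x \<in> emb ` energy_space p"
  then obtain \<Phi> where "\<Phi> \<in> energy_space p" "x = emb \<Phi>" by blast
  then show "c *\<^sub>R x \<in> emb ` energy_space p"
    using imageI[OF energy_space_scaleC[of \<Phi> "complex_of_real c"], of emb] by (simp add: emb_scaleR)
qed

text \<open>This is the completeness of the energy space. Convergence of second derivatives is
  integrated from the clamped ends; \<open>H1_closed\<close> also gives convergence of traces, so
  the boundary and transmission conditions survive in the limit.\<close>

lemma closed_emb: "closed (emb ` energy_space p)"
  unfolding closed_sequential_limits
proof (intro allI impI, elim conjE)
  fix w l assume w: "\<forall>n. w n \<in> emb ` energy_space p" and lim: "w \<longlonglongrightarrow> l"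
  then have "\<forall>n. \<exists>\<Phi>. \<Phi> \<in> energy_space p \<and> w n = emb \<Phi>" by blast
  then obtain \<Phi> where \<Phi>: "\<And>n. \<Phi> n \<in> energy_space p" "\<And>n. w n = emb (\<Phi> n)"
    unfolding choice_iff by blast
  define u y v z \<theta> where "u n = fst (fst (\<Phi> n))" and "y n = snd (fst (\<Phi> n))" and "v n = fst (snd (\<Phi> n))"
    and "z n = fst (snd (snd (\<Phi> n)))" and "\<theta> n = snd (snd (snd (\<Phi> n)))" for n
  have eq: "\<Phi> n = ((u n, y n), (v n, z n, \<theta> n))" for n
    by (simp add: u_def y_def v_def z_def \<theta>_def)
  note d = energy_space_D[OF \<Phi>(1)[unfolded eq]]
  note W = W1_D[OF d(1)] and VV = V1_D[OF W1_D(1)[OF d(1)]] and V = V1_D[OF d(2)]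
  obtain l1 l2 l3 l4 l5 l6 l7 where l: "l = (l1, l2, l3, l4, l5, l6, l7)" by (cases l) auto
  have L: "(\<lambda>n. (sqrt (\<beta>\<^sub>1 p) *\<^sub>R d\<^sub>1 p (d\<^sub>1 p (u n)), sqrt (\<beta>\<^sub>2 p) *\<^sub>R d\<^sub>2 p (d\<^sub>2 p (y n)),
     sqrt (\<rho>\<^sub>1 p) *\<^sub>R v n, sqrt (\<alpha>\<^sub>1 p) *\<^sub>R d\<^sub>1 p (v n), sqrt (\<rho>\<^sub>2 p) *\<^sub>R z n, sqrt (\<alpha>\<^sub>2 p) *\<^sub>R d\<^sub>2 p (z n),
     sqrt (\<rho>\<^sub>0 p) *\<^sub>R \<theta> n)) \<longlonglongrightarrow> (l1, l2, l3, l4, l5, l6, l7)"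
    using lim unfolding l \<Phi>(2) eq by simp
  have sc: "X \<longlonglongrightarrow> (1 / sqrt c) *\<^sub>R m" if "(\<lambda>n. sqrt c *\<^sub>R X n) \<longlonglongrightarrow> m" "c > 0" for X :: "nat \<Rightarrow> L2" and c m
    using tendsto_scaleR[OF tendsto_const that(1), of "1 / sqrt c"] that(2) by simp
  define U2 Y2 V0 V1 Z0 Z1 \<Theta> where "U2 = (1 / sqrt (\<beta>\<^sub>1 p)) *\<^sub>R l1" "Y2 = (1 / sqrt (\<beta>\<^sub>2 p)) *\<^sub>R l2"
    "V0 = (1 / sqrt (\<rho>\<^sub>1 p)) *\<^sub>R l3" "V1 = (1 / sqrt (\<alpha>\<^sub>1 p)) *\<^sub>R l4" "Z0 = (1 / sqrt (\<rho>\<^sub>2 p)) *\<^sub>R l5"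
    "Z1 = (1 / sqrt (\<alpha>\<^sub>2 p)) *\<^sub>R l6" "\<Theta> = (1 / sqrt (\<rho>\<^sub>0 p)) *\<^sub>R l7"
  note defs = this
  have u2: "(\<lambda>n. d\<^sub>1 p (d\<^sub>1 p (u n))) \<longlonglongrightarrow> U2" and y2: "(\<lambda>n. d\<^sub>2 p (d\<^sub>2 p (y n))) \<longlonglongrightarrow> Y2"
    and v0: "v \<longlonglongrightarrow> V0" and v1: "(\<lambda>n. d\<^sub>1 p (v n)) \<longlonglongrightarrow> V1"
    and z0: "z \<longlonglongrightarrow> Z0" and z1: "(\<lambda>n. d\<^sub>2 p (z n)) \<longlonglongrightarrow> Z1" and th: "\<theta> \<longlonglongrightarrow> \<Theta>"
  proof -
    note s1 = tendsto_snd[OF L, unfolded snd_conv]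
    note s2 = tendsto_snd[OF s1, unfolded snd_conv]
    note s3 = tendsto_snd[OF s2, unfolded snd_conv]
    note s4 = tendsto_snd[OF s3, unfolded snd_conv]
    note s5 = tendsto_snd[OF s4, unfolded snd_conv]
    show "(\<lambda>n. d\<^sub>1 p (d\<^sub>1 p (u n))) \<longlonglongrightarrow> U2"
      unfolding defs by (rule sc[OF tendsto_fst[OF L, unfolded fst_conv] \<beta>_pos(1)])
    show "(\<lambda>n. d\<^sub>2 p (d\<^sub>2 p (y n))) \<longlonglongrightarrow> Y2"
      unfolding defs by (rule sc[OF tendsto_fst[OF s1, unfolded fst_conv] \<beta>_pos(2)])
    show "v \<longlonglongrightarrow> V0"
      unfolding defs by (rule sc[OF tendsto_fst[OF s2, unfolded fst_conv] \<rho>_pos(2)])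
    show "(\<lambda>n. d\<^sub>1 p (v n)) \<longlonglongrightarrow> V1"
      unfolding defs by (rule sc[OF tendsto_fst[OF s3, unfolded fst_conv] \<alpha>_pos(1)])
    show "z \<longlonglongrightarrow> Z0"
      unfolding defs by (rule sc[OF tendsto_fst[OF s4, unfolded fst_conv] \<rho>_pos(3)])
    show "(\<lambda>n. d\<^sub>2 p (z n)) \<longlonglongrightarrow> Z1"
      unfolding defs by (rule sc[OF tendsto_fst[OF s5, unfolded fst_conv] \<alpha>_pos(2)])
    show "\<theta> \<longlonglongrightarrow> \<Theta>"
      unfolding defs by (rule sc[OF tendsto_snd[OF s5, unfolded snd_conv] \<rho>_pos(1)])
  qed
  \<comment> \<open>The lower order limits are not coordinates of \<open>emb\<close>; they are
    produced by the bounded primitive operators.\<close>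
  define U1 Y1 where "U1 = prim 0 (L\<^sub>0 p) U2" and "Y1 = bprim (L\<^sub>0 p) (L p) Y2"
  have u1: "(\<lambda>n. d\<^sub>1 p (u n)) \<longlonglongrightarrow> U1"
    using bounded_linear.tendsto[OF bounded_linear_prim u2, of 0 "L\<^sub>0 p"] ab1 W1_prim(1)[OF d(1)] by (simp add: U1_def)
  have y1: "(\<lambda>n. d\<^sub>2 p (y n)) \<longlonglongrightarrow> Y1"
    using bounded_linear.tendsto[OF bounded_linear_bprim y2, of "L\<^sub>0 p" "L p"] ab2 W1_prim(2)[OF d(1)] by (simp add: Y1_def)
  define U Y where "U = prim 0 (L\<^sub>0 p) U1" and "Y = bprim (L\<^sub>0 p) (L p) Y1"
  have u0: "u \<longlonglongrightarrow> U"
    using bounded_linear.tendsto[OF bounded_linear_prim u1, of 0 "L\<^sub>0 p"] ab1 V1_prim(1)[OF W1_D(1)[OF d(1)]] by (simp add: U_def)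
  have y0: "y \<longlonglongrightarrow> Y"
    using bounded_linear.tendsto[OF bounded_linear_bprim y1, of "L\<^sub>0 p" "L p"] ab2 V1_prim(2)[OF W1_D(1)[OF d(1)]] by (simp add: Y_def)
  note cU = H1_closed[OF ab1 VV(1) u0 u1] and cY = H1_closed[OF ab2 VV(2) y0 y1]
    and cU1 = H1_closed[OF ab1 W(2) u1 u2] and cY1 = H1_closed[OF ab2 W(3) y1 y2]
    and cV = H1_closed[OF ab1 V(1) v0 v1] and cZ = H1_closed[OF ab2 V(2) z0 z1]
  have pt: "0 \<in> {0..L\<^sub>0 p}" "L\<^sub>0 p \<in> {0..L\<^sub>0 p}" "L\<^sub>0 p \<in> {L\<^sub>0 p..L p}" "L p \<in> {L\<^sub>0 p..L p}"
    using ab1 ab2 by auto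
  have z: "c = 0" if "X \<longlonglongrightarrow> c" "\<And>n. X n = 0" for X :: "nat \<Rightarrow> complex" and c
  proof -
    have "X = (\<lambda>n. 0)" using that(2) by auto
    then show ?thesis using LIMSEQ_unique[OF that(1), of 0] by simp
  qed
  have same: "c = c'" if "X \<longlonglongrightarrow> c" "X' \<longlonglongrightarrow> c'" "\<And>n. X n = X' n" for X X' :: "nat \<Rightarrow> complex" and c c'
  proof -
    have "X = X'" using that(3) by auto
    then show ?thesis using LIMSEQ_unique[OF that(1), of c'] that(2) by simp
  qed
  have V': "(V0, Z0) \<in> V\<^sub>1 p"
    unfolding V\<^sub>1_def
    using cV(1) cZ(1) z[OF cV(3)[OF pt(1)] V(3)] z[OF cZ(3)[OF pt(4)] V(4)]
      same[OF cV(3)[OF pt(2)] cZ(3)[OF pt(3)] V(5)] by simp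
  have U': "(U, Y) \<in> V\<^sub>1 p"
    unfolding V\<^sub>1_def
    using cU(1) cY(1) z[OF cU(3)[OF pt(1)] VV(3)] z[OF cY(3)[OF pt(4)] VV(4)]
      same[OF cU(3)[OF pt(2)] cY(3)[OF pt(3)] VV(5)] by simp
  have W': "(U, Y) \<in> W\<^sub>1 p"
    using U' cU(2) cY(2) cU1(1) cY1(1) z[OF cU1(3)[OF pt(1)] W(4)] z[OF cY1(3)[OF pt(4)] W(5)]
      same[OF cU1(3)[OF pt(2)] cY1(3)[OF pt(3)] W(6)] by (intro W1_I) simp_all
  have "((U, Y), (V0, Z0, \<Theta>)) \<in> energy_space p"
    by (intro energy_space_I W' V' L2_on_closed[OF d(3) th])
  moreover have "emb ((U, Y), (V0, Z0, \<Theta>)) = l"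
    unfolding l emb.simps cU(2) cY(2) cU1(2) cY1(2) cV(2) cZ(2)
    using \<rho>_pos \<alpha>_pos \<beta>_pos by (simp add: defs)
  ultimately show "l \<in> emb ` energy_space p" by (rule image_eqI[OF sym, rotated])
qed

lemma form_a_zero_right: "(u, y) \<in> W\<^sub>1 p \<Longrightarrow> form_a p (u, y) (0, 0) = 0"
  using form_a_cip[of u y 0 0] ab1 ab2 by (simp add: H1_zero cip.zero_right del: form_a.simps)

declare form_a.simps [simp del] form_b.simps [simp del] form_c.simps [simp del]

text \<open>This is surjectivity of \<open>op_C\<close> onto the dual, by which the inverse inside
  \<open>op_A\<close> picks a genuine preimage. The functional is read as one on the energy space
  that ignores the first component.\<close>

lemma riesz_V2:
  assumes F: "F \<in> V\<^sub>2_dual p"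
  obtains G where "G \<in> V\<^sub>2 p" "op_C p G = F"
proof -
  let ?E = "energy_space p"
  have ext: "F \<in> extensional (V\<^sub>2 p)" and anti: "antilinear_on (V\<^sub>2 p) F"
    using F by (auto simp: V\<^sub>2_dual_def antidual_def)
  obtain M where M: "\<And>U. U \<in> V\<^sub>2 p \<Longrightarrow> cmod (F U) \<le> M * sqrt (Re (form_c p U U))"
    using F by (auto simp: V\<^sub>2_dual_def antidual_def)
  \<comment> \<open>Only the real part is represented at first, since \<open>emb\<close> maps into a
    real Hilbert space.\<close>
  define f where "f w = Re (F (snd (inv_into ?E emb w)))" for w
  have inv: "inv_into ?E emb (emb \<Phi>) = \<Phi>" if "\<Phi> \<in> ?E" for \<Phi>
    using inv_into_f_f[OF inj_emb that] .
  have fe: "f (emb \<Phi>) = Re (F (snd \<Phi>))" if "\<Phi> \<in> ?E" for \<Phi>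
    by (simp add: f_def inv that)
  have sV: "snd \<Phi> \<in> V\<^sub>2 p" if "\<Phi> \<in> ?E" for \<Phi>
    using that by (auto simp: energy_space_def)
  have Fadd: "F (U + U') = F U + F U'" if "U \<in> V\<^sub>2 p" "U' \<in> V\<^sub>2 p" for U U'
    using anti that by (simp add: antilinear_on_def)
  have Fsc: "F (c *\<^sub>C U) = cnj c * F U" if "U \<in> V\<^sub>2 p" for U c
    using anti that by (simp add: antilinear_on_def)
  have sn: "snd (c *\<^sub>C \<Phi>) = c *\<^sub>C snd \<Phi>" for c and \<Phi> :: state
    by (simp add: scaleC_prod_def)
  have "\<exists>z\<in>emb ` ?E. \<forall>x\<in>emb ` ?E. f x = inner z x"
  proof (rule riesz_closed_subspace[OF subspace_emb closed_emb, of f "\<bar>M\<bar>"])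
    fix x y assume "x \<in> emb ` ?E" "y \<in> emb ` ?E"
    then obtain \<Phi> \<Psi> where *: "\<Phi> \<in> ?E" "\<Psi> \<in> ?E" "x = emb \<Phi>" "y = emb \<Psi>" by blast
    then show "f (x + y) = f x + f y"
      using fe[OF emb_add(1)[OF *(1,2)]] by (simp add: emb_add(2) fe Fadd sV)
  next
    fix r x assume "x \<in> emb ` ?E"
    then obtain \<Phi> where *: "\<Phi> \<in> ?E" "x = emb \<Phi>" by blast
    then show "f (r *\<^sub>R x) = r * f x"
      using fe[OF energy_space_scaleC[OF *(1), of "complex_of_real r"]] Fsc[OF sV[OF *(1)], of "complex_of_real r"]
      by (simp add: emb_scaleR fe sn *)
  next
    fix x assume "x \<in> emb ` ?E"
    then obtain \<Phi> where *: "\<Phi> \<in> ?E" "x = emb \<Phi>" by blast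
    \<comment> \<open>Both forms are nonnegative on the diagonal, so the norm of
      \<open>V\<^sub>2 p\<close> is dominated by the energy norm. The modulus of \<open>M\<close>
      guards against a negative bound.\<close>
    have 0: "(0, snd \<Phi>) \<in> ?E"
      using *(1) W1_zero by (auto simp: energy_space_def zero_prod_def)
    have "Re (form_c p (snd \<Phi>) (snd \<Phi>)) = inner (emb (0, snd \<Phi>)) (emb (0, snd \<Phi>))"
      using inner_emb[OF 0, of "(0, snd \<Phi>)"] form_a_zero_right[OF W1_zero]
      by (simp add: energy_inner_def zero_prod_def)
    then have c: "0 \<le> Re (form_c p (snd \<Phi>) (snd \<Phi>))" by (simp only: inner_ge_zero)
    have a: "0 \<le> Re (form_a p (fst \<Phi>) (fst \<Phi>))"
    proof -
      obtain u y where uy: "fst \<Phi> = (u, y)" by (cases "fst \<Phi>")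
      then have "(u, y) \<in> W\<^sub>1 p" using *(1) by (auto simp: energy_space_def)
      from form_a_cip[OF this, of u y] show ?thesis
        using uy \<beta>_pos cip_self(2) by simp
    qed
    have "\<bar>f x\<bar> \<le> cmod (F (snd \<Phi>))"
      using *(1) by (simp add: *(2) fe abs_Re_le_cmod)
    also have "\<dots> \<le> M * sqrt (Re (form_c p (snd \<Phi>) (snd \<Phi>)))" by (rule M[OF sV[OF *(1)]])
    also have "\<dots> \<le> \<bar>M\<bar> * sqrt (Re (energy_inner p \<Phi> \<Phi>))"
      using a c by (intro mult_mono) (auto simp: energy_inner_def)
    also have "sqrt (Re (energy_inner p \<Phi> \<Phi>)) = norm x"
      using energy_norm_emb[OF *(1)] by (simp add: energy_norm_def *(2))
    finally show "\<bar>f x\<bar> \<le> \<bar>M\<bar> * norm x" .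
  qed blast
  then obtain \<Psi> where \<Psi>: "\<Psi> \<in> ?E" "\<And>\<Phi>. \<Phi> \<in> ?E \<Longrightarrow> f (emb \<Phi>) = inner (emb \<Psi>) (emb \<Phi>)" by blast
  define G where "G = snd \<Psi>"
  have G: "G \<in> V\<^sub>2 p" using sV[OF \<Psi>(1)] by (simp add: G_def)
  have re: "Re (F U) = Re (form_c p G U)" if U: "U \<in> V\<^sub>2 p" for U
  proof -
    have 0: "(0, U) \<in> ?E" using U W1_zero by (auto simp: energy_space_def zero_prod_def)
    obtain u y where uy: "fst \<Psi> = (u, y)" by (cases "fst \<Psi>")
    then have w: "(u, y) \<in> W\<^sub>1 p" using \<Psi>(1) by (auto simp: energy_space_def)
    have "form_a p (fst \<Psi>) (0, 0) = 0"
      using form_a_zero_right[OF w] uy by simp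
    then show ?thesis
      using \<Psi>(2)[OF 0] inner_emb[OF \<Psi>(1), of "(0, U)"] fe[OF 0] by (simp add: energy_inner_def G_def zero_prod_def)
  qed
  have "F U = form_c p G U" if U: "U \<in> V\<^sub>2 p" for U
  proof (rule complex_eqI)
    show "Re (F U) = Re (form_c p G U)" by (rule re[OF U])
    obtain v z \<theta> where u: "U = (v, z, \<theta>)" by (cases U)
    obtain v' z' \<theta>' where g: "G = (v', z', \<theta>')" by (cases G)
    have uV: "(v, z) \<in> V\<^sub>1 p" "\<theta> \<in> L2_on 0 (L\<^sub>0 p)" and gV: "(v', z') \<in> V\<^sub>1 p" "\<theta>' \<in> L2_on 0 (L\<^sub>0 p)"
      using U G by (auto simp: u g V\<^sub>2_def)
    have iU: "\<i> *\<^sub>C U \<in> V\<^sub>2 p"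
      using uV by (auto simp: u V\<^sub>2_def scaleC_prod_def V1_scaleC L2_on_scaleC)
    \<comment> \<open>For an antilinear functional the real part at i U is the imaginary part at U,
      so equality of real parts on all of \<open>V\<^sub>2 p\<close> gives full equality.\<close>
    have "form_c p G (\<i> *\<^sub>C U) = - \<i> * form_c p G U"
      using V1_D[OF uV(1)] ab1 ab2 unfolding u g scaleC_prod_def fst_conv snd_conv form_c_cip[OF gV]
      by (simp add: H1_scaleC cip_scaleC_right algebra_simps)
    then show "Im (F U) = Im (form_c p G U)"
      using re[OF iU] Fsc[OF U, of "\<i>"] by simp
  qed
  then have "op_C p G = F"
    using ext unfolding op_C_def by (intro extensionalityI[of _ "V\<^sub>2 p"]) auto
  then show thesis using G by (intro that)
qed

end

section \<open>The generator in weak form\<close>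

context plate
begin

text \<open>\<open>((u, y), (v, z, \<theta>)) \<in> D(\<A>)\<close> with image \<open>((v, z), (v', z', \<theta>'))\<close>, in weak form.\<close>

definition evol :: "L2 \<Rightarrow> L2 \<Rightarrow> L2 \<Rightarrow> L2 \<Rightarrow> L2 \<Rightarrow> L2 \<Rightarrow> L2 \<Rightarrow> L2 \<Rightarrow> bool" where
  "evol u y v z \<theta> v' z' \<theta>' \<longleftrightarrow>
    (u, y) \<in> W\<^sub>1 p \<and> (v, z) \<in> W\<^sub>1 p \<and> \<theta> \<in> H10 0 (L\<^sub>0 p) \<and> (v', z') \<in> V\<^sub>1 p \<and> \<theta>' \<in> L2_on 0 (L\<^sub>0 p) \<and>
    (\<forall>f g h. (f, g) \<in> W\<^sub>1 p \<longrightarrow> h \<in> H10 0 (L\<^sub>0 p) \<longrightarrow>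
      \<rho>\<^sub>1 p * cip v' f + \<alpha>\<^sub>1 p * cip (d\<^sub>1 p v') (d\<^sub>1 p f)
      + \<rho>\<^sub>2 p * cip z' g + \<alpha>\<^sub>2 p * cip (d\<^sub>2 p z') (d\<^sub>2 p g) + \<rho>\<^sub>0 p * cip \<theta>' h
      + \<gamma> p * (cip (d\<^sub>1 p v) (d\<^sub>1 p h) - cip (d\<^sub>1 p \<theta>) (d\<^sub>1 p f)) + \<kappa> p * cip (d\<^sub>1 p \<theta>) (d\<^sub>1 p h)
      + \<beta>\<^sub>1 p * cip (d\<^sub>1 p (d\<^sub>1 p u)) (d\<^sub>1 p (d\<^sub>1 p f)) + \<beta>\<^sub>2 p * cip (d\<^sub>2 p (d\<^sub>2 p y)) (d\<^sub>2 p (d\<^sub>2 p g)) = 0)"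

lemma H10_H1: "h \<in> H10 a b \<Longrightarrow> h \<in> H1 a b"
  by (simp add: H10_def)

text \<open>Both preimages in \<open>op_A\<close> are chosen by \<open>inv_into\<close>. Membership
  in the ranges comes from \<open>dom_A\<close> and from \<open>riesz_V2\<close>, and
  \<open>f_inv_into_f\<close> then turns the choices into an identity tested against
  \<open>W\<^sub>2 p\<close>.\<close>

lemma op_A_evol:
  assumes dom: "((u, y), (v, z, \<theta>)) \<in> dom_A p"
  obtains v' z' \<theta>' where "op_A p ((u, y), (v, z, \<theta>)) = ((v, z), (v', z', \<theta>'))" "evol u y v z \<theta> v' z' \<theta>'"
proof -
  have uy: "(u, y) \<in> W\<^sub>1 p" and vz: "(v, z) \<in> W\<^sub>1 p" and th: "\<theta> \<in> H10 0 (L\<^sub>0 p)"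
    using dom by (auto simp: dom_A_def W\<^sub>2_def)
  let ?BA = "BA\<^sub>1 p ((u, y), (v, z, \<theta>))"
  define F where "F = inv_into (V\<^sub>2_dual p) (dual_inclusion p) ?BA"
  have BA: "?BA \<in> dual_inclusion p ` V\<^sub>2_dual p" using dom by (auto simp: dom_A_def)
  have F: "F \<in> V\<^sub>2_dual p" "dual_inclusion p F = ?BA"
    unfolding F_def using inv_into_into[OF BA] f_inv_into_f[OF BA] by auto
  define G where "G = inv_into (V\<^sub>2 p) (op_C p) F"
  have FC: "F \<in> op_C p ` V\<^sub>2 p"
    using riesz_V2[OF F(1)] by blast
  have G: "G \<in> V\<^sub>2 p" "op_C p G = F"
    unfolding G_def using inv_into_into[OF FC] f_inv_into_f[OF FC] by auto
  obtain g1 g2 g3 where g: "G = (g1, g2, g3)" by (cases G)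
  have gV: "(g1, g2) \<in> V\<^sub>1 p" "g3 \<in> L2_on 0 (L\<^sub>0 p)" using G(1) by (auto simp: g V\<^sub>2_def)
  have op: "op_A p ((u, y), (v, z, \<theta>)) = ((v, z), (- g1, - g2, - g3))"
    using g by (simp add: G_def F_def)
  have mV: "(- g1, - g2) \<in> V\<^sub>1 p" "- g3 \<in> L2_on 0 (L\<^sub>0 p)"
    using V1_scaleC[OF gV(1), of "-1"] L2_on_scaleC[OF gV(2), of "-1"] by (auto simp: scaleC_minus1)
  have md: "d\<^sub>1 p (- g1) = - d\<^sub>1 p g1" "d\<^sub>2 p (- g2) = - d\<^sub>2 p g2"
    using H1_scaleC(2)[OF ab1 V1_D(1)[OF gV(1)], where c = "-1"] H1_scaleC(2)[OF ab2 V1_D(2)[OF gV(1)], where c = "-1"]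
    by (simp_all add: scaleC_minus1)
  have "evol u y v z \<theta> (- g1) (- g2) (- g3)"
    unfolding evol_def
  proof (intro conjI allI impI)
    fix f g' h assume fg: "(f, g') \<in> W\<^sub>1 p" and h: "h \<in> H10 0 (L\<^sub>0 p)"
    have w2: "(f, g', h) \<in> W\<^sub>2 p" using fg h by (auto simp: W\<^sub>2_def)
    have v2: "(f, g', h) \<in> V\<^sub>2 p"
      using W1_D(1)[OF fg] h H1_L2_on[OF H10_H1[OF h]] by (auto simp: V\<^sub>2_def)
    have "form_c p G (f, g', h) = F (f, g', h)"
      using G(2) v2 by (auto simp: op_C_def)
    also have "\<dots> = dual_inclusion p F (f, g', h)" using w2 by (simp add: dual_inclusion_def)
    also have "\<dots> = form_b p (v, z, \<theta>) (f, g', h) + form_a p (u, y) (f, g')"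
      unfolding F(2) using w2 by (simp add: BA\<^sub>1_def op_B_def op_A\<^sub>1_def)
    finally have "form_c p G (f, g', h) = form_b p (v, z, \<theta>) (f, g', h) + form_a p (u, y) (f, g')" .
    then show "\<rho>\<^sub>1 p * cip (- g1) f + \<alpha>\<^sub>1 p * cip (d\<^sub>1 p (- g1)) (d\<^sub>1 p f)
      + \<rho>\<^sub>2 p * cip (- g2) g' + \<alpha>\<^sub>2 p * cip (d\<^sub>2 p (- g2)) (d\<^sub>2 p g') + \<rho>\<^sub>0 p * cip (- g3) h
      + \<gamma> p * (cip (d\<^sub>1 p v) (d\<^sub>1 p h) - cip (d\<^sub>1 p \<theta>) (d\<^sub>1 p f)) + \<kappa> p * cip (d\<^sub>1 p \<theta>) (d\<^sub>1 p h)
      + \<beta>\<^sub>1 p * cip (d\<^sub>1 p (d\<^sub>1 p u)) (d\<^sub>1 p (d\<^sub>1 p f)) + \<beta>\<^sub>2 p * cip (d\<^sub>2 p (d\<^sub>2 p y)) (d\<^sub>2 p (d\<^sub>2 p g')) = 0"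
      unfolding g form_c_cip[OF gV] form_a_cip[OF uy] form_b_cip[OF W1_D(1)[OF vz] H10_H1[OF th]] md cip.minus_left
      by (simp add: algebra_simps)
  qed (use uy vz th mV in auto)
  then show thesis using op by (intro that)
qed

lemma evol_D:
  assumes "evol u y v z \<theta> v' z' \<theta>'"
  shows "(u, y) \<in> W\<^sub>1 p" "(v, z) \<in> W\<^sub>1 p" "\<theta> \<in> H10 0 (L\<^sub>0 p)" "(v', z') \<in> V\<^sub>1 p" "\<theta>' \<in> L2_on 0 (L\<^sub>0 p)"
    "(f, g) \<in> W\<^sub>1 p \<Longrightarrow> h \<in> H10 0 (L\<^sub>0 p) \<Longrightarrow>
      \<rho>\<^sub>1 p * cip v' f + \<alpha>\<^sub>1 p * cip (d\<^sub>1 p v') (d\<^sub>1 p f)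
      + \<rho>\<^sub>2 p * cip z' g + \<alpha>\<^sub>2 p * cip (d\<^sub>2 p z') (d\<^sub>2 p g) + \<rho>\<^sub>0 p * cip \<theta>' h
      + \<gamma> p * (cip (d\<^sub>1 p v) (d\<^sub>1 p h) - cip (d\<^sub>1 p \<theta>) (d\<^sub>1 p f)) + \<kappa> p * cip (d\<^sub>1 p \<theta>) (d\<^sub>1 p h)
      + \<beta>\<^sub>1 p * cip (d\<^sub>1 p (d\<^sub>1 p u)) (d\<^sub>1 p (d\<^sub>1 p f)) + \<beta>\<^sub>2 p * cip (d\<^sub>2 p (d\<^sub>2 p y)) (d\<^sub>2 p (d\<^sub>2 p g)) = 0"
  using assms by (auto simp: evol_def)

lemma evol_mech:
  assumes "evol u y v z \<theta> v' z' \<theta>'" "(f, g) \<in> W\<^sub>1 p"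
  shows "\<rho>\<^sub>1 p * cip v' f + \<alpha>\<^sub>1 p * cip (d\<^sub>1 p v') (d\<^sub>1 p f)
      + \<rho>\<^sub>2 p * cip z' g + \<alpha>\<^sub>2 p * cip (d\<^sub>2 p z') (d\<^sub>2 p g) - \<gamma> p * cip (d\<^sub>1 p \<theta>) (d\<^sub>1 p f)
      + \<beta>\<^sub>1 p * cip (d\<^sub>1 p (d\<^sub>1 p u)) (d\<^sub>1 p (d\<^sub>1 p f)) + \<beta>\<^sub>2 p * cip (d\<^sub>2 p (d\<^sub>2 p y)) (d\<^sub>2 p (d\<^sub>2 p g)) = 0"
  using evol_D(6)[OF assms H10_zero[OF ab1]] by (simp add: H1_zero(2)[OF ab1] cip.zero_right)

text \<open>The equation is tested with the velocity and the temperature. The coupling is skew and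
  drops out of the real part, the elastic form is hermitian and completes the energy inner product,
  and only heat conduction remains.\<close>

lemma evol_dissipation:
  assumes e: "evol u y v z \<theta> v' z' \<theta>'"
  shows "inner (emb ((v, z), (v', z', \<theta>'))) (emb ((u, y), (v, z, \<theta>))) = - \<kappa> p * (norm (d\<^sub>1 p \<theta>))\<^sup>2"
proof -
  note d = evol_D[OF e]
  have E: "((v, z), (v', z', \<theta>')) \<in> energy_space p" using d by (intro energy_space_I)
  have "cip (d\<^sub>1 p v) (d\<^sub>1 p \<theta>) = cnj (cip (d\<^sub>1 p \<theta>) (d\<^sub>1 p v))" by (rule cip_cnj)
  then have r: "Re (cip (d\<^sub>1 p v) (d\<^sub>1 p \<theta>)) = Re (cip (d\<^sub>1 p \<theta>) (d\<^sub>1 p v))" by simp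
  have a: "Re (cip (d\<^sub>1 p (d\<^sub>1 p v)) (d\<^sub>1 p (d\<^sub>1 p u))) = Re (cip (d\<^sub>1 p (d\<^sub>1 p u)) (d\<^sub>1 p (d\<^sub>1 p v)))"
    "Re (cip (d\<^sub>2 p (d\<^sub>2 p z)) (d\<^sub>2 p (d\<^sub>2 p y))) = Re (cip (d\<^sub>2 p (d\<^sub>2 p y)) (d\<^sub>2 p (d\<^sub>2 p z)))"
    using cip_cnj[of "d\<^sub>1 p (d\<^sub>1 p v)" "d\<^sub>1 p (d\<^sub>1 p u)"] cip_cnj[of "d\<^sub>2 p (d\<^sub>2 p z)" "d\<^sub>2 p (d\<^sub>2 p y)"] by simp_all
  show ?thesis
    unfolding inner_emb[OF E] energy_inner_def fst_conv snd_conv form_a_cip[OF d(2)] form_c_cip[OF d(4,5)]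
    using arg_cong[OF d(6)[OF d(2,3)], of Re] r a by (simp add: norm_L2_sq)
qed

end

section \<open>The given semigroup on the image of \<open>emb\<close>\<close>

locale plate_semigroup = plate +
  fixes T :: "real \<Rightarrow> state \<Rightarrow> state"
  assumes C0: "C0_contraction_semigroup (energy_space p) (energy_norm p) T"
    and generated: "semigroup_generated_by (energy_space p) (energy_norm p) T (dom_A p) (op_A p)"
begin

text \<open>The conjugate of \<open>T\<close> under \<open>emb\<close>; off the image the inverse is
  arbitrary, which \<open>contraction_semigroup\<close> tolerates.\<close>

definition S :: "real \<Rightarrow> L2 \<times> L2 \<times> L2 \<times> L2 \<times> L2 \<times> L2 \<times> L2 \<Rightarrow> L2 \<times> L2 \<times> L2 \<times> L2 \<times> L2 \<times> L2 \<times> L2" where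
  "S t w = emb (T t (inv_into (energy_space p) emb w))"

lemma S_emb: "\<Phi> \<in> energy_space p \<Longrightarrow> S t (emb \<Phi>) = emb (T t \<Phi>)"
  by (simp add: S_def inv_into_f_f[OF inj_emb])

lemma T_in: "0 \<le> t \<Longrightarrow> \<Phi> \<in> energy_space p \<Longrightarrow> T t \<Phi> \<in> energy_space p"
  using C0 by (auto simp: C0_contraction_semigroup_def)

sublocale contraction_semigroup "emb ` energy_space p" S
proof
  show "subspace (emb ` energy_space p)" "closed (emb ` energy_space p)"
    by (rule subspace_emb closed_emb)+
next
  fix t :: real and x assume t: "0 \<le> t" and "x \<in> emb ` energy_space p"
  then obtain \<Phi> where \<Phi>: "\<Phi> \<in> energy_space p" "x = emb \<Phi>" by blast
  show "S t x \<in> emb ` energy_space p" using \<Phi> T_in[OF t] by (simp add: S_emb)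
  show "S t (r *\<^sub>R x) = r *\<^sub>R S t x" for r
    using C0 t \<Phi> T_in[OF t \<Phi>(1)] energy_space_scaleC[OF \<Phi>(1)]
    by (simp add: S_emb emb_scaleR[symmetric] C0_contraction_semigroup_def complex_linear_on_def)
  show "norm (S t x) \<le> norm x"
    using C0 t \<Phi> T_in[OF t \<Phi>(1)]
    by (simp add: S_emb energy_norm_emb[symmetric] C0_contraction_semigroup_def)
  show "S t (x + y) = S t x + S t y" if y: "y \<in> emb ` energy_space p" for y
  proof -
    obtain \<Psi> where \<Psi>: "\<Psi> \<in> energy_space p" "y = emb \<Psi>" using y by blast
    have "T t (\<Phi> + \<Psi>) = T t \<Phi> + T t \<Psi>"
      using C0 t \<Phi> \<Psi> by (simp add: C0_contraction_semigroup_def complex_linear_on_def)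
    then show ?thesis
      using S_emb[OF emb_add(1)[OF \<Phi>(1) \<Psi>(1)], of t] emb_add(2)[OF T_in[OF t \<Phi>(1)] T_in[OF t \<Psi>(1)]]
      by (simp add: \<Phi> \<Psi> S_emb emb_add(2))
  qed
  show "S (s + t) x = S s (S t x)" if "0 \<le> s" for s
    using C0 t that \<Phi> T_in[OF t \<Phi>(1)] by (simp add: S_emb C0_contraction_semigroup_def)
next
  fix x assume "x \<in> emb ` energy_space p"
  then obtain \<Phi> where \<Phi>: "\<Phi> \<in> energy_space p" "x = emb \<Phi>" by blast
  show "S 0 x = x" using C0 \<Phi> by (simp add: S_emb C0_contraction_semigroup_def)
  have "((\<lambda>t. energy_norm p (T t \<Phi> - \<Phi>)) \<longlongrightarrow> 0) (at_right 0)"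
    using C0 \<Phi> by (simp add: C0_contraction_semigroup_def)
  then have "((\<lambda>t. norm (S t x - x)) \<longlongrightarrow> 0) (at_right 0)"
  proof (rule Lim_transform_eventually)
    show "\<forall>\<^sub>F t in at_right 0. energy_norm p (T t \<Phi> - \<Phi>) = norm (S t x - x)"
      using eventually_at_right_less[of "0::real"]
    proof eventually_elim
      fix t :: real assume "0 < t"
      then have "T t \<Phi> \<in> energy_space p" using T_in \<Phi> by simp
      then show "energy_norm p (T t \<Phi> - \<Phi>) = norm (S t x - x)"
        using \<Phi> by (simp add: S_emb energy_norm_emb emb_diff)
    qed
  qed
  then show "((\<lambda>t. S t x) \<longlongrightarrow> x) (at_right 0)"
    by (rule LIM_zero_cancel[OF tendsto_norm_zero_cancel])
qed

text \<open>\<open>emb\<close> is an isometry, so convergence of difference quotients in the image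
  is convergence in the energy norm; the hypothesis on the generator then identifies the
  limit.\<close>

lemma gen_dom_A:
  assumes "(emb \<Phi>, emb \<Psi>) \<in> gen" "\<Phi> \<in> energy_space p" "\<Psi> \<in> energy_space p"
  shows "\<Phi> \<in> dom_A p" "\<Psi> = op_A p \<Phi>"
proof -
  have lim: "((\<lambda>h. (1 / h) *\<^sub>R (S h (emb \<Phi>) - emb \<Phi>)) \<longlongrightarrow> emb \<Psi>) (at_right 0)"
    using assms by (simp add: gen_def)
  have "((\<lambda>h. energy_norm p (complex_of_real (1 / h) *\<^sub>C (T h \<Phi> - \<Phi>) - \<Psi>)) \<longlongrightarrow> 0) (at_right 0)"
  proof (rule Lim_transform_eventually[OF tendsto_norm_zero[OF LIM_zero[OF lim]]])
    show "\<forall>\<^sub>F h in at_right 0. norm ((1 / h) *\<^sub>R (S h (emb \<Phi>) - emb \<Phi>) - emb \<Psi>) =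
        energy_norm p (complex_of_real (1 / h) *\<^sub>C (T h \<Phi> - \<Phi>) - \<Psi>)"
      using eventually_at_right_less[of "0::real"]
    proof eventually_elim
      fix h :: real assume "0 < h"
      then have T: "T h \<Phi> \<in> energy_space p" using T_in assms(2) by simp
      note d = emb_diff[OF T assms(2)]
      note s = energy_space_scaleC[OF d(1), of "complex_of_real (1 / h)"]
      show "norm ((1 / h) *\<^sub>R (S h (emb \<Phi>) - emb \<Phi>) - emb \<Psi>) =
        energy_norm p (complex_of_real (1 / h) *\<^sub>C (T h \<Phi> - \<Phi>) - \<Psi>)"
        unfolding energy_norm_emb[OF emb_diff(1)[OF s assms(3)]] emb_diff(2)[OF s assms(3)]
          emb_scaleR[OF d(1)] d(2) S_emb[OF assms(2)] ..
    qed
  qed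
  then have "(\<Phi>, \<Psi>) \<in> infinitesimal_generator_graph (energy_space p) (energy_norm p) T"
    using assms by (simp add: infinitesimal_generator_graph_def)
  then show "\<Phi> \<in> dom_A p" "\<Psi> = op_A p \<Phi>"
    using generated unfolding semigroup_generated_by_def by auto
qed

lemma gen_evol:
  assumes g: "(emb \<Phi>, emb \<Psi>) \<in> gen" "\<Phi> \<in> energy_space p" "\<Psi> \<in> energy_space p"
  shows "fst \<Psi> = (fst (snd \<Phi>), fst (snd (snd \<Phi>)))"
    "evol (fst (fst \<Phi>)) (snd (fst \<Phi>)) (fst (snd \<Phi>)) (fst (snd (snd \<Phi>))) (snd (snd (snd \<Phi>)))
      (fst (snd \<Psi>)) (fst (snd (snd \<Psi>))) (snd (snd (snd \<Psi>)))"
proof -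
  obtain u y v z \<theta> where \<Phi>: "\<Phi> = ((u, y), (v, z, \<theta>))" by (rule state_cases)
  note d = gen_dom_A[OF g]
  obtain v' z' \<theta>' where *: "op_A p ((u, y), (v, z, \<theta>)) = ((v, z), (v', z', \<theta>'))" "evol u y v z \<theta> v' z' \<theta>'"
    using op_A_evol[OF d(1)[unfolded \<Phi>]] by blast
  have "\<Psi> = ((v, z), (v', z', \<theta>'))" using d(2) *(1) by (simp add: \<Phi>)
  then show "fst \<Psi> = (fst (snd \<Phi>), fst (snd (snd \<Phi>)))"
    "evol (fst (fst \<Phi>)) (snd (fst \<Phi>)) (fst (snd \<Phi>)) (fst (snd (snd \<Phi>))) (snd (snd (snd \<Phi>)))
      (fst (snd \<Psi>)) (fst (snd (snd \<Psi>))) (snd (snd (snd \<Psi>)))"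
    using *(2) by (simp_all add: \<Phi>)
qed

end

section \<open>Interpolating cubics, the heat equation and regularity\<close>

lemma H1_lincomb:
  assumes ab: "a < b" and f: "f \<in> H1 a b" and g: "g \<in> H1 a b"
  shows "A *\<^sub>C f + B *\<^sub>C g \<in> H1 a b"
    "weak_derivative a b (A *\<^sub>C f + B *\<^sub>C g) = A *\<^sub>C weak_derivative a b f + B *\<^sub>C weak_derivative a b g"
    "x \<in> {a..b} \<Longrightarrow> value_at a b (A *\<^sub>C f + B *\<^sub>C g) x = A * value_at a b f x + B * value_at a b g x"
  using H1_add[OF ab H1_scaleC(1)[OF ab f, of A] H1_scaleC(1)[OF ab g, of B]]
    H1_scaleC(2)[OF ab f, of A] H1_scaleC(2)[OF ab g, of B] H1_scaleC(3)[OF ab f, of x A] H1_scaleC(3)[OF ab g, of x B]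
  by auto

text \<open>Such a function continues a test pair across the interface with matching value and slope
  while staying clamped at the far end; a cubic with a double zero at \<open>c\<close>
  suffices.\<close>

lemma hermite_interpolation:
  assumes ab: "a < b" and cd: "c = a \<and> d = b \<or> c = b \<and> d = a"
  obtains f where "f \<in> H1 a b" "weak_derivative a b f \<in> H1 a b"
    "value_at a b f c = 0" "value_at a b (weak_derivative a b f) c = 0"
    "value_at a b f d = A" "value_at a b (weak_derivative a b f) d = B"
proof -
  define k where "k = complex_of_real (d - c)"
  have k: "k \<noteq> 0" using ab cd by (auto simp: k_def)
  \<comment> \<open>At \<open>d\<close> the quadratic factor of \<open>h\<close> is 1 with slope
    2/k, so the slope of the product is 2A/k + E; this is solved for the prescribed
    \<open>B\<close>.\<close>
  define E where "E = B - 2 * A / k"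
  define h where "h x = (of_real (x - c) / k)\<^sup>2 * (A + E * of_real (x - d))" for x
  define h' where "h' x = 2 * (of_real (x - c) / k) * (1 / k) * (A + E * of_real (x - d)) + (of_real (x - c) / k)\<^sup>2 * E" for x
  define h'' where "h'' x = 2 * (1 / k) * (1 / k) * (A + E * of_real (x - d)) + 4 * (of_real (x - c) / k) * (1 / k) * E" for x
  have lin: "((\<lambda>x. complex_of_real (x - e)) has_vector_derivative 1) (at x)" for e x
  proof -
    have "((\<lambda>x. x - e) has_field_derivative 1) (at x)" by (auto intro!: derivative_eq_intros)
    from has_vector_derivative_of_real[OF this] show ?thesis by simp
  qed
  have s: "((\<lambda>x. of_real (x - c) / k) has_vector_derivative 1 / k) (at x)" for x
    using has_vector_derivative_divide[OF lin[of c x], of k] by simp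
  have q: "((\<lambda>x. (of_real (x - c) / k)\<^sup>2) has_vector_derivative 2 * (of_real (x - c) / k) * (1 / k)) (at x)" for x
    using has_vector_derivative_mult[OF s s, of x] by (simp only: power2_eq_square) (simp add: algebra_simps)
  have l: "((\<lambda>x. A + E * of_real (x - d)) has_vector_derivative E) (at x)" for x
    using has_vector_derivative_add[OF has_vector_derivative_const has_vector_derivative_mult_right[OF lin[of d x], of E]] by simp
  have d1: "(h has_vector_derivative h' x) (at x)" for x
    using has_vector_derivative_mult[OF q[of x] l[of x]] unfolding h_def[abs_def] h'_def by (simp add: add.commute)
  have d2: "(h' has_vector_derivative h'' x) (at x)" for x
  proof -
    have "((\<lambda>x. 2 * (of_real (x - c) / k) * (1 / k)) has_vector_derivative 2 * (1 / k) * (1 / k)) (at x)"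
      by (rule has_vector_derivative_mult_left[OF has_vector_derivative_mult_right[OF s]])
    from has_vector_derivative_add[OF has_vector_derivative_mult[OF this l[of x]] has_vector_derivative_mult_left[OF q[of x], of E]]
    show ?thesis
      unfolding h'_def[abs_def] h''_def
      by (rule has_vector_derivative_eq_rhs) (simp add: algebra_simps)
  qed
  have ch': "continuous_on {a..b} h'"
    by (meson d2 continuous_at_imp_continuous_on has_vector_derivative_continuous)
  have ch'': "continuous_on {a..b} h''"
    unfolding h''_def[abs_def] using k by (intro continuous_intros) auto
  note 1 = cfun_C1[OF ab d1 ch'] and 2 = cfun_C1[OF ab d2 ch'']
  have pt: "c \<in> {a..b}" "d \<in> {a..b}" using ab cd by auto
  show thesis
  proof (rule that[of "cfun a b h"])
    show "value_at a b (cfun a b h) c = 0" "value_at a b (weak_derivative a b (cfun a b h)) c = 0"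
      using 1(3)[OF pt(1)] 2(3)[OF pt(1)] by (auto simp: 1(2) h_def h'_def)
    show "value_at a b (cfun a b h) d = A"
      using 1(3)[OF pt(2)] k by (simp add: h_def k_def[symmetric] del: of_real_diff)
    show "value_at a b (weak_derivative a b (cfun a b h)) d = B"
      using 2(3)[OF pt(2)] k by (simp add: 1(2) h'_def k_def[symmetric] E_def field_simps del: of_real_diff)
  qed (use 1 2 in auto)
qed

context plate
begin

text \<open>Testing with zero displacement and a compactly supported temperature shows that the flux
  has weak derivative \<open>\<rho>\<^sub>0 p\<close> times \<theta>'. The constant \<open>C\<close>
  stays unknown, since such test functions say nothing about the flux at the ends.\<close>

lemma evol_heat:
  assumes e: "evol u y v z \<theta> v' z' \<theta>'"
  obtains C where "of_real (\<gamma> p) *\<^sub>C d\<^sub>1 p v + of_real (\<kappa> p) *\<^sub>C d\<^sub>1 p \<theta> =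
    C *\<^sub>C box_fun 0 (L\<^sub>0 p) + prim 0 (L\<^sub>0 p) (of_real (\<rho>\<^sub>0 p) *\<^sub>C \<theta>')"
proof -
  note d = evol_D[OF e]
  let ?f = "of_real (\<gamma> p) *\<^sub>C d\<^sub>1 p v + of_real (\<kappa> p) *\<^sub>C d\<^sub>1 p \<theta>"
  have "has_weak_derivative 0 (L\<^sub>0 p) ?f (of_real (\<rho>\<^sub>0 p) *\<^sub>C \<theta>')"
    unfolding has_weak_derivative_iff[OF ab1]
  proof (intro allI impI)
    fix \<phi> \<phi>' assume t: "test_function 0 (L\<^sub>0 p) \<phi>" "test_function 0 (L\<^sub>0 p) \<phi>'"
      and dd: "\<forall>x. (\<phi> has_vector_derivative \<phi>' x) (at x)"
    have l2: "abs_L2 \<phi>' \<in> L2_on 0 (L\<^sub>0 p)"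
      by (rule H1_L2_on[OF H1_test_function(1)[OF ab1 t(2)]])
    have "d\<^sub>1 p (abs_L2 \<phi>) = abs_L2 \<phi>'"
      using const_plus_prim(2)[OF ab1 l2, of 0] test_function_prim(1)[OF t dd[rule_format] ab1] by simp
    then show "cip ?f (abs_L2 \<phi>') = - cip (of_real (\<rho>\<^sub>0 p) *\<^sub>C \<theta>') (abs_L2 \<phi>)"
      using d(6)[OF W1_zero H1_test_function(4)[OF ab1 t(1)]] ab1 ab2
      by (simp add: H1_zero cip.zero_right cip_add_left cip_scaleC_left eq_neg_iff_add_eq_0 algebra_simps)
  qed
  moreover have "?f \<in> L2_on 0 (L\<^sub>0 p)"
    by (intro L2_on_add L2_on_scaleC H1_repr(1)[OF ab1] V1_D(1)[OF W1_D(1)[OF d(2)]] H10_H1[OF d(3)])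
  ultimately show thesis
    using has_weak_derivative_imp_prim[OF ab1] that by blast
qed

text \<open>By the heat equation, \<open>v\<^sub>x\<close> is within \<open>\<epsilon>\<close> of a constant; the constant is small because \<open>v\<^sub>x(0) = 0\<close>
  and \<open>v\<^sub>x\<^sub>x\<close> is bounded, by the Rellich identity with weight \<open>x - L\<^sub>0\<close>.\<close>

lemma heat_estimate:
  assumes e: "evol u y v z \<theta> v' z' \<theta>'"
  defines "\<epsilon> \<equiv> (L\<^sub>0 p * (\<rho>\<^sub>0 p * norm \<theta>') + \<kappa> p * norm (d\<^sub>1 p \<theta>)) / \<bar>\<gamma> p\<bar>"
  shows "norm (d\<^sub>1 p v) \<le> \<epsilon> + sqrt (\<epsilon>\<^sup>2 + 4 * L\<^sub>0 p * \<epsilon> * norm (d\<^sub>1 p (d\<^sub>1 p v)))"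
proof -
  let ?I = "box_fun 0 (L\<^sub>0 p)" and ?w = "d\<^sub>1 p v" and ?g = "of_real (\<rho>\<^sub>0 p) *\<^sub>C \<theta>'"
  note d = evol_D[OF e] and w = W1_D[OF evol_D(2)[OF e]]
  obtain C where C: "of_real (\<gamma> p) *\<^sub>C ?w + of_real (\<kappa> p) *\<^sub>C d\<^sub>1 p \<theta> = C *\<^sub>C ?I + prim 0 (L\<^sub>0 p) ?g"
    using evol_heat[OF e] by blast
  define c where "c = C / of_real (\<gamma> p)"
  \<comment> \<open>\<open>r\<close> is the part of v_x that the heat equation controls; up to sign,
    the unknown constant is its value at 0.\<close>
  define r where "r = ?w - c *\<^sub>C ?I"
  have I0: "?I = 1 *\<^sub>C ?I + prim 0 (L\<^sub>0 p) 0"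
    using ab1 linear_0[OF bounded_linear.linear[OF bounded_linear_prim]] by (simp add: scaleC_one)
  note I = const_plus_prim[OF ab1 L2_on_zero, where C = 1, folded I0]
  have cI: "c *\<^sub>C ?I \<in> H1 0 (L\<^sub>0 p)" "d\<^sub>1 p (c *\<^sub>C ?I) = 0" "val\<^sub>1 p (c *\<^sub>C ?I) 0 = c"
    using H1_scaleC(1,2)[OF ab1 I(1), of c] I(2) H1_scaleC(3)[OF ab1 I(1), of 0 c] I(3)[of 0] ab1
    by (auto simp: cip.zero_left)
  have r: "r \<in> H1 0 (L\<^sub>0 p)" "d\<^sub>1 p r = d\<^sub>1 p ?w" "val\<^sub>1 p r 0 = - c"
    using H1_diff[OF ab1 w(2) cI(1)] H1_diff(3)[OF ab1 w(2) cI(1), of 0] cI w(4) ab1 by (auto simp: r_def)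
  have "of_real (\<gamma> p) *\<^sub>C r = prim 0 (L\<^sub>0 p) ?g - of_real (\<kappa> p) *\<^sub>C d\<^sub>1 p \<theta>"
  proof -
    have "of_real (\<gamma> p) *\<^sub>C r = of_real (\<gamma> p) *\<^sub>C ?w - C *\<^sub>C ?I"
      using \<gamma>_ne by (simp add: r_def scaleC_diff_right scaleC_scaleC c_def)
    moreover have "of_real (\<gamma> p) *\<^sub>C ?w = C *\<^sub>C ?I + prim 0 (L\<^sub>0 p) ?g - of_real (\<kappa> p) *\<^sub>C d\<^sub>1 p \<theta>"
      using C by (simp only: eq_diff_eq)
    ultimately show ?thesis by simp
  qed
  then have "\<bar>\<gamma> p\<bar> * norm r = norm (prim 0 (L\<^sub>0 p) ?g - of_real (\<kappa> p) *\<^sub>C d\<^sub>1 p \<theta>)"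
    using norm_scaleC_L2[of "of_real (\<gamma> p)" r] by simp
  also have "\<dots> \<le> L\<^sub>0 p * (\<rho>\<^sub>0 p * norm \<theta>') + \<kappa> p * norm (d\<^sub>1 p \<theta>)"
    using norm_prim_le[of 0 "L\<^sub>0 p" ?g] ab1 \<rho>_pos \<kappa>_pos
    by (intro order_trans[OF norm_triangle_ineq4] add_mono) (auto simp: norm_scaleC_L2)
  finally have nr: "norm r \<le> \<epsilon>"
    using \<gamma>_ne by (simp add: \<epsilon>_def field_simps)
  then have \<epsilon>: "0 \<le> \<epsilon>" using norm_ge_zero order_trans by blast
  have "(norm (c *\<^sub>C ?I))\<^sup>2 = L\<^sub>0 p * (cmod c)\<^sup>2"
    using ab1 by (simp add: norm_scaleC_L2 norm_box_fun power_mult_distrib)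
  \<comment> \<open>The weight vanishes at the interface, and the left end contributes the length
    times |c|^2, which is the squared norm of the constant function.\<close>
  also have "\<dots> = (norm r)\<^sup>2 + 2 * Re (cip r (mulx 0 (L\<^sub>0 p) (L\<^sub>0 p) (d\<^sub>1 p ?w)))"
    using rellich_identity[OF ab1 r(1), of "L\<^sub>0 p"] r by simp
  also have "\<dots> \<le> \<epsilon>\<^sup>2 + 2 * (\<epsilon> * (2 * L\<^sub>0 p * norm (d\<^sub>1 p ?w)))"
  proof (intro add_mono power_mono nr mult_left_mono)
    have "Re (cip r (mulx 0 (L\<^sub>0 p) (L\<^sub>0 p) (d\<^sub>1 p ?w))) \<le> norm r * norm (mulx 0 (L\<^sub>0 p) (L\<^sub>0 p) (d\<^sub>1 p ?w))"
      by (rule order_trans[OF complex_Re_le_cmod cip_cauchy_schwarz])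
    \<comment> \<open>The factor 2 comes from \<open>norm_mulx_le\<close>, which bounds the weight
      by the sum of the moduli of 0, \<open>L\<^sub>0 p\<close> and
      \<open>L\<^sub>0 p\<close>.\<close>
    also have "\<dots> \<le> \<epsilon> * (2 * L\<^sub>0 p * norm (d\<^sub>1 p ?w))"
      using norm_mulx_le[of 0 "L\<^sub>0 p" "L\<^sub>0 p" "d\<^sub>1 p ?w"] ab1 \<epsilon> nr by (intro mult_mono) auto
    finally show "Re (cip r (mulx 0 (L\<^sub>0 p) (L\<^sub>0 p) (d\<^sub>1 p ?w))) \<le> \<epsilon> * (2 * L\<^sub>0 p * norm (d\<^sub>1 p ?w))" .
  qed auto
  also have "\<dots> = \<epsilon>\<^sup>2 + 4 * L\<^sub>0 p * \<epsilon> * norm (d\<^sub>1 p ?w)" by simp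
  finally have "norm (c *\<^sub>C ?I) \<le> sqrt (\<epsilon>\<^sup>2 + 4 * L\<^sub>0 p * \<epsilon> * norm (d\<^sub>1 p ?w))"
    by (rule real_le_rsqrt)
  moreover have "norm ?w \<le> norm r + norm (c *\<^sub>C ?I)"
    using norm_triangle_ineq[of r "c *\<^sub>C ?I"] by (simp add: r_def)
  ultimately show ?thesis using nr by linarith
qed

text \<open>Continuation by zero: with such test functions the first interval drops out of the
  equation.\<close>

lemma W1_clamped:
  assumes "g \<in> H1 (L\<^sub>0 p) (L p)" "d\<^sub>2 p g \<in> H1 (L\<^sub>0 p) (L p)"
    "val\<^sub>2 p g (L p) = 0" "val\<^sub>2 p (d\<^sub>2 p g) (L p) = 0" "val\<^sub>2 p g (L\<^sub>0 p) = 0" "val\<^sub>2 p (d\<^sub>2 p g) (L\<^sub>0 p) = 0"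
  shows "(0, g) \<in> W\<^sub>1 p"
  using assms ab1 by (intro W1_I) (auto simp: V\<^sub>1_def H1_zero)

text \<open>The test functions used are those whose second derivative is \<open>h\<close> minus its orthogonal projection
  onto the affine functions; the orthogonality is exactly the clamped boundary condition.\<close>

lemma evol_regularity:
  assumes e: "evol u y v z \<theta> v' z' \<theta>'"
  shows "d\<^sub>2 p (d\<^sub>2 p y) \<in> H1 (L\<^sub>0 p) (L p)"
proof -
  let ?a = "L\<^sub>0 p" and ?b = "L p"
  let ?P = "prim ?a ?b" and ?e0 = "box_fun ?a ?b"
  note d = evol_D[OF e]
  have z': "z' \<in> H1 ?a ?b" using V1_D(2)[OF d(4)] .
  have y2: "d\<^sub>2 p (d\<^sub>2 p y) \<in> L2_on ?a ?b" using W1_D(3)[OF d(1)] d_L2_on by blast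
  have P: "?P g \<in> H1 ?a ?b" "d\<^sub>2 p (?P g) = g" "val\<^sub>2 p (?P g) ?a = 0" "val\<^sub>2 p (?P g) ?b = cip g ?e0"
    if "g \<in> L2_on ?a ?b" for g
    using const_plus_prim[OF ab2 that, where C = 0] const_plus_prim(3)[OF ab2 that, where C = 0 and x = ?a]
      const_plus_prim(3)[OF ab2 that, where C = 0 and x = ?b] ab2
    by (auto simp: box_fun_empty cip.zero_right)
  have e0: "?e0 \<in> L2_on ?a ?b" using ab2 by (intro box_fun_L2_on) auto
  \<comment> \<open>This is the equation \<rho> z' - \<alpha> z'_xx + \<beta> y_xxxx = 0 on the
    second interval, integrated twice; for the classes \<open>q\<close> tested below every term
    becomes a pairing with \<open>q\<close>.\<close>
  define h where "h = of_real (\<rho>\<^sub>2 p) *\<^sub>C ?P (?P z') - of_real (\<alpha>\<^sub>2 p) *\<^sub>C z' + of_real (\<beta>\<^sub>2 p) *\<^sub>C d\<^sub>2 p (d\<^sub>2 p y)"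
  have hL: "h \<in> L2_on ?a ?b"
    unfolding h_def using H1_L2_on[OF z'] y2 prim_L2_on by (intro L2_on_add L2_on_diff L2_on_scaleC)
  \<comment> \<open>Orthogonality of \<open>q\<close> to 1 and to x - a makes its first and second
    primitives vanish at the right end as well, so the double primitive is an admissible test
    function.\<close>
  have test: "cip h q = 0" if q: "q \<in> L2_on ?a ?b" "cip q ?e0 = 0" "cip q (?P ?e0) = 0" for q
  proof -
    note P1 = P[OF q(1)] and P2 = P[OF prim_L2_on[of ?a ?b q]]
    have "cip (?P q) ?e0 = 0"
      using cip_prim_parts[of q ?a ?b ?e0] q by simp
    then have z0: "val\<^sub>2 p (?P (?P q)) ?b = 0" "val\<^sub>2 p (?P q) ?b = 0" using P1 P2 q(2) by auto
    have W: "(0, ?P (?P q)) \<in> W\<^sub>1 p"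
      by (rule W1_clamped) (use P1 P2 z0 in auto)
    have "\<rho>\<^sub>2 p * cip z' (?P (?P q)) + \<alpha>\<^sub>2 p * cip (d\<^sub>2 p z') (?P q) + \<beta>\<^sub>2 p * cip (d\<^sub>2 p (d\<^sub>2 p y)) q = 0"
      using evol_mech[OF e W] P1 P2 ab1 by (simp add: H1_zero cip.zero_right)
    moreover have "cip (d\<^sub>2 p z') (?P q) = - cip z' q"
      using H1_parts[OF ab2 z' P1(1)] P1(2,3) z0(2) by (simp add: eq_neg_iff_add_eq_0)
    moreover have "cip z' (?P (?P q)) = cip (?P (?P z')) q"
    proof -
      note G1 = P[OF H1_L2_on[OF z']] and G2 = P[OF prim_L2_on[of ?a ?b z']]
      have "cip z' (?P (?P q)) = - cip (?P z') (?P q)"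
        using H1_parts[OF ab2 G1(1) P2(1)] G1(2,3) P2(2,3) z0(1) by (simp add: eq_neg_iff_add_eq_0)
      also have "\<dots> = cip (?P (?P z')) q"
        using H1_parts[OF ab2 G2(1) P1(1)] G2(2,3) P1(2,3) z0(2) by (simp add: neg_eq_iff_add_eq_0)
      finally show ?thesis .
    qed
    ultimately show ?thesis
      by (simp add: h_def cip_add_left cip.diff_left cip_scaleC_left)
  qed
  \<comment> \<open>Division by zero gives \<open>proj f 0 = 0\<close>, so orthogonality holds for
    every \<open>g\<close>.\<close>
  define proj where "proj f g = (cip f g / cip g g) *\<^sub>C g" for f g :: L2
  have proj: "cip (f - proj f g) g = 0" for f g
  proof (cases "g = 0")
    case False
    then have "cip g g \<noteq> 0" by (simp add: cip_self_norm)
    then show ?thesis by (simp add: proj_def cip.diff_left cip_scaleC_left)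
  qed (simp add: cip.zero_right)
  have orth: "cip (proj f g) k = 0" if "cip g k = 0" for f g k
    using that by (simp add: proj_def cip_scaleC_left)
  \<comment> \<open>Gram-Schmidt applied to 1 and x - a; \<open>q\<close> is then \<open>h\<close>
    with its affine part removed.\<close>
  define e1 where "e1 = ?P ?e0 - proj (?P ?e0) ?e0"
  define q where "q = h - proj h ?e0 - proj h e1"
  have e1: "cip e1 ?e0 = 0" "cip ?e0 e1 = 0"
    using proj[of "?P ?e0" ?e0] cip_cnj[of ?e0 e1] by (simp_all add: e1_def)
  have e0H: "?e0 \<in> H1 ?a ?b"
    using const_plus_prim(1)[OF ab2 L2_on_zero, where C = 1] ab2
      linear_0[OF bounded_linear.linear[OF bounded_linear_prim]] by (simp add: scaleC_one)
  have e1H: "e1 \<in> H1 ?a ?b"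
    unfolding e1_def proj_def by (intro H1_diff[OF ab2] H1_scaleC[OF ab2] P(1)[OF e0] e0H)
  have projH: "proj h ?e0 \<in> H1 ?a ?b" "proj h e1 \<in> H1 ?a ?b"
    unfolding proj_def by (intro H1_scaleC[OF ab2] e0H e1H)+
  have qe0: "cip q ?e0 = 0"
    using proj[of h ?e0] orth[OF e1(1), of h] by (simp add: q_def cip.diff_left)
  have qe1: "cip q e1 = 0"
    using proj[of h e1] orth[OF e1(2), of h] by (simp add: q_def cip.diff_left)
  have "?P ?e0 = e1 + proj (?P ?e0) ?e0" by (simp add: e1_def)
  then have "cip q (?P ?e0) = cip q (e1 + proj (?P ?e0) ?e0)" by (rule arg_cong)
  then have qP: "cip q (?P ?e0) = 0"
    unfolding cip_add_right using qe0 qe1 by (simp add: proj_def cip_scaleC_right)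
  have qL: "q \<in> L2_on ?a ?b"
    unfolding q_def by (intro L2_on_diff hL H1_L2_on projH)
  have "cip q q = cip h q - cip (proj h ?e0) q - cip (proj h e1) q"
    by (subst q_def) (simp only: cip.diff_left)
  also have "\<dots> = 0"
    using test[OF qL qe0 qP] qe0 qe1 cip_cnj[of ?e0 q] cip_cnj[of e1 q] by (simp add: proj_def cip_scaleC_left)
  \<comment> \<open>With no component orthogonal to the affine functions, \<open>h\<close> is affine
    and so lies in \<open>H1\<close>; solving for y_xx leaves only terms of class
    \<open>H1\<close>.\<close>
  finally have "q = 0" by (simp add: cip_self_norm)
  then have "h = proj h ?e0 + proj h e1" by (simp add: q_def algebra_simps)
  then have hH: "h \<in> H1 ?a ?b" using H1_add(1)[OF ab2 projH] by simp
  have "of_real (\<beta>\<^sub>2 p) *\<^sub>C d\<^sub>2 p (d\<^sub>2 p y) = h - of_real (\<rho>\<^sub>2 p) *\<^sub>C ?P (?P z') + of_real (\<alpha>\<^sub>2 p) *\<^sub>C z'"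
    by (simp add: h_def)
  also have "\<dots> \<in> H1 ?a ?b"
    by (intro H1_add[OF ab2] H1_diff[OF ab2] H1_scaleC[OF ab2] hH z' P(1)[OF prim_L2_on])
  finally have "(1 / of_real (\<beta>\<^sub>2 p)) *\<^sub>C (of_real (\<beta>\<^sub>2 p) *\<^sub>C d\<^sub>2 p (d\<^sub>2 p y)) \<in> H1 ?a ?b"
    by (rule H1_scaleC[OF ab2])
  then show ?thesis using \<beta>_pos by (simp add: scaleC_scaleC scaleC_one)
qed

end

subsection \<open>Multiplier estimate\<close>

lemma Bfun_bounded_linear:
  assumes f: "bounded_linear f" and g: "Bfun g F"
  shows "Bfun (\<lambda>x. f (g x)) F"
proof -
  obtain K where K: "0 \<le> K" "\<And>x. norm (f x) \<le> norm x * K"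
    using bounded_linear.nonneg_bounded[OF f] by blast
  obtain B where B: "eventually (\<lambda>x. norm (g x) \<le> B) F"
    using g by (auto elim: BfunE)
  have "eventually (\<lambda>x. norm (f (g x)) \<le> B * K) F"
    using B
  proof eventually_elim
    fix x assume "norm (g x) \<le> B"
    then show "norm (f (g x)) \<le> B * K"
      using K order_trans mult_right_mono by blast
  qed
  then show ?thesis by (rule BfunI)
qed

lemma Bfun_eventually_eq:
  fixes f g :: "'a \<Rightarrow> 'b::real_normed_vector"
  assumes "eventually (\<lambda>x. f x = g x) F" "Bfun f F"
  shows "Bfun g F"
proof -
  obtain B where B: "eventually (\<lambda>x. norm (f x) \<le> B) F"
    using assms(2) by (auto elim: BfunE)
  have "eventually (\<lambda>x. norm (g x) \<le> B) F"
    using B assms(1) by eventually_elim simp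
  then show ?thesis by (rule BfunI)
qed

lemma Bfun_diff:
  fixes f g :: "'a \<Rightarrow> 'b::real_normed_vector"
  assumes "Bfun f F" "Bfun g F"
  shows "Bfun (\<lambda>x. f x - g x) F"
proof -
  obtain B C where B: "eventually (\<lambda>x. norm (f x) \<le> B) F" and C: "eventually (\<lambda>x. norm (g x) \<le> C) F"
    using assms by (auto elim!: BfunE)
  have "eventually (\<lambda>x. norm (f x - g x) \<le> B + C) F"
    using B C by eventually_elim (rule order_trans[OF norm_triangle_ineq4 add_mono])
  then show ?thesis by (rule BfunI)
qed

lemma tendsto_0_cip:
  assumes "(f \<longlongrightarrow> 0) F" "Bfun g F"
  shows "((\<lambda>x. cip (f x) (g x)) \<longlongrightarrow> 0) F" "((\<lambda>x. cip (g x) (f x)) \<longlongrightarrow> 0) F"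
proof -
  have z: "Zfun f F" using assms(1) by (simp add: tendsto_Zfun_iff)
  show "((\<lambda>x. cip (f x) (g x)) \<longlongrightarrow> 0) F" "((\<lambda>x. cip (g x) (f x)) \<longlongrightarrow> 0) F"
    using cip.Zfun_prod_Bfun[OF z assms(2)] cip.Bfun_prod_Zfun[OF assms(2) z]
    by (simp_all add: tendsto_Zfun_iff)
qed

lemma Bfun_cip:
  assumes "Bfun f F" "Bfun g F"
  shows "Bfun (\<lambda>x. cip (f x) (g x)) F"
proof -
  obtain B C where B: "eventually (\<lambda>x. norm (f x) \<le> B) F" and C: "eventually (\<lambda>x. norm (g x) \<le> C) F" "0 < B"
    using assms by (auto elim!: BfunE)
  have "eventually (\<lambda>x. norm (cip (f x) (g x)) \<le> B * C) F"
    using B C(1)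
  proof eventually_elim
    fix x assume "norm (f x) \<le> B" "norm (g x) \<le> C"
    then have "norm (f x) * norm (g x) \<le> B * C"
      using C(2) by (intro mult_mono) auto
    then show "norm (cip (f x) (g x)) \<le> B * C"
      using cip_cauchy_schwarz[of "f x" "g x"] by linarith
  qed
  then show ?thesis by (rule BfunI)
qed

text \<open>Barbalat's argument: on a short window the mean value theorem yields a point where
  \<open>f'\<close> is small, because \<open>f\<close> hardly changes, and the bound on
  \<open>f''\<close> carries this to the left end of the window.\<close>

lemma derivative_tendsto_0:
  fixes f f' f'' :: "real \<Rightarrow> real"
  assumes f: "\<And>t. 0 < t \<Longrightarrow> (f has_real_derivative f' t) (at t)"
    and f': "\<And>t. 0 < t \<Longrightarrow> (f' has_real_derivative f'' t) (at t)"
    and K: "\<And>t. 0 < t \<Longrightarrow> \<bar>f'' t\<bar> \<le> K"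
    and lim: "(f \<longlongrightarrow> l) at_top"
  shows "(f' \<longlongrightarrow> 0) at_top"
proof (rule tendstoI)
  fix e :: real assume e: "0 < e"
  have K0: "0 \<le> K" using K[of 1] by linarith
  \<comment> \<open>Adding 1 makes \<open>k\<close> positive and strictly larger than
    \<open>K\<close>, so the window length h = e/(2k) satisfies K h < e/2.\<close>
  define k where "k = K + 1"
  have k: "0 < k" "K < k" using K0 by (auto simp: k_def)
  define h where "h = e / (2 * k)"
  have h: "0 < h" using e k by (simp add: h_def)
  have "K * h < k * h" using h k by simp
  also have "\<dots> = e / 2" using k by (simp add: h_def)
  finally have Kh: "K * h < e / 2" .
  have shift: "((\<lambda>t. f (t + h)) \<longlongrightarrow> l) at_top"
    by (rule filterlim_compose[OF lim]) (intro filterlim_at_top_add_at_top filterlim_ident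
        filterlim_tendsto_add_at_top[OF tendsto_const filterlim_ident, of h, simplified add.commute])
  have "((\<lambda>t. f (t + h) - f t) \<longlongrightarrow> l - l) at_top"
    by (intro tendsto_diff shift lim)
  then have "\<forall>\<^sub>F t in at_top. \<bar>f (t + h) - f t\<bar> < h * (e / 2)"
    using tendstoD[of "\<lambda>t. f (t + h) - f t" 0 at_top "h * (e/2)"] h e by (simp add: dist_real_def)
  then show "\<forall>\<^sub>F t in at_top. dist (f' t) 0 < e"
    using eventually_gt_at_top[of 0]
  proof eventually_elim
    fix t :: real assume small: "\<bar>f (t + h) - f t\<bar> < h * (e / 2)" and t: "0 < t"
    obtain x where x: "t < x" "x < t + h" "f (t + h) - f t = (t + h - t) * f' x"
      using MVT2[of t "t + h" f f'] f h t by auto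
    obtain y where y: "t < y" "y < x" "f' x - f' t = (x - t) * f'' y"
      using MVT2[of t x f' f''] f' x t by auto
    have "h * \<bar>f' x\<bar> < h * (e / 2)" using small x(3) h by (simp add: abs_mult)
    then have 1: "\<bar>f' x\<bar> < e / 2" using h by simp
    have "\<bar>f' x - f' t\<bar> \<le> h * K"
      unfolding y(3) abs_mult using x y t K[of y] h by (intro mult_mono) auto
    then show "dist (f' t) 0 < e" using 1 Kh by (simp add: dist_real_def mult.commute)
  qed
qed

lemma antimono_tendsto_at_top:
  fixes f :: "real \<Rightarrow> real"
  assumes mono: "\<And>s t. 0 < s \<Longrightarrow> s \<le> t \<Longrightarrow> f t \<le> f s" and nonneg: "\<And>t. 0 < t \<Longrightarrow> 0 \<le> f t"
  obtains l where "0 \<le> l" "(f \<longlongrightarrow> l) at_top" "\<And>t. 0 < t \<Longrightarrow> l \<le> f t"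
proof -
  define l where "l = Inf (f ` {0<..})"
  have bdd: "bdd_below (f ` {0<..})" using nonneg by (auto intro!: bdd_belowI2)
  have l: "l \<le> f t" if "0 < t" for t
    unfolding l_def using bdd that by (intro cInf_lower) auto
  have "0 \<le> l" unfolding l_def using nonneg by (intro cInf_greatest) auto
  moreover have "(f \<longlongrightarrow> l) at_top"
  proof (rule tendstoI)
    fix e :: real assume e: "0 < e"
    have "\<exists>x\<in>f ` {0<..}. x < l + e"
      using e bdd by (subst cInf_less_iff[symmetric]) (auto simp: l_def)
    then obtain s where s: "0 < s" "f s < l + e" by auto
    show "\<forall>\<^sub>F t in at_top. dist (f t) l < e"
      using eventually_ge_at_top[of s]
    proof eventually_elim
      fix t assume "s \<le> t"
      then show "dist (f t) l < e" using s mono[of s t] l[of t] by (simp add: dist_real_def)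
    qed
  qed
  ultimately show thesis using l that by blast
qed

text \<open>If c were positive, the slope would be at most -c/2 once \<eta> is below c/2, and over a
  long enough window the drop would exceed the oscillation that the bound permits.\<close>

lemma bounded_imp_drift_nonpos:
  fixes F F' \<eta> :: "real \<Rightarrow> real"
  assumes der: "\<And>t. 0 < t \<Longrightarrow> (F has_real_derivative F' t) (at t)"
    and le: "\<And>t. 0 < t \<Longrightarrow> F' t \<le> \<eta> t - c" and \<eta>: "(\<eta> \<longlongrightarrow> 0) at_top"
    and bd: "Bfun F at_top"
  shows "c \<le> 0"
proof (rule ccontr)
  assume "\<not> c \<le> 0"
  then have c: "0 < c" by simp
  obtain B where B: "\<forall>\<^sub>F t in at_top. norm (F t) \<le> B" using bd by (auto elim: BfunE)
  have "\<forall>\<^sub>F t in at_top. dist (\<eta> t) 0 < c / 2"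
    using tendstoD[OF \<eta>, of "c/2"] c by simp
  with B have "\<forall>\<^sub>F t in at_top. norm (F t) \<le> B \<and> dist (\<eta> t) 0 < c / 2"
    by eventually_elim simp
  then obtain t0 where t0: "\<And>t. t \<ge> t0 \<Longrightarrow> norm (F t) \<le> B \<and> dist (\<eta> t) 0 < c / 2"
    unfolding eventually_at_top_linorder by blast
  define s where "s = max t0 1"
  \<comment> \<open>With slope at most -c/2 this length forces a drop of 2B + 1, more than the 2B
    that the bound allows.\<close>
  define t where "t = s + (4 * B + 2) / c"
  have B0: "0 \<le> B" using order_trans[OF norm_ge_zero conjunct1[OF t0[of s]]] by (simp add: s_def)
  have st: "s < t" "0 < s" using B0 c by (auto simp: t_def s_def)
  obtain x where x: "s < x" "x < t" "F t - F s = (t - s) * F' x"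
    using MVT2[of s t F F'] der st by auto
  have "F' x \<le> - c / 2"
  proof -
    have "\<bar>\<eta> x\<bar> < c / 2" using t0[of x] x by (simp add: s_def dist_real_def)
    then show ?thesis using le[of x] x st by linarith
  qed
  then have "(t - s) * F' x \<le> (t - s) * (- c / 2)" using st by (intro mult_left_mono) auto
  also have "\<dots> = - (2 * B + 1)" using c by (simp add: t_def field_simps)
  finally have "F t \<le> F s - (2 * B + 1)" using x(3) by linarith
  moreover have "\<bar>F t\<bar> \<le> B" "\<bar>F s\<bar> \<le> B" using t0[of t] t0[of s] st by (auto simp: s_def)
  ultimately show False by linarith
qed

section \<open>Components of the embedded state and the multiplier\<close>

context plate
begin

text \<open>These maps undo the scaling in \<open>emb\<close>. Being bounded and linear on the
  product, they pass derivatives, bounds and limits of the embedded orbit on to its seven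
  components.\<close>

definition "c1 w = (1 / sqrt (\<beta>\<^sub>1 p)) *\<^sub>R fst (w :: L2 \<times> L2 \<times> L2 \<times> L2 \<times> L2 \<times> L2 \<times> L2)"
definition "c2 w = (1 / sqrt (\<beta>\<^sub>2 p)) *\<^sub>R fst (snd (w :: L2 \<times> L2 \<times> L2 \<times> L2 \<times> L2 \<times> L2 \<times> L2))"
definition "c3 w = (1 / sqrt (\<rho>\<^sub>1 p)) *\<^sub>R fst (snd (snd (w :: L2 \<times> L2 \<times> L2 \<times> L2 \<times> L2 \<times> L2 \<times> L2)))"
definition "c4 w = (1 / sqrt (\<alpha>\<^sub>1 p)) *\<^sub>R fst (snd (snd (snd (w :: L2 \<times> L2 \<times> L2 \<times> L2 \<times> L2 \<times> L2 \<times> L2))))"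
definition "c5 w = (1 / sqrt (\<rho>\<^sub>2 p)) *\<^sub>R fst (snd (snd (snd (snd (w :: L2 \<times> L2 \<times> L2 \<times> L2 \<times> L2 \<times> L2 \<times> L2)))))"
definition "c6 w = (1 / sqrt (\<alpha>\<^sub>2 p)) *\<^sub>R fst (snd (snd (snd (snd (snd (w :: L2 \<times> L2 \<times> L2 \<times> L2 \<times> L2 \<times> L2 \<times> L2))))))"
definition "c7 w = (1 / sqrt (\<rho>\<^sub>0 p)) *\<^sub>R snd (snd (snd (snd (snd (snd (w :: L2 \<times> L2 \<times> L2 \<times> L2 \<times> L2 \<times> L2 \<times> L2))))))"

lemmas c_defs = c1_def c2_def c3_def c4_def c5_def c6_def c7_def

lemma bounded_linear_c:
  "bounded_linear c1" "bounded_linear c2" "bounded_linear c3" "bounded_linear c4" "bounded_linear c5"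
  "bounded_linear c6" "bounded_linear c7"
  unfolding c_defs[abs_def]
  by (intro bounded_linear_const_scaleR bounded_linear_fst_comp bounded_linear_snd_comp bounded_linear_ident)+

lemma c_emb:
  "c1 (emb ((u, y), (v, z, \<theta>))) = d\<^sub>1 p (d\<^sub>1 p u)" "c2 (emb ((u, y), (v, z, \<theta>))) = d\<^sub>2 p (d\<^sub>2 p y)"
  "c3 (emb ((u, y), (v, z, \<theta>))) = v" "c4 (emb ((u, y), (v, z, \<theta>))) = d\<^sub>1 p v"
  "c5 (emb ((u, y), (v, z, \<theta>))) = z" "c6 (emb ((u, y), (v, z, \<theta>))) = d\<^sub>2 p z"
  "c7 (emb ((u, y), (v, z, \<theta>))) = \<theta>"
  using \<rho>_pos \<alpha>_pos \<beta>_pos by (simp_all add: c_defs)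

lemma norm_emb_sq:
  "(norm (emb ((u, y), (v, z, \<theta>))))\<^sup>2 =
    \<beta>\<^sub>1 p * (norm (d\<^sub>1 p (d\<^sub>1 p u)))\<^sup>2 + \<beta>\<^sub>2 p * (norm (d\<^sub>2 p (d\<^sub>2 p y)))\<^sup>2
    + \<rho>\<^sub>1 p * (norm v)\<^sup>2 + \<alpha>\<^sub>1 p * (norm (d\<^sub>1 p v))\<^sup>2 + \<rho>\<^sub>2 p * (norm z)\<^sup>2 + \<alpha>\<^sub>2 p * (norm (d\<^sub>2 p z))\<^sup>2
    + \<rho>\<^sub>0 p * (norm \<theta>)\<^sup>2"
  using \<rho>_pos \<alpha>_pos \<beta>_pos by (simp add: norm_Pair power_mult_distrib)

lemma cauchy_schwarz_Re: "\<bar>Re (cip f g)\<bar> \<le> norm f * norm g"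
  using abs_Re_le_cmod[of "cip f g"] cip_cauchy_schwarz[of f g] by linarith

text \<open>The multiplier is \<open>(x - L) y\<^sub>x - y\<close>, whose derivative is \<open>(x - L) y\<^sub>x\<^sub>x\<close>; it is continued to the
  first interval by a cubic polynomial. The boundary term at \<open>L\<^sub>0\<close> has the favourable sign and absorbs the
  contribution of the unknown trace \<open>y\<^sub>x\<^sub>x(L\<^sub>0)\<close>.\<close>

lemma multiplier_estimate:
  obtains K where "0 \<le> K"
    "\<And>u y v z \<theta> v' z' \<theta>'. evol u y v z \<theta> v' z' \<theta>' \<Longrightarrow>
      Re (\<rho>\<^sub>2 p * cip z' (mulx (L\<^sub>0 p) (L p) (L p) (d\<^sub>2 p y) - y)
        + \<alpha>\<^sub>2 p * cip (d\<^sub>2 p z') (mulx (L\<^sub>0 p) (L p) (L p) (d\<^sub>2 p (d\<^sub>2 p y))))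
      + 1/2 * \<beta>\<^sub>2 p * (norm (d\<^sub>2 p (d\<^sub>2 p y)))\<^sup>2 \<le>
      K * ((\<rho>\<^sub>1 p * norm v' + \<alpha>\<^sub>1 p * norm (d\<^sub>1 p v') + \<bar>\<gamma> p\<bar> * norm (d\<^sub>1 p \<theta>) + \<beta>\<^sub>1 p * norm (d\<^sub>1 p (d\<^sub>1 p u)))
          * cmod (of_real (L\<^sub>0 p - L p) * val\<^sub>1 p (d\<^sub>1 p u) (L\<^sub>0 p) - val\<^sub>1 p u (L\<^sub>0 p))
        + (\<rho>\<^sub>1 p * norm v' + \<alpha>\<^sub>1 p * norm (d\<^sub>1 p v') + \<bar>\<gamma> p\<bar> * norm (d\<^sub>1 p \<theta>) + \<beta>\<^sub>1 p * norm (d\<^sub>1 p (d\<^sub>1 p u)))\<^sup>2)"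
proof -
  let ?m = "mulx (L\<^sub>0 p) (L p) (L p)"
  define l where "l = L p - L\<^sub>0 p"
  have l: "0 < l" using ab2 by (simp add: l_def)
  have pt: "0 \<in> {0..L\<^sub>0 p}" "L\<^sub>0 p \<in> {0..L\<^sub>0 p}" "L\<^sub>0 p \<in> {L\<^sub>0 p..L p}" "L p \<in> {L\<^sub>0 p..L p}"
    using ab1 ab2 by auto
  \<comment> \<open>The two cubics carry unit value and unit slope at the interface. They depend
    only on the parameters, so \<open>K\<close> is independent of the solution.\<close>
  obtain q0 where q0: "q0 \<in> H1 0 (L\<^sub>0 p)" "d\<^sub>1 p q0 \<in> H1 0 (L\<^sub>0 p)" "val\<^sub>1 p q0 0 = 0" "val\<^sub>1 p (d\<^sub>1 p q0) 0 = 0"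
      "val\<^sub>1 p q0 (L\<^sub>0 p) = 1" "val\<^sub>1 p (d\<^sub>1 p q0) (L\<^sub>0 p) = 0"
    using hermite_interpolation[OF ab1, of 0 "L\<^sub>0 p" 1 0] by auto
  obtain q1 where q1: "q1 \<in> H1 0 (L\<^sub>0 p)" "d\<^sub>1 p q1 \<in> H1 0 (L\<^sub>0 p)" "val\<^sub>1 p q1 0 = 0" "val\<^sub>1 p (d\<^sub>1 p q1) 0 = 0"
      "val\<^sub>1 p q1 (L\<^sub>0 p) = 0" "val\<^sub>1 p (d\<^sub>1 p q1) (L\<^sub>0 p) = 1"
    using hermite_interpolation[OF ab1, of 0 "L\<^sub>0 p" 0 1] by auto
  define k where "k = norm q0 + norm q1 + norm (d\<^sub>1 p q0) + norm (d\<^sub>1 p q1) + norm (d\<^sub>1 p (d\<^sub>1 p q0)) + norm (d\<^sub>1 p (d\<^sub>1 p q1))"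
  have k: "0 \<le> k" by (simp add: k_def)
  \<comment> \<open>The first summand serves the term with \<open>A\<close>; the second is the price
    of absorbing the trace of y_xx by Young's inequality.\<close>
  define K where "K = k + k\<^sup>2 * l / (2 * \<beta>\<^sub>2 p)"
  have K: "k \<le> K" "k\<^sup>2 * l / (2 * \<beta>\<^sub>2 p) \<le> K" "0 \<le> K" using k l \<beta>_pos by (auto simp: K_def)
  have comb: "norm (A *\<^sub>C f + B *\<^sub>C g) \<le> (cmod A + cmod B) * k" if "norm f \<le> k" "norm g \<le> k" for A B and f g :: L2
  proof -
    have "norm (A *\<^sub>C f + B *\<^sub>C g) \<le> cmod A * norm f + cmod B * norm g"
      by (rule order_trans[OF norm_triangle_ineq]) (simp add: norm_scaleC_L2)
    also have "\<dots> \<le> cmod A * k + cmod B * k"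
      using that by (intro add_mono mult_left_mono) auto
    finally show ?thesis by (simp add: distrib_right)
  qed
  show thesis
  proof (rule that[OF K(3)])
    fix u y v z \<theta> v' z' \<theta>' assume e: "evol u y v z \<theta> v' z' \<theta>'"
    note d = evol_D[OF e] and w = W1_D[OF evol_D(1)[OF e]] and vv = V1_D[OF W1_D(1)[OF evol_D(1)[OF e]]]
    note y2 = evol_regularity[OF e]
    define \<epsilon> where "\<epsilon> = \<rho>\<^sub>1 p * norm v' + \<alpha>\<^sub>1 p * norm (d\<^sub>1 p v') + \<bar>\<gamma> p\<bar> * norm (d\<^sub>1 p \<theta>) + \<beta>\<^sub>1 p * norm (d\<^sub>1 p (d\<^sub>1 p u))"
    have \<epsilon>: "0 \<le> \<epsilon>" using \<rho>_pos \<alpha>_pos \<beta>_pos by (simp add: \<epsilon>_def)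
    \<comment> \<open>\<open>A\<close> and \<open>B\<close> are the value and the slope of the
      multiplier at the interface. The transmission conditions express \<open>A\<close> through
      traces of \<open>u\<close>, which can be controlled, while \<open>B\<close> contains the
      unknown trace \<open>b\<close>.\<close>
    define A where "A = of_real (L\<^sub>0 p - L p) * val\<^sub>1 p (d\<^sub>1 p u) (L\<^sub>0 p) - val\<^sub>1 p u (L\<^sub>0 p)"
    define b where "b = val\<^sub>2 p (d\<^sub>2 p (d\<^sub>2 p y)) (L\<^sub>0 p)"
    define B where "B = of_real (L\<^sub>0 p - L p) * b"
    define f where "f = A *\<^sub>C q0 + B *\<^sub>C q1"
    define g where "g = ?m (d\<^sub>2 p y) - y"
    note m1 = H1_mulx[OF ab2 w(3), of "L p"] and m2 = H1_mulx[OF ab2 y2, of "L p"]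
    have g: "g \<in> H1 (L\<^sub>0 p) (L p)" "d\<^sub>2 p g = ?m (d\<^sub>2 p (d\<^sub>2 p y))" "val\<^sub>2 p g (L p) = 0" "val\<^sub>2 p g (L\<^sub>0 p) = A"
      using H1_diff[OF ab2 m1(1) vv(2)] H1_diff(3)[OF ab2 m1(1) vv(2) pt(3)] H1_diff(3)[OF ab2 m1(1) vv(2) pt(4)]
        H1_mulx(3)[OF ab2 w(3) pt(3), of "L p"] H1_mulx(3)[OF ab2 w(3) pt(4), of "L p"] m1(2) vv(4,5) w(5,6)
      by (auto simp: g_def A_def)
    have g2: "d\<^sub>2 p (d\<^sub>2 p g) = d\<^sub>2 p (d\<^sub>2 p y) + ?m (d\<^sub>2 p (d\<^sub>2 p (d\<^sub>2 p y)))"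
      "val\<^sub>2 p (d\<^sub>2 p g) (L p) = 0" "val\<^sub>2 p (d\<^sub>2 p g) (L\<^sub>0 p) = B"
      unfolding g(2) using m2(2) H1_mulx(3)[OF ab2 y2 pt(4), of "L p"] H1_mulx(3)[OF ab2 y2 pt(3), of "L p"]
      by (auto simp: B_def b_def)
    note f0 = H1_lincomb[OF ab1 q0(1) q1(1), where A = A and B = B, folded f_def]
    have df: "d\<^sub>1 p f = A *\<^sub>C d\<^sub>1 p q0 + B *\<^sub>C d\<^sub>1 p q1" by (rule f0(2))
    note f1 = H1_lincomb[OF ab1 q0(2) q1(2), where A = A and B = B, folded df]
    have vf: "val\<^sub>1 p f x = A * val\<^sub>1 p q0 x + B * val\<^sub>1 p q1 x" "val\<^sub>1 p (d\<^sub>1 p f) x = A * val\<^sub>1 p (d\<^sub>1 p q0) x + B * val\<^sub>1 p (d\<^sub>1 p q1) x"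
      if "x \<in> {0..L\<^sub>0 p}" for x
      using H1_lincomb(3)[OF ab1 q0(1) q1(1) that, of A B] H1_lincomb(3)[OF ab1 q0(2) q1(2) that, of A B]
      by (simp_all add: f_def[symmetric] df[symmetric])
    have fg: "(f, g) \<in> W\<^sub>1 p"
    proof (rule W1_I)
      show "(f, g) \<in> V\<^sub>1 p"
        unfolding V\<^sub>1_def using f0(1) g(1,3,4) vf[OF pt(1)] vf[OF pt(2)] q0 q1 by simp
    qed (use f1(1) g(2) m2(1) g2 vf[OF pt(1)] vf[OF pt(2)] q0 q1 in auto)
    define M where "M = (cmod A + cmod B) * k"
    have kk: "norm q0 \<le> k" "norm q1 \<le> k" "norm (d\<^sub>1 p q0) \<le> k" "norm (d\<^sub>1 p q1) \<le> k"
      "norm (d\<^sub>1 p (d\<^sub>1 p q0)) \<le> k" "norm (d\<^sub>1 p (d\<^sub>1 p q1)) \<le> k"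
      by (simp_all add: k_def)
    have M: "norm f \<le> M" "norm (d\<^sub>1 p f) \<le> M" "norm (d\<^sub>1 p (d\<^sub>1 p f)) \<le> M"
      using comb[OF kk(1,2), of A B, folded f_def M_def] comb[OF kk(3,4), of A B, folded df M_def]
        comb[OF kk(5,6), of A B, folded f1(2) M_def] by auto
    \<comment> \<open>This uses the third derivative of y supplied by
      \<open>evol_regularity\<close>. Combined with the full elastic term, the identity leaves half
      of that term plus a positive multiple of |b|^2.\<close>
    have r: "2 * Re (cip (d\<^sub>2 p (d\<^sub>2 p y)) (?m (d\<^sub>2 p (d\<^sub>2 p (d\<^sub>2 p y))))) = l * (cmod b)\<^sup>2 - (norm (d\<^sub>2 p (d\<^sub>2 p y)))\<^sup>2"
      using rellich_identity[OF ab2 y2, of "L p"] by (simp add: b_def l_def left_diff_distrib)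
    have "Re (\<rho>\<^sub>2 p * cip z' g + \<alpha>\<^sub>2 p * cip (d\<^sub>2 p z') (?m (d\<^sub>2 p (d\<^sub>2 p y))))
        + \<beta>\<^sub>2 p * (norm (d\<^sub>2 p (d\<^sub>2 p y)))\<^sup>2 + \<beta>\<^sub>2 p * Re (cip (d\<^sub>2 p (d\<^sub>2 p y)) (?m (d\<^sub>2 p (d\<^sub>2 p (d\<^sub>2 p y)))))
      = - (\<rho>\<^sub>1 p * Re (cip v' f)) - \<alpha>\<^sub>1 p * Re (cip (d\<^sub>1 p v') (d\<^sub>1 p f)) + \<gamma> p * Re (cip (d\<^sub>1 p \<theta>) (d\<^sub>1 p f))
        - \<beta>\<^sub>1 p * Re (cip (d\<^sub>1 p (d\<^sub>1 p u)) (d\<^sub>1 p (d\<^sub>1 p f)))"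
      using arg_cong[OF evol_mech[OF e fg], of Re] unfolding g2(1) unfolding g(2)
      by (simp add: cip_add_right norm_L2_sq algebra_simps)
    also have "\<dots> \<le> \<rho>\<^sub>1 p * (norm v' * M) + \<alpha>\<^sub>1 p * (norm (d\<^sub>1 p v') * M) + \<bar>\<gamma> p\<bar> * (norm (d\<^sub>1 p \<theta>) * M)
        + \<beta>\<^sub>1 p * (norm (d\<^sub>1 p (d\<^sub>1 p u)) * M)"
    proof -
      have c: "\<bar>Re (cip f' g')\<bar> \<le> norm f' * M" if "norm g' \<le> M" for f' g'
        using cauchy_schwarz_Re[of f' g'] mult_left_mono[OF that, of "norm f'"] by simp
      have neg: "- (r * x) \<le> r * y" if "\<bar>x\<bar> \<le> y" "0 < r" for r x y :: real
      proof -
        have "r * (- x) \<le> r * y" using that by (intro mult_left_mono) auto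
        then show ?thesis by simp
      qed
      have pos: "r * x \<le> \<bar>r\<bar> * y" if "\<bar>x\<bar> \<le> y" for r x y :: real
      proof -
        have "\<bar>r * x\<bar> \<le> \<bar>r\<bar> * y" unfolding abs_mult using that by (intro mult_left_mono) auto
        then show ?thesis by linarith
      qed
      show ?thesis
        unfolding diff_conv_add_uminus
        by (intro add_mono neg pos c M \<rho>_pos \<alpha>_pos \<beta>_pos)
    qed
    also have "\<dots> = \<epsilon> * M" by (simp add: \<epsilon>_def algebra_simps)
    finally have main: "Re (\<rho>\<^sub>2 p * cip z' g + \<alpha>\<^sub>2 p * cip (d\<^sub>2 p z') (?m (d\<^sub>2 p (d\<^sub>2 p y))))
        + 1/2 * \<beta>\<^sub>2 p * (norm (d\<^sub>2 p (d\<^sub>2 p y)))\<^sup>2 + 1/2 * \<beta>\<^sub>2 p * l * (cmod b)\<^sup>2 \<le> \<epsilon> * M"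
      using arg_cong[OF r, of "\<lambda>x. \<beta>\<^sub>2 p * x"] by (simp add: algebra_simps)
    have "\<epsilon> * M = \<epsilon> * k * cmod A + \<epsilon> * k * l * cmod b"
      using l by (simp add: M_def B_def norm_mult l_def algebra_simps del: of_real_diff)
    moreover have "\<epsilon> * k * l * cmod b \<le> 1/2 * \<beta>\<^sub>2 p * l * (cmod b)\<^sup>2 + k\<^sup>2 * l / (2 * \<beta>\<^sub>2 p) * \<epsilon>\<^sup>2"
    proof -
      \<comment> \<open>Completing the square: the term linear in |b| is absorbed by the quadratic
        one on the left of \<open>main\<close>.\<close>
      have "0 \<le> l / (2 * \<beta>\<^sub>2 p) * (\<beta>\<^sub>2 p * cmod b - k * \<epsilon>)\<^sup>2"
        using l \<beta>_pos by simp
      also have "\<dots> = 1/2 * \<beta>\<^sub>2 p * l * (cmod b)\<^sup>2 + k\<^sup>2 * l / (2 * \<beta>\<^sub>2 p) * \<epsilon>\<^sup>2 - \<epsilon> * k * l * cmod b"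
        using \<beta>_pos by (simp add: power2_diff power_mult_distrib field_simps power2_eq_square)
      finally show ?thesis by simp
    qed
    moreover have "\<epsilon> * k * cmod A \<le> K * (\<epsilon> * cmod A)"
      using K(1) mult_right_mono[OF K(1), of "\<epsilon> * cmod A"] \<epsilon> by (simp add: algebra_simps)
    moreover have "k\<^sup>2 * l / (2 * \<beta>\<^sub>2 p) * \<epsilon>\<^sup>2 \<le> K * \<epsilon>\<^sup>2"
      by (intro mult_right_mono K(2)) simp
    ultimately show "Re (\<rho>\<^sub>2 p * cip z' (?m (d\<^sub>2 p y) - y) + \<alpha>\<^sub>2 p * cip (d\<^sub>2 p z') (?m (d\<^sub>2 p (d\<^sub>2 p y))))
      + 1/2 * \<beta>\<^sub>2 p * (norm (d\<^sub>2 p (d\<^sub>2 p y)))\<^sup>2 \<le>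
      K * ((\<rho>\<^sub>1 p * norm v' + \<alpha>\<^sub>1 p * norm (d\<^sub>1 p v') + \<bar>\<gamma> p\<bar> * norm (d\<^sub>1 p \<theta>) + \<beta>\<^sub>1 p * norm (d\<^sub>1 p (d\<^sub>1 p u)))
          * cmod (of_real (L\<^sub>0 p - L p) * val\<^sub>1 p (d\<^sub>1 p u) (L\<^sub>0 p) - val\<^sub>1 p u (L\<^sub>0 p))
        + (\<rho>\<^sub>1 p * norm v' + \<alpha>\<^sub>1 p * norm (d\<^sub>1 p v') + \<bar>\<gamma> p\<bar> * norm (d\<^sub>1 p \<theta>) + \<beta>\<^sub>1 p * norm (d\<^sub>1 p (d\<^sub>1 p u)))\<^sup>2)"
      using main unfolding g_def[symmetric] \<epsilon>_def[symmetric] A_def[symmetric] distrib_left by linarith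
  qed
qed

end

subsection \<open>Decay along smooth trajectories\<close>

text \<open>\<open>U j\<close>, \<open>Y j\<close>, \<open>\<Theta> j\<close> are the time derivatives of order \<open>j\<close> of displacements and temperature along an
  orbit starting in \<open>D(\<A>\<^sup>6)\<close>. The bounds below lose time derivatives: the temperature of order \<open>j \<le> 3\<close>
  decays, hence so does \<open>U j\<close> for \<open>1 \<le> j \<le> 3\<close>, which is what the multiplier argument for \<open>Y 1\<close> consumes.\<close>

locale plate_trajectory = plate +
  fixes U Y \<Theta> :: "nat \<Rightarrow> real \<Rightarrow> L2"
  assumes ev: "0 < t \<Longrightarrow> j \<le> 4 \<Longrightarrow>
      evol (U j t) (Y j t) (U (Suc j) t) (Y (Suc j) t) (\<Theta> j t) (U (Suc (Suc j)) t) (Y (Suc (Suc j)) t) (\<Theta> (Suc j) t)"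
    and der: "0 < t \<Longrightarrow> j \<le> 4 \<Longrightarrow>
      ((\<lambda>t. emb ((U j t, Y j t), (U (Suc j) t, Y (Suc j) t, \<Theta> j t))) has_vector_derivative
        emb ((U (Suc j) t, Y (Suc j) t), (U (Suc (Suc j)) t, Y (Suc (Suc j)) t, \<Theta> (Suc j) t))) (at t)"
    and bnd: "\<exists>M. \<forall>j\<le>5. \<forall>t>0. norm (emb ((U j t, Y j t), (U (Suc j) t, Y (Suc j) t, \<Theta> j t))) \<le> M"
begin

definition X where "X j t = emb ((U j t, Y j t), (U (Suc j) t, Y (Suc j) t, \<Theta> j t))"

lemma X_der: "0 < t \<Longrightarrow> j \<le> 4 \<Longrightarrow> (X j has_vector_derivative X (Suc j) t) (at t)"
  using der unfolding X_def[abs_def] .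

lemma c_X:
  "c1 (X j t) = d\<^sub>1 p (d\<^sub>1 p (U j t))" "c2 (X j t) = d\<^sub>2 p (d\<^sub>2 p (Y j t))"
  "c3 (X j t) = U (Suc j) t" "c4 (X j t) = d\<^sub>1 p (U (Suc j) t)"
  "c5 (X j t) = Y (Suc j) t" "c6 (X j t) = d\<^sub>2 p (Y (Suc j) t)" "c7 (X j t) = \<Theta> j t"
  unfolding X_def by (rule c_emb)+

text \<open>For j = 5 the pair occurs as the velocity in the equation of order 4.\<close>

lemma W: "0 < t \<Longrightarrow> j \<le> 5 \<Longrightarrow> (U j t, Y j t) \<in> W\<^sub>1 p"
  using evol_D(1)[OF ev[of t j]] evol_D(2)[OF ev[of t "j - 1"]] by (cases "j = 5") auto

lemma Bfun_X: "j \<le> 5 \<Longrightarrow> Bfun (X j) at_top"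
proof -
  assume j: "j \<le> 5"
  obtain M where M: "\<And>t. 0 < t \<Longrightarrow> norm (X j t) \<le> M"
    using bnd j unfolding X_def by blast
  have "eventually (\<lambda>t. norm (X j t) \<le> M) at_top"
    using eventually_gt_at_top[of 0] by eventually_elim (rule M)
  then show ?thesis by (rule BfunI)
qed

text \<open>Second derivatives are components of the bounded state; integrating from the clamped
  ends bounds the lower orders.\<close>

lemma Bfun_comp:
  assumes "j \<le> 5"
  shows "Bfun (\<lambda>t. d\<^sub>1 p (d\<^sub>1 p (U j t))) at_top" "Bfun (\<lambda>t. d\<^sub>2 p (d\<^sub>2 p (Y j t))) at_top"
    "Bfun (\<lambda>t. d\<^sub>1 p (U j t)) at_top" "Bfun (\<lambda>t. d\<^sub>2 p (Y j t)) at_top" "Bfun (U j) at_top" "Bfun (Y j) at_top"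
    "Bfun (\<Theta> j) at_top"
proof -
  note b = Bfun_bounded_linear[OF _ Bfun_X[OF assms]]
  show 1: "Bfun (\<lambda>t. d\<^sub>1 p (d\<^sub>1 p (U j t))) at_top" and 2: "Bfun (\<lambda>t. d\<^sub>2 p (d\<^sub>2 p (Y j t))) at_top"
    using b[OF bounded_linear_c(1)] b[OF bounded_linear_c(2)] unfolding c_X .
  show "Bfun (\<Theta> j) at_top" using b[OF bounded_linear_c(7)] unfolding c_X .
  have ab: "0 \<le> L\<^sub>0 p" "L\<^sub>0 p \<le> L p" using ab1 ab2 by auto
  show 3: "Bfun (\<lambda>t. d\<^sub>1 p (U j t)) at_top"
    by (rule Bfun_eventually_eq[OF _ Bfun_bounded_linear[OF bounded_linear_prim[OF ab(1)] 1]])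
      (use eventually_gt_at_top[of 0] in eventually_elim, rule W1_prim(1)[OF W[OF _ assms], symmetric])
  show 4: "Bfun (\<lambda>t. d\<^sub>2 p (Y j t)) at_top"
    by (rule Bfun_eventually_eq[OF _ Bfun_bounded_linear[OF bounded_linear_bprim[OF ab(2)] 2]])
      (use eventually_gt_at_top[of 0] in eventually_elim, rule W1_prim(2)[OF W[OF _ assms], symmetric])
  show "Bfun (U j) at_top"
    by (rule Bfun_eventually_eq[OF _ Bfun_bounded_linear[OF bounded_linear_prim[OF ab(1)] 3]])
      (use eventually_gt_at_top[of 0] in eventually_elim, rule V1_prim(1)[OF W1_D(1)[OF W[OF _ assms]], symmetric])
  show "Bfun (Y j) at_top"
    by (rule Bfun_eventually_eq[OF _ Bfun_bounded_linear[OF bounded_linear_bprim[OF ab(2)] 4]])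
      (use eventually_gt_at_top[of 0] in eventually_elim, rule V1_prim(2)[OF W1_D(1)[OF W[OF _ assms]], symmetric])
qed

lemma inner_X_der:
  assumes "0 < t" "i \<le> 4" "j \<le> 4"
  shows "((\<lambda>t. inner (X i t) (X j t)) has_real_derivative inner (X i t) (X (Suc j) t) + inner (X (Suc i) t) (X j t)) (at t)"
  using bounded_bilinear.has_vector_derivative[OF bounded_bilinear_inner X_der[OF assms(1,2)] X_der[OF assms(1,3)]]
  by (simp add: has_real_derivative_iff_has_vector_derivative)

lemma dissipation:
  assumes "0 < t" "j \<le> 4"
  shows "inner (X (Suc j) t) (X j t) = - \<kappa> p * (norm (d\<^sub>1 p (\<Theta> j t)))\<^sup>2"
  unfolding X_def by (rule evol_dissipation[OF ev[OF assms]])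

lemma energy_der:
  assumes "0 < t" "j \<le> 4"
  shows "((\<lambda>t. inner (X j t) (X j t)) has_real_derivative 2 * inner (X (Suc j) t) (X j t)) (at t)"
  using inner_X_der[OF assms assms(2)] by (simp add: inner_commute[of "X j t" "X (Suc j) t"])

lemma energy_limit:
  assumes "j \<le> 4"
  obtains l where "0 \<le> l" "((\<lambda>t. inner (X j t) (X j t)) \<longlongrightarrow> l) at_top" "\<And>t. 0 < t \<Longrightarrow> l \<le> inner (X j t) (X j t)"
proof (rule antimono_tendsto_at_top[of "\<lambda>t. inner (X j t) (X j t)"])
  fix s t :: real assume st: "0 < s" "s \<le> t"
  show "inner (X j t) (X j t) \<le> inner (X j s) (X j s)"
  proof (rule DERIV_nonpos_imp_nonincreasing[OF st(2)])
    fix x assume "s \<le> x" "x \<le> t"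
    then have x: "0 < x" using st by simp
    show "\<exists>y. ((\<lambda>t. inner (X j t) (X j t)) has_real_derivative y) (at x) \<and> y \<le> 0"
      using energy_der[OF x assms] dissipation[OF x assms] \<kappa>_pos by (intro exI conjI) auto
  qed
qed (use that in auto)

text \<open>\<open>derivative_tendsto_0\<close> is applied to the energy of \<open>X j\<close>,
  whose second derivative contains \<open>X (Suc (Suc j))\<close>; bounds up to order 5 give the
  range j \<le> 3.\<close>

lemma \<Theta>_der_tendsto_0:
  assumes j: "j \<le> 3"
  shows "((\<lambda>t. d\<^sub>1 p (\<Theta> j t)) \<longlongrightarrow> 0) at_top"
proof -
  obtain l where l: "((\<lambda>t. inner (X j t) (X j t)) \<longlongrightarrow> l) at_top"
    using energy_limit[of j] j by auto
  obtain M where M: "\<And>i t. i \<le> 5 \<Longrightarrow> 0 < t \<Longrightarrow> norm (X i t) \<le> M"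
    using bnd unfolding X_def by blast
  have M0: "0 \<le> M" using order_trans[OF norm_ge_zero M[of 0 1]] by simp
  have ip: "\<bar>inner (X i t) (X k t)\<bar> \<le> M * M" if "i \<le> 5" "k \<le> 5" "0 < t" for i k t
    using that M0 by (intro order_trans[OF Cauchy_Schwarz_ineq2] mult_mono M) auto
  have "((\<lambda>t. 2 * inner (X (Suc j) t) (X j t)) \<longlongrightarrow> 0) at_top"
  proof (rule derivative_tendsto_0[OF _ _ _ l])
    fix t :: real assume t: "0 < t"
    show "((\<lambda>t. inner (X j t) (X j t)) has_real_derivative 2 * inner (X (Suc j) t) (X j t)) (at t)"
      using j by (intro energy_der[OF t]) auto
    show "((\<lambda>t. 2 * inner (X (Suc j) t) (X j t)) has_real_derivative
        2 * (inner (X (Suc j) t) (X (Suc j) t) + inner (X (Suc (Suc j)) t) (X j t))) (at t)"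
      using j by (intro DERIV_cmult inner_X_der[OF t]) auto
    show "\<bar>2 * (inner (X (Suc j) t) (X (Suc j) t) + inner (X (Suc (Suc j)) t) (X j t))\<bar> \<le> 4 * (M * M)"
    proof -
      have "\<bar>inner (X (Suc j) t) (X (Suc j) t)\<bar> \<le> M * M" "\<bar>inner (X (Suc (Suc j)) t) (X j t)\<bar> \<le> M * M"
        using ip[of "Suc j" "Suc j" t] ip[of "Suc (Suc j)" j t] j t by auto
      moreover have "\<bar>2 * (x + y)\<bar> \<le> 4 * z" if "\<bar>x\<bar> \<le> z" "\<bar>y\<bar> \<le> z" for x y z :: real
        using that unfolding abs_le_iff by (intro conjI; argo)
      ultimately show ?thesis by blast
    qed
  qed
  then have "((\<lambda>t. - (1 / (2 * \<kappa> p)) * (2 * inner (X (Suc j) t) (X j t))) \<longlongrightarrow> - (1 / (2 * \<kappa> p)) * 0) at_top"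
    by (intro tendsto_intros)
  then have "((\<lambda>t. - (1 / (2 * \<kappa> p)) * (2 * inner (X (Suc j) t) (X j t))) \<longlongrightarrow> 0) at_top" by simp
  then have "((\<lambda>t. (norm (d\<^sub>1 p (\<Theta> j t)))\<^sup>2) \<longlongrightarrow> 0) at_top"
  proof (rule Lim_transform_eventually)
    show "\<forall>\<^sub>F t in at_top. - (1 / (2 * \<kappa> p)) * (2 * inner (X (Suc j) t) (X j t)) = (norm (d\<^sub>1 p (\<Theta> j t)))\<^sup>2"
      using eventually_gt_at_top[of 0] by eventually_elim (use dissipation j \<kappa>_pos in simp)
  qed
  from tendsto_real_sqrt[OF this] show ?thesis
    by (simp add: tendsto_norm_zero_iff)
qed

text \<open>The temperature vanishes at 0 by \<open>H10_value\<close>, so it is the primitive of its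
  gradient.\<close>

lemma \<Theta>_tendsto_0:
  assumes j: "j \<le> 3"
  shows "(\<Theta> j \<longlongrightarrow> 0) at_top"
proof -
  have "((\<lambda>t. prim 0 (L\<^sub>0 p) (d\<^sub>1 p (\<Theta> j t))) \<longlongrightarrow> prim 0 (L\<^sub>0 p) 0) at_top"
    using ab1 by (intro bounded_linear.tendsto[OF bounded_linear_prim \<Theta>_der_tendsto_0[OF j]]) auto
  moreover have "prim 0 (L\<^sub>0 p) 0 = 0"
    using ab1 by (intro linear_0 bounded_linear.linear[OF bounded_linear_prim]) auto
  ultimately have "((\<lambda>t. prim 0 (L\<^sub>0 p) (d\<^sub>1 p (\<Theta> j t))) \<longlongrightarrow> 0) at_top" by simp
  then show ?thesis
  proof (rule Lim_transform_eventually)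
    show "\<forall>\<^sub>F t in at_top. prim 0 (L\<^sub>0 p) (d\<^sub>1 p (\<Theta> j t)) = \<Theta> j t"
      using eventually_gt_at_top[of 0]
    proof eventually_elim
      fix t :: real assume "0 < t"
      then have h: "\<Theta> j t \<in> H10 0 (L\<^sub>0 p)" using evol_D(3)[OF ev[of t j]] j by auto
      show "prim 0 (L\<^sub>0 p) (d\<^sub>1 p (\<Theta> j t)) = \<Theta> j t"
        using H1_eq_prim[OF ab1 H10_H1[OF h] H10_value(1)[OF ab1 h]] by simp
    qed
  qed
qed

text \<open>In the equation of order j - 1 the velocity is \<open>U j\<close> and the temperature
  rate is \<open>\<Theta> j\<close>, so \<open>heat_estimate\<close> bounds the former by null
  functions and a bounded second derivative. \<open>U 0\<close> is never a velocity, hence 1 \<le>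
  j.\<close>

lemma U_der_tendsto_0:
  assumes j: "1 \<le> j" "j \<le> 3"
  shows "((\<lambda>t. d\<^sub>1 p (U j t)) \<longlongrightarrow> 0) at_top"
proof -
  define \<epsilon> where "\<epsilon> t = (L\<^sub>0 p * (\<rho>\<^sub>0 p * norm (\<Theta> j t)) + \<kappa> p * norm (d\<^sub>1 p (\<Theta> (j - 1) t))) / \<bar>\<gamma> p\<bar>" for t
  have "(\<epsilon> \<longlongrightarrow> (L\<^sub>0 p * (\<rho>\<^sub>0 p * norm (0::L2)) + \<kappa> p * norm (0::L2)) / \<bar>\<gamma> p\<bar>) at_top"
    unfolding \<epsilon>_def[abs_def] using j \<gamma>_ne by (intro tendsto_intros \<Theta>_tendsto_0 \<Theta>_der_tendsto_0) auto
  then have \<epsilon>: "(\<epsilon> \<longlongrightarrow> 0) at_top" by simp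
  obtain K where K: "eventually (\<lambda>t. norm (d\<^sub>1 p (d\<^sub>1 p (U j t))) \<le> K) at_top"
    using Bfun_comp(1)[of j] j by (auto elim: BfunE)
  have "((\<lambda>t. \<epsilon> t + sqrt ((\<epsilon> t)\<^sup>2 + 4 * L\<^sub>0 p * \<epsilon> t * K)) \<longlongrightarrow> 0 + sqrt (0\<^sup>2 + 4 * L\<^sub>0 p * 0 * K)) at_top"
    by (intro tendsto_intros \<epsilon>)
  then have lim: "((\<lambda>t. \<epsilon> t + sqrt ((\<epsilon> t)\<^sup>2 + 4 * L\<^sub>0 p * \<epsilon> t * K)) \<longlongrightarrow> 0) at_top" by simp
  show ?thesis
  proof (rule Lim_null_comparison[OF _ lim])
    show "\<forall>\<^sub>F t in at_top. norm (d\<^sub>1 p (U j t)) \<le> \<epsilon> t + sqrt ((\<epsilon> t)\<^sup>2 + 4 * L\<^sub>0 p * \<epsilon> t * K)"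
      using K eventually_gt_at_top[of 0]
    proof eventually_elim
      fix t :: real assume K: "norm (d\<^sub>1 p (d\<^sub>1 p (U j t))) \<le> K" and t: "0 < t"
      have e: "evol (U (j - 1) t) (Y (j - 1) t) (U j t) (Y j t) (\<Theta> (j - 1) t) (U (Suc j) t) (Y (Suc j) t) (\<Theta> j t)"
        using ev[OF t, of "j - 1"] j by simp
      have \<epsilon>0: "0 \<le> \<epsilon> t" unfolding \<epsilon>_def using ab1 \<rho>_pos \<kappa>_pos by simp
      have "norm (d\<^sub>1 p (U j t)) \<le> \<epsilon> t + sqrt ((\<epsilon> t)\<^sup>2 + 4 * L\<^sub>0 p * \<epsilon> t * norm (d\<^sub>1 p (d\<^sub>1 p (U j t))))"
        using heat_estimate[OF e] by (simp only: \<epsilon>_def)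
      also have "\<dots> \<le> \<epsilon> t + sqrt ((\<epsilon> t)\<^sup>2 + 4 * L\<^sub>0 p * \<epsilon> t * K)"
        using K \<epsilon>0 ab1 by (intro add_left_mono real_sqrt_le_mono mult_left_mono) auto
      finally show "norm (d\<^sub>1 p (U j t)) \<le> \<epsilon> t + sqrt ((\<epsilon> t)\<^sup>2 + 4 * L\<^sub>0 p * \<epsilon> t * K)" .
    qed
  qed
qed

text \<open>The displacement and its trace follow from the gradient because \<open>U j\<close>
  vanishes at 0. The trace of the gradient takes the Rellich identity with weight x, which pairs the
  vanishing gradient with the merely bounded second derivative.\<close>

lemma U_tendsto_0:
  assumes j: "1 \<le> j" "j \<le> 3"
  shows "(U j \<longlongrightarrow> 0) at_top" "((\<lambda>t. val\<^sub>1 p (U j t) (L\<^sub>0 p)) \<longlongrightarrow> 0) at_top"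
    "((\<lambda>t. val\<^sub>1 p (d\<^sub>1 p (U j t)) (L\<^sub>0 p)) \<longlongrightarrow> 0) at_top"
proof -
  note u' = U_der_tendsto_0[OF j]
  have W: "(U j t, Y j t) \<in> W\<^sub>1 p" if "0 < t" for t using W[OF that, of j] j by simp
  have "((\<lambda>t. L\<^sub>0 p * norm (d\<^sub>1 p (U j t))) \<longlongrightarrow> L\<^sub>0 p * 0) at_top"
    by (intro tendsto_intros tendsto_norm_zero u')
  then have 1: "((\<lambda>t. L\<^sub>0 p * norm (d\<^sub>1 p (U j t))) \<longlongrightarrow> 0) at_top" by simp
  show "(U j \<longlongrightarrow> 0) at_top"
  proof (rule Lim_null_comparison[OF _ 1])
    show "\<forall>\<^sub>F t in at_top. norm (U j t) \<le> L\<^sub>0 p * norm (d\<^sub>1 p (U j t))"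
      using eventually_gt_at_top[of 0]
    proof eventually_elim
      fix t :: real assume t: "0 < t"
      note v = V1_D[OF W1_D(1)[OF W[OF t]]]
      show "norm (U j t) \<le> L\<^sub>0 p * norm (d\<^sub>1 p (U j t))"
        using H1_norm_le[OF ab1 v(1), of 0] v(3) ab1 by simp
    qed
  qed
  have "((\<lambda>t. sqrt (L\<^sub>0 p) * norm (d\<^sub>1 p (U j t))) \<longlongrightarrow> sqrt (L\<^sub>0 p) * 0) at_top"
    by (intro tendsto_intros tendsto_norm_zero u')
  then have 2: "((\<lambda>t. sqrt (L\<^sub>0 p) * norm (d\<^sub>1 p (U j t))) \<longlongrightarrow> 0) at_top" by simp
  show "((\<lambda>t. val\<^sub>1 p (U j t) (L\<^sub>0 p)) \<longlongrightarrow> 0) at_top"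
  proof (rule Lim_null_comparison[OF _ 2])
    show "\<forall>\<^sub>F t in at_top. cmod (val\<^sub>1 p (U j t) (L\<^sub>0 p)) \<le> sqrt (L\<^sub>0 p) * norm (d\<^sub>1 p (U j t))"
      using eventually_gt_at_top[of 0]
    proof eventually_elim
      fix t :: real assume t: "0 < t"
      note v = V1_D[OF W1_D(1)[OF W[OF t]]]
      show "cmod (val\<^sub>1 p (U j t) (L\<^sub>0 p)) \<le> sqrt (L\<^sub>0 p) * norm (d\<^sub>1 p (U j t))"
        using value_at_le[OF ab1 v(1), of "L\<^sub>0 p" 0] v(3) ab1 by simp
    qed
  qed
  let ?m = "mulx 0 (L\<^sub>0 p) 0"
  have "Bfun (\<lambda>t. ?m (d\<^sub>1 p (d\<^sub>1 p (U j t)))) at_top"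
    using j by (intro Bfun_bounded_linear[OF bounded_linear_mulx] Bfun_comp) auto
  from tendsto_Re[OF tendsto_0_cip(1)[OF u' this]]
  have R: "((\<lambda>t. Re (cip (d\<^sub>1 p (U j t)) (?m (d\<^sub>1 p (d\<^sub>1 p (U j t)))))) \<longlongrightarrow> 0) at_top" by simp
  have "((\<lambda>t. sqrt (((norm (d\<^sub>1 p (U j t)))\<^sup>2 + 2 * Re (cip (d\<^sub>1 p (U j t)) (?m (d\<^sub>1 p (d\<^sub>1 p (U j t)))))) / L\<^sub>0 p))
      \<longlongrightarrow> sqrt ((0\<^sup>2 + 2 * 0) / L\<^sub>0 p)) at_top"
    using ab1 by (intro tendsto_real_sqrt tendsto_divide tendsto_add tendsto_mult tendsto_const tendsto_power
        tendsto_norm_zero u' R) auto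
  then have 3: "((\<lambda>t. sqrt (((norm (d\<^sub>1 p (U j t)))\<^sup>2 + 2 * Re (cip (d\<^sub>1 p (U j t)) (?m (d\<^sub>1 p (d\<^sub>1 p (U j t)))))) / L\<^sub>0 p))
      \<longlongrightarrow> 0) at_top" by simp
  show "((\<lambda>t. val\<^sub>1 p (d\<^sub>1 p (U j t)) (L\<^sub>0 p)) \<longlongrightarrow> 0) at_top"
  proof (rule Lim_null_comparison[OF _ 3])
    show "\<forall>\<^sub>F t in at_top. cmod (val\<^sub>1 p (d\<^sub>1 p (U j t)) (L\<^sub>0 p)) \<le>
        sqrt (((norm (d\<^sub>1 p (U j t)))\<^sup>2 + 2 * Re (cip (d\<^sub>1 p (U j t)) (?m (d\<^sub>1 p (d\<^sub>1 p (U j t)))))) / L\<^sub>0 p)"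
      using eventually_gt_at_top[of 0]
    proof eventually_elim
      fix t :: real assume t: "0 < t"
      show "cmod (val\<^sub>1 p (d\<^sub>1 p (U j t)) (L\<^sub>0 p)) \<le>
        sqrt (((norm (d\<^sub>1 p (U j t)))\<^sup>2 + 2 * Re (cip (d\<^sub>1 p (U j t)) (?m (d\<^sub>1 p (d\<^sub>1 p (U j t)))))) / L\<^sub>0 p)"
        using rellich_identity[OF ab1 W1_D(2)[OF W[OF t]], of 0] ab1
        by (intro real_le_rsqrt) (simp add: pos_le_divide_eq mult.commute)
    qed
  qed
qed

text \<open>The equation of order 1 is tested with \<open>U 1\<close> itself, continued to the
  second interval by cubics with the traces of \<open>U 1\<close>. These traces tend to 0, so every
  term except the bending energy on the first interval is a product of a null and a bounded
  function.\<close>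

lemma U1_der2_tendsto_0: "((\<lambda>t. d\<^sub>1 p (d\<^sub>1 p (U 1 t))) \<longlongrightarrow> 0) at_top"
proof -
  let ?a = "L\<^sub>0 p" and ?b = "L p"
  have pt: "?a \<in> {?a..?b}" "?b \<in> {?a..?b}" using ab2 by auto
  obtain q0 where q0: "q0 \<in> H1 ?a ?b" "d\<^sub>2 p q0 \<in> H1 ?a ?b" "val\<^sub>2 p q0 ?b = 0" "val\<^sub>2 p (d\<^sub>2 p q0) ?b = 0"
      "val\<^sub>2 p q0 ?a = 1" "val\<^sub>2 p (d\<^sub>2 p q0) ?a = 0"
    using hermite_interpolation[OF ab2, of ?b ?a 1 0] by auto
  obtain q1 where q1: "q1 \<in> H1 ?a ?b" "d\<^sub>2 p q1 \<in> H1 ?a ?b" "val\<^sub>2 p q1 ?b = 0" "val\<^sub>2 p (d\<^sub>2 p q1) ?b = 0"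
      "val\<^sub>2 p q1 ?a = 0" "val\<^sub>2 p (d\<^sub>2 p q1) ?a = 1"
    using hermite_interpolation[OF ab2, of ?b ?a 0 1] by auto
  define A B where "A t = val\<^sub>1 p (U 1 t) ?a" and "B t = val\<^sub>1 p (d\<^sub>1 p (U 1 t)) ?a" for t
  have A: "(A \<longlongrightarrow> 0) at_top" and B: "(B \<longlongrightarrow> 0) at_top"
    unfolding A_def B_def using U_tendsto_0(2,3)[of 1] by auto
  have comb: "((\<lambda>t. A t *\<^sub>C f + B t *\<^sub>C g) \<longlongrightarrow> 0) at_top" for f g :: L2
  proof -
    have "((\<lambda>t. A t *\<^sub>C f + B t *\<^sub>C g) \<longlongrightarrow> 0 *\<^sub>C f + 0 *\<^sub>C g) at_top"
      by (intro tendsto_add bounded_linear.tendsto[OF bounded_linear_scaleC_left] A B)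
    then show ?thesis by simp
  qed
  let ?g = "\<lambda>t. A t *\<^sub>C q0 + B t *\<^sub>C q1" and ?g' = "\<lambda>t. A t *\<^sub>C d\<^sub>2 p q0 + B t *\<^sub>C d\<^sub>2 p q1"
    and ?g'' = "\<lambda>t. A t *\<^sub>C d\<^sub>2 p (d\<^sub>2 p q0) + B t *\<^sub>C d\<^sub>2 p (d\<^sub>2 p q1)"
  let ?R = "\<lambda>t. \<rho>\<^sub>1 p * cip (U 3 t) (U 1 t) + \<alpha>\<^sub>1 p * cip (d\<^sub>1 p (U 3 t)) (d\<^sub>1 p (U 1 t))
      + \<rho>\<^sub>2 p * cip (Y 3 t) (?g t) + \<alpha>\<^sub>2 p * cip (d\<^sub>2 p (Y 3 t)) (?g' t) - \<gamma> p * cip (d\<^sub>1 p (\<Theta> 1 t)) (d\<^sub>1 p (U 1 t))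
      + \<beta>\<^sub>2 p * cip (d\<^sub>2 p (d\<^sub>2 p (Y 1 t))) (?g'' t)"
  have bT: "Bfun (\<lambda>t. d\<^sub>1 p (U 1 t)) at_top" by (rule Bfun_comp) simp
  have "(?R \<longlongrightarrow> of_real (\<rho>\<^sub>1 p) * 0 + of_real (\<alpha>\<^sub>1 p) * 0 + of_real (\<rho>\<^sub>2 p) * 0 + of_real (\<alpha>\<^sub>2 p) * 0
      - of_real (\<gamma> p) * 0 + of_real (\<beta>\<^sub>2 p) * 0) at_top"
    by (intro tendsto_add tendsto_diff tendsto_mult tendsto_const tendsto_0_cip(2) comb U_tendsto_0(1) U_der_tendsto_0
        Bfun_comp tendsto_0_cip(1)[OF \<Theta>_der_tendsto_0 bT]) auto
  then have "(?R \<longlongrightarrow> 0) at_top" by simp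
  then have "((\<lambda>t. sqrt (Re (of_real (- (1 / \<beta>\<^sub>1 p)) * ?R t))) \<longlongrightarrow> sqrt (Re (of_real (- (1 / \<beta>\<^sub>1 p)) * 0))) at_top"
    by (intro tendsto_real_sqrt tendsto_Re tendsto_mult tendsto_const)
  then have lim: "((\<lambda>t. sqrt (Re (of_real (- (1 / \<beta>\<^sub>1 p)) * ?R t))) \<longlongrightarrow> 0) at_top" by simp
  show ?thesis
  proof (rule Lim_null_comparison[OF _ lim])
    show "\<forall>\<^sub>F t in at_top. norm (d\<^sub>1 p (d\<^sub>1 p (U 1 t))) \<le> sqrt (Re (of_real (- (1 / \<beta>\<^sub>1 p)) * ?R t))"
      using eventually_gt_at_top[of 0]
    proof eventually_elim
      fix t :: real assume t: "0 < t"
      have e: "evol (U 1 t) (Y 1 t) (U 2 t) (Y 2 t) (\<Theta> 1 t) (U 3 t) (Y 3 t) (\<Theta> 2 t)"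
        using ev[OF t, of 1] by (simp add: numeral_eq_Suc)
      note w = W1_D[OF evol_D(1)[OF e]] and v = V1_D[OF W1_D(1)[OF evol_D(1)[OF e]]]
      note g0 = H1_lincomb[OF ab2 q0(1) q1(1), where A = "A t" and B = "B t"]
      note g1 = H1_lincomb[OF ab2 q0(2) q1(2), where A = "A t" and B = "B t"]
      have "(U 1 t, ?g t) \<in> W\<^sub>1 p"
      proof (rule W1_I)
        show "(U 1 t, ?g t) \<in> V\<^sub>1 p"
          unfolding V\<^sub>1_def using v(1,3) g0(1) g0(3)[OF pt(1)] g0(3)[OF pt(2)] q0 q1 by (simp add: A_def)
      qed (use w g0(2) g1(1) g1(3)[OF pt(1)] g1(3)[OF pt(2)] q0 q1 in \<open>auto simp: B_def\<close>)
      from evol_mech[OF e this] have "of_real (\<beta>\<^sub>1 p * (norm (d\<^sub>1 p (d\<^sub>1 p (U 1 t))))\<^sup>2) = - ?R t"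
        unfolding g0(2) g1(2) cip_self_norm of_real_mult by (simp add: eq_neg_iff_add_eq_0 algebra_simps)
      then have "complex_of_real ((norm (d\<^sub>1 p (d\<^sub>1 p (U 1 t))))\<^sup>2) = of_real (- (1 / \<beta>\<^sub>1 p)) * ?R t"
        using \<beta>_pos by (simp add: field_simps)
      then have "(norm (d\<^sub>1 p (d\<^sub>1 p (U 1 t))))\<^sup>2 = Re (of_real (- (1 / \<beta>\<^sub>1 p)) * ?R t)"
        by (metis Re_complex_of_real)
      then show "norm (d\<^sub>1 p (d\<^sub>1 p (U 1 t))) \<le> sqrt (Re (of_real (- (1 / \<beta>\<^sub>1 p)) * ?R t))"
        by (intro real_le_rsqrt) simp
    qed
  qed
qed

end

section \<open>Decay of the energies of order 1 and 0\<close>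

context plate_trajectory
begin

lemma energy1_tendsto_0: "((\<lambda>t. inner (X 1 t) (X 1 t)) \<longlongrightarrow> 0) at_top"
proof -
  let ?m = "mulx (L\<^sub>0 p) (L p) (L p)"
  define l where "l = L p - L\<^sub>0 p"
  obtain e where e: "0 \<le> e" "((\<lambda>t. inner (X 1 t) (X 1 t)) \<longlongrightarrow> e) at_top" "\<And>t. 0 < t \<Longrightarrow> e \<le> inner (X 1 t) (X 1 t)"
    using energy_limit[of 1] by auto
  obtain K where K: "0 \<le> K"
    "\<And>u y v z \<theta> v' z' \<theta>'. evol u y v z \<theta> v' z' \<theta>' \<Longrightarrow>
      Re (\<rho>\<^sub>2 p * cip z' (?m (d\<^sub>2 p y) - y) + \<alpha>\<^sub>2 p * cip (d\<^sub>2 p z') (?m (d\<^sub>2 p (d\<^sub>2 p y))))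
      + 1/2 * \<beta>\<^sub>2 p * (norm (d\<^sub>2 p (d\<^sub>2 p y)))\<^sup>2 \<le>
      K * ((\<rho>\<^sub>1 p * norm v' + \<alpha>\<^sub>1 p * norm (d\<^sub>1 p v') + \<bar>\<gamma> p\<bar> * norm (d\<^sub>1 p \<theta>) + \<beta>\<^sub>1 p * norm (d\<^sub>1 p (d\<^sub>1 p u)))
          * cmod (of_real (L\<^sub>0 p - L p) * val\<^sub>1 p (d\<^sub>1 p u) (L\<^sub>0 p) - val\<^sub>1 p u (L\<^sub>0 p))
        + (\<rho>\<^sub>1 p * norm v' + \<alpha>\<^sub>1 p * norm (d\<^sub>1 p v') + \<bar>\<gamma> p\<bar> * norm (d\<^sub>1 p \<theta>) + \<beta>\<^sub>1 p * norm (d\<^sub>1 p (d\<^sub>1 p u)))\<^sup>2)"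
    using multiplier_estimate by blast
  define g where "g t = ?m (d\<^sub>2 p (Y 1 t)) - Y 1 t" for t
  \<comment> \<open>The velocity \<open>Y 2\<close> is paired in the inertial form with
    \<open>g\<close>, whose space derivative is (x - L) times the second derivative of
    \<open>Y 1\<close>. In the time derivative, \<open>multiplier_estimate\<close> handles the terms
    with the acceleration \<open>Y 3\<close>, and the Rellich identity those where \<open>g\<close>
    is differentiated.\<close>
  define F where "F t = Re (\<rho>\<^sub>2 p * cip (Y 2 t) (g t) + \<alpha>\<^sub>2 p * cip (d\<^sub>2 p (Y 2 t)) (?m (d\<^sub>2 p (d\<^sub>2 p (Y 1 t)))))" for t
  define F' where "F' t = Re (\<rho>\<^sub>2 p * (cip (Y 2 t) (?m (d\<^sub>2 p (Y 2 t)) - Y 2 t) + cip (Y 3 t) (g t))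
      + \<alpha>\<^sub>2 p * (cip (d\<^sub>2 p (Y 2 t)) (?m (d\<^sub>2 p (d\<^sub>2 p (Y 2 t)))) + cip (d\<^sub>2 p (Y 3 t)) (?m (d\<^sub>2 p (d\<^sub>2 p (Y 1 t))))))" for t
  have derF: "(F has_real_derivative F' t) (at t)" if t: "0 < t" for t
  proof -
    note bl = bounded_linear.has_vector_derivative
    have y1: "(Y 1 has_vector_derivative Y 2 t) (at t)" "((\<lambda>t. d\<^sub>2 p (Y 1 t)) has_vector_derivative d\<^sub>2 p (Y 2 t)) (at t)"
      using bl[OF bounded_linear_c(5) X_der[OF t, of 0]] bl[OF bounded_linear_c(6) X_der[OF t, of 0]]
      by (simp_all add: c_X numeral_2_eq_2)
    have y2: "(Y 2 has_vector_derivative Y 3 t) (at t)" "((\<lambda>t. d\<^sub>2 p (Y 2 t)) has_vector_derivative d\<^sub>2 p (Y 3 t)) (at t)"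
      "((\<lambda>t. d\<^sub>2 p (d\<^sub>2 p (Y 1 t))) has_vector_derivative d\<^sub>2 p (d\<^sub>2 p (Y 2 t))) (at t)"
      using bl[OF bounded_linear_c(5) X_der[OF t, of 1]] bl[OF bounded_linear_c(6) X_der[OF t, of 1]]
        bl[OF bounded_linear_c(2) X_der[OF t, of 1]]
      by (simp_all add: c_X numeral_2_eq_2 numeral_3_eq_3)
    have g: "(g has_vector_derivative ?m (d\<^sub>2 p (Y 2 t)) - Y 2 t) (at t)"
      unfolding g_def[abs_def] by (intro has_vector_derivative_diff bl[OF bounded_linear_mulx] y1)
    have "(F has_vector_derivative F' t) (at t)"
      unfolding F_def[abs_def] F'_def
      by (intro bl[OF bounded_linear_Re] has_vector_derivative_add has_vector_derivative_mult_right
          cip.has_vector_derivative g y2 bl[OF bounded_linear_mulx])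
    then show ?thesis by (simp add: has_real_derivative_iff_has_vector_derivative)
  qed
  define \<epsilon> where "\<epsilon> t = \<rho>\<^sub>1 p * norm (U 3 t) + \<alpha>\<^sub>1 p * norm (d\<^sub>1 p (U 3 t)) + \<bar>\<gamma> p\<bar> * norm (d\<^sub>1 p (\<Theta> 1 t))
      + \<beta>\<^sub>1 p * norm (d\<^sub>1 p (d\<^sub>1 p (U 1 t)))" for t
  define A where "A t = of_real (L\<^sub>0 p - L p) * val\<^sub>1 p (d\<^sub>1 p (U 1 t)) (L\<^sub>0 p) - val\<^sub>1 p (U 1 t) (L\<^sub>0 p)" for t
  \<comment> \<open>The part of the energy of order 1 that lives on the first interval; all of it is
    already known to vanish.\<close>
  define \<zeta> where "\<zeta> t = \<beta>\<^sub>1 p * (norm (d\<^sub>1 p (d\<^sub>1 p (U 1 t))))\<^sup>2 + \<rho>\<^sub>1 p * (norm (U 2 t))\<^sup>2 + \<alpha>\<^sub>1 p * (norm (d\<^sub>1 p (U 2 t)))\<^sup>2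
      + \<rho>\<^sub>0 p * (norm (\<Theta> 1 t))\<^sup>2" for t
  define \<eta> where "\<eta> t = K * (\<epsilon> t * cmod (A t) + (\<epsilon> t)\<^sup>2) + 1/2 * (\<rho>\<^sub>2 p * l * (cmod (val\<^sub>1 p (U 2 t) (L\<^sub>0 p)))\<^sup>2)
      + 1/2 * (\<alpha>\<^sub>2 p * l * (cmod (val\<^sub>1 p (d\<^sub>1 p (U 2 t)) (L\<^sub>0 p)))\<^sup>2) + 1/2 * \<zeta> t" for t
  have \<eta>: "(\<eta> \<longlongrightarrow> 0) at_top"
  proof -
    have n: "((\<lambda>t. norm (U 3 t)) \<longlongrightarrow> 0) at_top" "((\<lambda>t. norm (d\<^sub>1 p (U 3 t))) \<longlongrightarrow> 0) at_top"
      "((\<lambda>t. norm (d\<^sub>1 p (\<Theta> 1 t))) \<longlongrightarrow> 0) at_top" "((\<lambda>t. norm (d\<^sub>1 p (d\<^sub>1 p (U 1 t)))) \<longlongrightarrow> 0) at_top"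
      "((\<lambda>t. norm (U 2 t)) \<longlongrightarrow> 0) at_top" "((\<lambda>t. norm (d\<^sub>1 p (U 2 t))) \<longlongrightarrow> 0) at_top"
      "((\<lambda>t. norm (\<Theta> 1 t)) \<longlongrightarrow> 0) at_top"
      "((\<lambda>t. cmod (val\<^sub>1 p (U 2 t) (L\<^sub>0 p))) \<longlongrightarrow> 0) at_top" "((\<lambda>t. cmod (val\<^sub>1 p (d\<^sub>1 p (U 2 t)) (L\<^sub>0 p))) \<longlongrightarrow> 0) at_top"
      using U_tendsto_0[of 3] U_der_tendsto_0[of 3] \<Theta>_der_tendsto_0[of 1] U1_der2_tendsto_0 U_tendsto_0[of 2]
        U_der_tendsto_0[of 2] \<Theta>_tendsto_0[of 1] by (auto intro!: tendsto_norm_zero)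
    have "(\<epsilon> \<longlongrightarrow> \<rho>\<^sub>1 p * 0 + \<alpha>\<^sub>1 p * 0 + \<bar>\<gamma> p\<bar> * 0 + \<beta>\<^sub>1 p * 0) at_top"
      unfolding \<epsilon>_def[abs_def] by (intro tendsto_add tendsto_mult tendsto_const n)
    then have \<epsilon>: "(\<epsilon> \<longlongrightarrow> 0) at_top" by simp
    have "(A \<longlongrightarrow> of_real (L\<^sub>0 p - L p) * 0 - 0) at_top"
      unfolding A_def[abs_def] by (intro tendsto_diff tendsto_mult tendsto_const U_tendsto_0) auto
    then have A: "((\<lambda>t. cmod (A t)) \<longlongrightarrow> 0) at_top" by (intro tendsto_norm_zero) simp
    have "(\<eta> \<longlongrightarrow> K * (0 * 0 + 0\<^sup>2) + 1/2 * (\<rho>\<^sub>2 p * l * 0\<^sup>2) + 1/2 * (\<alpha>\<^sub>2 p * l * 0\<^sup>2)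
        + 1/2 * (\<beta>\<^sub>1 p * 0\<^sup>2 + \<rho>\<^sub>1 p * 0\<^sup>2 + \<alpha>\<^sub>1 p * 0\<^sup>2 + \<rho>\<^sub>0 p * 0\<^sup>2)) at_top"
      unfolding \<eta>_def[abs_def] \<zeta>_def
      by (intro tendsto_add tendsto_mult tendsto_power tendsto_const n \<epsilon> A)
    then show ?thesis by simp
  qed
  \<comment> \<open>Bookkeeping of signs: the multiplier estimate supplies -1/2 of the elastic term,
    the Rellich identities -1/2 of both kinetic terms, and the summand -y of the multiplier a
    further full \<open>\<rho>\<^sub>2 p\<close> term. Together this is at most -1/2 of the energy
    on the second interval, which is at least \<open>e - \<zeta> t\<close>.\<close>
  have drift: "F' t \<le> \<eta> t - 1/2 * e" if t: "0 < t" for t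
  proof -
    have ev1: "evol (U 1 t) (Y 1 t) (U 2 t) (Y 2 t) (\<Theta> 1 t) (U 3 t) (Y 3 t) (\<Theta> 2 t)"
      using ev[OF t, of 1] by (simp add: numeral_eq_Suc)
    note w = W1_D[OF evol_D(2)[OF ev1]] and v = V1_D[OF W1_D(1)[OF evol_D(2)[OF ev1]]]
    have y2: "d\<^sub>2 p (d\<^sub>2 p (Y 2 t)) \<in> L2_on (L\<^sub>0 p) (L p)" using d_L2_on(2)[OF w(3)] .
    have 1: "2 * Re (cip (Y 2 t) (?m (d\<^sub>2 p (Y 2 t)))) = l * (cmod (val\<^sub>1 p (U 2 t) (L\<^sub>0 p)))\<^sup>2 - (norm (Y 2 t))\<^sup>2"
      using rellich_identity[OF ab2 v(2), of "L p"] v(5) by (simp add: l_def left_diff_distrib)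
    have 2: "2 * Re (cip (d\<^sub>2 p (Y 2 t)) (?m (d\<^sub>2 p (d\<^sub>2 p (Y 2 t))))) =
        l * (cmod (val\<^sub>1 p (d\<^sub>1 p (U 2 t)) (L\<^sub>0 p)))\<^sup>2 - (norm (d\<^sub>2 p (Y 2 t)))\<^sup>2"
      using rellich_identity[OF ab2 w(3), of "L p"] w(6) by (simp add: l_def left_diff_distrib)
    have 3: "Re (\<rho>\<^sub>2 p * cip (Y 3 t) (g t) + \<alpha>\<^sub>2 p * cip (d\<^sub>2 p (Y 3 t)) (?m (d\<^sub>2 p (d\<^sub>2 p (Y 1 t)))))
      + 1/2 * \<beta>\<^sub>2 p * (norm (d\<^sub>2 p (d\<^sub>2 p (Y 1 t))))\<^sup>2 \<le> K * (\<epsilon> t * cmod (A t) + (\<epsilon> t)\<^sup>2)"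
      using K(2)[OF ev1] by (simp only: g_def \<epsilon>_def A_def)
    have N: "inner (X 1 t) (X 1 t) = \<zeta> t + \<beta>\<^sub>2 p * (norm (d\<^sub>2 p (d\<^sub>2 p (Y 1 t))))\<^sup>2 + \<rho>\<^sub>2 p * (norm (Y 2 t))\<^sup>2
        + \<alpha>\<^sub>2 p * (norm (d\<^sub>2 p (Y 2 t)))\<^sup>2"
      unfolding power2_norm_eq_inner[symmetric] X_def \<zeta>_def
      by (subst norm_emb_sq) (simp add: numeral_2_eq_2)
    have F': "F' t = Re (\<rho>\<^sub>2 p * cip (Y 3 t) (g t) + \<alpha>\<^sub>2 p * cip (d\<^sub>2 p (Y 3 t)) (?m (d\<^sub>2 p (d\<^sub>2 p (Y 1 t)))))
        + 1/2 * \<rho>\<^sub>2 p * (2 * Re (cip (Y 2 t) (?m (d\<^sub>2 p (Y 2 t))))) - \<rho>\<^sub>2 p * (norm (Y 2 t))\<^sup>2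
        + 1/2 * \<alpha>\<^sub>2 p * (2 * Re (cip (d\<^sub>2 p (Y 2 t)) (?m (d\<^sub>2 p (d\<^sub>2 p (Y 2 t))))))"
      unfolding F'_def by (simp add: cip.diff_right norm_L2_sq algebra_simps)
    have "F' t \<le> K * (\<epsilon> t * cmod (A t) + (\<epsilon> t)\<^sup>2) + 1/2 * (\<rho>\<^sub>2 p * l * (cmod (val\<^sub>1 p (U 2 t) (L\<^sub>0 p)))\<^sup>2)
      + 1/2 * (\<alpha>\<^sub>2 p * l * (cmod (val\<^sub>1 p (d\<^sub>1 p (U 2 t)) (L\<^sub>0 p)))\<^sup>2)
      - 1/2 * (\<beta>\<^sub>2 p * (norm (d\<^sub>2 p (d\<^sub>2 p (Y 1 t))))\<^sup>2) - 3/2 * (\<rho>\<^sub>2 p * (norm (Y 2 t))\<^sup>2) - 1/2 * (\<alpha>\<^sub>2 p * (norm (d\<^sub>2 p (Y 2 t)))\<^sup>2)"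
      using 3 unfolding F' 1 2 by (simp add: algebra_simps)
    moreover have "0 \<le> \<rho>\<^sub>2 p * (norm (Y 2 t))\<^sup>2" using \<rho>_pos by simp
    ultimately show ?thesis
      using e(3)[OF t] unfolding N \<eta>_def by linarith
  qed
  have bF: "Bfun F at_top"
  proof -
    have b: "Bfun (\<lambda>t. cip (Y 2 t) (g t)) at_top" "Bfun (\<lambda>t. cip (d\<^sub>2 p (Y 2 t)) (?m (d\<^sub>2 p (d\<^sub>2 p (Y 1 t))))) at_top"
      unfolding g_def by (intro Bfun_cip Bfun_diff Bfun_bounded_linear[OF bounded_linear_mulx] Bfun_comp; simp)+
    have "Bfun (\<lambda>t. Re (\<rho>\<^sub>2 p * cip (Y 2 t) (g t)) - Re (- (\<alpha>\<^sub>2 p * cip (d\<^sub>2 p (Y 2 t)) (?m (d\<^sub>2 p (d\<^sub>2 p (Y 1 t))))))) at_top"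
      by (intro Bfun_diff Bfun_bounded_linear[OF bounded_linear_Re] Bfun_bounded_linear[OF bounded_linear_minus[OF bounded_linear_ident]]
          Bfun_bounded_linear[OF bounded_linear_mult_right] b)
    then show ?thesis unfolding F_def[abs_def] by simp
  qed
  have "1/2 * e \<le> 0"
    by (rule bounded_imp_drift_nonpos[OF derF drift \<eta> bF])
  then show ?thesis using e(1,2) by simp
qed

lemma energy0_tendsto_0: "((\<lambda>t. inner (X 0 t) (X 0 t)) \<longlongrightarrow> 0) at_top"
proof -
  have "((\<lambda>t. sqrt (inner (X 1 t) (X 1 t))) \<longlongrightarrow> sqrt 0) at_top"
    by (intro tendsto_intros energy1_tendsto_0)
  then have X1: "(X 1 \<longlongrightarrow> 0) at_top"
    by (simp add: norm_eq_sqrt_inner[symmetric] tendsto_norm_zero_iff)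
  have c: "((\<lambda>t. f (X 1 t)) \<longlongrightarrow> 0) at_top" if "bounded_linear f" for f :: "_ \<Rightarrow> L2"
    using bounded_linear.tendsto[OF that X1] linear_0[OF bounded_linear.linear[OF that]] by simp
  have n2: "(U 2 \<longlongrightarrow> 0) at_top" "((\<lambda>t. d\<^sub>1 p (U 2 t)) \<longlongrightarrow> 0) at_top" "(Y 2 \<longlongrightarrow> 0) at_top" "((\<lambda>t. d\<^sub>2 p (Y 2 t)) \<longlongrightarrow> 0) at_top"
    "((\<lambda>t. d\<^sub>2 p (d\<^sub>2 p (Y 1 t))) \<longlongrightarrow> 0) at_top"
    using c[OF bounded_linear_c(3)] c[OF bounded_linear_c(4)] c[OF bounded_linear_c(5)] c[OF bounded_linear_c(6)]
      c[OF bounded_linear_c(2)] by (simp_all add: c_X numeral_2_eq_2)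
  have ab: "L\<^sub>0 p \<le> L p" using ab2 by simp
  have b0: "bprim (L\<^sub>0 p) (L p) 0 = 0"
    using linear_0[OF bounded_linear.linear[OF bounded_linear_bprim[OF ab]]] .
  have y1': "((\<lambda>t. d\<^sub>2 p (Y 1 t)) \<longlongrightarrow> 0) at_top"
  proof (rule Lim_transform_eventually)
    show "((\<lambda>t. bprim (L\<^sub>0 p) (L p) (d\<^sub>2 p (d\<^sub>2 p (Y 1 t)))) \<longlongrightarrow> 0) at_top"
      using bounded_linear.tendsto[OF bounded_linear_bprim[OF ab] n2(5)] b0 by simp
    show "\<forall>\<^sub>F t in at_top. bprim (L\<^sub>0 p) (L p) (d\<^sub>2 p (d\<^sub>2 p (Y 1 t))) = d\<^sub>2 p (Y 1 t)"
      using eventually_gt_at_top[of 0] by eventually_elim (rule W1_prim(2)[OF W, symmetric], simp_all)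
  qed
  have y1: "(Y 1 \<longlongrightarrow> 0) at_top"
  proof (rule Lim_transform_eventually)
    show "((\<lambda>t. bprim (L\<^sub>0 p) (L p) (d\<^sub>2 p (Y 1 t))) \<longlongrightarrow> 0) at_top"
      using bounded_linear.tendsto[OF bounded_linear_bprim[OF ab] y1'] b0 by simp
    show "\<forall>\<^sub>F t in at_top. bprim (L\<^sub>0 p) (L p) (d\<^sub>2 p (Y 1 t)) = Y 1 t"
      using eventually_gt_at_top[of 0] by eventually_elim (rule V1_prim(2)[OF W1_D(1)[OF W], symmetric], simp_all)
  qed
  \<comment> \<open>The accelerations are components of \<open>X 1\<close>, and the temperature
    gradient of order 0 vanishes through dissipation; paired with displacements that are merely
    bounded, every term is null.\<close>
  let ?R = "\<lambda>t. \<rho>\<^sub>1 p * cip (U 2 t) (U 0 t) + \<alpha>\<^sub>1 p * cip (d\<^sub>1 p (U 2 t)) (d\<^sub>1 p (U 0 t))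
      + \<rho>\<^sub>2 p * cip (Y 2 t) (Y 0 t) + \<alpha>\<^sub>2 p * cip (d\<^sub>2 p (Y 2 t)) (d\<^sub>2 p (Y 0 t)) - \<gamma> p * cip (d\<^sub>1 p (\<Theta> 0 t)) (d\<^sub>1 p (U 0 t))"
  have "(?R \<longlongrightarrow> of_real (\<rho>\<^sub>1 p) * 0 + of_real (\<alpha>\<^sub>1 p) * 0 + of_real (\<rho>\<^sub>2 p) * 0 + of_real (\<alpha>\<^sub>2 p) * 0 - of_real (\<gamma> p) * 0) at_top"
    by (intro tendsto_add tendsto_diff tendsto_mult tendsto_const tendsto_0_cip(1) n2 Bfun_comp \<Theta>_der_tendsto_0) auto
  then have R: "(?R \<longlongrightarrow> 0) at_top" by simp
  let ?Q = "\<lambda>t. \<rho>\<^sub>1 p * (norm (U 1 t))\<^sup>2 + \<alpha>\<^sub>1 p * (norm (d\<^sub>1 p (U 1 t)))\<^sup>2 + \<rho>\<^sub>2 p * (norm (Y 1 t))\<^sup>2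
      + \<alpha>\<^sub>2 p * (norm (d\<^sub>2 p (Y 1 t)))\<^sup>2 + \<rho>\<^sub>0 p * (norm (\<Theta> 0 t))\<^sup>2"
  have "(?Q \<longlongrightarrow> \<rho>\<^sub>1 p * 0\<^sup>2 + \<alpha>\<^sub>1 p * 0\<^sup>2 + \<rho>\<^sub>2 p * 0\<^sup>2 + \<alpha>\<^sub>2 p * 0\<^sup>2 + \<rho>\<^sub>0 p * 0\<^sup>2) at_top"
    by (intro tendsto_add tendsto_mult tendsto_power tendsto_const tendsto_norm_zero U_tendsto_0(1) U_der_tendsto_0
        y1 y1' \<Theta>_tendsto_0) auto
  then have Q: "(?Q \<longlongrightarrow> 0) at_top" by simp
  have "((\<lambda>t. ?Q t - Re (?R t)) \<longlongrightarrow> 0 - Re 0) at_top"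
    by (intro tendsto_diff Q tendsto_Re R)
  then have lim: "((\<lambda>t. ?Q t - Re (?R t)) \<longlongrightarrow> 0) at_top" by simp
  show ?thesis
  proof (rule Lim_transform_eventually[OF lim])
    show "\<forall>\<^sub>F t in at_top. ?Q t - Re (?R t) = inner (X 0 t) (X 0 t)"
      using eventually_gt_at_top[of 0]
    proof eventually_elim
      fix t :: real assume t: "0 < t"
      have ev0: "evol (U 0 t) (Y 0 t) (U 1 t) (Y 1 t) (\<Theta> 0 t) (U 2 t) (Y 2 t) (\<Theta> 1 t)"
        using ev[OF t, of 0] by (simp add: numeral_eq_Suc)
      have "- Re (?R t) = \<beta>\<^sub>1 p * (norm (d\<^sub>1 p (d\<^sub>1 p (U 0 t))))\<^sup>2 + \<beta>\<^sub>2 p * (norm (d\<^sub>2 p (d\<^sub>2 p (Y 0 t))))\<^sup>2"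
        using arg_cong[OF evol_mech[OF ev0 evol_D(1)[OF ev0]], of Re] by (simp add: norm_L2_sq)
      then show "?Q t - Re (?R t) = inner (X 0 t) (X 0 t)"
        unfolding power2_norm_eq_inner[symmetric] X_def by (subst norm_emb_sq) simp
    qed
  qed
qed

end

section \<open>Smooth orbits, density and conclusion\<close>

context plate_semigroup
begin

text \<open>Six powers of the generator give seven points \<open>w 0\<close> to \<open>w 6\<close>.
  Each but the last is rewritten through displacements of the next order, which yields the six
  states of order 0 to 5 that \<open>plate_trajectory\<close> asks for.\<close>

lemma orbit_of_smooth_tendsto_0:
  assumes "w0 \<in> gen_dom 6"
  shows "((\<lambda>t. norm (S t w0)) \<longlongrightarrow> 0) at_top"
proof -
  obtain w where w: "w 0 = w0" "\<And>j. j < 6 \<Longrightarrow> (w j, w (Suc j)) \<in> gen" "\<And>j. j \<le> 6 \<Longrightarrow> w j \<in> emb ` energy_space p"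
    using gen_dom_chain[OF assms] by blast
  define \<Phi> where "\<Phi> j t = inv_into (energy_space p) emb (S t (w j))" for j t
  have in_S: "S t (w j) \<in> emb ` energy_space p" if "0 < t" "j \<le> 6" for j t
    using maps[OF _ w(3)[OF that(2)], of t] that by simp
  have \<Phi>: "\<Phi> j t \<in> energy_space p" "emb (\<Phi> j t) = S t (w j)" if "0 < t" "j \<le> 6" for j t
    unfolding \<Phi>_def using inv_into_into[OF in_S[OF that]] f_inv_into_f[OF in_S[OF that]] by auto
  \<comment> \<open>Velocities are not recorded separately: they are the displacements of the next
    derivative, which is what \<open>eq\<close> proves.\<close>
  define U Y \<Theta> where "U j t = fst (fst (\<Phi> j t))" and "Y j t = snd (fst (\<Phi> j t))" and "\<Theta> j t = snd (snd (snd (\<Phi> j t)))" for j t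
  have g: "(emb (\<Phi> j t), emb (\<Phi> (Suc j) t)) \<in> gen" if "0 < t" "j < 6" for j t
    using gen_S[OF w(2)[OF that(2)], of t] that by (simp add: \<Phi>)
  have eq: "\<Phi> j t = ((U j t, Y j t), (U (Suc j) t, Y (Suc j) t, \<Theta> j t))" if "0 < t" "j < 6" for j t
    using gen_evol(1)[OF g[OF that] \<Phi>(1) \<Phi>(1)] that
    by (auto simp: U_def Y_def \<Theta>_def prod_eq_iff)
  have emb: "emb ((U j t, Y j t), (U (Suc j) t, Y (Suc j) t, \<Theta> j t)) = S t (w j)" if "0 < t" "j \<le> 5" for j t
    using eq[of t j] \<Phi>(2)[of t j] that by simp
  interpret tr: plate_trajectory p U Y \<Theta>
  proof
    fix t :: real and j :: nat assume t: "0 < t" and j: "j \<le> 4"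
    show "evol (U j t) (Y j t) (U (Suc j) t) (Y (Suc j) t) (\<Theta> j t) (U (Suc (Suc j)) t) (Y (Suc (Suc j)) t) (\<Theta> (Suc j) t)"
      using gen_evol(2)[OF g[OF t] \<Phi>(1)[OF t] \<Phi>(1)[OF t], of j] eq[OF t, of j] eq[OF t, of "Suc j"] j by simp
    have "((\<lambda>t. S t (w j)) has_vector_derivative S t (w (Suc j))) (at t)"
      using w(2)[of j] j by (intro has_vector_derivative_orbit t) auto
    then have "((\<lambda>t. S t (w j)) has_vector_derivative
        emb ((U (Suc j) t, Y (Suc j) t), (U (Suc (Suc j)) t, Y (Suc (Suc j)) t, \<Theta> (Suc j) t))) (at t)"
      using emb[OF t, of "Suc j"] j by simp
    then show "((\<lambda>t. emb ((U j t, Y j t), (U (Suc j) t, Y (Suc j) t, \<Theta> j t))) has_vector_derivative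
        emb ((U (Suc j) t, Y (Suc j) t), (U (Suc (Suc j)) t, Y (Suc (Suc j)) t, \<Theta> (Suc j) t))) (at t)"
    proof (rule has_vector_derivative_transform_within_open[where S = "{0<..}"])
      fix s :: real assume "s \<in> {0<..}"
      then show "S s (w j) = emb ((U j s, Y j s), (U (Suc j) s, Y (Suc j) s, \<Theta> j s))"
        using emb[of s j] j by simp
    qed (use t in auto)
  next
    have "norm (emb ((U j t, Y j t), (U (Suc j) t, Y (Suc j) t, \<Theta> j t))) \<le> (\<Sum>i\<le>5. norm (w i))" if "j \<le> 5" "0 < t" for j t
    proof -
      have "norm (S t (w j)) \<le> norm (w j)"
        using that w(3)[of j] by (intro contraction) auto
      also have "\<dots> \<le> (\<Sum>i\<le>5. norm (w i))"
        using that by (intro member_le_sum) auto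
      finally show ?thesis using emb[OF that(2,1)] by simp
    qed
    then show "\<exists>M. \<forall>j\<le>5. \<forall>t>0. norm (emb ((U j t, Y j t), (U (Suc j) t, Y (Suc j) t, \<Theta> j t))) \<le> M" by blast
  qed
  have "((\<lambda>t. sqrt (inner (tr.X 0 t) (tr.X 0 t))) \<longlongrightarrow> sqrt 0) at_top"
    by (intro tendsto_intros tr.energy0_tendsto_0)
  then have "((\<lambda>t. norm (tr.X 0 t)) \<longlongrightarrow> 0) at_top"
    by (simp add: norm_eq_sqrt_inner)
  then show ?thesis
  proof (rule Lim_transform_eventually)
    show "\<forall>\<^sub>F t in at_top. norm (tr.X 0 t) = norm (S t w0)"
      using eventually_gt_at_top[of 0] by eventually_elim (simp add: tr.X_def emb w(1) del: emb.simps)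
  qed
qed

text \<open>Contractivity keeps an orbit close to a nearby smooth one uniformly in time.\<close>

lemma orbit_tendsto_0:
  assumes x: "x \<in> emb ` energy_space p"
  shows "((\<lambda>t. norm (S t x)) \<longlongrightarrow> 0) at_top"
proof (rule tendstoI)
  fix e :: real assume e: "0 < e"
  obtain w0 where w0: "w0 \<in> gen_dom 6" "norm (x - w0) < e / 2"
    using gen_dom_dense[OF x half_gt_zero[OF e], of 6] by blast
  have w0X: "w0 \<in> emb ` energy_space p" using w0(1) gen_dom_subset by blast
  have "\<forall>\<^sub>F t in at_top. norm (S t w0) < e / 2"
    using tendstoD[OF orbit_of_smooth_tendsto_0[OF w0(1)], of "e/2"] e by simp
  then show "\<forall>\<^sub>F t in at_top. dist (norm (S t x)) 0 < e"
    using eventually_ge_at_top[of 0]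
  proof eventually_elim
    fix t :: real assume small: "norm (S t w0) < e / 2" and t: "0 \<le> t"
    have "norm (S t x - S t w0) < e / 2"
      using contraction[OF t X_diff[OF x w0X]] S_diff[OF t x w0X] w0(2) by simp
    then show "dist (norm (S t x)) 0 < e"
      using small norm_triangle_lt[of "S t x - S t w0" "S t w0" e] by simp
  qed
qed

end

theorem theorem3p3:
  fixes p :: params and T :: "real \<Rightarrow> state \<Rightarrow> state"
  assumes "0 < L\<^sub>0 p" and "L\<^sub>0 p < L p"
    and "\<rho>\<^sub>0 p > 0" and "\<rho>\<^sub>1 p > 0" and "\<rho>\<^sub>2 p > 0"
    and "\<alpha>\<^sub>1 p > 0" and "\<alpha>\<^sub>2 p > 0"
    and "\<beta>\<^sub>1 p > 0" and "\<beta>\<^sub>2 p > 0"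
    and "\<kappa> p > 0" and "\<gamma> p \<noteq> 0"
    and "C0_contraction_semigroup (energy_space p) (energy_norm p) T"
    and "semigroup_generated_by (energy_space p) (energy_norm p) T (dom_A p) (op_A p)"
  shows "\<forall>\<Phi>\<^sub>0 \<in> energy_space p. ((\<lambda>t. energy_norm p (T t \<Phi>\<^sub>0)) \<longlongrightarrow> 0) at_top"
proof
  fix \<Phi>\<^sub>0 assume \<Phi>\<^sub>0: "\<Phi>\<^sub>0 \<in> energy_space p"
  interpret plate_semigroup p T
    using assms by unfold_locales
  show "((\<lambda>t. energy_norm p (T t \<Phi>\<^sub>0)) \<longlongrightarrow> 0) at_top"
  proof (rule Lim_transform_eventually[OF orbit_tendsto_0[OF imageI[OF \<Phi>\<^sub>0]]])
    show "\<forall>\<^sub>F t in at_top. norm (S t (emb \<Phi>\<^sub>0)) = energy_norm p (T t \<Phi>\<^sub>0)"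
      using eventually_ge_at_top[of 0]
      by eventually_elim (simp add: S_emb \<Phi>\<^sub>0 energy_norm_emb T_in)
  qed
qed

end
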